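(* Let $d\ge2$, $0<T<\infty$, $\nu>0$, $\kappa>0$, let $\Omega\subset\mathbb{R}^d$ be a bounded domain, let $1<p<\infty$, $p'=p/(p-1)$, and let $\boldsymbol v_0\in\mathbf V\cap\mathbf V_p$. Assume that one of the following two sets of hypotheses holds: (A) $\partial\Omega$ is Lipschitz-continuous, $\boldsymbol f\in L^{\infty}(0,T;W^{-1,2}(\Omega)^d)\cap L^{p'}(0,T;L^{p'}(\Omega)^d)$, and either ($p>1$ and $2\le d\le3$) or ($p\ge\frac d2$ and $d>3$); (B) $\partial\Omega$ is of class $C^2$, $\boldsymbol f\in L^{p'}(0,T;L^{p'}(\Omega)^d)$, $d=4$ and $\frac{2d}{d+2}<p<\frac d2$ (i.e. $\frac43<p<2$). Then the weak solution to the generalised Navier-Stokes-Voigt problem with data $\boldsymbol v_0$, $\boldsymbol f$ is unique in the class of weak solutions (problem and notion of weak solution as defined in the context).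
   Context: Notation. $Q_T:=\Omega\times(0,T)$, $\Gamma_T:=\partial\Omega\times(0,T)$. $\mathbf D(\boldsymbol v):=\frac12(\nabla\boldsymbol v+(\nabla\boldsymbol v)^{\top})$. Let $\mathcal V:=\{\boldsymbol v\in C_0^\infty(\Omega)^d:\ \nabla\cdot\boldsymbol v=0\}$. $\mathbf V_p$ is the closure of $\mathcal V$ in $W^{1,p}(\Omega)^d$, and $\mathbf V:=\mathbf V_2$, endowed with the equivalent norm $\|\boldsymbol v\|_{\mathbf V}=\|\nabla\boldsymbol v\|_2$. $W^{-1,2}(\Omega)^d$ is the dual of $W^{1,2}_0(\Omega)^d$. Problem. The generalised Navier-Stokes-Voigt problem is: find a velocity $\boldsymbol v$ and pressure $\pi$ with $$\partial_t(\boldsymbol v-\kappa\Delta\boldsymbol v)+\operatorname{\mathbf{div}}(\boldsymbol v\otimes\boldsymbol v)+\nabla\pi-\nu\operatorname{\mathbf{div}}\big(|\mathbf D(\boldsymbol v)|^{p-2}\mathbf D(\boldsymbol v)\big)=\boldsymbol f\ \text{ in }Q_T,\qquad \operatorname{div}\boldsymbol v=0\ \text{ in }Q_T,$$ $$\boldsymbol v=\boldsymbol v_0\ \text{ in }\Omega\times\{0\},\qquad \boldsymbol v=\boldsymbol 0\ \text{ on }\Gamma_T.$$ Weak solution. For $\boldsymbol f\in L^1(Q_T)^d$, $\boldsymbol v_0\in\mathbf V$, $p>1$, a function $\boldsymbol v$ is a weak solution of this problem if: (1) $\boldsymbol v\in L^\infty(0,T;\mathbf V)\cap L^p(0,T;\mathbf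 V_p)$; (2) $\partial_t\boldsymbol v\in L^2(0,T;\mathbf V)$; (3) $\boldsymbol v(0)=\boldsymbol v_0$, in the sense that $\lim_{t\to0^+}\int_\Omega\boldsymbol v(t)\cdot\boldsymbol\psi\,dx=\int_\Omega\boldsymbol v_0\cdot\boldsymbol\psi\,dx$ for all $\boldsymbol\psi\in\mathcal V$; (4) for every smooth vector field $\boldsymbol\varphi$ with $\operatorname{div}\boldsymbol\varphi=0$ and $\operatorname{supp}\boldsymbol\varphi$ compactly contained in $\Omega\times[0,T)$, $$-\int_0^T\!\!\int_\Omega\boldsymbol v\cdot\partial_t\boldsymbol\varphi\,dx\,dt-\kappa\int_0^T\!\!\int_\Omega\nabla\boldsymbol v:\nabla\partial_t\boldsymbol\varphi\,dx\,dt+\nu\int_0^T\!\!\int_\Omega|\mathbf D(\boldsymbol v)|^{p-2}\mathbf D(\boldsymbol v):\mathbf D(\boldsymbol\varphi)\,dx\,dt$$ $$=\int_\Omega\boldsymbol v_0\cdot\boldsymbol\varphi(0)\,dx+\kappa\int_\Omega\nabla\boldsymbol v_0:\nabla\boldsymbol\varphi(0)\,dx+\int_0^T\!\!\int_\Omega\boldsymbol f\cdot\boldsymbol\varphi\,dx\,dt+\int_0^T\!\!\int_\Omega\boldsymbol v\otimes\boldsymbol v:\nabla\boldsymbol\varphi\,dx\,dt.$$ *)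

theory Defs
  imports "HOL-Analysis.Analysis"
begin

section \<open>Smooth functions and test functions\<close>

text \<open>
  On a Euclidean space, continuity of all iterated directional derivatives is equivalent to
  continuity of the iterated Frechet derivatives.
\<close>

primrec Ck :: "nat \<Rightarrow> ('a::euclidean_space \<Rightarrow> 'b::real_normed_vector) \<Rightarrow> bool" where
  "Ck 0 f \<longleftrightarrow> continuous_on UNIV f"
| "Ck (Suc k) f \<longleftrightarrow>
     (\<forall>x. f differentiable (at x)) \<and> (\<forall>h. Ck k (\<lambda>x. frechet_derivative f (at x) h))"

definition smooth :: "('a::euclidean_space \<Rightarrow> 'b::real_normed_vector) \<Rightarrow> bool" where
  "smooth f \<longleftrightarrow> (\<forall>k. Ck k f)"

text \<open>Elements of $C_0^\infty(S)$ are extended by zero to the whole space.\<close>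

definition C0inf :: "'a::euclidean_space set \<Rightarrow> ('a \<Rightarrow> 'b::real_normed_vector) set" where
  "C0inf S = {\<phi>. smooth \<phi> \<and> compact (closure {x. \<phi> x \<noteq> 0}) \<and> closure {x. \<phi> x \<noteq> 0} \<subseteq> S}"

definition solenoidal_C0inf :: "(real^'n) set \<Rightarrow> (real^'n \<Rightarrow> real^'n) set" where
  "solenoidal_C0inf \<Omega> = {\<psi> \<in> C0inf \<Omega>. \<forall>x. trace (jacobian \<psi> (at x)) = 0}"


section \<open>Domains and regularity of the boundary\<close>

definition bounded_domain :: "'a::euclidean_space set \<Rightarrow> bool" where
  "bounded_domain \<Omega> \<longleftrightarrow> open \<Omega> \<and> connected \<Omega> \<and> \<Omega> \<noteq> {} \<and> bounded \<Omega>"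

text \<open>
  Near every boundary point, and for a suitable unit vector \<open>e\<close> giving the vertical direction,
  \<open>\<Omega>\<close> is the strict epigraph of a function \<open>\<gamma>\<close> of class \<open>R\<close> over the hyperplane orthogonal to
  \<open>e\<close>.  The function \<open>\<gamma>\<close> is defined on the whole space, but only its values on that hyperplane
  enter; composing with the orthogonal projection shows that this is no restriction for the
  Lipschitz and $C^k$ classes.
\<close>

definition boundary_of_class :: "(('a::euclidean_space \<Rightarrow> real) \<Rightarrow> bool) \<Rightarrow> 'a set \<Rightarrow> bool" where
  "boundary_of_class R \<Omega> \<longleftrightarrow>
     (\<forall>x\<in>frontier \<Omega>. \<exists>r>0. \<exists>e \<gamma>. norm e = 1 \<and> R \<gamma> \<and>
        \<Omega> \<inter> ball x r = {y \<in> ball x r. y \<bullet> e > \<gamma> (y - (y \<bullet> e) *\<^sub>R e)})"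

definition Lipschitz_boundary :: "'a::euclidean_space set \<Rightarrow> bool" where
  "Lipschitz_boundary = boundary_of_class (\<lambda>\<gamma>. \<exists>L. L-lipschitz_on UNIV \<gamma>)"

definition C2_boundary :: "'a::euclidean_space set \<Rightarrow> bool" where
  "C2_boundary = boundary_of_class (Ck 2)"


section \<open>Lebesgue and Sobolev spaces\<close>

text \<open>
  Elements of function spaces over \<open>\<Omega>\<close> are represented by functions on the whole space, of which
  only the values almost everywhere on \<open>\<Omega>\<close> matter.  The ``norms'' below are thus seminorms on
  representatives.
\<close>

definition Lp :: "real \<Rightarrow> 'a::euclidean_space set \<Rightarrow> ('a \<Rightarrow> 'b::euclidean_space) set" where
  "Lp p \<Omega> = {u \<in> borel_measurable (lebesgue_on \<Omega>).
               integrable (lebesgue_on \<Omega>) (\<lambda>x. norm (u x) powr p)}"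

definition Lp_norm :: "real \<Rightarrow> 'a::euclidean_space set \<Rightarrow> ('a \<Rightarrow> 'b::euclidean_space) \<Rightarrow> real" where
  "Lp_norm p \<Omega> u = (\<integral>x. norm (u x) powr p \<partial>lebesgue_on \<Omega>) powr (1 / p)"

text \<open>As for \<open>jacobian\<close>, the entry \<open>G x $ i $ j\<close> is the derivative of \<open>u\<^sub>i\<close> in direction \<open>j\<close>.\<close>

definition has_weak_gradient ::
    "(real^'n) set \<Rightarrow> (real^'n \<Rightarrow> real^'n) \<Rightarrow> (real^'n \<Rightarrow> real^'n^'n) \<Rightarrow> bool" where
  "has_weak_gradient \<Omega> u G \<longleftrightarrow>
     (\<forall>K. compact K \<and> K \<subseteq> \<Omega> \<longrightarrow> u absolutely_integrable_on K \<and> G absolutely_integrable_on K) \<and>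
     (\<forall>\<phi>\<in>C0inf \<Omega>. \<forall>i j.
        (\<integral>x. u x $ i * frechet_derivative \<phi> (at x) (axis j 1) \<partial>lebesgue_on \<Omega>) =
        - (\<integral>x. G x $ i $ j * \<phi> x \<partial>lebesgue_on \<Omega>))"

text \<open>The weak gradient is unique up to null sets; an arbitrary representative is chosen.\<close>

definition weak_grad :: "(real^'n) set \<Rightarrow> (real^'n \<Rightarrow> real^'n) \<Rightarrow> real^'n \<Rightarrow> real^'n^'n" where
  "weak_grad \<Omega> u = (SOME G. has_weak_gradient \<Omega> u G)"

definition W1p :: "real \<Rightarrow> (real^'n) set \<Rightarrow> (real^'n \<Rightarrow> real^'n) set" where
  "W1p p \<Omega> = {u \<in> Lp p \<Omega>. \<exists>G\<in>Lp p \<Omega>. has_weak_gradient \<Omega> u G}"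

definition W1p_norm :: "real \<Rightarrow> (real^'n) set \<Rightarrow> (real^'n \<Rightarrow> real^'n) \<Rightarrow> real" where
  "W1p_norm p \<Omega> u =
     (Lp_norm p \<Omega> u powr p + Lp_norm p \<Omega> (weak_grad \<Omega> u) powr p) powr (1 / p)"

definition W1p_closure ::
    "real \<Rightarrow> (real^'n) set \<Rightarrow> (real^'n \<Rightarrow> real^'n) set \<Rightarrow> (real^'n \<Rightarrow> real^'n) set" where
  "W1p_closure p \<Omega> S = {u \<in> W1p p \<Omega>. \<forall>\<epsilon>>0. \<exists>w\<in>S. W1p_norm p \<Omega> (u - w) < \<epsilon>}"

definition W1p_0 :: "real \<Rightarrow> (real^'n) set \<Rightarrow> (real^'n \<Rightarrow> real^'n) set" where
  "W1p_0 p \<Omega> = W1p_closure p \<Omega> (C0inf \<Omega>)"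

definition Vp :: "real \<Rightarrow> (real^'n) set \<Rightarrow> (real^'n \<Rightarrow> real^'n) set" where
  "Vp p \<Omega> = W1p_closure p \<Omega> (solenoidal_C0inf \<Omega>)"

definition V_norm :: "(real^'n) set \<Rightarrow> (real^'n \<Rightarrow> real^'n) \<Rightarrow> real" where
  "V_norm \<Omega> u = Lp_norm 2 \<Omega> (weak_grad \<Omega> u)"

text \<open>The dual $W^{-1,2}(\Omega)^d$ of $W^{1,2}_0(\Omega)^d$.\<close>

definition Wm12 :: "(real^'n) set \<Rightarrow> ((real^'n \<Rightarrow> real^'n) \<Rightarrow> real) set" where
  "Wm12 \<Omega> = {F.
     (\<forall>u\<in>W1p_0 2 \<Omega>. \<forall>w\<in>W1p_0 2 \<Omega>. F (\<lambda>x. u x + w x) = F u + F w) \<and>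
     (\<forall>u\<in>W1p_0 2 \<Omega>. \<forall>c. F (\<lambda>x. c *\<^sub>R u x) = c * F u) \<and>
     (\<exists>C. \<forall>u\<in>W1p_0 2 \<Omega>. \<bar>F u\<bar> \<le> C * W1p_norm 2 \<Omega> u)}"

definition Wm12_norm :: "(real^'n) set \<Rightarrow> ((real^'n \<Rightarrow> real^'n) \<Rightarrow> real) \<Rightarrow> real" where
  "Wm12_norm \<Omega> F = Sup {\<bar>F u\<bar> | u. u \<in> W1p_0 2 \<Omega> \<and> W1p_norm 2 \<Omega> u \<le> 1}"


section \<open>Bochner spaces\<close>

text \<open>
  Strong measurability on \<open>(0,T)\<close> with values in the seminormed space with carrier \<open>X\<close> and
  seminorm \<open>N\<close>: almost everywhere limit of simple functions.
\<close>

definition strongly_measurable ::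
    "real \<Rightarrow> 'x::minus set \<Rightarrow> ('x \<Rightarrow> real) \<Rightarrow> (real \<Rightarrow> 'x) \<Rightarrow> bool" where
  "strongly_measurable T X N u \<longleftrightarrow>
     (\<exists>s::nat \<Rightarrow> real \<Rightarrow> 'x.
        (\<forall>k. finite (s k ` {0<..<T}) \<and> s k ` {0<..<T} \<subseteq> X \<and>
             (\<forall>w. {t \<in> {0<..<T}. s k t = w} \<in> sets lebesgue)) \<and>
        (AE t in lebesgue_on {0<..<T}. (\<lambda>k. N (s k t - u t)) \<longlonglongrightarrow> 0))"

definition Bochner_Lp ::
    "real \<Rightarrow> real \<Rightarrow> 'x::minus set \<Rightarrow> ('x \<Rightarrow> real) \<Rightarrow> (real \<Rightarrow> 'x) set" where
  "Bochner_Lp q T X N = {u. strongly_measurable T X N u \<and>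
     (AE t in lebesgue_on {0<..<T}. u t \<in> X) \<and>
     integrable (lebesgue_on {0<..<T}) (\<lambda>t. N (u t) powr q)}"

definition Bochner_Linf ::
    "real \<Rightarrow> 'x::minus set \<Rightarrow> ('x \<Rightarrow> real) \<Rightarrow> (real \<Rightarrow> 'x) set" where
  "Bochner_Linf T X N = {u. strongly_measurable T X N u \<and>
     (AE t in lebesgue_on {0<..<T}. u t \<in> X) \<and>
     (\<exists>C. AE t in lebesgue_on {0<..<T}. N (u t) \<le> C)}"

text \<open>
  A time-dependent field \<open>f\<close> belongs to $L^\infty(0,T;W^{-1,2}(\Omega)^d)$ if, for almost every \<open>t\<close>,
  the distribution given by \<open>f t\<close> extends to a functional \<open>F t\<close> in $W^{-1,2}(\Omega)^d$, and
  \<open>F\<close> is in the Bochner space.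
\<close>

definition Linf_Wm12 :: "real \<Rightarrow> (real^'n) set \<Rightarrow> (real \<Rightarrow> real^'n \<Rightarrow> real^'n) set" where
  "Linf_Wm12 T \<Omega> = {f. \<exists>F\<in>Bochner_Linf T (Wm12 \<Omega>) (Wm12_norm \<Omega>).
     AE t in lebesgue_on {0<..<T}. \<forall>\<psi>\<in>C0inf \<Omega>. F t \<psi> = (\<integral>x. f t x \<bullet> \<psi> x \<partial>lebesgue_on \<Omega>)}"


section \<open>Weak solutions of the generalised Navier-Stokes-Voigt problem\<close>

definition dt :: "(real \<times> 'a \<Rightarrow> 'b::real_normed_vector) \<Rightarrow> real \<Rightarrow> 'a \<Rightarrow> 'b" where
  "dt \<phi> t x = vector_derivative (\<lambda>s. \<phi> (s, x)) (at t)"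

definition sym_part :: "real^'n^'n \<Rightarrow> real^'n^'n" where
  "sym_part A = (1 / 2) *\<^sub>R (A + transpose A)"

definition tensor :: "real^'n \<Rightarrow> real^'n \<Rightarrow> real^'n^'n" where
  "tensor a b = (\<chi> i j. a $ i * b $ j)"

text \<open>Distributional time derivative on \<open>(0,T) \<times> \<Omega>\<close>.\<close>

definition has_weak_dt ::
    "real \<Rightarrow> (real^'n) set \<Rightarrow> (real \<Rightarrow> real^'n \<Rightarrow> real^'n) \<Rightarrow>
     (real \<Rightarrow> real^'n \<Rightarrow> real^'n) \<Rightarrow> bool" where
  "has_weak_dt T \<Omega> v g \<longleftrightarrow>
     (\<forall>\<phi>\<in>C0inf ({0<..<T} \<times> \<Omega>).
        (\<integral>t. (\<integral>x. v t x \<bullet> dt \<phi> t x \<partial>lebesgue_on \<Omega>) \<partial>lebesgue_on {0<..<T}) =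
        - (\<integral>t. (\<integral>x. g t x \<bullet> \<phi> (t, x) \<partial>lebesgue_on \<Omega>) \<partial>lebesgue_on {0<..<T}))"

text \<open>
  Divergence-free smooth fields on $[0,T) \times \Omega$, smooth up to \<open>t = 0\<close>, with compact support
  in $[0,T) \times \Omega$.  They need not vanish at \<open>t = 0\<close>, and are represented by arbitrary smooth
  extensions to the whole space-time, of which only the part with \<open>t \<ge> 0\<close> is constrained.
\<close>

definition NSV_test :: "real \<Rightarrow> (real^'n) set \<Rightarrow> (real \<times> (real^'n) \<Rightarrow> real^'n) set" where
  "NSV_test T \<Omega> = {\<phi>. smooth \<phi> \<and>
     (let S = closure {(t, x). 0 \<le> t \<and> \<phi> (t, x) \<noteq> 0} in compact S \<and> S \<subseteq> {0..<T} \<times> \<Omega>) \<and>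
     (\<forall>t\<ge>0. \<forall>x. trace (jacobian (\<lambda>y. \<phi> (t, y)) (at x)) = 0)}"

text \<open>
  Since \<open>v\<close> stands for an equivalence class of functions of \<open>t\<close>, the limit in the initial condition
  is taken outside null sets of times (essential limit).  The inner product and norm of matrices
  are those of \<open>real^'n^'n\<close>, i.e.\ the contraction \<open>A : B\<close> and the Frobenius norm.
\<close>

definition weak_solution_NSV ::
    "real \<Rightarrow> (real^'n) set \<Rightarrow> real \<Rightarrow> real \<Rightarrow> real \<Rightarrow> (real^'n \<Rightarrow> real^'n) \<Rightarrow>
     (real \<Rightarrow> real^'n \<Rightarrow> real^'n) \<Rightarrow> (real \<Rightarrow> real^'n \<Rightarrow> real^'n) \<Rightarrow> bool" where
  "weak_solution_NSV T \<Omega> p \<nu> \<kappa> v\<^sub>0 f v \<longleftrightarrow>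
     v \<in> Bochner_Linf T (Vp 2 \<Omega>) (V_norm \<Omega>) \<and>
     v \<in> Bochner_Lp p T (Vp p \<Omega>) (W1p_norm p \<Omega>) \<and>
     (\<exists>g\<in>Bochner_Lp 2 T (Vp 2 \<Omega>) (V_norm \<Omega>). has_weak_dt T \<Omega> v g) \<and>
     (\<forall>\<psi>\<in>solenoidal_C0inf \<Omega>.
        ((\<lambda>t. \<integral>x. v t x \<bullet> \<psi> x \<partial>lebesgue_on \<Omega>) \<longlongrightarrow> (\<integral>x. v\<^sub>0 x \<bullet> \<psi> x \<partial>lebesgue_on \<Omega>))
          (inf (at_right 0) (ae_filter lebesgue))) \<and>
     (\<forall>\<phi>\<in>NSV_test T \<Omega>.
        - (\<integral>t. (\<integral>x. v t x \<bullet> dt \<phi> t x \<partial>lebesgue_on \<Omega>) \<partial>lebesgue_on {0<..<T})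
        - \<kappa> * (\<integral>t. (\<integral>x. weak_grad \<Omega> (v t) x \<bullet> jacobian (dt \<phi> t) (at x)
                    \<partial>lebesgue_on \<Omega>) \<partial>lebesgue_on {0<..<T})
        + \<nu> * (\<integral>t. (\<integral>x. (norm (sym_part (weak_grad \<Omega> (v t) x)) powr (p - 2)
                            *\<^sub>R sym_part (weak_grad \<Omega> (v t) x))
                         \<bullet> sym_part (jacobian (\<lambda>y. \<phi> (t, y)) (at x))
                    \<partial>lebesgue_on \<Omega>) \<partial>lebesgue_on {0<..<T})
        = (\<integral>x. v\<^sub>0 x \<bullet> \<phi> (0, x) \<partial>lebesgue_on \<Omega>)
        + \<kappa> * (\<integral>x. weak_grad \<Omega> v\<^sub>0 x \<bullet> jacobian (\<lambda>y. \<phi> (0, y)) (at x) \<partial>lebesgue_on \<Omega>)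
        + (\<integral>t. (\<integral>x. f t x \<bullet> \<phi> (t, x) \<partial>lebesgue_on \<Omega>) \<partial>lebesgue_on {0<..<T})
        + (\<integral>t. (\<integral>x. tensor (v t x) (v t x) \<bullet> jacobian (\<lambda>y. \<phi> (t, y)) (at x)
                \<partial>lebesgue_on \<Omega>) \<partial>lebesgue_on {0<..<T}))"

end

theory Submission
  imports Defs
begin

text \<open>
  Let \<open>u = v - w\<close> be the difference of two weak solutions, and let
  \[ B(a, c) = \int_\Omega a \cdot c + \kappa \int_\Omega \nabla a : \nabla c \]
  be the energy form of the problem. In the difference of the two equations the force and the initial
  velocity cancel. Formally, testing it with \<open>u\<close> gives
  \[ \frac{1}{2} \frac{d}{dt} B(u, u) + \nu \int_\Omega (S(v) - S(w)) : D(u)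
     = \int_\Omega (v \otimes v - w \otimes w) : \nabla u, \qquad u(0) = 0, \]
  where $S(v) = |D(v)|^{p-2} D(v)$. The viscous term is nonnegative by monotonicity (\<open>visc_monotone\<close>).
  The convective term is $\int (u \otimes v + w \otimes u) : \nabla u$, and by the inequalities of
  Hoelder and Sobolev it is at most
  $C (\|\nabla v\|_r + \|\nabla w\|_r) \|\nabla u\|_2^2$ for every \<open>r \<ge> 2\<close> that is at least half of the
  dimension (\<open>convective_exponents\<close>, \<open>convective_estimate\<close>). In at most four dimensions \<open>r = 2\<close> is
  possible, and otherwise \<open>p\<close> is at least half of the dimension and \<open>r = p\<close> is possible. In both cases
  the factor in front of $\|\nabla u\|_2^2$ is integrable in time (\<open>convective_weight\<close>). As \<open>\<kappa> > 0\<close>, the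
  energy $E = B(u, u)$ dominates $\|\nabla u\|_2^2$, so that $E' \le m E$ with an integrable function
  \<open>m\<close>, and \<open>E\<close> vanishes by Gronwall's lemma (\<open>Gronwall_AE\<close>).

  Two steps of this argument need justification. First, \<open>u(t)\<close> is not a test function. For each test
  function in space the equation holds outside a null set of times that depends on it
  (\<open>difference_equation\<close>). Since \<open>u\<close> is strongly measurable, it is a limit of simple functions, which
  have only countably many values altogether, and each of these is a limit of test functions. Thus
  countably many test functions approximate \<open>u(t)\<close> at almost every time (\<open>countable_tests\<close>), and the
  equation for them holds outside one common null set; at a fixed time it extends to \<open>u(t)\<close> by density
  (\<open>tested_with_difference\<close>).

  Second, the time derivative \<open>g\<close> of \<open>u\<close> is a distributional one, given by its pairing in $L^2$. Pairing
  with $\psi - \kappa \Delta \psi$ instead of $\psi$ turns it into the derivative with respect to \<open>B\<close>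
  (\<open>energy_representative\<close>). As the equation admits test functions that do not vanish at time 0, it
  contains the initial condition, and a lemma of du Bois-Reymond type gives
  $B(u(t), \psi) = \int_0^t B(g(s), \psi)\,ds$ (\<open>du_Bois_Reymond\<close>). Using this twice,
  \[ E(r) = \int_0^r \int_0^r B(g(s), g(t))\,ds\,dt = 2 \int_0^r \int_0^t B(g(s), g(t))\,ds\,dt
     = 2 \int_0^r B(g(t), u(t))\,dt \]
  by the symmetry of \<open>B\<close> (\<open>symmetric_square_integral\<close>, \<open>energy_identity\<close>), which is the chain rule in
  the form that Gronwall's lemma requires.

  The spaces are closures of test functions, so the Sobolev inequality is first proved for test
  functions, by Gagliardo's method of integrating out the coordinates one by one
  (\<open>Gagliardo_inequality\<close>, \<open>Sobolev_inequality_lborel\<close>), and extended by Fatou's lemma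
  (\<open>Sobolev_closure\<close>). The fundamental lemma of the calculus of variations, from powers of smooth
  bump functions, gives the uniqueness of weak gradients and the lemma of du Bois-Reymond type.
\<close>

section \<open>Calculus of smooth functions\<close>

lemma Ck_Suc_imp_Ck: "Ck (Suc k) f \<Longrightarrow> Ck k f"
proof (induction k arbitrary: f)
  case 0
  then show ?case
    by (auto intro!: continuous_at_imp_continuous_on differentiable_imp_continuous_within)
next
  case (Suc k)
  then show ?case
    by (metis Ck.simps(2))
qed

text \<open>
  The directional derivatives in \<open>Ck\<close> are applications of \<open>frechet_derivative\<close>, which is determined
  by any derivative at hand.
\<close>

lemma Ck_SucI:
  assumes "\<And>x. (f has_derivative f' x) (at x)" and "\<And>h. Ck k (\<lambda>x. f' x h)"
  shows "Ck (Suc k) f"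
proof -
  have "frechet_derivative f (at x) = f' x" for x
    using assms(1) frechet_derivative_at by metis
  with assms show ?thesis
    by (auto simp: differentiable_def)
qed

lemma Ck_const: "Ck k (\<lambda>x. c)"
proof (induction k arbitrary: c)
  case (Suc k)
  show ?case by (rule Ck_SucI[where f' = "\<lambda>x h. 0"]) (auto simp: Suc)
qed simp

lemma frechet_has_derivative: "Ck (Suc k) f \<Longrightarrow> (f has_derivative frechet_derivative f (at x)) (at x)"
  using frechet_derivative_works by auto

lemma Ck_add: "Ck k f \<Longrightarrow> Ck k g \<Longrightarrow> Ck k (\<lambda>x. f x + g x)"
proof (induction k arbitrary: f g)
  case 0
  then show ?case by (auto intro: continuous_intros)
next
  case (Suc k)
  show ?case
  proof (rule Ck_SucI)
    show "((\<lambda>x. f x + g x) has_derivative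
        (\<lambda>h. frechet_derivative f (at x) h + frechet_derivative g (at x) h)) (at x)" for x
      using Suc.prems by (intro has_derivative_add frechet_has_derivative)
    show "Ck k (\<lambda>x. frechet_derivative f (at x) h + frechet_derivative g (at x) h)" for h
      using Suc by auto
  qed
qed

lemma (in bounded_bilinear) Ck_bilinear:
  "Ck k f \<Longrightarrow> Ck k g \<Longrightarrow> Ck k (\<lambda>x. prod (f x) (g x))"
proof (induction k arbitrary: f g)
  case 0
  then show ?case by (auto intro: continuous_on)
next
  case (Suc k)
  show ?case
  proof (rule Ck_SucI)
    show "((\<lambda>x. prod (f x) (g x)) has_derivative
        (\<lambda>h. prod (f x) (frechet_derivative g (at x) h) + prod (frechet_derivative f (at x) h) (g x))) (at x)" for x
      using Suc.prems by (intro FDERIV frechet_has_derivative)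
    show "Ck k (\<lambda>x. prod (f x) (frechet_derivative g (at x) h) + prod (frechet_derivative f (at x) h) (g x))" for h
      using Suc.prems by (intro Ck_add Suc.IH) (auto simp del: Ck.simps intro: Ck_Suc_imp_Ck, auto)
  qed
qed

lemma Ck_comp_affine:
  assumes "bounded_linear L"
  shows "Ck k f \<Longrightarrow> Ck k (\<lambda>x. f (L x + c))"
proof (induction k arbitrary: f)
  case 0
  then have "continuous_on UNIV (\<lambda>x. f (L x + c))"
    by (intro continuous_on_compose2[of UNIV f UNIV "\<lambda>x. L x + c"] continuous_on_add
        bounded_linear.continuous_on[OF assms] continuous_on_id continuous_on_const) auto
  then show ?case by simp
next
  case (Suc k)
  show ?case
  proof (rule Ck_SucI)
    have "((\<lambda>x. L x + c) has_derivative L) (at x)" for x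
      by (auto intro!: derivative_eq_intros bounded_linear_imp_has_derivative assms)
    then show "((\<lambda>x. f (L x + c)) has_derivative
        (\<lambda>h. frechet_derivative f (at (L x + c)) (L h))) (at x)" for x
      using has_derivative_compose[of "\<lambda>x. L x + c" L x UNIV f] frechet_has_derivative[OF Suc.prems]
      by blast
    show "Ck k (\<lambda>x. frechet_derivative f (at (L x + c)) (L h))" for h
      using Suc.prems by (intro Suc.IH) auto
  qed
qed

lemma Ck_linear_comp:
  assumes "bounded_linear L"
  shows "Ck k f \<Longrightarrow> Ck k (\<lambda>x. L (f x))"
proof (induction k arbitrary: f)
  case 0
  then show ?case
    by (auto intro!: bounded_linear.continuous_on[OF assms])
next
  case (Suc k)
  show ?case
  proof (rule Ck_SucI)
    show "((\<lambda>x. L (f x)) has_derivative (\<lambda>h. L (frechet_derivative f (at x) h))) (at x)" for x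
      using Suc.prems by (intro bounded_linear.has_derivative[OF assms] frechet_has_derivative)
    show "Ck k (\<lambda>x. L (frechet_derivative f (at x) h))" for h
      using Suc.prems by (intro Suc.IH) auto
  qed
qed

lemma Ck_prod: "finite I \<Longrightarrow> (\<And>i. i \<in> I \<Longrightarrow> Ck k (f i)) \<Longrightarrow> Ck k (\<lambda>x. \<Prod>i\<in>I. f i x :: real)"
  by (induction I rule: finite_induct)
     (auto intro: Ck_const bounded_bilinear.Ck_bilinear[OF bounded_bilinear_mult])

lemma smooth_const: "smooth (\<lambda>x. c)"
  by (simp add: smooth_def Ck_const)

lemma smooth_add: "smooth f \<Longrightarrow> smooth g \<Longrightarrow> smooth (\<lambda>x. f x + g x)"
  by (simp add: smooth_def Ck_add)

lemma smooth_mult: "smooth f \<Longrightarrow> smooth g \<Longrightarrow> smooth (\<lambda>x. f x * g x :: real)"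
  by (simp add: smooth_def bounded_bilinear.Ck_bilinear[OF bounded_bilinear_mult])

lemma smooth_scaleR: "smooth f \<Longrightarrow> smooth g \<Longrightarrow> smooth (\<lambda>x. f x *\<^sub>R g x)"
  by (simp add: smooth_def bounded_bilinear.Ck_bilinear[OF bounded_bilinear_scaleR])

lemma smooth_comp_affine: "bounded_linear L \<Longrightarrow> smooth f \<Longrightarrow> smooth (\<lambda>x. f (L x + c))"
  by (simp add: smooth_def Ck_comp_affine)

lemma smooth_comp_linear: "bounded_linear L \<Longrightarrow> smooth f \<Longrightarrow> smooth (\<lambda>x. f (L x))"
  using smooth_comp_affine[of L f 0] by simp

lemma smooth_linear_comp: "bounded_linear L \<Longrightarrow> smooth f \<Longrightarrow> smooth (\<lambda>x. L (f x))"
  by (simp add: smooth_def Ck_linear_comp)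

lemma smooth_has_derivative:
  "smooth f \<Longrightarrow> (f has_derivative frechet_derivative f (at x)) (at x)"
  unfolding smooth_def by (metis frechet_has_derivative)

lemma smooth_frechet_derivative: "smooth f \<Longrightarrow> smooth (\<lambda>x. frechet_derivative f (at x) h)"
  unfolding smooth_def by (metis Ck.simps(2))

lemma smoothI_derivative:
  assumes "\<And>x. (f has_derivative f' x) (at x)" and "\<And>h. smooth (\<lambda>x. f' x h)"
  shows "smooth f"
  unfolding smooth_def
proof
  fix k
  have "Ck (Suc k) f"
    using assms by (intro Ck_SucI) (auto simp: smooth_def)
  then show "Ck k f" by (rule Ck_Suc_imp_Ck)
qed

lemma smooth_continuous_on: "smooth f \<Longrightarrow> continuous_on S f"
  unfolding smooth_def by (metis Ck.simps(1) continuous_on_subset subset_UNIV)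

lemma smooth_power: "smooth f \<Longrightarrow> smooth (\<lambda>x. f x ^ n :: real)"
  by (induction n) (auto intro: smooth_const smooth_mult)

lemma smooth_minus: "smooth f \<Longrightarrow> smooth (\<lambda>x. - f x)"
  by (rule smooth_linear_comp[OF bounded_linear_minus[OF bounded_linear_ident]])

lemma smooth_diff: "smooth f \<Longrightarrow> smooth g \<Longrightarrow> smooth (\<lambda>x. f x - g x)"
  using smooth_add[of f "\<lambda>x. - g x"] smooth_minus by fastforce

text \<open>
  The functions $x^{-n} e^{-1/x}$ on the positive half line. For the bump functions only \<open>n = 0\<close>
  matters, but the whole family is closed under differentiation up to linear combinations.
\<close>

definition flat :: "nat \<Rightarrow> real \<Rightarrow> real" where
  "flat n x = (if x > 0 then exp (- inverse x) * inverse x ^ n else 0)"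

text \<open>
  Differentiability at 0: the exponential beats every power of \<open>1 / x\<close>.
\<close>

lemma flat_div_tendsto_0: "((\<lambda>x. flat n x / x) \<longlongrightarrow> 0) (at 0)"
proof -
  have "((\<lambda>y::real. y ^ Suc n / exp y) \<longlongrightarrow> 0) at_top"
    by (rule tendsto_power_div_exp_0)
  then have "((\<lambda>x::real. inverse x ^ Suc n / exp (inverse x)) \<longlongrightarrow> 0) (at_right 0)"
    by (rule filterlim_compose) (rule filterlim_inverse_at_top_right)
  then have "((\<lambda>x. flat n x / x) \<longlongrightarrow> 0) (at_right 0)"
    by (rule Lim_transform_eventually)
       (auto simp: flat_def eventually_at_filter exp_minus field_simps)
  moreover have "((\<lambda>x. flat n x / x) \<longlongrightarrow> 0) (at_left 0)"
    by (rule Lim_transform_eventually[OF tendsto_const])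
       (auto simp: flat_def eventually_at_filter)
  ultimately show ?thesis
    by (rule filterlim_split_at[rotated])
qed

lemma flat_has_derivative:
  "(flat n has_derivative (\<lambda>h. (flat (n + 2) x - real n * flat (n + 1) x) * h)) (at x)"
proof -
  consider "x > 0" | "x < 0" | "x = 0" by linarith
  then have "(flat n has_real_derivative (flat (n + 2) x - real n * flat (n + 1) x)) (at x)"
  proof cases
    case 1
    have "((\<lambda>x. exp (- inverse x) * inverse x ^ n) has_real_derivative
        (flat (n + 2) x - real n * flat (n + 1) x)) (at x)"
    proof (rule DERIV_cong)
      define y where "y = inverse x"
      have y: "(inverse has_real_derivative - (y * y)) (at x)"
        using 1 DERIV_inverse[of x UNIV] by (simp add: y_def power2_eq_square)
      show "((\<lambda>x. exp (- inverse x) * inverse x ^ n) has_real_derivative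
          exp (- inverse x) * (real n * (inverse x ^ (n - 1) * - (y * y))) +
          exp (- inverse x) * - (- (y * y)) * inverse x ^ n) (at x)"
        by (rule DERIV_mult' DERIV_fun_exp DERIV_minus y DERIV_power[THEN DERIV_cong])+ simp
      have "flat m x = exp (- y) * y ^ m" for m
        using 1 by (simp add: flat_def y_def)
      then show "exp (- inverse x) * (real n * (inverse x ^ (n - 1) * - (y * y))) +
          exp (- inverse x) * - (- (y * y)) * inverse x ^ n =
          flat (n + 2) x - real n * flat (n + 1) x"
        unfolding y_def[symmetric] by (cases n) (simp_all add: algebra_simps)
    qed
    then show ?thesis
      by (rule has_field_derivative_transform_within_open[where S = "{0<..}"])
         (use 1 in \<open>auto simp: flat_def\<close>)
  next
    case 2
    have "((\<lambda>x. 0) has_real_derivative (flat (n + 2) x - real n * flat (n + 1) x)) (at x)"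
      using 2 by (auto simp: flat_def)
    then show ?thesis
      by (rule has_field_derivative_transform_within_open[where S = "{..<0}"])
         (use 2 in \<open>auto simp: flat_def\<close>)
  next
    case 3
    have "flat m 0 = 0" for m by (simp add: flat_def)
    then show ?thesis
      using flat_div_tendsto_0[of n] 3 by (auto simp: has_field_derivative_iff)
  qed
  then show ?thesis
    by (simp add: has_field_derivative_def mult.commute[of _ "flat (n + 2) x - real n * flat (n + 1) x"])
qed

lemma smooth_flat: "smooth (flat n)"
proof -
  have "Ck k (flat n)" for k
  proof (induction k arbitrary: n)
    case 0
    have "isCont (flat n) x" for x
      using flat_has_derivative has_derivative_continuous by blast
    then show ?case by (auto intro: continuous_at_imp_continuous_on)
  next
    case (Suc k)
    have "Ck k (\<lambda>x. flat (n + 2) x + (- real n) * flat (n + 1) x)"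
      by (intro Ck_add bounded_bilinear.Ck_bilinear[OF bounded_bilinear_mult] Ck_const Suc)
    then have "Ck k (\<lambda>x. (flat (n + 2) x + (- real n) * flat (n + 1) x) * h)" for h
      by (intro bounded_bilinear.Ck_bilinear[OF bounded_bilinear_mult] Ck_const)
    then show ?case
      by (intro Ck_SucI[OF flat_has_derivative]) simp
  qed
  then show ?thesis by (simp add: smooth_def)
qed

lemma exists_smooth_bump_box:
  fixes a b :: "'a::euclidean_space"
  shows "\<exists>\<beta>::'a \<Rightarrow> real. smooth \<beta> \<and> (\<forall>x. 0 \<le> \<beta> x \<and> \<beta> x < 1) \<and> (\<forall>x. 0 < \<beta> x \<longleftrightarrow> x \<in> box a b)"
proof -
  define \<beta> where
    "\<beta> = (\<lambda>x. (1 / 2) * (\<Prod>i\<in>Basis. flat 0 (x \<bullet> i - a \<bullet> i) * flat 0 (b \<bullet> i - x \<bullet> i)))"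
  have flat: "0 \<le> flat 0 y" "flat 0 y \<le> 1" "0 < flat 0 y \<longleftrightarrow> 0 < y" for y
    by (auto simp: flat_def)
  have "smooth (\<lambda>x::'a. flat 0 (x \<bullet> i + (- (a \<bullet> i))))" for i
    by (rule smooth_comp_affine) (auto intro: bounded_linear_intros smooth_flat)
  moreover have "smooth (\<lambda>x::'a. flat 0 (- (x \<bullet> i) + b \<bullet> i))" for i
    by (rule smooth_comp_affine[OF bounded_linear_minus[OF bounded_linear_inner_left] smooth_flat])
  ultimately have "smooth (\<lambda>x::'a. flat 0 (x \<bullet> i + (- (a \<bullet> i))) * flat 0 (- (x \<bullet> i) + b \<bullet> i))" for i
    by (rule smooth_mult)
  then have "smooth (\<lambda>x. \<Prod>i\<in>Basis. flat 0 (x \<bullet> i - a \<bullet> i) * flat 0 (b \<bullet> i - x \<bullet> i))"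
    by (auto simp: smooth_def intro!: Ck_prod)
  then have "smooth \<beta>"
    unfolding \<beta>_def by (intro smooth_mult smooth_const)
  moreover have "0 \<le> \<beta> x \<and> \<beta> x < 1" for x
  proof -
    have "0 \<le> (\<Prod>i\<in>Basis. flat 0 (x \<bullet> i - a \<bullet> i) * flat 0 (b \<bullet> i - x \<bullet> i))"
      "(\<Prod>i\<in>Basis. flat 0 (x \<bullet> i - a \<bullet> i) * flat 0 (b \<bullet> i - x \<bullet> i)) \<le> 1"
      by (auto intro!: prod_nonneg prod_le_1 mult_le_one simp: flat)
    then show ?thesis by (simp add: \<beta>_def)
  qed
  moreover have "0 < \<beta> x \<longleftrightarrow> x \<in> box a b" for x
  proof
    assume "0 < \<beta> x"
    have "0 < flat 0 (x \<bullet> i - a \<bullet> i) * flat 0 (b \<bullet> i - x \<bullet> i)" if "i \<in> Basis" for i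
    proof (rule ccontr)
      assume "\<not> ?thesis"
      moreover have "0 \<le> flat 0 (x \<bullet> i - a \<bullet> i) * flat 0 (b \<bullet> i - x \<bullet> i)"
        by (simp add: flat)
      ultimately have "\<beta> x = 0"
        using that unfolding \<beta>_def by (auto simp del: mult_eq_0_iff simp: prod_zero_iff)
      with \<open>0 < \<beta> x\<close> show False by simp
    qed
    then show "x \<in> box a b"
      using flat by (fastforce simp: mem_box zero_less_mult_iff not_less[symmetric])
  next
    assume "x \<in> box a b"
    then show "0 < \<beta> x"
      by (auto simp: \<beta>_def mem_box flat intro!: prod_pos)
  qed
  ultimately show ?thesis by blast
qed

section \<open>Test functions\<close>

lemma C0inf_smooth: "\<phi> \<in> C0inf S \<Longrightarrow> smooth \<phi>"
  by (simp add: C0inf_def)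

text \<open>
  It suffices to know some compact set outside of which the function vanishes; \<open>C0infE\<close> is the
  converse. With this pair of rules the closure of the support does not appear any more.
\<close>

lemma C0infI:
  assumes "smooth \<phi>" "compact K" "K \<subseteq> S" "\<And>x. x \<notin> K \<Longrightarrow> \<phi> x = 0"
  shows "\<phi> \<in> C0inf S"
proof -
  have sub: "closure {x. \<phi> x \<noteq> 0} \<subseteq> K"
    using assms by (intro closure_minimal) (auto intro: compact_imp_closed)
  then have "compact (closure {x. \<phi> x \<noteq> 0})"
    using assms(2) by (metis closed_closure compact_Int_closed inf.absorb_iff2)
  with sub assms show ?thesis by (auto simp: C0inf_def)
qed

lemma C0infE:
  assumes "\<phi> \<in> C0inf S"
  obtains K where "compact K" "K \<subseteq> S" "\<And>x. x \<notin> K \<Longrightarrow> \<phi> x = 0"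
proof (rule that)
  show "compact (closure {x. \<phi> x \<noteq> 0})" "closure {x. \<phi> x \<noteq> 0} \<subseteq> S"
    using assms by (auto simp: C0inf_def)
  show "\<phi> x = 0" if "x \<notin> closure {x. \<phi> x \<noteq> 0}" for x
    using that closure_subset[of "{x. \<phi> x \<noteq> 0}"] by blast
qed

lemma C0inf_zero: "(\<lambda>x. 0) \<in> C0inf S"
  by (rule C0infI[of _ "{}"]) (auto intro: smooth_const)

lemma C0inf_add:
  assumes "\<phi> \<in> C0inf S" "\<psi> \<in> C0inf S"
  shows "(\<lambda>x. \<phi> x + \<psi> x) \<in> C0inf S"
proof -
  obtain K where K: "compact K" "K \<subseteq> S" "\<And>x. x \<notin> K \<Longrightarrow> \<phi> x = 0"
    using C0infE[OF assms(1)] by blast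
  obtain L where L: "compact L" "L \<subseteq> S" "\<And>x. x \<notin> L \<Longrightarrow> \<psi> x = 0"
    using C0infE[OF assms(2)] by blast
  show ?thesis
    by (rule C0infI[of _ "K \<union> L"]) (use K L assms in \<open>auto intro: smooth_add C0inf_smooth\<close>)
qed

lemma C0inf_linear_comp:
  assumes "bounded_linear L" "\<phi> \<in> C0inf S"
  shows "(\<lambda>x. L (\<phi> x)) \<in> C0inf S"
proof -
  obtain K where "compact K" "K \<subseteq> S" "\<And>x. x \<notin> K \<Longrightarrow> \<phi> x = 0"
    using C0infE[OF assms(2)] by blast
  then show ?thesis
    using assms linear_0[OF bounded_linear.linear[OF assms(1)]]
    by (intro C0infI[of _ K]) (auto intro: smooth_linear_comp C0inf_smooth)
qed

lemma C0inf_diff: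
  assumes "\<phi> \<in> C0inf S" "\<psi> \<in> C0inf S"
  shows "(\<lambda>x. \<phi> x - \<psi> x) \<in> C0inf S"
  using C0inf_add[OF assms(1) C0inf_linear_comp[OF _ assms(2), of "\<lambda>x. - x"]]
  by (simp add: bounded_linear_minus bounded_linear_ident)

lemma C0inf_sum:
  "finite I \<Longrightarrow> (\<And>i. i \<in> I \<Longrightarrow> f i \<in> C0inf S) \<Longrightarrow> (\<lambda>x. \<Sum>i\<in>I. f i x) \<in> C0inf S"
  by (induction I rule: finite_induct) (auto intro: C0inf_zero C0inf_add)

lemma C0inf_scale:
  assumes "smooth \<theta>" "\<phi> \<in> C0inf S"
  shows "(\<lambda>x. \<theta> x *\<^sub>R \<phi> x) \<in> C0inf S"
proof -
  obtain K where "compact K" "K \<subseteq> S" "\<And>x. x \<notin> K \<Longrightarrow> \<phi> x = 0"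
    using C0infE[OF assms(2)] by blast
  then show ?thesis
    using assms by (intro C0infI[of _ K]) (auto intro: smooth_scaleR C0inf_smooth)
qed

lemma C0inf_frechet_derivative:
  assumes "\<phi> \<in> C0inf S"
  shows "(\<lambda>x. frechet_derivative \<phi> (at x) h) \<in> C0inf S"
proof -
  obtain K where K: "compact K" "K \<subseteq> S" "\<And>x. x \<notin> K \<Longrightarrow> \<phi> x = 0"
    using C0infE[OF assms] by blast
  have "frechet_derivative \<phi> (at x) h = 0" if "x \<notin> K" for x
  proof -
    have "open (- K)" using K compact_imp_closed by auto
    then have "(\<phi> has_derivative (\<lambda>h. 0)) (at x)"
      by (intro has_derivative_transform_within_open[of "\<lambda>x. 0" "\<lambda>h. 0" x UNIV "- K" \<phi>])
         (use that K in auto)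
    then show ?thesis
      using frechet_derivative_at by metis
  qed
  with K show ?thesis
    by (intro C0infI[of _ K]) (auto intro: smooth_frechet_derivative C0inf_smooth assms)
qed

lemma C0inf_bounded:
  assumes "\<phi> \<in> C0inf S"
  obtains B where "\<And>x. norm (\<phi> x) \<le> B" "B \<ge> 0"
proof -
  obtain K where K: "compact K" "K \<subseteq> S" "\<And>x. x \<notin> K \<Longrightarrow> \<phi> x = 0"
    using C0infE[OF assms] by blast
  have "compact (\<phi> ` K)"
    by (intro compact_continuous_image smooth_continuous_on C0inf_smooth[OF assms] K)
  then obtain B where B: "\<And>x. x \<in> K \<Longrightarrow> norm (\<phi> x) \<le> B" "B > 0"
    using compact_imp_bounded bounded_pos[of "\<phi> ` K"] by auto
  have "norm (\<phi> x) \<le> B" for x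
    using B K(3)[of x] by (cases "x \<in> K") auto
  then show ?thesis
    using B(2) by (rule that[OF _ less_imp_le])
qed

section \<open>The fundamental lemma of the calculus of variations\<close>

text \<open>
  Boxes are stable under intersection and generate the Borel sets, so that Dynkin's theorem applies.
\<close>

lemma set_integral_zero_of_boxes:
  fixes g :: "'a::euclidean_space \<Rightarrow> real"
  assumes g: "integrable lborel g" and total: "(\<integral>x. g x \<partial>lborel) = 0"
    and box: "\<And>a b. (\<integral>x\<in>box a b. g x \<partial>lborel) = 0"
    and A: "A \<in> sets borel"
  shows "(\<integral>x\<in>A. g x \<partial>lborel) = 0"
proof -
  let ?E = "range (\<lambda>(a, b). box a b::'a set)"
  have E: "Int_stable ?E" "?E \<subseteq> Pow UNIV" "A \<in> sigma_sets UNIV ?E"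
    using A by (auto simp: Int_stable_def box_Int_box borel_eq_box)
  have meas: "B \<in> sets lborel" if "B \<in> sigma_sets UNIV ?E" for B
    using that by (simp add: borel_eq_box)
  have int: "set_integrable lborel B g" if "B \<in> sigma_sets UNIV ?E" for B
    using integrable_mult_indicator[OF meas[OF that] g] by (simp add: set_integrable_def)
  show ?thesis
    using E
  proof (induction rule: sigma_sets_induct_disjoint)
    case (basic B)
    then show ?case using box by auto
  next
    case empty
    then show ?case by (simp add: set_lebesgue_integral_def)
  next
    case (compl B)
    have "UNIV - B \<in> sigma_sets UNIV ?E"
      using compl by (auto intro: sigma_sets.Compl)
    then have "(\<integral>x\<in>B \<union> (UNIV - B). g x \<partial>lborel) =
        (\<integral>x\<in>B. g x \<partial>lborel) + (\<integral>x\<in>UNIV - B. g x \<partial>lborel)"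
      using compl by (intro set_integral_Un int) auto
    moreover have "B \<union> (UNIV - B) = UNIV" by blast
    ultimately show ?case
      using total compl by (simp add: set_lebesgue_integral_def)
  next
    case (union B)
    then have B: "B i \<in> sigma_sets UNIV ?E" for i by auto
    then have "(\<Union>i. B i) \<in> sigma_sets UNIV ?E"
      by (rule sigma_sets.Union)
    then have "(\<integral>x\<in>(\<Union>i. B i). g x \<partial>lborel) = (\<Sum>i. \<integral>x\<in>B i. g x \<partial>lborel)"
      using union B by (intro lebesgue_integral_countable_add int meas) (auto simp: disjoint_family_on_def)
    then show ?case using union by simp
  qed
qed

lemma integrable_mult_C0inf:
  fixes f :: "'a::euclidean_space \<Rightarrow> real"
  assumes f: "\<And>K. compact K \<Longrightarrow> K \<subseteq> S \<Longrightarrow> f absolutely_integrable_on K"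
    and \<phi>: "\<phi> \<in> C0inf S" and S: "open S"
  shows "integrable (lebesgue_on S) (\<lambda>x. f x * \<phi> x)"
proof -
  obtain K where K: "compact K" "K \<subseteq> S" "\<And>x. x \<notin> K \<Longrightarrow> \<phi> x = 0"
    using C0infE[OF \<phi>] by blast
  obtain B where B: "\<And>x. norm (\<phi> x) \<le> B"
    using C0inf_bounded[OF \<phi>] by blast
  have [measurable]: "\<phi> \<in> borel_measurable lebesgue"
    using smooth_continuous_on[OF C0inf_smooth[OF \<phi>], of UNIV]
    by (simp add: borel_measurable_continuous_onI measurable_completion)
  have int: "integrable lebesgue (\<lambda>x. indicator K x *\<^sub>R f x)"
    using f[OF K(1,2)] by (simp add: set_integrable_def)
  have "integrable lebesgue (\<lambda>x. (indicator K x *\<^sub>R f x) * \<phi> x)"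
  proof (rule Bochner_Integration.integrable_bound)
    show "integrable lebesgue (\<lambda>x. B * norm (indicator K x *\<^sub>R f x))"
      using int by (intro integrable_mult_right integrable_norm)
    show "(\<lambda>x. (indicator K x *\<^sub>R f x) * \<phi> x) \<in> borel_measurable lebesgue"
      using int by measurable
    have "\<bar>c * \<phi> x\<bar> \<le> \<bar>B * \<bar>c\<bar>\<bar>" for c x
      using mult_mono[OF B[of x] order_refl[of "\<bar>c\<bar>"]] order_trans[OF norm_ge_zero B[of x]]
      by (simp add: abs_mult mult.commute)
    then show "AE x in lebesgue. norm ((indicator K x *\<^sub>R f x) * \<phi> x)
        \<le> norm (B * norm (indicator K x *\<^sub>R f x))"
      by simp
  qed
  moreover have "(\<lambda>x. (indicator K x *\<^sub>R f x) * \<phi> x) = (\<lambda>x. indicator S x *\<^sub>R (f x * \<phi> x))"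
    using K by (fastforce split: split_indicator)
  ultimately show ?thesis
    using S by (subst integrable_restrict_space) simp_all
qed

text \<open>
  Powers of a bump function \<open>\<beta>\<close> turn into a test function \<open>1 - (1 - \<beta>) ^ k\<close> that increases to the
  indicator of a box. Hence the integrals of \<open>f\<close> over boxes in \<open>S\<close> vanish, therefore those over Borel
  subsets of a box, and \<open>f\<close> vanishes almost everywhere in it; countably many boxes cover \<open>S\<close>.
\<close>

lemma fundamental_lemma:
  fixes f :: "'a::euclidean_space \<Rightarrow> real"
  assumes S: "open S"
    and f: "\<And>K. compact K \<Longrightarrow> K \<subseteq> S \<Longrightarrow> f absolutely_integrable_on K"
    and zero: "\<And>\<phi>. \<phi> \<in> C0inf S \<Longrightarrow> (\<integral>x. f x * \<phi> x \<partial>lebesgue_on S) = 0"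
  shows "AE x in lebesgue_on S. f x = 0"
proof -
  have box_zero: "integrable lebesgue (\<lambda>x. indicator (box a b) x * f x) \<and>
      (\<integral>x. indicator (box a b) x * f x \<partial>lebesgue) = 0" if sub: "cbox a b \<subseteq> S" for a b
  proof -
    obtain \<beta> :: "'a \<Rightarrow> real" where \<beta>: "smooth \<beta>" "\<And>x. 0 \<le> \<beta> x" "\<And>x. \<beta> x < 1"
      "\<And>x. 0 < \<beta> x \<longleftrightarrow> x \<in> box a b"
      using exists_smooth_bump_box[of a b] by auto
    define \<rho> where "\<rho> = (\<lambda>k x. 1 - (1 - \<beta> x) ^ k)"
    have \<rho>_le: "\<bar>\<rho> k x\<bar> \<le> 1" for k x
      using \<beta>(2,3)[of x] power_le_one[of "1 - \<beta> x" k] zero_le_power[of "1 - \<beta> x" k]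
      by (auto simp: \<rho>_def abs_le_iff)
    have \<beta>0: "\<beta> x = 0" if "x \<notin> box a b" for x
      using \<beta>(2,4) that by (metis less_eq_real_def)
    have \<rho>0: "\<rho> k x = 0" if "x \<notin> box a b" for k x
      using \<beta>0[OF that] by (simp add: \<rho>_def)
    have \<rho>C: "\<rho> k \<in> C0inf S" for k
    proof (rule C0infI[of _ "cbox a b"])
      show "smooth (\<rho> k)"
        unfolding \<rho>_def by (intro smooth_diff smooth_const smooth_power \<beta>(1))
      show "\<rho> k x = 0" if "x \<notin> cbox a b" for x
        using \<rho>0 that box_subset_cbox by blast
    qed (use sub in \<open>auto simp: compact_cbox\<close>)
    have lim: "(\<lambda>k. \<rho> k x) \<longlonglongrightarrow> indicator (box a b) x" for x
    proof (cases "x \<in> box a b")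
      case True
      have "(\<lambda>k. 1 - (1 - \<beta> x) ^ k) \<longlonglongrightarrow> 1 - 0"
        by (intro tendsto_diff tendsto_const LIMSEQ_realpow_zero)
           (use \<beta>(3)[of x] \<beta>(4)[of x] True in auto)
      then show ?thesis using True by (simp add: \<rho>_def)
    next
      case False
      then show ?thesis by (simp add: \<rho>0)
    qed
    have int: "integrable lebesgue (\<lambda>x. indicator (cbox a b) x *\<^sub>R f x)"
      using f[OF compact_cbox sub] by (simp add: set_integrable_def)
    have [measurable]: "\<rho> k \<in> borel_measurable lebesgue" for k
      using smooth_continuous_on[OF C0inf_smooth[OF \<rho>C], of UNIV]
      by (simp add: borel_measurable_continuous_onI measurable_completion)
    define h where "h = (\<lambda>x. indicator (cbox a b) x *\<^sub>R f x)"
    have [measurable]: "h \<in> borel_measurable lebesgue" "box a b \<in> sets lebesgue"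
      using int by (auto simp: h_def)
    have "integrable lebesgue (\<lambda>x. indicator (box a b) x * h x) \<and>
        (\<lambda>k. \<integral>x. \<rho> k x * h x \<partial>lebesgue) \<longlonglongrightarrow> (\<integral>x. indicator (box a b) x * h x \<partial>lebesgue)"
    proof (intro conjI)
      have i: "integrable lebesgue (\<lambda>x. \<bar>h x\<bar>)"
        using int unfolding h_def by (rule integrable_abs)
      show "integrable lebesgue (\<lambda>x. indicator (box a b) x * h x)"
      proof (rule Bochner_Integration.integrable_bound[OF i])
        show "(\<lambda>x. indicator (box a b) x * h x) \<in> borel_measurable lebesgue"
          by measurable
      qed (auto split: split_indicator)
      show "(\<lambda>k. \<integral>x. \<rho> k x * h x \<partial>lebesgue) \<longlonglongrightarrow> (\<integral>x. indicator (box a b) x * h x \<partial>lebesgue)"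
      proof (rule integral_dominated_convergence[where w = "\<lambda>x. \<bar>h x\<bar>"])
        show "AE x in lebesgue. (\<lambda>k. \<rho> k x * h x) \<longlonglongrightarrow> indicator (box a b) x * h x"
          by (auto intro!: tendsto_mult lim)
        show "AE x in lebesgue. norm (\<rho> k x * h x) \<le> \<bar>h x\<bar>" for k
          using \<rho>_le by (auto simp: abs_mult intro!: mult_left_le_one_le)
        show "(\<lambda>x. \<rho> k x * h x) \<in> borel_measurable lebesgue"
          "(\<lambda>x. indicator (box a b) x * h x) \<in> borel_measurable lebesgue" for k
          by measurable
      qed (rule i)
    qed
    moreover have "(\<integral>x. \<rho> k x * h x \<partial>lebesgue) = 0" for k
    proof -
      have "(\<integral>x. \<rho> k x * h x \<partial>lebesgue) = (\<integral>x. indicator S x *\<^sub>R (f x * \<rho> k x) \<partial>lebesgue)"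
        using sub \<rho>0 box_subset_cbox[of a b]
        by (intro Bochner_Integration.integral_cong) (auto simp: h_def indicator_def)
      also have "\<dots> = (\<integral>x. f x * \<rho> k x \<partial>lebesgue_on S)"
        using S by (subst integral_restrict_space) auto
      finally show ?thesis using zero[OF \<rho>C] by simp
    qed
    moreover have "indicator (box a b) x * h x = indicator (box a b) x * f x" for x
      using box_subset_cbox[of a b] by (auto simp: h_def indicator_def)
    ultimately show ?thesis
      by (simp add: LIMSEQ_const_iff)
  qed
  have local: "AE x in lebesgue. x \<in> box c d \<longrightarrow> f x = 0" if sub: "cbox c d \<subseteq> S" for c d
  proof -
    define g where "g = (\<lambda>x. indicator (box c d) x * f x)"
    have gi: "integrable lebesgue g" "(\<integral>x. g x \<partial>lebesgue) = 0"
      using box_zero[OF sub] by (auto simp: g_def)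
    then obtain g' where g': "g' \<in> borel_measurable lborel" "AE x in lborel. g x = g' x"
      using completion_ex_borel_measurable_real[of g lborel] by auto
    have eq: "AE x in lebesgue. g x = g' x"
      using g'(2) by (rule AE_completion)
    have [measurable]: "g' \<in> borel_measurable borel" "g \<in> borel_measurable lebesgue"
      using g' gi by auto
    have [measurable]: "g' \<in> borel_measurable lebesgue"
      using g'(1) by (rule measurable_completion)
    have g'i: "integrable lborel g'"
      using gi(1) eq integrable_cong_AE[of g lebesgue g'] integrable_completion[of g' lborel] by auto
    have set_eq: "(\<integral>x\<in>A. g' x \<partial>lborel) = (\<integral>x. indicator A x * g x \<partial>lebesgue)" if "A \<in> sets borel" for A
    proof -
      have "(\<integral>x\<in>A. g' x \<partial>lborel) = (\<integral>x. indicator A x * g' x \<partial>lebesgue)"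
        unfolding set_lebesgue_integral_def using that by (subst integral_completion) auto
      also have "\<dots> = (\<integral>x. indicator A x * g x \<partial>lebesgue)"
      proof (rule integral_cong_AE)
        have [measurable]: "A \<in> sets lebesgue"
          using that by auto
        show "(\<lambda>x. indicator A x * g' x) \<in> borel_measurable lebesgue"
          "(\<lambda>x. indicator A x * g x) \<in> borel_measurable lebesgue"
          by measurable
        show "AE x in lebesgue. indicat_real A x * g' x = indicat_real A x * g x"
          using eq by eventually_elim simp
      qed
      finally show ?thesis .
    qed
    have "(\<integral>x\<in>A. g' x \<partial>lborel) = 0" if "A \<in> sets borel" for A
    proof (rule set_integral_zero_of_boxes[OF g'i _ _ that])
      show "(\<integral>x. g' x \<partial>lborel) = 0"
        using set_eq[of UNIV] gi by (simp add: set_lebesgue_integral_def)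
      show "(\<integral>x\<in>box a b. g' x \<partial>lborel) = 0" for a b
      proof -
        obtain a' b' where ab: "box a b \<inter> box c d = box a' b'"
          using box_Int_box by blast
        have "cbox a' b' \<subseteq> S" if "box a' b' \<noteq> {}"
        proof -
          have "closure (box a' b') \<subseteq> cbox c d"
            unfolding ab[symmetric] using box_subset_cbox[of c d] by (intro closure_minimal) auto
          then show ?thesis
            using sub that by (simp add: closure_box)
        qed
        moreover have eq: "(\<lambda>x. indicator (box a b) x * g x) = (\<lambda>x. indicator (box a' b') x * f x)"
          unfolding ab[symmetric] g_def by (simp add: indicator_inter_arith mult.assoc)
        ultimately have "(\<integral>x. indicator (box a' b') x * f x \<partial>lebesgue) = 0"
          using box_zero[of a' b'] by (cases "box a' b' = {}") auto
        then show ?thesis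
          using set_eq[of "box a b"] unfolding eq by simp
      qed
    qed
    then have "AE x in lborel. g' x = 0"
      using density_unique_real[OF g'i, of "\<lambda>x. 0"] by (simp add: set_lebesgue_integral_def)
    then have "AE x in lebesgue. g' x = 0"
      by (rule AE_completion)
    with eq show ?thesis
      by eventually_elim (auto simp: g_def)
  qed
  obtain \<D> where \<D>: "countable \<D>" "\<D> \<subseteq> Pow S" "\<And>X. X \<in> \<D> \<Longrightarrow> \<exists>a b. X = cbox a b" "\<Union>\<D> = S"
    using open_countable_Union_open_cbox[OF S] by blast
  have "AE x in lebesgue. \<forall>X\<in>\<D>. x \<in> X \<longrightarrow> f x = 0"
    unfolding AE_ball_countable[OF \<D>(1)]
  proof
    fix X assume X: "X \<in> \<D>"
    then obtain a b where ab: "X = cbox a b"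
      using \<D>(3) by blast
    have "cbox a b \<subseteq> S" using X \<D>(2) ab by blast
    then have "AE x in lebesgue. x \<in> box a b \<longrightarrow> f x = 0"
      by (rule local)
    moreover have "AE x in lebesgue. x \<notin> cbox a b - box a b"
      by (rule AE_not_in) (simp add: negligible_frontier_interval flip: negligible_iff_null_sets)
    ultimately show "AE x in lebesgue. x \<in> X \<longrightarrow> f x = 0"
      by eventually_elim (use ab in auto)
  qed
  then have "AE x in lebesgue. x \<in> S \<longrightarrow> f x = 0"
    by eventually_elim (use \<D>(4) in blast)
  then show ?thesis
    using S by (subst AE_restrict_space_iff) auto
qed

lemma absolutely_integrable_continuous_compact:
  fixes f :: "'a::euclidean_space \<Rightarrow> 'b::euclidean_space"
  assumes "compact K" "continuous_on K f"
  shows "f absolutely_integrable_on K"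
proof -
  have "set_integrable lborel K f"
    using borel_integrable_compact[OF assms] by (simp add: set_integrable_def indicator_scaleR_eq_if)
  then show ?thesis
    unfolding set_integrable_def by (simp add: integrable_completion)
qed

section \<open>Weak gradients\<close>

lemma matrix_entry_bounded_linear: "bounded_linear (\<lambda>A::real^'n^'m. A $ i $ j)"
  using bounded_linear_compose[OF bounded_linear_vec_nth[of j] bounded_linear_vec_nth[of i]]
  by simp

lemma has_weak_gradientD:
  assumes "has_weak_gradient \<Omega> u G" "\<phi> \<in> C0inf \<Omega>"
  shows "(\<integral>x. u x $ i * frechet_derivative \<phi> (at x) (axis j 1) \<partial>lebesgue_on \<Omega>) =
    - (\<integral>x. G x $ i $ j * \<phi> x \<partial>lebesgue_on \<Omega>)"
  using assms unfolding has_weak_gradient_def by blast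

lemma has_weak_gradient_entry_integrable:
  assumes "has_weak_gradient \<Omega> u G" "compact K" "K \<subseteq> \<Omega>"
  shows "(\<lambda>x. u x $ i) absolutely_integrable_on K" "(\<lambda>x. G x $ i $ j) absolutely_integrable_on K"
proof -
  have "u absolutely_integrable_on K" "G absolutely_integrable_on K"
    using assms unfolding has_weak_gradient_def by blast+
  then show "(\<lambda>x. u x $ i) absolutely_integrable_on K" "(\<lambda>x. G x $ i $ j) absolutely_integrable_on K"
    using absolutely_integrable_linear[OF _ bounded_linear_vec_nth[of i]]
      absolutely_integrable_linear[OF _ matrix_entry_bounded_linear[of i j]]
    by (auto simp: o_def)
qed

lemma has_weak_gradient_unique:
  assumes \<Omega>: "open \<Omega>" and G: "has_weak_gradient \<Omega> u G" and H: "has_weak_gradient \<Omega> u H"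
  shows "AE x in lebesgue_on \<Omega>. G x = H x"
proof -
  have "AE x in lebesgue_on \<Omega>. G x $ i $ j - H x $ i $ j = 0" for i j
  proof (rule fundamental_lemma[OF \<Omega>])
    show "(\<lambda>x. G x $ i $ j - H x $ i $ j) absolutely_integrable_on K" if "compact K" "K \<subseteq> \<Omega>" for K
      using that assms by (auto intro!: set_integral_diff has_weak_gradient_entry_integrable)
    fix \<phi> :: "real^'a \<Rightarrow> real" assume \<phi>: "\<phi> \<in> C0inf \<Omega>"
    have "integrable (lebesgue_on \<Omega>) (\<lambda>x. G x $ i $ j * \<phi> x)" "integrable (lebesgue_on \<Omega>) (\<lambda>x. H x $ i $ j * \<phi> x)"
      by (intro integrable_mult_C0inf[OF _ \<phi> \<Omega>] has_weak_gradient_entry_integrable[OF G]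
          has_weak_gradient_entry_integrable[OF H]; assumption)+
    moreover have "(\<integral>x. G x $ i $ j * \<phi> x \<partial>lebesgue_on \<Omega>) = (\<integral>x. H x $ i $ j * \<phi> x \<partial>lebesgue_on \<Omega>)"
      using has_weak_gradientD[OF G \<phi>, of i j] has_weak_gradientD[OF H \<phi>, of i j] by simp
    ultimately show "(\<integral>x. (G x $ i $ j - H x $ i $ j) * \<phi> x \<partial>lebesgue_on \<Omega>) = 0"
      by (simp add: left_diff_distrib)
  qed
  then have "AE x in lebesgue_on \<Omega>. \<forall>i j. G x $ i $ j - H x $ i $ j = 0"
    by (simp add: AE_all_countable)
  then show ?thesis
    by eventually_elim (simp add: vec_eq_iff)
qed

lemma has_weak_gradient_diff:
  assumes \<Omega>: "open \<Omega>" and G: "has_weak_gradient \<Omega> u G" and H: "has_weak_gradient \<Omega> w H"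
  shows "has_weak_gradient \<Omega> (\<lambda>x. u x - w x) (\<lambda>x. G x - H x)"
  unfolding has_weak_gradient_def
proof (intro conjI allI impI ballI)
  fix K assume "compact K \<and> K \<subseteq> \<Omega>"
  then show "(\<lambda>x. u x - w x) absolutely_integrable_on K" "(\<lambda>x. G x - H x) absolutely_integrable_on K"
    using G H by (auto simp: has_weak_gradient_def intro!: set_integral_diff)
next
  fix \<phi> :: "real^'a \<Rightarrow> real" and i j assume \<phi>: "\<phi> \<in> C0inf \<Omega>"
  have \<phi>': "(\<lambda>x. frechet_derivative \<phi> (at x) (axis j 1)) \<in> C0inf \<Omega>"
    by (rule C0inf_frechet_derivative[OF \<phi>])
  have "integrable (lebesgue_on \<Omega>) (\<lambda>x. G x $ i $ j * \<phi> x)" "integrable (lebesgue_on \<Omega>) (\<lambda>x. H x $ i $ j * \<phi> x)"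
    "integrable (lebesgue_on \<Omega>) (\<lambda>x. u x $ i * frechet_derivative \<phi> (at x) (axis j 1))"
    "integrable (lebesgue_on \<Omega>) (\<lambda>x. w x $ i * frechet_derivative \<phi> (at x) (axis j 1))"
    by (intro integrable_mult_C0inf[OF _ \<phi> \<Omega>] integrable_mult_C0inf[OF _ \<phi>' \<Omega>]
        has_weak_gradient_entry_integrable[OF G] has_weak_gradient_entry_integrable[OF H]; assumption)+
  then show "(\<integral>x. (u x - w x) $ i * frechet_derivative \<phi> (at x) (axis j 1) \<partial>lebesgue_on \<Omega>) =
      - (\<integral>x. (G x - H x) $ i $ j * \<phi> x \<partial>lebesgue_on \<Omega>)"
    using has_weak_gradientD[OF G \<phi>, of i j] has_weak_gradientD[OF H \<phi>, of i j]
    by (simp add: left_diff_distrib)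
qed

lemma weak_grad_works: "has_weak_gradient \<Omega> u G \<Longrightarrow> has_weak_gradient \<Omega> u (weak_grad \<Omega> u)"
  unfolding weak_grad_def by (rule someI[of "has_weak_gradient \<Omega> u"])

lemma weak_grad_eq:
  "open \<Omega> \<Longrightarrow> has_weak_gradient \<Omega> u G \<Longrightarrow> AE x in lebesgue_on \<Omega>. weak_grad \<Omega> u x = G x"
  using has_weak_gradient_unique weak_grad_works by blast

text \<open>The mean of a difference quotient vanishes by translation invariance; let the step tend to 0.\<close>

lemma integral_frechet_derivative_C0inf:
  fixes \<phi> :: "'a::euclidean_space \<Rightarrow> real"
  assumes \<phi>: "\<phi> \<in> C0inf S"
  shows "(\<integral>x. frechet_derivative \<phi> (at x) h \<partial>lborel) = 0"
proof -
  obtain K where K: "compact K" "K \<subseteq> S" "\<And>x. x \<notin> K \<Longrightarrow> \<phi> x = 0"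
    using C0infE[OF \<phi>] by blast
  obtain R where R: "\<And>x. x \<in> K \<Longrightarrow> norm x \<le> R"
    using K(1) compact_imp_bounded bounded_iff by metis
  obtain B where B: "\<And>x. norm (frechet_derivative \<phi> (at x) h) \<le> B"
    using C0inf_bounded[OF C0inf_frechet_derivative[OF \<phi>]] by metis
  have d: "(\<phi> has_derivative frechet_derivative \<phi> (at x)) (at x)" for x
    by (rule smooth_has_derivative[OF C0inf_smooth[OF \<phi>]])
  have line: "((\<lambda>s. \<phi> (x + s *\<^sub>R h)) has_real_derivative frechet_derivative \<phi> (at (x + s *\<^sub>R h)) h) (at s)" for x s
  proof -
    have "((\<lambda>s. x + s *\<^sub>R h) has_derivative (\<lambda>s. s *\<^sub>R h)) (at s)"
      by (auto intro!: derivative_eq_intros)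
    then have "((\<lambda>s. \<phi> (x + s *\<^sub>R h)) has_derivative (\<lambda>s'. frechet_derivative \<phi> (at (x + s *\<^sub>R h)) (s' *\<^sub>R h))) (at s)"
      by (rule has_derivative_compose[OF _ d])
    moreover have "frechet_derivative \<phi> (at y) (s' *\<^sub>R h) = s' * frechet_derivative \<phi> (at y) h" for y s'
      using linear_scale[OF has_derivative_linear[OF d]] by simp
    ultimately show ?thesis
      by (simp add: has_field_derivative_def mult.commute[of _ "frechet_derivative \<phi> _ h"])
  qed
  have lip: "\<bar>\<phi> (x + s *\<^sub>R h) - \<phi> x\<bar> \<le> B * s" if s: "s > 0" for x s
  proof -
    obtain z where "\<phi> (x + s *\<^sub>R h) - \<phi> (x + 0 *\<^sub>R h) = (s - 0) * frechet_derivative \<phi> (at (x + z *\<^sub>R h)) h"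
      using MVT2[of 0 s "\<lambda>s. \<phi> (x + s *\<^sub>R h)" "\<lambda>z. frechet_derivative \<phi> (at (x + z *\<^sub>R h)) h"]
        line s by blast
    then show ?thesis
      using B[of "x + z *\<^sub>R h"] s by (simp add: abs_mult mult.commute)
  qed
  have cont: "continuous_on UNIV \<phi>"
    by (rule smooth_continuous_on[OF C0inf_smooth[OF \<phi>]])
  have [measurable]: "\<phi> \<in> borel_measurable borel" "(\<lambda>x. \<phi> (x + c)) \<in> borel_measurable borel" for c
    by (intro borel_measurable_continuous_onI continuous_on_compose2[OF cont] continuous_intros; simp)+
  have int: "integrable lborel \<phi>"
  proof -
    have "integrable lborel (\<lambda>x. indicator K x *\<^sub>R \<phi> x)"
      by (intro borel_integrable_compact K continuous_on_subset[OF cont]) auto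
    moreover have "(\<lambda>x. indicator K x *\<^sub>R \<phi> x) = \<phi>"
      using K(3) by (fastforce split: split_indicator)
    ultimately show ?thesis by simp
  qed
  have trans: "integrable lborel (\<lambda>x. \<phi> (x + c)) \<and> (\<integral>x. \<phi> (x + c) \<partial>lborel) = (\<integral>x. \<phi> x \<partial>lborel)" for c
    using integrable_distr_eq[of "(+) c" lborel borel \<phi>] integral_distr[of "(+) c" lborel borel \<phi>]
      lborel_distr_plus[of c] int
    by (simp add: add.commute)
  \<comment> \<open>Difference quotients in direction \<open>h\<close> with step \<open>1 / (n + 1)\<close>.\<close>
  define D where "D = (\<lambda>n x. real (Suc n) * (\<phi> (x + (1 / real (Suc n)) *\<^sub>R h) - \<phi> x))"
  have "(\<integral>x. D n x \<partial>lborel) = 0" for n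
    using trans[of "(1 / real (Suc n)) *\<^sub>R h"] int by (simp add: D_def)
  moreover have "(\<lambda>n. \<integral>x. D n x \<partial>lborel) \<longlonglongrightarrow> (\<integral>x. frechet_derivative \<phi> (at x) h \<partial>lborel)"
  proof (rule integral_dominated_convergence[where w = "\<lambda>x. indicator (cball 0 (R + norm h)) x *\<^sub>R B"])
    show "integrable lborel (\<lambda>x::'a. indicator (cball 0 (R + norm h)) x *\<^sub>R B)"
      by (intro borel_integrable_compact) auto
    show "AE x in lborel. (\<lambda>n. D n x) \<longlonglongrightarrow> frechet_derivative \<phi> (at x) h"
    proof (rule AE_I2)
      fix x :: 'a
      have "((\<lambda>s. (\<phi> (x + s *\<^sub>R h) - \<phi> x) / s) \<longlongrightarrow> frechet_derivative \<phi> (at x) h) (at 0)"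
        using line[of x 0] by (simp add: has_field_derivative_iff)
      moreover have "filterlim (\<lambda>n. 1 / real (Suc n)) (at 0) sequentially"
        using LIMSEQ_inverse_real_of_nat
        by (auto simp: filterlim_at inverse_eq_divide simp del: of_nat_Suc intro!: always_eventually)
      ultimately have "(\<lambda>n. (\<phi> (x + (1 / real (Suc n)) *\<^sub>R h) - \<phi> x) / (1 / real (Suc n)))
          \<longlonglongrightarrow> frechet_derivative \<phi> (at x) h"
        by (rule filterlim_compose)
      then show "(\<lambda>n. D n x) \<longlonglongrightarrow> frechet_derivative \<phi> (at x) h"
        by (simp add: D_def mult.commute)
    qed
    show "AE x in lborel. norm (D n x) \<le> indicator (cball 0 (R + norm h)) x *\<^sub>R B" for n
    proof (rule AE_I2)
      fix x :: 'a
      show "norm (D n x) \<le> indicator (cball 0 (R + norm h)) x *\<^sub>R B"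
      proof (cases "norm x \<le> R + norm h")
        case True
        have "\<bar>D n x\<bar> \<le> real (Suc n) * (B * (1 / real (Suc n)))"
          unfolding D_def abs_mult abs_of_nat
          by (intro mult_left_mono lip) (simp_all del: of_nat_Suc)
        then show ?thesis using True by simp
      next
        case False
        have "norm ((1 / real (Suc n)) *\<^sub>R h) \<le> norm h"
          by (simp add: divide_le_eq_1 field_simps)
        then have "norm (x + (1 / real (Suc n)) *\<^sub>R h) > R"
          using False norm_diff_ineq[of x "(1 / real (Suc n)) *\<^sub>R h"] by linarith
        then have "x + (1 / real (Suc n)) *\<^sub>R h \<notin> K"
          using R by force
        moreover have "x \<notin> K" using R[of x] False norm_ge_zero[of h] by auto
        ultimately show ?thesis using K(3) False by (simp add: D_def)
      qed
    qed
  qed (auto simp: D_def intro!: borel_measurable_continuous_onI smooth_continuous_on smooth_frechet_derivative C0inf_smooth[OF \<phi>])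
  ultimately show ?thesis
    by (simp add: LIMSEQ_const_iff)
qed

lemma jacobian_entry:
  "jacobian \<psi> (at x) $ i $ j = frechet_derivative \<psi> (at x) (axis j 1) $ i"
  by (simp add: jacobian_def matrix_def)

lemma continuous_on_jacobian:
  fixes \<psi> :: "real^'n \<Rightarrow> real^'m"
  assumes "smooth \<psi>"
  shows "continuous_on S (\<lambda>x. jacobian \<psi> (at x))"
proof -
  have "continuous_on S (\<lambda>x. \<chi> i j. frechet_derivative \<psi> (at x) (axis j 1) $ i)"
    by (intro continuous_on_vec_lambda continuous_on_component smooth_continuous_on
        smooth_frechet_derivative assms)
  then show ?thesis
    by (simp add: jacobian_def matrix_def)
qed

text \<open>
  Apply \<open>integral_frechet_derivative_C0inf\<close> to the product of a component of \<open>\<psi>\<close> and a test function.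
\<close>

lemma has_weak_gradient_jacobian:
  fixes \<psi> :: "real^'n \<Rightarrow> real^'n"
  assumes \<Omega>: "open \<Omega>" and \<psi>: "\<psi> \<in> C0inf \<Omega>"
  shows "has_weak_gradient \<Omega> \<psi> (\<lambda>x. jacobian \<psi> (at x))"
  unfolding has_weak_gradient_def
proof (intro conjI allI impI ballI)
  fix K assume "compact K \<and> K \<subseteq> \<Omega>"
  then show "\<psi> absolutely_integrable_on K" "(\<lambda>x. jacobian \<psi> (at x)) absolutely_integrable_on K"
    by (intro absolutely_integrable_continuous_compact continuous_on_jacobian
        smooth_continuous_on[OF C0inf_smooth[OF \<psi>]] C0inf_smooth[OF \<psi>]; simp)+
next
  fix \<phi> :: "real^'n \<Rightarrow> real" and i j assume \<phi>: "\<phi> \<in> C0inf \<Omega>"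
  let ?e = "axis j 1 :: real^'n"
  have \<psi>i: "(\<lambda>x. \<psi> x $ i) \<in> C0inf \<Omega>"
    by (rule C0inf_linear_comp[OF bounded_linear_vec_nth \<psi>])
  have prod: "(\<lambda>x. \<psi> x $ i * \<phi> x) \<in> C0inf \<Omega>"
    using C0inf_scale[OF C0inf_smooth[OF \<psi>i] \<phi>] by simp
  have der: "frechet_derivative (\<lambda>x. \<psi> x $ i * \<phi> x) (at x) ?e =
      \<psi> x $ i * frechet_derivative \<phi> (at x) ?e + jacobian \<psi> (at x) $ i $ j * \<phi> x" for x
  proof -
    have "((\<lambda>x. \<psi> x $ i * \<phi> x) has_derivative (\<lambda>h. \<psi> x $ i * frechet_derivative \<phi> (at x) h +
        frechet_derivative \<psi> (at x) h $ i * \<phi> x)) (at x)"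
      by (intro has_derivative_mult bounded_linear.has_derivative[OF bounded_linear_vec_nth]
          smooth_has_derivative C0inf_smooth[OF \<phi>] C0inf_smooth[OF \<psi>])
    from frechet_derivative_at[OF this, symmetric] show ?thesis
      by (simp add: jacobian_entry)
  qed
  obtain K where K: "compact K" "K \<subseteq> \<Omega>" "\<And>x. x \<notin> K \<Longrightarrow> \<phi> x = 0"
    using C0infE[OF \<phi>] by blast
  have \<phi>': "(\<lambda>x. frechet_derivative \<phi> (at x) ?e) \<in> C0inf \<Omega>"
    by (rule C0inf_frechet_derivative[OF \<phi>])
  have ai: "(\<lambda>x. \<psi> x $ i) absolutely_integrable_on K" "(\<lambda>x. jacobian \<psi> (at x) $ i $ j) absolutely_integrable_on K"
    if "compact K" for K
    using that by (intro absolutely_integrable_continuous_compact continuous_on_component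
        continuous_on_jacobian smooth_continuous_on C0inf_smooth[OF \<psi>]; assumption)+
  have int: "integrable (lebesgue_on \<Omega>) (\<lambda>x. \<psi> x $ i * frechet_derivative \<phi> (at x) ?e)"
    "integrable (lebesgue_on \<Omega>) (\<lambda>x. jacobian \<psi> (at x) $ i $ j * \<phi> x)"
    by (intro integrable_mult_C0inf[OF _ \<phi> \<Omega>] integrable_mult_C0inf[OF _ \<phi>' \<Omega>] ai; assumption)+
  have "(\<integral>x. frechet_derivative (\<lambda>x. \<psi> x $ i * \<phi> x) (at x) ?e \<partial>lebesgue_on \<Omega>) =
      (\<integral>x. indicator \<Omega> x *\<^sub>R frechet_derivative (\<lambda>x. \<psi> x $ i * \<phi> x) (at x) ?e \<partial>lebesgue)"
    using \<Omega> by (subst integral_restrict_space) auto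
  also have "\<dots> = (\<integral>x. frechet_derivative (\<lambda>x. \<psi> x $ i * \<phi> x) (at x) ?e \<partial>lebesgue)"
  proof (intro Bochner_Integration.integral_cong refl)
    fix x
    obtain L where L: "L \<subseteq> \<Omega>" "\<And>x. x \<notin> L \<Longrightarrow> frechet_derivative (\<lambda>x. \<psi> x $ i * \<phi> x) (at x) ?e = 0"
      using C0infE[OF C0inf_frechet_derivative[OF prod, of ?e]] by blast
    then show "indicator \<Omega> x *\<^sub>R frechet_derivative (\<lambda>x. \<psi> x $ i * \<phi> x) (at x) ?e =
        frechet_derivative (\<lambda>x. \<psi> x $ i * \<phi> x) (at x) ?e"
      by (cases "x \<in> \<Omega>") auto
  qed
  also have "\<dots> = (\<integral>x. frechet_derivative (\<lambda>x. \<psi> x $ i * \<phi> x) (at x) ?e \<partial>lborel)"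
    by (intro integral_completion) (auto intro!: borel_measurable_continuous_onI
      smooth_continuous_on smooth_frechet_derivative C0inf_smooth[OF prod])
  also have "\<dots> = 0"
    by (rule integral_frechet_derivative_C0inf[OF prod])
  finally show "(\<integral>x. \<psi> x $ i * frechet_derivative \<phi> (at x) ?e \<partial>lebesgue_on \<Omega>) =
      - (\<integral>x. jacobian \<psi> (at x) $ i $ j * \<phi> x \<partial>lebesgue_on \<Omega>)"
    using int by (simp add: der)
qed

section \<open>The Sobolev inequality\<close>

text \<open>
  Convexity of the exponential function.
\<close>

lemma weighted_AM_GM:
  fixes l x :: "'i \<Rightarrow> real"
  assumes fin: "finite I" and l: "\<And>i. i \<in> I \<Longrightarrow> 0 < l i" "(\<Sum>i\<in>I. l i) = 1"
    and x: "\<And>i. i \<in> I \<Longrightarrow> 0 \<le> x i"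
  shows "(\<Prod>i\<in>I. x i powr l i) \<le> (\<Sum>i\<in>I. l i * x i)"
proof (cases "\<exists>i\<in>I. x i = 0")
  case True
  then have "(\<Prod>i\<in>I. x i powr l i) = 0"
    using fin by auto
  moreover have "0 \<le> (\<Sum>i\<in>I. l i * x i)"
    using x l by (intro sum_nonneg mult_nonneg_nonneg) (auto intro: less_imp_le)
  ultimately show ?thesis by linarith
next
  case False
  with x have pos: "\<And>i. i \<in> I \<Longrightarrow> 0 < x i" by (metis order_less_le)
  have "I \<noteq> {}" using l(2) by auto
  have "(\<Prod>i\<in>I. x i powr l i) = (\<Prod>i\<in>I. exp (l i * ln (x i)))"
    by (intro prod.cong refl) (use pos in \<open>fastforce simp: powr_def\<close>)
  also have "\<dots> = exp (\<Sum>i\<in>I. l i *\<^sub>R ln (x i))"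
    by (simp add: exp_sum fin)
  also have "\<dots> \<le> (\<Sum>i\<in>I. l i * exp (ln (x i)))"
    using l(1) by (intro convex_on_sum[OF fin \<open>I \<noteq> {}\<close> exp_convex l(2)]) (auto intro: less_imp_le)
  also have "\<dots> = (\<Sum>i\<in>I. l i * x i)"
    using pos by (intro sum.cong) auto
  finally show ?thesis .
qed

text \<open>
  With the factors normalised to have integral 1, integrate the weighted inequality of the means.
\<close>

lemma weighted_Holder:
  fixes f :: "'i \<Rightarrow> 'x \<Rightarrow> real"
  assumes fin: "finite I" and l: "\<And>i. i \<in> I \<Longrightarrow> 0 < l i" "(\<Sum>i\<in>I. l i) = 1"
    and f: "\<And>i. i \<in> I \<Longrightarrow> integrable M (f i)" "\<And>i x. i \<in> I \<Longrightarrow> 0 \<le> f i x"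
  shows "integrable M (\<lambda>x. \<Prod>i\<in>I. f i x powr l i)"
    and "(\<integral>x. (\<Prod>i\<in>I. f i x powr l i) \<partial>M) \<le> (\<Prod>i\<in>I. (\<integral>x. f i x \<partial>M) powr l i)"
proof -
  have meas: "(\<lambda>x. \<Prod>i\<in>I. f i x powr l i) \<in> borel_measurable M"
    using f(1) by (intro borel_measurable_prod powr_real_measurable borel_measurable_const) auto
  have nonneg: "0 \<le> (\<Prod>i\<in>I. f i x powr l i)" for x
    by (intro prod_nonneg) auto
  have int: "integrable M (\<lambda>x. \<Sum>i\<in>I. c i * f i x)" for c :: "'i \<Rightarrow> real"
    using f(1) by (intro Bochner_Integration.integrable_sum integrable_mult_right) auto
  show i: "integrable M (\<lambda>x. \<Prod>i\<in>I. f i x powr l i)"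
  proof (rule Bochner_Integration.integrable_bound[OF int[of l] meas])
    show "AE x in M. norm (\<Prod>i\<in>I. f i x powr l i) \<le> norm (\<Sum>i\<in>I. l i * f i x)"
      using weighted_AM_GM[OF fin l, of "\<lambda>i. f i _"] f(2) nonneg by (auto intro: order_trans[OF _ abs_ge_self])
  qed
  define A where "A = (\<lambda>i. \<integral>x. f i x \<partial>M)"
  have A0: "0 \<le> A i" if "i \<in> I" for i
    unfolding A_def using f(2)[OF that] by simp
  show "(\<integral>x. (\<Prod>i\<in>I. f i x powr l i) \<partial>M) \<le> (\<Prod>i\<in>I. (\<integral>x. f i x \<partial>M) powr l i)"
  proof (cases "\<exists>i\<in>I. A i = 0")
    case True
    then obtain i where i: "i \<in> I" "A i = 0" by blast
    then have "AE x in M. f i x = 0"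
      using integral_nonneg_eq_0_iff_AE[OF f(1)[OF i(1)]] f(2)[OF i(1)] by (simp add: A_def)
    then have "AE x in M. (\<Prod>i\<in>I. f i x powr l i) = 0"
      by eventually_elim (use i fin in auto)
    then have "(\<integral>x. (\<Prod>i\<in>I. f i x powr l i) \<partial>M) = 0"
      by (rule integral_eq_zero_AE)
    then show ?thesis by (auto intro: prod_nonneg)
  next
    case False
    with A0 have pos: "0 < A i" if "i \<in> I" for i using that by (metis order_less_le)
    define P where "P = (\<Prod>i\<in>I. A i powr l i)"
    have P: "0 < P" unfolding P_def using pos by (intro prod_pos) (simp add: less_imp_neq[symmetric])
    have "(\<Prod>i\<in>I. f i x powr l i) \<le> P * (\<Sum>i\<in>I. (l i / A i) * f i x)" for x
    proof -
      have "(\<Prod>i\<in>I. f i x powr l i) = P * (\<Prod>i\<in>I. (f i x / A i) powr l i)"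
        unfolding P_def prod.distrib[symmetric]
        by (intro prod.cong refl, subst powr_mult[symmetric]) (use pos f(2) in \<open>auto simp: less_imp_le less_imp_neq[symmetric]\<close>)
      also have "(\<Prod>i\<in>I. (f i x / A i) powr l i) \<le> (\<Sum>i\<in>I. l i * (f i x / A i))"
        using pos f(2) by (intro weighted_AM_GM fin l) (auto intro!: divide_nonneg_pos)
      finally show ?thesis using P by simp
    qed
    then have "(\<integral>x. (\<Prod>i\<in>I. f i x powr l i) \<partial>M) \<le> (\<integral>x. P * (\<Sum>i\<in>I. (l i / A i) * f i x) \<partial>M)"
      by (intro integral_mono i integrable_mult_right int)
    also have "\<dots> = P * (\<Sum>i\<in>I. (l i / A i) * A i)"
      using f(1) by (simp add: A_def Bochner_Integration.integral_sum)
    also have "\<dots> = P"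
      using pos l(2) by (simp add: less_imp_neq[symmetric])
    finally show ?thesis by (simp add: P_def A_def)
  qed
qed

subsection \<open>Integrating out one coordinate\<close>

definition coord_upd :: "'a::euclidean_space \<Rightarrow> 'a \<Rightarrow> real \<Rightarrow> 'a" where
  "coord_upd b x s = x + (s - x \<bullet> b) *\<^sub>R b"

text \<open>
  Cutting off the Lebesgue measure makes all bounded measurable functions integrable along the
  coordinate directions. For functions that vanish where some coordinate exceeds \<open>R\<close> in modulus this
  does not change the integrals.
\<close>

definition interval_lborel :: "real \<Rightarrow> real measure" where
  "interval_lborel R = density lborel (\<lambda>s. ennreal (indicator {-R..R} s))"

text \<open>
  The integral over the coordinate in direction \<open>b\<close>, as a function on the same space that is constant
  in this direction. Iterated integrals thus become compositions of operators which commute.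
\<close>

definition coord_integral :: "real \<Rightarrow> 'a::euclidean_space \<Rightarrow> ('a \<Rightarrow> real) \<Rightarrow> 'a \<Rightarrow> real" where
  "coord_integral R b G x = (\<integral>s. G (coord_upd b x s) \<partial>interval_lborel R)"

lemma interval_lborel_space [simp]: "space (interval_lborel R) = UNIV"
  and interval_lborel_sets [simp, measurable_cong]: "sets (interval_lborel R) = sets borel"
  by (simp_all add: interval_lborel_def)

lemma finite_measure_interval_lborel: "finite_measure (interval_lborel R)"
proof
  have "emeasure (interval_lborel R) UNIV = (\<integral>\<^sup>+s. indicator {-R..R} s \<partial>lborel)"
    by (simp add: interval_lborel_def emeasure_density ennreal_indicator)
  also have "\<dots> = emeasure lborel {-R..R}"
    by simp
  finally show "emeasure (interval_lborel R) (space (interval_lborel R)) \<noteq> \<infinity>"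
    by (simp add: emeasure_lborel_Icc_eq)
qed

lemma coord_upd_upd: "b \<in> Basis \<Longrightarrow> coord_upd b (coord_upd b x s) t = coord_upd b x t"
  by (simp add: coord_upd_def algebra_simps inner_add_left)

lemma coord_upd_commute:
  "b \<in> Basis \<Longrightarrow> c \<in> Basis \<Longrightarrow> b \<noteq> c \<Longrightarrow>
    coord_upd b (coord_upd c x s) t = coord_upd c (coord_upd b x t) s"
  by (simp add: coord_upd_def algebra_simps inner_add_left inner_Basis)

lemma coord_upd_measurable [measurable]:
  "case_prod (coord_upd b) \<in> borel_measurable (borel \<Otimes>\<^sub>M borel)"
  unfolding coord_upd_def by measurable

text \<open>The class of functions on which the operators act: integrability is automatic in it.\<close>

definition bdd_nonneg_borel :: "('a::euclidean_space \<Rightarrow> real) \<Rightarrow> bool" where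
  "bdd_nonneg_borel G \<longleftrightarrow> G \<in> borel_measurable borel \<and> (\<forall>x. 0 \<le> G x) \<and> (\<exists>B. \<forall>x. G x \<le> B)"

lemma bdd_nonneg_borel_slice:
  assumes "bdd_nonneg_borel G"
  shows "(\<lambda>s. G (coord_upd b x s)) \<in> borel_measurable borel"
    and "integrable (interval_lborel R) (\<lambda>s. G (coord_upd b x s))"
proof -
  obtain B where [measurable]: "G \<in> borel_measurable borel" and B: "\<And>x. 0 \<le> G x" "\<And>x. G x \<le> B"
    using assms by (auto simp: bdd_nonneg_borel_def)
  show [measurable]: "(\<lambda>s. G (coord_upd b x s)) \<in> borel_measurable borel"
    unfolding coord_upd_def by measurable
  interpret finite_measure "interval_lborel R" by (rule finite_measure_interval_lborel)
  show "integrable (interval_lborel R) (\<lambda>s. G (coord_upd b x s))"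
    by (rule integrable_const_bound[of _ B]) (use B in auto)
qed

lemma bdd_nonneg_borel_coord_integral:
  assumes "bdd_nonneg_borel G"
  shows "bdd_nonneg_borel (coord_integral R b G)"
proof -
  obtain B where G[measurable]: "G \<in> borel_measurable borel" and B: "\<And>x. 0 \<le> G x" "\<And>x. G x \<le> B"
    using assms by (auto simp: bdd_nonneg_borel_def)
  interpret finite_measure "interval_lborel R" by (rule finite_measure_interval_lborel)
  have "(\<lambda>(x, s). G (coord_upd b x s)) \<in> borel_measurable (borel \<Otimes>\<^sub>M interval_lborel R)"
    unfolding coord_upd_def by measurable
  then have "coord_integral R b G \<in> borel_measurable borel"
    unfolding coord_integral_def by (intro borel_measurable_lebesgue_integral) (simp add: case_prod_beta)
  moreover have "0 \<le> coord_integral R b G x" for x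
    unfolding coord_integral_def using B by simp
  moreover have "coord_integral R b G x \<le> (\<integral>s. B \<partial>interval_lborel R)" for x
    unfolding coord_integral_def
    by (intro integral_mono bdd_nonneg_borel_slice assms integrable_const B)
  ultimately show ?thesis by (auto simp: bdd_nonneg_borel_def)
qed

lemma coord_integral_commute:
  assumes G: "bdd_nonneg_borel G" and bc: "b \<in> Basis" "c \<in> Basis" "b \<noteq> c"
  shows "coord_integral R b (coord_integral R c G) x = coord_integral R c (coord_integral R b G) x"
proof -
  obtain B where [measurable]: "G \<in> borel_measurable borel" and B: "\<And>x. 0 \<le> G x" "\<And>x. G x \<le> B"
    using G by (auto simp: bdd_nonneg_borel_def)
  interpret finite_measure "interval_lborel R" by (rule finite_measure_interval_lborel)
  interpret pair_sigma_finite "interval_lborel R" "interval_lborel R" ..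
  interpret P: finite_measure "interval_lborel R \<Otimes>\<^sub>M interval_lborel R"
    by (rule finite_measure_pair_measure) (rule finite_measure_interval_lborel)+
  have "(\<lambda>(s, t). G (coord_upd c (coord_upd b x s) t)) \<in> borel_measurable (interval_lborel R \<Otimes>\<^sub>M interval_lborel R)"
    unfolding coord_upd_def by measurable
  then have "integrable (interval_lborel R \<Otimes>\<^sub>M interval_lborel R) (\<lambda>(s, t). G (coord_upd c (coord_upd b x s) t))"
    by (intro P.integrable_const_bound[of _ B]) (use B in auto)
  from Fubini_integral[OF this] show ?thesis
    by (simp add: coord_integral_def coord_upd_commute[OF bc])
qed

lemma coord_integral_upd_self:
  "b \<in> Basis \<Longrightarrow> coord_integral R b G (coord_upd b x s) = coord_integral R b G x"
  by (simp add: coord_integral_def coord_upd_upd)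

subsection \<open>The Loomis--Whitney--Gagliardo inequality\<close>

text \<open>
  One more coordinate \<open>k\<close> is integrated out: the factor with index \<open>k\<close> does not depend on it, and
  Hoelder's inequality with equal weights applies to the remaining ones.
\<close>

lemma Gagliardo_step:
  fixes A W :: "'a::euclidean_space \<Rightarrow> real"
  assumes A: "bdd_nonneg_borel A" and W: "bdd_nonneg_borel W"
    and dim: "2 \<le> DIM('a)" and k: "k \<in> Basis" "k \<notin> J"
    and le: "\<And>x. A x \<le> (\<Prod>i\<in>Basis. (if i \<in> J then W x else coord_integral R i W x) powr (1 / (real DIM('a) - 1)))"
  shows "coord_integral R k A x \<le>
    (\<Prod>i\<in>Basis. (if i \<in> insert k J then coord_integral R k W x
        else coord_integral R i (coord_integral R k W) x) powr (1 / (real DIM('a) - 1)))"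
proof -
  let ?l = "1 / (real DIM('a) - 1)"
  define F where "F = (\<lambda>i. if i \<in> J then W else coord_integral R i W)"
  have F: "bdd_nonneg_borel (F i)" for i
    unfolding F_def using W bdd_nonneg_borel_coord_integral by auto
  have F0: "0 \<le> F i y" for i y
    using F by (auto simp: bdd_nonneg_borel_def)
  have Fk: "F k (coord_upd k x s) = coord_integral R k W x" for s
    using k by (simp add: F_def coord_integral_upd_self)
  let ?f = "\<lambda>i s. F i (coord_upd k x s)"
  have holder: "integrable (interval_lborel R) (\<lambda>s. \<Prod>i\<in>Basis - {k}. ?f i s powr ?l)"
    "(\<integral>s. (\<Prod>i\<in>Basis - {k}. ?f i s powr ?l) \<partial>interval_lborel R) \<le>
       (\<Prod>i\<in>Basis - {k}. (\<integral>s. ?f i s \<partial>interval_lborel R) powr ?l)"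
    using dim k by (intro weighted_Holder bdd_nonneg_borel_slice F F0; simp add: card_Diff_singleton of_nat_diff)+
  have le': "A (coord_upd k x s) \<le> coord_integral R k W x powr ?l * (\<Prod>i\<in>Basis - {k}. ?f i s powr ?l)" for s
  proof -
    have "A (coord_upd k x s) \<le> (\<Prod>i\<in>Basis. ?f i s powr ?l)"
      using le[of "coord_upd k x s"] by (simp add: F_def if_distrib[of "\<lambda>g. g (coord_upd k x s)"] cong: if_cong)
    also have "\<dots> = ?f k s powr ?l * (\<Prod>i\<in>Basis - {k}. ?f i s powr ?l)"
      using k by (intro prod.remove) auto
    finally show ?thesis by (simp add: Fk)
  qed
  have "coord_integral R k A x \<le>
      (\<integral>s. coord_integral R k W x powr ?l * (\<Prod>i\<in>Basis - {k}. ?f i s powr ?l) \<partial>interval_lborel R)"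
    unfolding coord_integral_def[of R k A]
    by (intro integral_mono bdd_nonneg_borel_slice A integrable_mult_right holder le')
  also have "\<dots> = coord_integral R k W x powr ?l * (\<integral>s. (\<Prod>i\<in>Basis - {k}. ?f i s powr ?l) \<partial>interval_lborel R)"
    by simp
  also have "\<dots> \<le> coord_integral R k W x powr ?l * (\<Prod>i\<in>Basis - {k}. (\<integral>s. ?f i s \<partial>interval_lborel R) powr ?l)"
    by (intro mult_left_mono holder) auto
  also have "(\<Prod>i\<in>Basis - {k}. (\<integral>s. ?f i s \<partial>interval_lborel R) powr ?l) =
      (\<Prod>i\<in>Basis - {k}. (if i \<in> insert k J then coord_integral R k W x
        else coord_integral R i (coord_integral R k W) x) powr ?l)"
  proof (intro prod.cong refl)
    fix i assume i: "i \<in> Basis - {k}"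
    have "(\<integral>s. ?f i s \<partial>interval_lborel R) = coord_integral R k (F i) x"
      by (simp add: coord_integral_def)
    then show "(\<integral>s. ?f i s \<partial>interval_lborel R) powr ?l = (if i \<in> insert k J then coord_integral R k W x
        else coord_integral R i (coord_integral R k W) x) powr ?l"
      using i k coord_integral_commute[OF W k(1), of i] by (auto simp: F_def)
  qed
  also have "coord_integral R k W x powr ?l * \<dots> = (\<Prod>i\<in>Basis. (if i \<in> insert k J then coord_integral R k W x
        else coord_integral R i (coord_integral R k W) x) powr ?l)"
    using k by (subst (2) prod.remove[of _ k]) auto
  finally show ?thesis .
qed

definition coord_integrals :: "real \<Rightarrow> 'a::euclidean_space list \<Rightarrow> ('a \<Rightarrow> real) \<Rightarrow> 'a \<Rightarrow> real" where
  "coord_integrals R bs G = fold (coord_integral R) bs G"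

text \<open>
  The coordinates in \<open>bs\<close> are integrated out one after another; \<open>J\<close> collects those that are done.
\<close>

lemma Gagliardo_list:
  fixes A W :: "'a::euclidean_space \<Rightarrow> real"
  assumes "bdd_nonneg_borel A" "bdd_nonneg_borel W" "2 \<le> DIM('a)"
    and "distinct bs" "set bs \<subseteq> Basis" "set bs \<inter> J = {}"
    and "\<And>x. A x \<le> (\<Prod>i\<in>Basis. (if i \<in> J then W x else coord_integral R i W x) powr (1 / (real DIM('a) - 1)))"
  shows "coord_integrals R bs A x \<le>
    (\<Prod>i\<in>Basis. (if i \<in> set bs \<union> J then coord_integrals R bs W x
        else coord_integral R i (coord_integrals R bs W) x) powr (1 / (real DIM('a) - 1)))"
  using assms
proof (induction bs arbitrary: A W J)
  case Nil
  then show ?case unfolding coord_integrals_def by (simp cong: if_cong)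
next
  case (Cons k bs)
  have "coord_integrals R bs (coord_integral R k A) x \<le>
    (\<Prod>i\<in>Basis. (if i \<in> set bs \<union> insert k J then coord_integrals R bs (coord_integral R k W) x
        else coord_integral R i (coord_integrals R bs (coord_integral R k W)) x) powr (1 / (real DIM('a) - 1)))"
  proof (rule Cons.IH)
    show "bdd_nonneg_borel (coord_integral R k A)" "bdd_nonneg_borel (coord_integral R k W)"
      by (intro bdd_nonneg_borel_coord_integral Cons.prems)+
    show "coord_integral R k A x \<le> (\<Prod>i\<in>Basis. (if i \<in> insert k J then coord_integral R k W x
        else coord_integral R i (coord_integral R k W) x) powr (1 / (real DIM('a) - 1)))" for x
      using Cons.prems by (intro Gagliardo_step) auto
  qed (use Cons.prems in auto)
  then show ?case unfolding coord_integrals_def by (simp cong: if_cong)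
qed

lemma nn_integral_interval_lborel:
  assumes [measurable]: "g \<in> borel_measurable borel" and zero: "\<And>s. \<bar>s\<bar> > R \<Longrightarrow> g s = 0"
  shows "(\<integral>\<^sup>+s. g s \<partial>interval_lborel R) = (\<integral>\<^sup>+s. g s \<partial>lborel)"
proof -
  have "(\<integral>\<^sup>+s. g s \<partial>interval_lborel R) = (\<integral>\<^sup>+s. ennreal (indicator {-R..R} s) * g s \<partial>lborel)"
    unfolding interval_lborel_def by (rule nn_integral_density) auto
  also have "\<dots> = (\<integral>\<^sup>+s. g s \<partial>lborel)"
    using zero by (intro nn_integral_cong) (auto simp: indicator_def abs_if split: if_splits)
  finally show ?thesis .
qed

lemma coord_integrals_eq_nn_integral:
  fixes H :: "'a::euclidean_space \<Rightarrow> real"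
  assumes "bdd_nonneg_borel H" "distinct bs" "set bs \<subseteq> Basis"
    and "\<And>x b. b \<in> set bs \<Longrightarrow> \<bar>x \<bullet> b\<bar> > R \<Longrightarrow> H x = 0"
  shows "ennreal (coord_integrals R bs H x) =
    (\<integral>\<^sup>+f. ennreal (H (x + (\<Sum>b\<in>set bs. (f b - x \<bullet> b) *\<^sub>R b))) \<partial>(\<Pi>\<^sub>M b\<in>set bs. lborel))"
  using assms
proof (induction bs arbitrary: H)
  case Nil
  then show ?case
    by (simp add: coord_integrals_def PiM_empty nn_integral_count_space_finite)
next
  case (Cons k bs)
  interpret product_sigma_finite "\<lambda>b::'a. lborel :: real measure"
    by standard
  have H[measurable]: "H \<in> borel_measurable borel" and H0: "\<And>x. 0 \<le> H x"
    using Cons.prems(1) by (auto simp: bdd_nonneg_borel_def)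
  have k: "k \<in> Basis" "k \<notin> set bs" using Cons.prems by auto
  have "ennreal (coord_integrals R (k # bs) H x) = ennreal (coord_integrals R bs (coord_integral R k H) x)"
    by (simp add: coord_integrals_def)
  also have "\<dots> = (\<integral>\<^sup>+f. ennreal (coord_integral R k H (x + (\<Sum>b\<in>set bs. (f b - x \<bullet> b) *\<^sub>R b))) \<partial>(\<Pi>\<^sub>M b\<in>set bs. lborel))"
  proof (rule Cons.IH)
    show "bdd_nonneg_borel (coord_integral R k H)"
      by (intro bdd_nonneg_borel_coord_integral Cons.prems)
    fix y b assume b: "b \<in> set bs" "\<bar>y \<bullet> b\<bar> > R"
    moreover have "k \<bullet> b = 0"
      using b k Cons.prems(3) by (intro inner_not_same_Basis) auto
    ultimately have "coord_upd k y s \<bullet> b = y \<bullet> b" for s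
      by (simp add: coord_upd_def inner_add_left)
    then have "H (coord_upd k y s) = 0" for s
      using b Cons.prems(4)[of b] by simp
    then show "coord_integral R k H y = 0"
      by (simp add: coord_integral_def)
  qed (use Cons.prems in auto)
  also have "\<dots> = (\<integral>\<^sup>+f. (\<integral>\<^sup>+s. ennreal (H (x + (\<Sum>b\<in>set (k # bs). ((f(k := s)) b - x \<bullet> b) *\<^sub>R b))) \<partial>lborel)
      \<partial>(\<Pi>\<^sub>M b\<in>set bs. lborel))"
  proof (intro nn_integral_cong)
    fix f :: "'a \<Rightarrow> real"
    define y where "y = x + (\<Sum>b\<in>set bs. (f b - x \<bullet> b) *\<^sub>R b)"
    have yk: "y \<bullet> k = x \<bullet> k"
    proof -
      have "(\<Sum>b\<in>set bs. (f b - x \<bullet> b) * (b \<bullet> k)) = 0"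
      proof (intro sum.neutral ballI)
        fix b assume "b \<in> set bs"
        then have "b \<bullet> k = 0"
          using k Cons.prems(3) by (intro inner_not_same_Basis) auto
        then show "(f b - x \<bullet> b) * (b \<bullet> k) = 0" by simp
      qed
      then show ?thesis by (simp add: y_def inner_add_left inner_sum_left)
    qed
    have upd: "coord_upd k y s = x + (\<Sum>b\<in>set (k # bs). ((f(k := s)) b - x \<bullet> b) *\<^sub>R b)" for s
    proof -
      have "(\<Sum>b\<in>set bs. ((f(k := s)) b - x \<bullet> b) *\<^sub>R b) = (\<Sum>b\<in>set bs. (f b - x \<bullet> b) *\<^sub>R b)"
        using k by (intro sum.cong) auto
      then show ?thesis
        using k by (simp add: coord_upd_def yk) (simp add: y_def)
    qed
    have zero: "H (coord_upd k y s) = 0" if "\<bar>s\<bar> > R" for s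
    proof -
      have "coord_upd k y s \<bullet> k = s"
        using k by (simp add: coord_upd_def inner_add_left)
      then show ?thesis using Cons.prems(4)[of k "coord_upd k y s"] that by simp
    qed
    have "ennreal (coord_integral R k H y) = (\<integral>\<^sup>+s. ennreal (H (coord_upd k y s)) \<partial>interval_lborel R)"
      unfolding coord_integral_def
      using bdd_nonneg_borel_slice[OF Cons.prems(1)] H0 by (intro nn_integral_eq_integral[symmetric]) auto
    also have "\<dots> = (\<integral>\<^sup>+s. ennreal (H (coord_upd k y s)) \<partial>lborel)"
      using bdd_nonneg_borel_slice[OF Cons.prems(1)] zero by (intro nn_integral_interval_lborel) auto
    finally show "ennreal (coord_integral R k H (x + (\<Sum>b\<in>set bs. (f b - x \<bullet> b) *\<^sub>R b))) =
      (\<integral>\<^sup>+s. ennreal (H (x + (\<Sum>b\<in>set (k # bs). ((f(k := s)) b - x \<bullet> b) *\<^sub>R b))) \<partial>lborel)"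
      by (simp only: upd y_def[symmetric])
  qed
  also have "\<dots> = (\<integral>\<^sup>+f. ennreal (H (x + (\<Sum>b\<in>set (k # bs). (f b - x \<bullet> b) *\<^sub>R b))) \<partial>(\<Pi>\<^sub>M b\<in>insert k (set bs). lborel))"
  proof (rule product_nn_integral_insert[symmetric])
    have "(\<lambda>f. \<Sum>b\<in>set (k # bs). (f b - x \<bullet> b) *\<^sub>R b) \<in> borel_measurable (\<Pi>\<^sub>M b\<in>insert k (set bs). lborel)"
      by (intro borel_measurable_sum borel_measurable_scaleR borel_measurable_diff borel_measurable_const) auto
    then show "(\<lambda>f. ennreal (H (x + (\<Sum>b\<in>set (k # bs). (f b - x \<bullet> b) *\<^sub>R b)))) \<in> borel_measurable (\<Pi>\<^sub>M b\<in>insert k (set bs). lborel)"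
      by measurable
  qed (use k in auto)
  finally show ?case by simp
qed

lemma coord_integrals_eq_integral:
  fixes H :: "'a::euclidean_space \<Rightarrow> real"
  assumes H: "bdd_nonneg_borel H" and bs: "distinct bs" "set bs = Basis"
    and zero: "\<And>x b. b \<in> Basis \<Longrightarrow> \<bar>x \<bullet> b\<bar> > R \<Longrightarrow> H x = 0"
  shows "integrable lborel H" "coord_integrals R bs H x = (\<integral>x. H x \<partial>lborel)"
proof -
  have H'[measurable]: "H \<in> borel_measurable borel" and H0: "\<And>x. 0 \<le> H x"
    using H by (auto simp: bdd_nonneg_borel_def)
  have "bdd_nonneg_borel (coord_integrals R bs H)"
    using H unfolding coord_integrals_def
    by (induction bs arbitrary: H) (auto intro: bdd_nonneg_borel_coord_integral)
  then have nn: "0 \<le> coord_integrals R bs H x" by (auto simp: bdd_nonneg_borel_def)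
  have "ennreal (coord_integrals R bs H x) =
    (\<integral>\<^sup>+f. ennreal (H (x + (\<Sum>b\<in>Basis. (f b - x \<bullet> b) *\<^sub>R b))) \<partial>(\<Pi>\<^sub>M b\<in>Basis. lborel))"
    using coord_integrals_eq_nn_integral[OF H bs(1), of R x] bs zero by simp
  also have "\<dots> = (\<integral>\<^sup>+f. ennreal (H (\<Sum>b\<in>Basis. f b *\<^sub>R b)) \<partial>(\<Pi>\<^sub>M b\<in>Basis. lborel))"
    by (simp add: algebra_simps sum_subtractf euclidean_representation)
  also have "\<dots> = (\<integral>\<^sup>+x. ennreal (H x) \<partial>lborel)"
    by (subst (2) lborel_eq) (simp add: nn_integral_distr)
  finally have eq: "(\<integral>\<^sup>+x. ennreal (H x) \<partial>lborel) = ennreal (coord_integrals R bs H x)" by simp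
  then show "integrable lborel H" "coord_integrals R bs H x = (\<integral>x. H x \<partial>lborel)"
    using nn_integral_eq_integrable[of H lborel "coord_integrals R bs H x"] H0 nn by auto
qed

text \<open>
  Start with \<open>J = {}\<close>, where the hypothesis is that \<open>h\<close> to the power \<open>n / (n - 1)\<close> is at most a product
  of \<open>n\<close> factors, the one with index \<open>i\<close> being constant in direction \<open>i\<close>, and integrate out all
  coordinates.
\<close>

lemma Gagliardo_inequality:
  fixes h H :: "'a::euclidean_space \<Rightarrow> real"
  assumes h: "bdd_nonneg_borel h" and H: "bdd_nonneg_borel H" and dim: "2 \<le> DIM('a)"
    and zero: "\<And>x b. b \<in> Basis \<Longrightarrow> \<bar>x \<bullet> b\<bar> > R \<Longrightarrow> h x = 0 \<and> H x = 0"
    and le: "\<And>b x. b \<in> Basis \<Longrightarrow> h x \<le> coord_integral R b H x"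
  shows "(\<integral>x. h x powr (real DIM('a) / (real DIM('a) - 1)) \<partial>lborel) \<le>
    (\<integral>x. H x \<partial>lborel) powr (real DIM('a) / (real DIM('a) - 1))"
proof -
  let ?n = "real DIM('a)" and ?l = "1 / (real DIM('a) - 1)"
  obtain bs :: "'a list" where bs: "distinct bs" "set bs = Basis"
    using finite_distinct_list[OF finite_Basis] by blast
  define A where "A = (\<lambda>x. h x powr (?n / (?n - 1)))"
  obtain B where [measurable]: "h \<in> borel_measurable borel" and B: "\<And>x. 0 \<le> h x" "\<And>x. h x \<le> B"
    using h by (auto simp: bdd_nonneg_borel_def)
  have "A \<in> borel_measurable borel" unfolding A_def by measurable
  moreover have "A x \<le> B powr (?n / (?n - 1))" for x
    unfolding A_def using B dim by (intro powr_mono2) auto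
  ultimately have A: "bdd_nonneg_borel A" by (auto simp: bdd_nonneg_borel_def A_def)
  have pow: "(\<Prod>i\<in>(Basis :: 'a set). c powr ?l) = c powr (?n / (?n - 1))" for c
    using dim powr_power[of c ?l "DIM('a)"] by (cases "c = 0") auto
  have "A x \<le> (\<Prod>i\<in>Basis. (if i \<in> {} then H x else coord_integral R i H x) powr ?l)" for x
  proof -
    have "A x = (\<Prod>i\<in>(Basis :: 'a set). h x powr ?l)"
      by (simp only: A_def pow)
    also have "\<dots> \<le> (\<Prod>i\<in>Basis. coord_integral R i H x powr ?l)"
      using le B dim by (intro prod_mono) (auto intro!: powr_mono2)
    finally show ?thesis by simp
  qed
  from Gagliardo_list[OF A H dim bs(1) _ _ this, of 0] bs(2)
  have "coord_integrals R bs A 0 \<le> (\<Prod>i\<in>(Basis :: 'a set). coord_integrals R bs H 0 powr ?l)"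
    by simp
  moreover have "coord_integrals R bs A 0 = (\<integral>x. A x \<partial>lborel)"
    by (rule coord_integrals_eq_integral[OF A bs]) (use zero in \<open>auto simp: A_def\<close>)
  moreover have "coord_integrals R bs H 0 = (\<integral>x. H x \<partial>lborel)"
    by (rule coord_integrals_eq_integral[OF H bs]) (use zero in auto)
  moreover have "0 \<le> (\<integral>x. H x \<partial>lborel)"
    using H by (auto simp: bdd_nonneg_borel_def)
  ultimately show ?thesis by (simp only: A_def pow)
qed

subsection \<open>From Gagliardo to Sobolev\<close>

text \<open>The exponent is larger than 1, hence the power is differentiable also at the zeros of \<open>c\<close>.\<close>

lemma norm_powr_has_derivative:
  fixes c :: "real \<Rightarrow> 'b::euclidean_space"
  assumes c: "(c has_vector_derivative c') (at s)" and \<gamma>: "1 < \<gamma>"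
  obtains D where "((\<lambda>t. norm (c t) powr \<gamma>) has_real_derivative D) (at s)"
    "\<bar>D\<bar> \<le> \<gamma> * norm (c s) powr (\<gamma> - 1) * norm c'"
proof (cases "c s = 0")
  case False
  have 1: "(c has_derivative (\<lambda>h. h *\<^sub>R c')) (at s)"
    using c by (simp add: has_vector_derivative_def)
  have 2: "(norm has_derivative (\<lambda>h. sgn (c s) \<bullet> h)) (at (c s))"
    using has_derivative_norm[OF False] by (simp add: inner_commute)
  have "((\<lambda>t. norm (c t)) has_derivative (\<lambda>h. sgn (c s) \<bullet> (h *\<^sub>R c'))) (at s)"
    by (rule has_derivative_compose[OF 1 2])
  then have "((\<lambda>t. norm (c t)) has_real_derivative (sgn (c s) \<bullet> c')) (at s)"
    by (simp add: has_field_derivative_def mult_commute_abs)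
  then have "((\<lambda>t. norm (c t) powr \<gamma>) has_real_derivative (\<gamma> * norm (c s) powr (\<gamma> - 1) * (sgn (c s) \<bullet> c'))) (at s)"
    using False by (auto intro!: derivative_eq_intros)
  moreover have "\<bar>sgn (c s) \<bullet> c'\<bar> \<le> norm c'"
    using Cauchy_Schwarz_ineq2[of "sgn (c s)" c'] False by (simp add: norm_sgn)
  then have "\<bar>\<gamma> * norm (c s) powr (\<gamma> - 1) * (sgn (c s) \<bullet> c')\<bar> \<le> \<gamma> * norm (c s) powr (\<gamma> - 1) * norm c'"
    using \<gamma> by (auto simp: abs_mult intro!: mult_left_mono)
  ultimately show ?thesis by (rule that)
next
  case True
  define rem where "rem = (\<lambda>t. norm ((c t - c s) - (t - s) *\<^sub>R c') / norm (t - s))"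
  have "(rem \<longlongrightarrow> 0) (at s)"
    using c unfolding has_vector_derivative_def has_derivative_iff_norm rem_def by blast
  moreover have "((\<lambda>t. norm (c t) powr (\<gamma> - 1)) \<longlongrightarrow> 0) (at s)"
  proof -
    have "(c \<longlongrightarrow> c s) (at s)"
      using has_vector_derivative_continuous[OF c] by (simp add: continuous_within)
    then have "((\<lambda>t. norm (c t)) \<longlongrightarrow> 0) (at s)"
      using True tendsto_norm_zero by fastforce
    then show ?thesis
      using \<gamma> by (intro tendsto_zero_powrI[of _ _ _ "\<gamma> - 1"]) auto
  qed
  ultimately have lim: "((\<lambda>t. (rem t + norm c') * norm (c t) powr (\<gamma> - 1)) \<longlongrightarrow> (0 + norm c') * 0) (at s)"
    by (intro tendsto_mult tendsto_add tendsto_const)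
  have "((\<lambda>t. (norm (c t) powr \<gamma> - norm (c s) powr \<gamma>) / (t - s)) \<longlongrightarrow> 0) (at s)"
  proof (rule Lim_null_comparison)
    show "\<forall>\<^sub>F t in at s. norm ((norm (c t) powr \<gamma> - norm (c s) powr \<gamma>) / (t - s))
        \<le> (rem t + norm c') * norm (c t) powr (\<gamma> - 1)"
      unfolding eventually_at_filter
    proof (intro always_eventually allI impI)
      fix t assume t: "t \<noteq> s"
      have "norm (c t) \<le> norm ((c t - c s) - (t - s) *\<^sub>R c') + norm ((t - s) *\<^sub>R c')"
        using True norm_triangle_ineq[of "(c t - c s) - (t - s) *\<^sub>R c'" "(t - s) *\<^sub>R c'"] by simp
      also have "\<dots> = (rem t + norm c') * norm (t - s)"
        unfolding rem_def norm_scaleR real_norm_def distrib_right using t by simp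
      finally have "norm (c t) / norm (t - s) \<le> rem t + norm c'"
        using t by (simp add: pos_divide_le_eq)
      then have "norm (c t) / norm (t - s) * norm (c t) powr (\<gamma> - 1) \<le> (rem t + norm c') * norm (c t) powr (\<gamma> - 1)"
        by (rule mult_right_mono) simp
      moreover have "norm (c t) * norm (c t) powr (\<gamma> - 1) = norm (c t) powr \<gamma>"
        using \<gamma> powr_mult_base[of "norm (c t)" "\<gamma> - 1"] by simp
      ultimately show "norm ((norm (c t) powr \<gamma> - norm (c s) powr \<gamma>) / (t - s))
        \<le> (rem t + norm c') * norm (c t) powr (\<gamma> - 1)"
        using True \<gamma> by simp
    qed
    show "((\<lambda>t. (rem t + norm c') * norm (c t) powr (\<gamma> - 1)) \<longlongrightarrow> 0) (at s)"
      using lim by simp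
  qed
  then have "((\<lambda>t. norm (c t) powr \<gamma>) has_real_derivative 0) (at s)"
    by (simp add: has_field_derivative_iff)
  then show ?thesis
    by (rule that) (use \<gamma> in simp)
qed

text \<open>
  The fundamental theorem of calculus from a point to the left of the support, where \<open>c\<close> vanishes.
\<close>

lemma norm_powr_le_integral:
  fixes c :: "real \<Rightarrow> 'b::euclidean_space"
  assumes c: "\<And>s. (c has_vector_derivative c' s) (at s)" "continuous_on UNIV c'"
    and zero: "\<And>s. \<bar>s\<bar> > R \<Longrightarrow> c s = 0" and \<gamma>: "1 < \<gamma>"
  shows "norm (c s) powr \<gamma> \<le> (\<integral>t. \<gamma> * norm (c t) powr (\<gamma> - 1) * norm (c' t) \<partial>interval_lborel R)"
proof -
  define m where "m = (\<lambda>t. \<gamma> * norm (c t) powr (\<gamma> - 1) * norm (c' t))"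
  have cc: "continuous_on UNIV c"
    using c(1) by (auto intro!: continuous_at_imp_continuous_on has_vector_derivative_continuous)
  have m: "continuous_on S m" for S
    unfolding m_def using \<gamma> cc c(2)
    by (intro continuous_on_mult continuous_on_const continuous_on_powr' continuous_on_norm) (auto intro: continuous_on_subset)
  have m0: "0 \<le> m t" for t using \<gamma> by (auto simp: m_def)
  have mz: "m t = 0" if "\<bar>t\<bar> > R" for t using zero[OF that] by (simp add: m_def)
  have nonneg: "0 \<le> (\<integral>t. m t \<partial>interval_lborel R)"
    using m0 by simp
  show ?thesis unfolding m_def[symmetric]
  proof (cases "\<bar>s\<bar> > R")
    case True
    then show "norm (c s) powr \<gamma> \<le> (\<integral>t. m t \<partial>interval_lborel R)"
      using zero nonneg by simp
  next
    case False
    \<comment> \<open>Any point to the left of the interval from \<open>- R\<close> to \<open>R\<close> would do.\<close>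
    define a where "a = - R - 1"
    have as: "a < s" using False by (auto simp: a_def)
    have "\<forall>t. \<exists>D. ((\<lambda>t. norm (c t) powr \<gamma>) has_real_derivative D) (at t) \<and> \<bar>D\<bar> \<le> m t"
      unfolding m_def
      by (rule allI, rule norm_powr_has_derivative[OF c(1) \<gamma>]) (rule exI, rule conjI)
    from choice[OF this] obtain D where
      D: "((\<lambda>t. norm (c t) powr \<gamma>) has_real_derivative D t) (at t)" "\<bar>D t\<bar> \<le> m t" for t
      by blast
    have "norm (norm (c s) powr \<gamma> - norm (c a) powr \<gamma>) \<le> integral {a..s} m - integral {a..a} m"
    proof (rule differentiable_bound_general[OF as])
      show "continuous_on {a..s} (\<lambda>t. norm (c t) powr \<gamma>)"
        using D(1) by (auto intro!: continuous_at_imp_continuous_on DERIV_isCont)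
      show "continuous_on {a..s} (\<lambda>t. integral {a..t} m)"
        by (intro indefinite_integral_continuous_1 integrable_continuous_interval m)
      fix t assume t: "a < t" "t < s"
      show "((\<lambda>t. norm (c t) powr \<gamma>) has_vector_derivative D t) (at t)"
        using D(1) by (simp add: has_real_derivative_iff_has_vector_derivative)
      have "((\<lambda>t. integral {a..t} m) has_vector_derivative m t) (at t within {a..s})"
        using t by (intro integral_has_vector_derivative m) auto
      then show "((\<lambda>t. integral {a..t} m) has_vector_derivative m t) (at t)"
        using t by (simp add: at_within_Icc_at)
      show "norm (D t) \<le> m t" using D(2) by simp
    qed
    moreover have "c a = 0" using zero[of a] False by (auto simp: a_def)
    ultimately have "norm (c s) powr \<gamma> \<le> integral {a..s} m"
      by simp
    also have "\<dots> = (\<integral>t. indicator {a..s} t *\<^sub>R m t \<partial>lborel)"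
      using set_borel_integral_eq_integral(2)[of "{a..s}" m] borel_integrable_atLeastAtMost'[OF m, of a s]
      by (simp add: set_lebesgue_integral_def)
    also have "\<dots> \<le> (\<integral>t. indicator {-R..R} t *\<^sub>R m t \<partial>lborel)"
    proof (rule integral_mono)
      show "integrable lborel (\<lambda>t. indicator {a..s} t *\<^sub>R m t)" "integrable lborel (\<lambda>t. indicator {-R..R} t *\<^sub>R m t)"
        by (intro borel_integrable_compact m; simp)+
      show "indicator {a..s} t *\<^sub>R m t \<le> indicator {-R..R} t *\<^sub>R m t" for t
        using m0[of t] mz[of t] by (auto simp: indicator_def abs_if split: if_splits)
    qed
    also have "\<dots> = (\<integral>t. m t \<partial>interval_lborel R)"
      unfolding interval_lborel_def using m
      by (subst integral_density) (auto intro: borel_measurable_continuous_onI)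
    finally show "norm (c s) powr \<gamma> \<le> (\<integral>t. m t \<partial>interval_lborel R)" .
  qed
qed

lemma norm_frechet_le_jacobian:
  fixes \<psi> :: "real^'n \<Rightarrow> real^'m"
  shows "norm (frechet_derivative \<psi> (at x) (axis j 1)) \<le> norm (jacobian \<psi> (at x))"
proof -
  have "frechet_derivative \<psi> (at x) (axis j 1) $ i = jacobian \<psi> (at x) $ i $ j" for i
    by (simp add: jacobian_entry)
  then have "(norm (frechet_derivative \<psi> (at x) (axis j 1)))\<^sup>2 = (\<Sum>i\<in>UNIV. (jacobian \<psi> (at x) $ i $ j)\<^sup>2)"
    unfolding power2_norm_eq_inner inner_vec_def by (simp add: power2_eq_square)
  also have "\<dots> \<le> (\<Sum>i\<in>UNIV. \<Sum>k\<in>UNIV. (jacobian \<psi> (at x) $ i $ k)\<^sup>2)"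
    by (intro sum_mono member_le_sum) auto
  also have "\<dots> = (norm (jacobian \<psi> (at x)))\<^sup>2"
    unfolding power2_norm_eq_inner inner_vec_def by (simp add: power2_eq_square)
  finally show ?thesis
    by (rule power2_le_imp_le) simp
qed

text \<open>
  The inequality for the exponent 1 is Gagliardo's. It is applied to \<open>norm \<psi> powr \<gamma>\<close>, with \<open>\<gamma>\<close> such that
  \<open>\<gamma> n / (n - 1) = n q / (n - q)\<close>. The derivative of this function is estimated by Hoelder's inequality with
  the exponents \<open>q / (q - 1)\<close> and \<open>q\<close>; the first factor is again a power of the left-hand side, with a
  smaller exponent, and cancels.
\<close>

lemma Sobolev_inequality_lborel:
  fixes \<psi> :: "real^'n \<Rightarrow> real^'m" and q :: real
  assumes \<psi>: "\<psi> \<in> C0inf S" and q: "1 < q" "q < real CARD('n)"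
  defines "n \<equiv> real CARD('n)"
  shows "(\<integral>x. norm (\<psi> x) powr (n * q / (n - q)) \<partial>lborel) powr ((n - q) / (n * q)) \<le>
    q * (n - 1) / (n - q) * (\<integral>x. norm (jacobian \<psi> (at x)) powr q \<partial>lborel) powr (1 / q)"
proof -
  define \<gamma> where "\<gamma> = q * (n - 1) / (n - q)"
  define J where "J = (\<lambda>x. norm (jacobian \<psi> (at x)))"
  have n: "1 < n" "q < n" using q by (auto simp: n_def)
  then have dim: "2 \<le> DIM(real^'n)" by (simp add: n_def)
  have \<gamma>: "1 < \<gamma>"
  proof -
    have "n - q < q * (n - 1)" using q n by (simp add: algebra_simps)
    then show ?thesis using n by (simp add: \<gamma>_def)
  qed
  have sm: "smooth \<psi>" by (rule C0inf_smooth[OF \<psi>])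
  have cont: "continuous_on UNIV \<psi>" "continuous_on UNIV (\<lambda>x. jacobian \<psi> (at x))"
    using sm by (auto intro: smooth_continuous_on continuous_on_jacobian)
  obtain K where K: "compact K" "K \<subseteq> S" "\<And>x. x \<notin> K \<Longrightarrow> \<psi> x = 0"
    using C0infE[OF \<psi>] by blast
  obtain R where R: "\<And>x. x \<in> K \<Longrightarrow> norm x \<le> R"
    using K(1) compact_imp_bounded bounded_iff by metis
  have J0: "J x = 0" if "x \<notin> K" for x
  proof -
    have "(\<psi> has_derivative (\<lambda>h. 0)) (at x)"
      using K that compact_imp_closed[OF K(1)]
      by (intro has_derivative_transform_within_open[of "\<lambda>x. 0" "\<lambda>h. 0" x UNIV "- K" \<psi>]) auto
    from frechet_derivative_at[OF this, symmetric] show ?thesis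
      by (simp add: J_def vec_eq_iff jacobian_entry)
  qed
  have zero: "\<psi> x = 0" "J x = 0" if "b \<in> Basis" "\<bar>x \<bullet> b\<bar> > R" for x b
  proof -
    have "x \<notin> K" using that R[of x] Basis_le_norm[OF that(1), of x] by force
    then show "\<psi> x = 0" "J x = 0" using K J0 by auto
  qed
  have bddc: "bdd_nonneg_borel g" if "continuous_on UNIV g" "\<And>x. 0 \<le> g x" "\<And>x. x \<notin> K \<Longrightarrow> g x = 0" for g :: "real^'n \<Rightarrow> real"
  proof -
    have "compact (g ` K)"
      using that(1) by (intro compact_continuous_image K) (auto intro: continuous_on_subset)
    then obtain B where B: "\<And>x. x \<in> K \<Longrightarrow> \<bar>g x\<bar> \<le> B" "B > 0"
      using compact_imp_bounded bounded_pos[of "g ` K"] by auto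
    then have "g x \<le> B" for x
      using abs_le_D1[OF B(1)[of x]] B(2) that(3)[of x] by (cases "x \<in> K") auto
    then show ?thesis
      using that by (auto simp: bdd_nonneg_borel_def intro: borel_measurable_continuous_onI)
  qed
  have int: "integrable lborel g" if "continuous_on UNIV g" "\<And>x. 0 \<le> g x" "\<And>x. x \<notin> K \<Longrightarrow> g x = 0" for g :: "real^'n \<Rightarrow> real"
  proof -
    have "integrable lborel (\<lambda>x. indicator K x *\<^sub>R g x)"
      using that(1) by (intro borel_integrable_compact K) (auto intro: continuous_on_subset)
    moreover have "(\<lambda>x. indicator K x *\<^sub>R g x) = g"
      using that(3) by (fastforce split: split_indicator)
    ultimately show ?thesis by simp
  qed
  have cpow: "continuous_on UNIV (\<lambda>x. norm (\<psi> x) powr e)" "continuous_on UNIV (\<lambda>x. J x powr e)" if "e > 0" for e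
    unfolding J_def using that cont by (auto intro!: continuous_on_powr' continuous_on_norm)
  let ?h = "\<lambda>x. norm (\<psi> x) powr \<gamma>" and ?H = "\<lambda>x. \<gamma> * norm (\<psi> x) powr (\<gamma> - 1) * J x"
  let ?Y = "\<integral>x. norm (\<psi> x) powr (n * q / (n - q)) \<partial>lborel"
  let ?G = "\<integral>x. J x powr q \<partial>lborel"
  have cJ: "continuous_on UNIV J" unfolding J_def by (intro continuous_on_norm cont)
  have bh: "bdd_nonneg_borel ?h"
    using \<gamma> K by (intro bddc cpow) auto
  have cH: "continuous_on UNIV ?H"
    using \<gamma> by (intro continuous_on_mult continuous_on_const cpow cJ) auto
  have bH: "bdd_nonneg_borel ?H"
    using \<gamma> K J0 by (intro bddc cH) (auto simp: J_def)
  have line: "?h x \<le> coord_integral R b ?H x" if b: "b \<in> Basis" for b x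
  proof -
    obtain j where j: "b = axis j 1" using b by (auto simp: Basis_vec_def)
    have d: "((\<lambda>s. \<psi> (coord_upd b x s)) has_vector_derivative frechet_derivative \<psi> (at (coord_upd b x s)) b) (at s)" for s
    proof -
      have "((\<lambda>s. coord_upd b x s) has_derivative (\<lambda>h. h *\<^sub>R b)) (at s)"
        unfolding coord_upd_def by (auto intro!: derivative_eq_intros)
      from has_derivative_compose[OF this smooth_has_derivative[OF sm]]
      show ?thesis
        using linear_scale[OF has_derivative_linear[OF smooth_has_derivative[OF sm]]]
        by (simp add: has_vector_derivative_def)
    qed
    have ccu: "continuous_on UNIV (coord_upd b x)"
      unfolding coord_upd_def by (intro continuous_intros)
    have cont': "continuous_on UNIV (\<lambda>s. frechet_derivative \<psi> (at (coord_upd b x s)) b)"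
      by (rule continuous_on_compose2[OF smooth_continuous_on[OF smooth_frechet_derivative[OF sm]] ccu subset_UNIV])
    have z: "\<psi> (coord_upd b x s) = 0" if "\<bar>s\<bar> > R" for s
      using zero(1)[OF b, of "coord_upd b x s"] that b by (simp add: coord_upd_def inner_add_left)
    have "?h x = norm (\<psi> (coord_upd b x (x \<bullet> b))) powr \<gamma>"
      by (simp add: coord_upd_def)
    also have "\<dots> \<le> (\<integral>t. \<gamma> * norm (\<psi> (coord_upd b x t)) powr (\<gamma> - 1) *
        norm (frechet_derivative \<psi> (at (coord_upd b x t)) b) \<partial>interval_lborel R)"
      by (rule norm_powr_le_integral[OF d cont' z \<gamma>])
    also have "\<dots> \<le> coord_integral R b ?H x"
      unfolding coord_integral_def
    proof (rule integral_mono')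
      show "integrable (interval_lborel R) (\<lambda>s. ?H (coord_upd b x s))"
        by (rule bdd_nonneg_borel_slice(2)[OF bH])
      fix t
      show "\<gamma> * norm (\<psi> (coord_upd b x t)) powr (\<gamma> - 1) * norm (frechet_derivative \<psi> (at (coord_upd b x t)) b)
          \<le> ?H (coord_upd b x t)"
        unfolding J_def j using \<gamma> by (intro mult_left_mono norm_frechet_le_jacobian) auto
      show "0 \<le> ?H (coord_upd b x t)" using \<gamma> by (auto simp: J_def)
    qed
    finally show ?thesis .
  qed
  have Y0: "0 \<le> ?Y" by simp
  have "?Y = (\<integral>x. ?h x powr (n / (n - 1)) \<partial>lborel)"
    using n by (simp add: powr_powr \<gamma>_def mult.commute)
  also have "\<dots> \<le> (\<integral>x. ?H x \<partial>lborel) powr (n / (n - 1))"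
    using Gagliardo_inequality[OF bh bH dim _ line] zero \<gamma> by (simp add: n_def)
  also have "\<dots> \<le> (\<gamma> * (?Y powr (1 - 1 / q) * ?G powr (1 / q))) powr (n / (n - 1))"
  proof (rule powr_mono2)
    show "0 \<le> (\<integral>x. ?H x \<partial>lborel)" using bH by (auto simp: bdd_nonneg_borel_def)
    define f where "f = (\<lambda>i::bool. if i then (\<lambda>x. norm (\<psi> x) powr (n * q / (n - q))) else (\<lambda>x. J x powr q))"
    define l where "l = (\<lambda>i::bool. if i then 1 - 1 / q else 1 / q)"
    have e: "(\<gamma> - 1) = n * q / (n - q) * (1 - 1 / q)"
      using n q by (simp add: \<gamma>_def field_simps)
    have "(\<Prod>i\<in>UNIV. f i x powr l i) = norm (\<psi> x) powr (\<gamma> - 1) * J x" for x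
      using q by (simp add: UNIV_bool f_def l_def e powr_powr J_def mult.commute)
    moreover have "(\<integral>x. (\<Prod>i\<in>UNIV. f i x powr l i) \<partial>lborel) \<le> (\<Prod>i\<in>UNIV. (\<integral>x. f i x \<partial>lborel) powr l i)"
    proof (rule weighted_Holder)
      show "integrable lborel (f i)" for i
        unfolding f_def using n q K J0 by (auto intro!: int cpow)
    qed (use q in \<open>auto simp: UNIV_bool f_def l_def J_def\<close>)
    ultimately have "(\<integral>x. norm (\<psi> x) powr (\<gamma> - 1) * J x \<partial>lborel) \<le> ?Y powr (1 - 1 / q) * ?G powr (1 / q)"
      by (simp add: UNIV_bool f_def l_def mult.commute)
    moreover have "(\<integral>x. ?H x \<partial>lborel) = \<gamma> * (\<integral>x. norm (\<psi> x) powr (\<gamma> - 1) * J x \<partial>lborel)"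
      by (simp add: mult.assoc)
    ultimately show "(\<integral>x. ?H x \<partial>lborel) \<le> \<gamma> * (?Y powr (1 - 1 / q) * ?G powr (1 / q))"
      using \<gamma> by simp
  qed (use n in auto)
  finally have main: "?Y \<le> (\<gamma> * (?Y powr (1 - 1 / q) * ?G powr (1 / q))) powr (n / (n - 1))" .
  have "?Y powr ((n - q) / (n * q)) \<le> \<gamma> * ?G powr (1 / q)"
  proof (cases "?Y = 0")
    case False
    with Y0 have Y: "0 < ?Y" by linarith
    have "?Y powr ((n - 1) / n) \<le> ((\<gamma> * (?Y powr (1 - 1 / q) * ?G powr (1 / q))) powr (n / (n - 1))) powr ((n - 1) / n)"
      using main Y n by (intro powr_mono2) auto
    also have "\<dots> = \<gamma> * (?Y powr (1 - 1 / q) * ?G powr (1 / q))"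
      using n \<gamma> by (simp add: powr_powr)
    finally have "?Y powr ((n - 1) / n) * ?Y powr - (1 - 1 / q) \<le> \<gamma> * (?Y powr (1 - 1 / q) * ?G powr (1 / q)) * ?Y powr - (1 - 1 / q)"
      by (rule mult_right_mono) simp
    also have "\<dots> = \<gamma> * ?G powr (1 / q) * (?Y powr (1 - 1 / q) * ?Y powr - (1 - 1 / q))"
      by (simp only: mult_ac)
    also have "?Y powr (1 - 1 / q) * ?Y powr - (1 - 1 / q) = 1"
      using Y by (simp add: powr_add[symmetric])
    also have "?Y powr ((n - 1) / n) * ?Y powr - (1 - 1 / q) = ?Y powr ((n - 1) / n + - (1 - 1 / q))"
      by (simp only: powr_add)
    also have "(n - 1) / n + - (1 - 1 / q) = (n - q) / (n * q)"
      using n q by (simp add: field_simps)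
    finally show ?thesis by simp
  qed (use \<gamma> in simp)
  then show ?thesis by (simp add: \<gamma>_def J_def)
qed

section \<open>Lebesgue spaces on a bounded open set\<close>

lemma Holder2:
  fixes f g :: "'x \<Rightarrow> real"
  assumes "integrable M f" "integrable M g" "\<And>x. 0 \<le> f x" "\<And>x. 0 \<le> g x" "0 < l" "l < 1"
  shows "integrable M (\<lambda>x. f x powr l * g x powr (1 - l))"
    "(\<integral>x. f x powr l * g x powr (1 - l) \<partial>M) \<le> (\<integral>x. f x \<partial>M) powr l * (\<integral>x. g x \<partial>M) powr (1 - l)"
proof -
  define F where "F = (\<lambda>i::bool. if i then f else g)"
  define L where "L = (\<lambda>i::bool. if i then l else 1 - l)"
  have "\<And>i. i \<in> UNIV \<Longrightarrow> 0 < L i" "(\<Sum>i\<in>UNIV. L i) = 1"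
    "\<And>i. i \<in> UNIV \<Longrightarrow> integrable M (F i)" "\<And>i x. i \<in> UNIV \<Longrightarrow> 0 \<le> F i x"
    using assms by (auto simp: F_def L_def UNIV_bool)
  note H = weighted_Holder[where f = F and l = L and I = UNIV and M = M, OF finite_class.finite_UNIV this]
  from H
  show "integrable M (\<lambda>x. f x powr l * g x powr (1 - l))"
    "(\<integral>x. f x powr l * g x powr (1 - l) \<partial>M) \<le> (\<integral>x. f x \<partial>M) powr l * (\<integral>x. g x \<partial>M) powr (1 - l)"
    by (simp_all add: F_def L_def UNIV_bool mult.commute)
qed

lemma powr_add_le:
  fixes a b q :: real
  assumes "0 \<le> a" "0 \<le> b" "0 \<le> q"
  shows "(a + b) powr q \<le> 2 powr q * (a powr q + b powr q)"
proof -
  have "(a + b) powr q \<le> (2 * max a b) powr q"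
    using assms by (intro powr_mono2) auto
  also have "\<dots> = 2 powr q * max a b powr q"
    using assms by (simp add: powr_mult)
  also have "max a b powr q \<le> a powr q + b powr q"
    by (cases "a \<le> b") auto
  finally show ?thesis by simp
qed

lemma borel_measurable_lebesgue_on_AE:
  fixes u w :: "'a::euclidean_space \<Rightarrow> 'b::euclidean_space"
  assumes S: "S \<in> sets lebesgue" and u: "u \<in> borel_measurable (lebesgue_on S)"
    and eq: "AE x in lebesgue_on S. w x = u x"
  shows "w \<in> borel_measurable (lebesgue_on S)"
proof -
  have "(\<lambda>x. if x \<in> S then w x else 0) \<in> borel_measurable lebesgue"
  proof (rule borel_measurable_AE)
    show "(\<lambda>x. if x \<in> S then u x else 0) \<in> borel_measurable lebesgue"
      using u borel_measurable_if[OF S] by blast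
    have "AE x in lebesgue. x \<in> S \<longrightarrow> w x = u x"
      using eq S by (subst (asm) AE_restrict_space_iff) auto
    then show "AE x in lebesgue. (if x \<in> S then u x else 0) = (if x \<in> S then w x else 0)"
      by eventually_elim auto
  qed
  then show ?thesis
    using borel_measurable_if[OF S] by blast
qed

locale bounded_open =
  fixes \<Omega> :: "(real^'n) set"
  assumes open_\<Omega>: "open \<Omega>" and bounded_\<Omega>: "bounded \<Omega>"
begin

abbreviation M where "M \<equiv> lebesgue_on \<Omega>"

abbreviation grad :: "(real^'n \<Rightarrow> real^'n) \<Rightarrow> real^'n \<Rightarrow> real^'n^'n" where
  "grad \<equiv> weak_grad \<Omega>"

text \<open>
  The power of the seminorm of $L^q$, which is more convenient than the seminorm itself, since it is
  an integral. Up to the factor in \<open>Lp_diff\<close> it satisfies the triangle inequality.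
\<close>

definition pint :: "real \<Rightarrow> (real^'n \<Rightarrow> 'b::euclidean_space) \<Rightarrow> real" where
  "pint q u = (\<integral>x. norm (u x) powr q \<partial>M)"

sublocale finite_measure M
  using bounded_\<Omega> open_\<Omega> by (intro finite_measure_lebesgue_on) (simp add: lmeasurable_open)

lemma pint_nonneg [simp]: "0 \<le> pint q u"
  by (simp add: pint_def)

lemma Lp_norm_eq: "Lp_norm q \<Omega> u = pint q u powr (1 / q)"
  by (simp add: Lp_norm_def pint_def)

lemma Lp_norm_nonneg: "0 \<le> Lp_norm q \<Omega> u"
  by (simp add: Lp_norm_eq)

lemma Lp_norm_powr: "q > 0 \<Longrightarrow> Lp_norm q \<Omega> u powr q = pint q u"
  by (simp add: Lp_norm_eq powr_powr)

lemma LpD: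
  assumes "u \<in> Lp q \<Omega>"
  shows "u \<in> borel_measurable M" "integrable M (\<lambda>x. norm (u x) powr q)"
  using assms by (auto simp: Lp_def)

lemma Lp_cong_AE:
  assumes "u \<in> Lp q \<Omega>" "AE x in M. w x = u x"
  shows "w \<in> Lp q \<Omega>"
proof -
  have u: "u \<in> borel_measurable M" "integrable M (\<lambda>x. norm (u x) powr q)"
    using LpD[OF assms(1)] by auto
  have w: "w \<in> borel_measurable M"
    by (rule borel_measurable_lebesgue_on_AE[OF _ u(1) assms(2)]) (use open_\<Omega> in auto)
  have "integrable M (\<lambda>x. norm (w x) powr q)"
    using u assms(2) w by (subst integrable_cong_AE[where g = "\<lambda>x. norm (u x) powr q"]) (auto elim: eventually_mono)
  with w show ?thesis by (simp add: Lp_def)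
qed

lemma pint_cong_AE:
  assumes "u \<in> borel_measurable M" "w \<in> borel_measurable M" "AE x in M. u x = w x"
  shows "pint q u = pint q w"
  unfolding pint_def using assms by (intro integral_cong_AE) auto

lemma Lp_bound:
  assumes "u \<in> Lp q \<Omega>" "w \<in> borel_measurable M" "AE x in M. norm (w x) \<le> C * norm (u x)" "0 < q" "0 \<le> C"
  shows "w \<in> Lp q \<Omega>" "pint q w \<le> C powr q * pint q u"
proof -
  have le: "AE x in M. norm (w x) powr q \<le> C powr q * norm (u x) powr q"
    using assms(3)
  proof eventually_elim
    case (elim x)
    then have "norm (w x) powr q \<le> (C * norm (u x)) powr q"
      using assms by (intro powr_mono2) auto
    then show ?case using assms by (simp add: powr_mult)
  qed
  have int: "integrable M (\<lambda>x. C powr q * norm (u x) powr q)"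
    using LpD[OF assms(1)] by simp
  have i: "integrable M (\<lambda>x. norm (w x) powr q)"
  proof (rule Bochner_Integration.integrable_bound[OF int])
    show "AE x in M. norm (norm (w x) powr q) \<le> norm (C powr q * norm (u x) powr q)"
      using le by eventually_elim simp
  qed (use assms(2) in measurable)
  then show "w \<in> Lp q \<Omega>" using assms by (simp add: Lp_def)
  show "pint q w \<le> C powr q * pint q u"
    unfolding pint_def using integral_mono_AE[OF i int le] by simp
qed

lemma Lp_diff:
  assumes u: "u \<in> Lp q \<Omega>" and w: "w \<in> Lp q \<Omega>" and q: "0 < q"
  shows "(\<lambda>x. u x - w x) \<in> Lp q \<Omega>"
    and "pint q (\<lambda>x. u x - w x) \<le> 2 powr q * (pint q u + pint q w)"
proof -
  have le: "norm (u x - w x) powr q \<le> 2 powr q * (norm (u x) powr q + norm (w x) powr q)" for x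
  proof -
    have "norm (u x - w x) powr q \<le> (norm (u x) + norm (w x)) powr q"
      using q by (intro powr_mono2 norm_triangle_ineq4) auto
    also have "\<dots> \<le> 2 powr q * (norm (u x) powr q + norm (w x) powr q)"
      using q by (intro powr_add_le) auto
    finally show ?thesis .
  qed
  have [measurable]: "u \<in> borel_measurable M" "w \<in> borel_measurable M"
    using u w by (auto simp: Lp_def)
  have int: "integrable M (\<lambda>x. 2 powr q * (norm (u x) powr q + norm (w x) powr q))"
    using u w by (auto simp: Lp_def)
  have i: "integrable M (\<lambda>x. norm (u x - w x) powr q)"
    by (rule Bochner_Integration.integrable_bound[OF int]) (use le in auto)
  then show "(\<lambda>x. u x - w x) \<in> Lp q \<Omega>" by (simp add: Lp_def)
  have "pint q (\<lambda>x. u x - w x) \<le> (\<integral>x. 2 powr q * (norm (u x) powr q + norm (w x) powr q) \<partial>M)"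
    unfolding pint_def by (intro integral_mono i int le)
  also have "\<dots> = 2 powr q * (pint q u + pint q w)"
    using u w by (simp add: Lp_def pint_def)
  finally show "pint q (\<lambda>x. u x - w x) \<le> 2 powr q * (pint q u + pint q w)" .
qed

lemma Lp_embedding:
  assumes u: "u \<in> Lp r \<Omega>" and qr: "0 < q" "q \<le> r"
  shows "u \<in> Lp q \<Omega>" "Lp_norm q \<Omega> u \<le> (1 + measure M \<Omega>) powr (1 / q - 1 / r) * Lp_norm r \<Omega> u"
proof -
  have [measurable]: "u \<in> borel_measurable M" and int: "integrable M (\<lambda>x. norm (u x) powr r)"
    using LpD[OF u] .
  have "u \<in> Lp q \<Omega> \<and> Lp_norm q \<Omega> u \<le> (1 + measure M \<Omega>) powr (1 / q - 1 / r) * Lp_norm r \<Omega> u"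
  proof (cases "q = r")
    case True
    have "1 + measure M \<Omega> \<noteq> 0"
      using measure_nonneg[of M \<Omega>] by linarith
    then show ?thesis using True u by simp
  next
    case False
    with qr have l: "0 < q / r" "q / r < 1" by auto
    have c: "integrable M (\<lambda>x. 1::real)" by simp
    have eq: "(norm (u x) powr r) powr (q / r) * 1 powr (1 - q / r) = norm (u x) powr q" for x
      using qr by (simp add: powr_powr)
    from Holder2[OF int c _ _ l] eq have i: "integrable M (\<lambda>x. norm (u x) powr q)"
      and le: "pint q u \<le> pint r u powr (q / r) * measure M \<Omega> powr (1 - q / r)"
      by (simp_all add: pint_def)
    have "pint q u \<le> pint r u powr (q / r) * (1 + measure M \<Omega>) powr (1 - q / r)"
      using le by (rule order_trans) (use l in \<open>auto intro!: mult_left_mono powr_mono2\<close>)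
    then have "pint q u powr (1 / q) \<le> (pint r u powr (q / r) * (1 + measure M \<Omega>) powr (1 - q / r)) powr (1 / q)"
      using qr by (intro powr_mono2) auto
    also have "\<dots> = (1 + measure M \<Omega>) powr (1 / q - 1 / r) * pint r u powr (1 / r)"
      using qr by (simp add: powr_mult powr_powr diff_divide_distrib mult.commute)
    finally show ?thesis using i by (simp add: Lp_norm_eq Lp_def)
  qed
  then show "u \<in> Lp q \<Omega>" "Lp_norm q \<Omega> u \<le> (1 + measure M \<Omega>) powr (1 / q - 1 / r) * Lp_norm r \<Omega> u"
    by auto
qed

lemma pint_tendsto_embedding:
  assumes f: "\<And>k. f k \<in> Lp r \<Omega>" and lim: "(\<lambda>k. pint r (f k)) \<longlonglongrightarrow> 0" and q: "0 < q" "q \<le> r"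
  shows "(\<lambda>k. pint q (f k)) \<longlonglongrightarrow> 0"
proof -
  define c where "c = (1 + measure M \<Omega>) powr (1 / q - 1 / r)"
  have le: "pint q (f k) \<le> (c * pint r (f k) powr (1 / r)) powr q" for k
  proof -
    have "pint q (f k) = Lp_norm q \<Omega> (f k) powr q"
      using q by (simp add: Lp_norm_powr)
    also have "\<dots> \<le> (c * Lp_norm r \<Omega> (f k)) powr q"
      unfolding c_def using q by (intro powr_mono2 Lp_embedding(2) f Lp_norm_nonneg) auto
    finally show ?thesis by (simp add: Lp_norm_eq)
  qed
  have "(\<lambda>k. (c * pint r (f k) powr (1 / r)) powr q) \<longlonglongrightarrow> (c * 0 powr (1 / r)) powr q"
    by (intro tendsto_powr' tendsto_mult tendsto_const lim) (use q in \<open>auto simp: c_def\<close>)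
  then have "(\<lambda>k. (c * pint r (f k) powr (1 / r)) powr q) \<longlonglongrightarrow> 0"
    using q by simp
  then show ?thesis
  proof (rule tendsto_sandwich[rotated -1])
    show "\<forall>\<^sub>F k in sequentially. 0 \<le> pint q (f k)" by simp
    show "\<forall>\<^sub>F k in sequentially. pint q (f k) \<le> (c * pint r (f k) powr (1 / r)) powr q"
      by (intro always_eventually allI le)
  qed (rule tendsto_const)
qed

lemma Cauchy_Schwarz_Lp:
  assumes u: "u \<in> Lp 2 \<Omega>" and w: "w \<in> Lp 2 \<Omega>"
  shows "integrable M (\<lambda>x. norm (u x) * norm (w x))"
    "(\<integral>x. norm (u x) * norm (w x) \<partial>M) \<le> Lp_norm 2 \<Omega> u * Lp_norm 2 \<Omega> w"
    "integrable M (\<lambda>x. u x \<bullet> w x)"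
    "\<bar>\<integral>x. u x \<bullet> w x \<partial>M\<bar> \<le> Lp_norm 2 \<Omega> u * Lp_norm 2 \<Omega> w"
proof -
  have [measurable]: "u \<in> borel_measurable M" "w \<in> borel_measurable M"
    and int: "integrable M (\<lambda>x. norm (u x) powr 2)" "integrable M (\<lambda>x. norm (w x) powr 2)"
    using u w by (auto simp: Lp_def)
  have eq: "(norm (u x) powr 2) powr (1 / 2) * (norm (w x) powr 2) powr (1 - 1 / 2) = norm (u x) * norm (w x)" for x
    by (simp only: powr_powr) simp
  from Holder2[OF int, of "1 / 2"] eq
  show i: "integrable M (\<lambda>x. norm (u x) * norm (w x))"
    and le: "(\<integral>x. norm (u x) * norm (w x) \<partial>M) \<le> Lp_norm 2 \<Omega> u * Lp_norm 2 \<Omega> w"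
    by (simp_all add: Lp_norm_eq pint_def del: powr_numeral)
  show i2: "integrable M (\<lambda>x. u x \<bullet> w x)"
    by (rule Bochner_Integration.integrable_bound[OF i]) (auto simp: Cauchy_Schwarz_ineq2)
  have "\<bar>\<integral>x. u x \<bullet> w x \<partial>M\<bar> \<le> (\<integral>x. norm (u x \<bullet> w x) \<partial>M)"
    using integral_norm_bound[of M "\<lambda>x. u x \<bullet> w x"] by simp
  also have "\<dots> \<le> (\<integral>x. norm (u x) * norm (w x) \<partial>M)"
    using i i2 by (intro integral_mono) (auto simp: Cauchy_Schwarz_ineq2)
  finally show "\<bar>\<integral>x. u x \<bullet> w x \<partial>M\<bar> \<le> Lp_norm 2 \<Omega> u * Lp_norm 2 \<Omega> w"
    using le by simp
qed

lemma bounded_in_Lp: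
  assumes [measurable]: "u \<in> borel_measurable M" and "\<And>x. norm (u x) \<le> B" "0 < q"
  shows "u \<in> Lp q \<Omega>"
proof -
  have "integrable M (\<lambda>x. norm (u x) powr q)"
    by (rule integrable_const_bound[of _ "B powr q"]) (use assms in \<open>auto intro!: powr_mono2\<close>)
  then show ?thesis by (simp add: Lp_def)
qed

lemma continuous_measurable_M: "continuous_on UNIV u \<Longrightarrow> u \<in> borel_measurable M"
  using open_\<Omega> by (intro continuous_imp_measurable_on_sets_lebesgue) (auto intro: continuous_on_subset)

lemma C0inf_measurable: "\<psi> \<in> C0inf S \<Longrightarrow> \<psi> \<in> borel_measurable M"
  by (intro continuous_measurable_M smooth_continuous_on C0inf_smooth)

lemma C0inf_in_Lp: "\<psi> \<in> C0inf S \<Longrightarrow> 0 < q \<Longrightarrow> \<psi> \<in> Lp q \<Omega>"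
  by (rule C0inf_bounded, assumption) (rule bounded_in_Lp[OF C0inf_measurable])

lemma jacobian_C0inf:
  fixes \<psi> :: "real^'n \<Rightarrow> real^'n"
  assumes "\<psi> \<in> C0inf S"
  shows "(\<lambda>x. jacobian \<psi> (at x)) \<in> borel_measurable M"
    and "\<exists>B\<ge>0. \<forall>x. norm (jacobian \<psi> (at x)) \<le> B"
    and "0 < q \<Longrightarrow> (\<lambda>x. jacobian \<psi> (at x)) \<in> Lp q \<Omega>"
proof -
  show m: "(\<lambda>x. jacobian \<psi> (at x)) \<in> borel_measurable M"
    by (intro continuous_measurable_M continuous_on_jacobian C0inf_smooth[OF assms])
  have "\<exists>B. \<forall>x. norm (frechet_derivative \<psi> (at x) (axis j 1)) \<le> B" for j
    by (rule C0inf_bounded[OF C0inf_frechet_derivative[OF assms, of "axis j 1"]]) blast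
  then have "\<forall>j. \<exists>B. \<forall>x. norm (frechet_derivative \<psi> (at x) (axis j 1)) \<le> B"
    by blast
  from choice[OF this] obtain B where B: "\<And>j x. norm (frechet_derivative \<psi> (at x) (axis j 1)) \<le> B j"
    by blast
  have "norm (jacobian \<psi> (at x)) \<le> (\<Sum>i\<in>(UNIV::'n set). \<Sum>j\<in>UNIV. B j)" for x
  proof -
    have "norm (jacobian \<psi> (at x)) \<le> (\<Sum>i\<in>UNIV. norm (jacobian \<psi> (at x) $ i))"
      unfolding norm_vec_def[of "jacobian \<psi> (at x)"] by (rule L2_set_le_sum) auto
    also have "\<dots> \<le> (\<Sum>i\<in>(UNIV::'n set). \<Sum>j\<in>UNIV. B j)"
    proof (rule sum_mono)
      fix i :: 'n
      have "norm (jacobian \<psi> (at x) $ i) \<le> (\<Sum>j\<in>UNIV. \<bar>jacobian \<psi> (at x) $ i $ j\<bar>)"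
        by (rule norm_le_l1_cart)
      also have "\<dots> \<le> (\<Sum>j\<in>UNIV. B j)"
        unfolding jacobian_entry by (intro sum_mono order_trans[OF component_le_norm_cart B])
      finally show "norm (jacobian \<psi> (at x) $ i) \<le> (\<Sum>j\<in>UNIV. B j)" .
    qed
    finally show ?thesis .
  qed
  then show ex: "\<exists>B\<ge>0. \<forall>x. norm (jacobian \<psi> (at x)) \<le> B"
    by (intro exI[of _ "max 0 (\<Sum>i\<in>(UNIV::'n set). \<Sum>j\<in>UNIV. B j)"]) (auto simp: le_max_iff_disj)
  then show "0 < q \<Longrightarrow> (\<lambda>x. jacobian \<psi> (at x)) \<in> Lp q \<Omega>"
    using bounded_in_Lp[OF m] by auto
qed

section \<open>Sobolev spaces\<close>

lemma grad_in_Lp: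
  assumes "u \<in> W1p q \<Omega>"
  shows "grad u \<in> Lp q \<Omega>" "has_weak_gradient \<Omega> u (grad u)"
proof -
  obtain G where G: "G \<in> Lp q \<Omega>" "has_weak_gradient \<Omega> u G"
    using assms by (auto simp: W1p_def)
  show "has_weak_gradient \<Omega> u (grad u)" by (rule weak_grad_works[OF G(2)])
  show "grad u \<in> Lp q \<Omega>"
    by (rule Lp_cong_AE[OF G(1) weak_grad_eq[OF open_\<Omega> G(2)]])
qed

lemma grad_diff:
  assumes "has_weak_gradient \<Omega> u G" "has_weak_gradient \<Omega> w H"
  shows "AE x in M. grad (\<lambda>x. u x - w x) x = grad u x - grad w x"
proof -
  have "AE x in M. grad (\<lambda>x. u x - w x) x = G x - H x"
    by (rule weak_grad_eq[OF open_\<Omega> has_weak_gradient_diff[OF open_\<Omega> assms]])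
  moreover note weak_grad_eq[OF open_\<Omega> assms(1)] weak_grad_eq[OF open_\<Omega> assms(2)]
  ultimately show ?thesis by eventually_elim simp
qed

lemma grad_test: "\<psi> \<in> C0inf \<Omega> \<Longrightarrow> AE x in M. grad \<psi> x = jacobian \<psi> (at x)"
  by (rule weak_grad_eq[OF open_\<Omega> has_weak_gradient_jacobian[OF open_\<Omega>]])

lemma C0inf_in_W1p: "\<psi> \<in> C0inf \<Omega> \<Longrightarrow> 0 < q \<Longrightarrow> \<psi> \<in> W1p q \<Omega>"
  unfolding W1p_def using C0inf_in_Lp jacobian_C0inf(3) has_weak_gradient_jacobian[OF open_\<Omega>] by blast

lemma W1p_diff:
  assumes "u \<in> W1p q \<Omega>" "w \<in> W1p q \<Omega>" "0 < q"
  shows "(\<lambda>x. u x - w x) \<in> W1p q \<Omega>"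
proof -
  have "u \<in> Lp q \<Omega>" "w \<in> Lp q \<Omega>" using assms by (auto simp: W1p_def)
  then have "(\<lambda>x. u x - w x) \<in> Lp q \<Omega>" using assms(3) by (rule Lp_diff(1))
  moreover have "(\<lambda>x. grad u x - grad w x) \<in> Lp q \<Omega>"
    by (rule Lp_diff(1)[OF grad_in_Lp(1)[OF assms(1)] grad_in_Lp(1)[OF assms(2)] assms(3)])
  moreover have "has_weak_gradient \<Omega> (\<lambda>x. u x - w x) (\<lambda>x. grad u x - grad w x)"
    by (rule has_weak_gradient_diff[OF open_\<Omega> grad_in_Lp(2)[OF assms(1)] grad_in_Lp(2)[OF assms(2)]])
  ultimately show ?thesis unfolding W1p_def by blast
qed

lemma W1p_norm_eq: "0 < q \<Longrightarrow> W1p_norm q \<Omega> u = (pint q u + pint q (grad u)) powr (1 / q)"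
  by (simp add: W1p_norm_def Lp_norm_powr)

lemma W1p_norm_powr: "0 < q \<Longrightarrow> W1p_norm q \<Omega> u powr q = pint q u + pint q (grad u)"
  by (simp add: W1p_norm_eq powr_powr)

lemma pint_grad_diff:
  assumes "u \<in> W1p q \<Omega>" "w \<in> W1p q \<Omega>" "0 < q"
  shows "pint r (grad (\<lambda>x. u x - w x)) = pint r (\<lambda>x. grad u x - grad w x)"
  by (intro pint_cong_AE grad_diff[OF grad_in_Lp(2)[OF assms(1)] grad_in_Lp(2)[OF assms(2)]]
      borel_measurable_diff LpD(1)[OF grad_in_Lp(1)[OF assms(1)]] LpD(1)[OF grad_in_Lp(1)[OF assms(2)]]
      LpD(1)[OF grad_in_Lp(1)[OF W1p_diff[OF assms]]])

lemma pint_grad_diff_test: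
  assumes "u \<in> W1p q \<Omega>" "\<psi> \<in> C0inf \<Omega>" "0 < q"
  shows "pint r (\<lambda>x. grad u x - grad \<psi> x) = pint r (\<lambda>x. grad u x - jacobian \<psi> (at x))"
  using LpD(1)[OF grad_in_Lp(1)] assms C0inf_in_W1p[OF assms(2,3)] grad_test[OF assms(2)]
  by (intro pint_cong_AE borel_measurable_diff jacobian_C0inf(1)) (auto elim: eventually_mono)

text \<open>
  The weak gradient of a test function can be replaced by the classical one, and the sum in the norm
  by two separate conditions.
\<close>

lemma W1p_closure_iff:
  assumes S: "S \<subseteq> C0inf \<Omega>" and q: "0 < q"
  shows "u \<in> W1p_closure q \<Omega> S \<longleftrightarrow> u \<in> W1p q \<Omega> \<and>
    (\<forall>\<epsilon>>0. \<exists>\<psi>\<in>S. pint q (\<lambda>x. u x - \<psi> x) < \<epsilon> \<and> pint q (\<lambda>x. grad u x - jacobian \<psi> (at x)) < \<epsilon>)"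
    (is "_ \<longleftrightarrow> _ \<and> ?R")
proof -
  have eq: "W1p_norm q \<Omega> (u - \<psi>) =
      (pint q (\<lambda>x. u x - \<psi> x) + pint q (\<lambda>x. grad u x - jacobian \<psi> (at x))) powr (1 / q)"
    if "u \<in> W1p q \<Omega>" "\<psi> \<in> S" for \<psi>
    using that S q pint_grad_diff[OF that(1) C0inf_in_W1p[of \<psi>] q, of q] pint_grad_diff_test[OF that(1) _ q, of \<psi> q]
    by (auto simp: W1p_norm_eq fun_diff_def)
  have "(\<forall>\<epsilon>>0. \<exists>\<psi>\<in>S. W1p_norm q \<Omega> (u - \<psi>) < \<epsilon>) \<longleftrightarrow> ?R" if u: "u \<in> W1p q \<Omega>"
  proof
    assume L: "\<forall>\<epsilon>>0. \<exists>\<psi>\<in>S. W1p_norm q \<Omega> (u - \<psi>) < \<epsilon>"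
    show ?R
    proof (intro allI impI)
      fix \<epsilon> :: real assume "\<epsilon> > 0"
      then obtain \<psi> where \<psi>: "\<psi> \<in> S" "W1p_norm q \<Omega> (u - \<psi>) < \<epsilon> powr (1 / q)"
        using L[rule_format, of "\<epsilon> powr (1 / q)"] by auto
      have "pint q (\<lambda>x. u x - \<psi> x) + pint q (\<lambda>x. grad u x - jacobian \<psi> (at x)) < \<epsilon>"
      proof (rule ccontr)
        assume "\<not> ?thesis"
        then have "\<epsilon> powr (1 / q) \<le> W1p_norm q \<Omega> (u - \<psi>)"
          unfolding eq[OF u \<psi>(1)] using q \<open>\<epsilon> > 0\<close> by (intro powr_mono2) auto
        with \<psi>(2) show False by simp
      qed
      then have "pint q (\<lambda>x. u x - \<psi> x) < \<epsilon>" "pint q (\<lambda>x. grad u x - jacobian \<psi> (at x)) < \<epsilon>"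
        using pint_nonneg[of q "\<lambda>x. u x - \<psi> x"] pint_nonneg[of q "\<lambda>x. grad u x - jacobian \<psi> (at x)"]
        by linarith+
      with \<psi>(1) show "\<exists>\<psi>\<in>S. pint q (\<lambda>x. u x - \<psi> x) < \<epsilon> \<and> pint q (\<lambda>x. grad u x - jacobian \<psi> (at x)) < \<epsilon>"
        by blast
    qed
  next
    assume R: ?R
    show "\<forall>\<epsilon>>0. \<exists>\<psi>\<in>S. W1p_norm q \<Omega> (u - \<psi>) < \<epsilon>"
    proof (intro allI impI)
      fix \<epsilon> :: real assume "\<epsilon> > 0"
      then obtain \<psi> where \<psi>: "\<psi> \<in> S" "pint q (\<lambda>x. u x - \<psi> x) < \<epsilon> powr q / 2"
        "pint q (\<lambda>x. grad u x - jacobian \<psi> (at x)) < \<epsilon> powr q / 2"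
        using R[rule_format, of "\<epsilon> powr q / 2"] by auto
      have "(pint q (\<lambda>x. u x - \<psi> x) + pint q (\<lambda>x. grad u x - jacobian \<psi> (at x))) powr (1 / q) < (\<epsilon> powr q) powr (1 / q)"
        using \<psi> q by (intro powr_less_mono2) auto
      then have "W1p_norm q \<Omega> (u - \<psi>) < \<epsilon>"
        using \<open>\<epsilon> > 0\<close> q by (simp add: eq[OF u \<psi>(1)] powr_powr)
      with \<psi>(1) show "\<exists>\<psi>\<in>S. W1p_norm q \<Omega> (u - \<psi>) < \<epsilon>" by blast
    qed
  qed
  then show ?thesis by (auto simp: W1p_closure_def)
qed

lemma solenoidal_subset: "solenoidal_C0inf \<Omega> \<subseteq> C0inf \<Omega>"
  by (auto simp: solenoidal_C0inf_def)

lemma frechet_derivative_diff: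
  "smooth f \<Longrightarrow> smooth g \<Longrightarrow> frechet_derivative (\<lambda>x. f x - g x) (at x) =
    (\<lambda>h. frechet_derivative f (at x) h - frechet_derivative g (at x) h)"
  by (rule frechet_derivative_at[symmetric]) (intro has_derivative_diff smooth_has_derivative)

lemma jacobian_diff:
  fixes f g :: "real^'n \<Rightarrow> real^'n"
  shows "smooth f \<Longrightarrow> smooth g \<Longrightarrow> jacobian (\<lambda>x. f x - g x) (at x) = jacobian f (at x) - jacobian g (at x)"
  by (simp add: vec_eq_iff jacobian_entry frechet_derivative_diff)

lemma solenoidal_diff:
  assumes "\<phi> \<in> solenoidal_C0inf \<Omega>" "\<psi> \<in> solenoidal_C0inf \<Omega>"
  shows "(\<lambda>x. \<phi> x - \<psi> x) \<in> solenoidal_C0inf \<Omega>"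
  using assms by (auto simp: solenoidal_C0inf_def C0inf_diff jacobian_diff C0inf_smooth trace_sub)

lemma Vp_diff:
  assumes u: "u \<in> Vp q \<Omega>" and w: "w \<in> Vp q \<Omega>" and q: "0 < q"
  shows "(\<lambda>x. u x - w x) \<in> Vp q \<Omega>"
  unfolding Vp_def W1p_closure_iff[OF solenoidal_subset q]
proof (intro conjI allI impI)
  have u': "u \<in> W1p q \<Omega>" and w': "w \<in> W1p q \<Omega>"
    using u w unfolding Vp_def W1p_closure_def by auto
  then show uw: "(\<lambda>x. u x - w x) \<in> W1p q \<Omega>" using q by (rule W1p_diff)
  fix \<epsilon> :: real assume \<epsilon>: "\<epsilon> > 0"
  define \<delta> where "\<delta> = \<epsilon> / (2 * 2 powr q)"
  have \<delta>: "0 < \<delta>" "2 powr q * (\<delta> + \<delta>) = \<epsilon>" using \<epsilon> by (auto simp: \<delta>_def)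
  obtain \<phi> where \<phi>: "\<phi> \<in> solenoidal_C0inf \<Omega>" "pint q (\<lambda>x. u x - \<phi> x) < \<delta>" "pint q (\<lambda>x. grad u x - jacobian \<phi> (at x)) < \<delta>"
    using u \<delta>(1) unfolding Vp_def W1p_closure_iff[OF solenoidal_subset q] by blast
  obtain \<psi> where \<psi>: "\<psi> \<in> solenoidal_C0inf \<Omega>" "pint q (\<lambda>x. w x - \<psi> x) < \<delta>" "pint q (\<lambda>x. grad w x - jacobian \<psi> (at x)) < \<delta>"
    using w \<delta>(1) unfolding Vp_def W1p_closure_iff[OF solenoidal_subset q] by blast
  have C: "\<phi> \<in> C0inf \<Omega>" "\<psi> \<in> C0inf \<Omega>" using \<phi> \<psi> solenoidal_subset by auto
  have L: "u \<in> Lp q \<Omega>" "w \<in> Lp q \<Omega>" using u' w' by (auto simp: W1p_def)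
  have "pint q (\<lambda>x. u x - w x - (\<phi> x - \<psi> x)) = pint q (\<lambda>x. (u x - \<phi> x) - (w x - \<psi> x))"
    by (simp add: algebra_simps)
  also have "\<dots> \<le> 2 powr q * (pint q (\<lambda>x. u x - \<phi> x) + pint q (\<lambda>x. w x - \<psi> x))"
    by (intro Lp_diff L C0inf_in_Lp[OF C(1)] C0inf_in_Lp[OF C(2)] q)
  also have "\<dots> < 2 powr q * (\<delta> + \<delta>)"
    using \<phi> \<psi> by (intro mult_strict_left_mono add_strict_mono) auto
  finally have 1: "pint q (\<lambda>x. u x - w x - (\<phi> x - \<psi> x)) < \<epsilon>" using \<delta> by simp
  have "pint q (\<lambda>x. grad (\<lambda>x. u x - w x) x - jacobian (\<lambda>x. \<phi> x - \<psi> x) (at x)) =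
      pint q (\<lambda>x. (grad u x - jacobian \<phi> (at x)) - (grad w x - jacobian \<psi> (at x)))"
  proof (rule pint_cong_AE)
    show "AE x in M. grad (\<lambda>x. u x - w x) x - jacobian (\<lambda>x. \<phi> x - \<psi> x) (at x) =
      (grad u x - jacobian \<phi> (at x)) - (grad w x - jacobian \<psi> (at x))"
      using grad_diff[OF grad_in_Lp(2)[OF u'] grad_in_Lp(2)[OF w']]
      by eventually_elim (simp add: jacobian_diff C C0inf_smooth[OF C(1)] C0inf_smooth[OF C(2)])
  qed (intro borel_measurable_diff LpD(1)[OF grad_in_Lp(1)[OF u']] LpD(1)[OF grad_in_Lp(1)[OF w']]
      LpD(1)[OF grad_in_Lp(1)[OF uw]] jacobian_C0inf(1)[OF C0inf_diff[OF C]] jacobian_C0inf(1)[OF C(1)] jacobian_C0inf(1)[OF C(2)])+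
  also have "\<dots> \<le> 2 powr q * (pint q (\<lambda>x. grad u x - jacobian \<phi> (at x)) + pint q (\<lambda>x. grad w x - jacobian \<psi> (at x)))"
    by (intro Lp_diff grad_in_Lp(1)[OF u'] grad_in_Lp(1)[OF w'] jacobian_C0inf(3)[OF C(1)] jacobian_C0inf(3)[OF C(2)] q)
  also have "\<dots> < 2 powr q * (\<delta> + \<delta>)"
    using \<phi> \<psi> by (intro mult_strict_left_mono add_strict_mono) auto
  finally have 2: "pint q (\<lambda>x. grad (\<lambda>x. u x - w x) x - jacobian (\<lambda>x. \<phi> x - \<psi> x) (at x)) < \<epsilon>" using \<delta> by simp
  show "\<exists>\<psi>\<in>solenoidal_C0inf \<Omega>. pint q (\<lambda>x. u x - w x - \<psi> x) < \<epsilon> \<and>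
      pint q (\<lambda>x. grad (\<lambda>x. u x - w x) x - jacobian \<psi> (at x)) < \<epsilon>"
    by (intro bexI[OF _ solenoidal_diff[OF \<phi>(1) \<psi>(1)]] conjI 1 2)
qed

lemma Vp_W1p: "u \<in> Vp q \<Omega> \<Longrightarrow> u \<in> W1p q \<Omega>"
  by (simp add: Vp_def W1p_closure_def)

lemma Vp_Lp: "u \<in> Vp q \<Omega> \<Longrightarrow> u \<in> Lp q \<Omega>" "u \<in> Vp q \<Omega> \<Longrightarrow> grad u \<in> Lp q \<Omega>"
  using Vp_W1p grad_in_Lp by (auto simp: W1p_def)

subsection \<open>Sobolev embedding of the closure of the test functions\<close>

text \<open>
  The inequality on the whole space, restricted to \<open>\<Omega>\<close>: test functions vanish outside.
\<close>

lemma Sobolev_test: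
  fixes \<psi> :: "real^'n \<Rightarrow> real^'n"
  assumes \<psi>: "\<psi> \<in> C0inf \<Omega>" and q: "1 < q" "q < real CARD('n)"
  defines "n \<equiv> real CARD('n)"
  shows "pint (n * q / (n - q)) \<psi> \<le>
    ((q * (n - 1) / (n - q)) powr q * pint q (\<lambda>x. jacobian \<psi> (at x))) powr (n / (n - q))"
proof -
  have n: "1 < n" "q < n" using q by (auto simp: n_def)
  obtain K where K: "compact K" "K \<subseteq> \<Omega>" "\<And>x. x \<notin> K \<Longrightarrow> \<psi> x = 0"
    using C0infE[OF \<psi>] by blast
  have J0: "jacobian \<psi> (at x) = 0" if "x \<notin> \<Omega>" for x
  proof -
    have "(\<lambda>x. frechet_derivative \<psi> (at x) h) \<in> C0inf \<Omega>" for h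
      by (rule C0inf_frechet_derivative[OF \<psi>])
    then have "frechet_derivative \<psi> (at x) h = 0" for h
      using that by (blast elim: C0infE)
    then show ?thesis by (simp add: vec_eq_iff jacobian_entry)
  qed
  have restrict: "(\<integral>x. g x \<partial>M) = (\<integral>x. g x \<partial>lborel)"
    if "g \<in> borel_measurable borel" "\<And>x. x \<notin> \<Omega> \<Longrightarrow> g x = 0" for g :: "real^'n \<Rightarrow> real"
  proof -
    have "(\<integral>x. g x \<partial>M) = (\<integral>x. indicator \<Omega> x *\<^sub>R g x \<partial>lebesgue)"
      using open_\<Omega> by (subst integral_restrict_space) auto
    also have "(\<lambda>x. indicator \<Omega> x *\<^sub>R g x) = g"
      using that(2) by (fastforce split: split_indicator)
    finally show ?thesis using that(1) by (simp add: integral_completion)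
  qed
  have [measurable]: "\<psi> \<in> borel_measurable borel" "(\<lambda>x. jacobian \<psi> (at x)) \<in> borel_measurable borel"
    using C0inf_smooth[OF \<psi>] by (auto intro!: borel_measurable_continuous_onI smooth_continuous_on continuous_on_jacobian)
  have \<psi>0: "\<psi> x = 0" if "x \<notin> \<Omega>" for x
    using K(2,3) that by blast
  have P: "pint r \<psi> = (\<integral>x. norm (\<psi> x) powr r \<partial>lborel)" "pint r (\<lambda>x. jacobian \<psi> (at x)) = (\<integral>x. norm (jacobian \<psi> (at x)) powr r \<partial>lborel)" for r
    unfolding pint_def using \<psi>0 J0 by (auto intro!: restrict)
  have "pint (n * q / (n - q)) \<psi> powr ((n - q) / (n * q)) \<le> q * (n - 1) / (n - q) * pint q (\<lambda>x. jacobian \<psi> (at x)) powr (1 / q)"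
    using Sobolev_inequality_lborel[OF \<psi> q] by (simp add: P n_def)
  then have "(pint (n * q / (n - q)) \<psi> powr ((n - q) / (n * q))) powr (n * q / (n - q)) \<le>
    (q * (n - 1) / (n - q) * pint q (\<lambda>x. jacobian \<psi> (at x)) powr (1 / q)) powr (n * q / (n - q))"
    using q n by (intro powr_mono2) auto
  also have "\<dots> = ((q * (n - 1) / (n - q) * pint q (\<lambda>x. jacobian \<psi> (at x)) powr (1 / q)) powr q) powr (n / (n - q))"
    by (simp only: powr_powr) (simp add: mult.commute)
  also have "(q * (n - 1) / (n - q) * pint q (\<lambda>x. jacobian \<psi> (at x)) powr (1 / q)) powr q =
      (q * (n - 1) / (n - q)) powr q * pint q (\<lambda>x. jacobian \<psi> (at x))"
    using q n by (subst powr_mult) (auto simp: powr_powr)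
  finally show ?thesis using q n by (simp add: powr_powr)
qed

text \<open>
  Fatou's lemma along an almost everywhere convergent subsequence of approximating test functions.
  The factor 2 comes from estimating differences with \<open>Lp_diff\<close> instead of the triangle inequality.
\<close>

lemma Sobolev_closure:
  assumes u: "u \<in> W1p_closure r \<Omega> (C0inf \<Omega>)" and q: "1 < q" "q < real CARD('n)" and r: "q \<le> r"
  defines "n \<equiv> real CARD('n)"
  shows "u \<in> Lp (n * q / (n - q)) \<Omega>"
    "Lp_norm (n * q / (n - q)) \<Omega> u \<le> 2 * (q * (n - 1) / (n - q)) * Lp_norm q \<Omega> (grad u)"
proof -
  have n: "1 < n" "q < n" using q by (auto simp: n_def)
  let ?s = "n * q / (n - q)" and ?C = "q * (n - 1) / (n - q)"
  have s: "0 < ?s" using n q by simp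
  have r0: "0 < r" using q r by simp
  have u1: "u \<in> W1p r \<Omega>" using u by (simp add: W1p_closure_def)
  define P where "P = (\<lambda>k \<psi>. \<psi> \<in> C0inf \<Omega> \<and> pint r (\<lambda>x. u x - \<psi> x) < 1 / real (Suc k) \<and>
      pint r (\<lambda>x. grad u x - jacobian \<psi> (at x)) < 1 / real (Suc k))"
  have "\<forall>k. \<exists>\<psi>. P k \<psi>"
  proof
    fix k
    have "0 < 1 / real (Suc k)" by simp
    then show "\<exists>\<psi>. P k \<psi>"
      using u unfolding W1p_closure_iff[OF subset_refl r0] P_def by blast
  qed
  from choice[OF this] obtain \<psi> where P: "\<And>k. P k (\<psi> k)" by blast
  have \<psi>: "\<And>k. \<psi> k \<in> C0inf \<Omega>" "\<And>k. pint r (\<lambda>x. u x - \<psi> k x) < 1 / real (Suc k)"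
    "\<And>k. pint r (\<lambda>x. grad u x - jacobian (\<psi> k) (at x)) < 1 / real (Suc k)"
    using P by (simp_all add: P_def)
  have Lu: "u \<in> Lp r \<Omega>" "grad u \<in> Lp r \<Omega>" "grad u \<in> Lp q \<Omega>"
    using u1 grad_in_Lp(1)[OF u1] Lp_embedding(1)[of "grad u" r q] q r by (auto simp: W1p_def)
  have [measurable]: "u \<in> borel_measurable M" "\<psi> k \<in> borel_measurable M" for k
    using Lu(1) C0inf_measurable[OF \<psi>(1)] by (auto simp: Lp_def)
  have lim1: "(\<lambda>k. pint r (\<lambda>x. u x - \<psi> k x)) \<longlonglongrightarrow> 0"
    by (rule real_tendsto_sandwich[OF _ _ tendsto_const LIMSEQ_Suc[OF lim_1_over_n]])
       (use \<psi>(2) in \<open>auto intro!: always_eventually less_imp_le\<close>)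
  have lim2: "(\<lambda>k. pint r (\<lambda>x. grad u x - jacobian (\<psi> k) (at x))) \<longlonglongrightarrow> 0"
    by (rule real_tendsto_sandwich[OF _ _ tendsto_const LIMSEQ_Suc[OF lim_1_over_n]])
       (use \<psi>(3) in \<open>auto intro!: always_eventually less_imp_le\<close>)
  have lim3: "(\<lambda>k. pint q (\<lambda>x. grad u x - jacobian (\<psi> k) (at x))) \<longlonglongrightarrow> 0"
    by (rule pint_tendsto_embedding[OF _ lim2]) (use q r Lp_diff(1)[OF Lu(2) jacobian_C0inf(3)[OF \<psi>(1) r0] r0] in auto)
  have "\<exists>\<rho>::nat \<Rightarrow> nat. strict_mono \<rho> \<and> (AE x in M. (\<lambda>k. norm (u x - \<psi> (\<rho> k) x) powr r) \<longlonglongrightarrow> 0)"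
  proof (rule tendsto_L1_AE_subseq)
    show "integrable M (\<lambda>x. norm (u x - \<psi> k x) powr r)" for k
      using Lp_diff(1)[OF Lu(1) C0inf_in_Lp[OF \<psi>(1) r0] r0] by (simp add: Lp_def)
    show "(\<lambda>k. \<integral>x. norm (norm (u x - \<psi> k x) powr r) \<partial>M) \<longlonglongrightarrow> 0"
      using lim1 by (simp add: pint_def)
  qed
  then obtain \<rho> :: "nat \<Rightarrow> nat" where \<rho>: "strict_mono \<rho>" "AE x in M. (\<lambda>k. norm (u x - \<psi> (\<rho> k) x) powr r) \<longlonglongrightarrow> 0"
    by blast
  have conv: "AE x in M. (\<lambda>k. ennreal (norm (\<psi> (\<rho> k) x) powr ?s)) \<longlonglongrightarrow> ennreal (norm (u x) powr ?s)"
    using \<rho>(2)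
  proof eventually_elim
    case (elim x)
    have "(\<lambda>k. (norm (u x - \<psi> (\<rho> k) x) powr r) powr (1 / r)) \<longlonglongrightarrow> 0 powr (1 / r)"
      using r0 by (intro tendsto_powr' elim tendsto_const) auto
    then have "(\<lambda>k. norm (u x - \<psi> (\<rho> k) x)) \<longlonglongrightarrow> 0"
      using r0 by (simp add: powr_powr)
    then have "(\<lambda>k. \<psi> (\<rho> k) x) \<longlonglongrightarrow> u x"
      by (subst tendsto_dist_iff) (simp add: dist_norm norm_minus_commute)
    then show ?case
      using s by (intro tendsto_ennrealI tendsto_powr' tendsto_norm tendsto_const) auto
  qed
  define b where "b = (\<lambda>k. (?C powr q * (2 powr q * (pint q (grad u) + pint q (\<lambda>x. grad u x - jacobian (\<psi> (\<rho> k)) (at x))))) powr (n / (n - q)))"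
  define B where "B = (?C powr q * (2 powr q * (pint q (grad u) + 0))) powr (n / (n - q))"
  have bB: "b \<longlonglongrightarrow> B"
    unfolding b_def B_def using n q LIMSEQ_subseq_LIMSEQ[OF lim3 \<rho>(1)]
    by (intro tendsto_powr' tendsto_mult tendsto_add tendsto_const) (auto simp: o_def)
  have le_b: "pint ?s (\<psi> (\<rho> k)) \<le> b k" for k
  proof -
    have "pint q (\<lambda>x. jacobian (\<psi> (\<rho> k)) (at x)) = pint q (\<lambda>x. grad u x - (grad u x - jacobian (\<psi> (\<rho> k)) (at x)))"
      by simp
    also have "\<dots> \<le> 2 powr q * (pint q (grad u) + pint q (\<lambda>x. grad u x - jacobian (\<psi> (\<rho> k)) (at x)))"
      using q by (intro Lp_diff Lu jacobian_C0inf(3)[OF \<psi>(1)]) auto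
    finally have "(?C powr q * pint q (\<lambda>x. jacobian (\<psi> (\<rho> k)) (at x))) powr (n / (n - q)) \<le> b k"
      unfolding b_def using n by (intro powr_mono2 mult_left_mono) auto
    with Sobolev_test[OF \<psi>(1)[of "\<rho> k"] q] show ?thesis by (simp add: n_def)
  qed
  have nn: "(\<integral>\<^sup>+x. ennreal (norm (\<psi> (\<rho> k) x) powr ?s) \<partial>M) \<le> ennreal (b k)" for k
  proof -
    have "integrable M (\<lambda>x. norm (\<psi> (\<rho> k) x) powr ?s)"
      using C0inf_in_Lp[OF \<psi>(1) s] by (simp add: Lp_def)
    then have "(\<integral>\<^sup>+x. ennreal (norm (\<psi> (\<rho> k) x) powr ?s) \<partial>M) = ennreal (pint ?s (\<psi> (\<rho> k)))"
      unfolding pint_def by (intro nn_integral_eq_integral) auto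
    then show ?thesis using le_b by (simp add: ennreal_leI)
  qed
  have "(\<integral>\<^sup>+x. ennreal (norm (u x) powr ?s) \<partial>M) = (\<integral>\<^sup>+x. liminf (\<lambda>k. ennreal (norm (\<psi> (\<rho> k) x) powr ?s)) \<partial>M)"
  proof (intro nn_integral_cong_AE)
    show "AE x in M. ennreal (norm (u x) powr ?s) = liminf (\<lambda>k. ennreal (norm (\<psi> (\<rho> k) x) powr ?s))"
      using conv by eventually_elim (rule lim_imp_Liminf[OF trivial_limit_sequentially, symmetric])
  qed
  also have "\<dots> \<le> liminf (\<lambda>k. \<integral>\<^sup>+x. ennreal (norm (\<psi> (\<rho> k) x) powr ?s) \<partial>M)"
    by (intro nn_integral_liminf) measurable
  also have "\<dots> \<le> liminf (\<lambda>k. ennreal (b k))"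
    by (intro Liminf_mono always_eventually allI nn)
  also have "\<dots> = ennreal B"
    using bB by (intro lim_imp_Liminf tendsto_ennrealI) auto
  finally have fin: "(\<integral>\<^sup>+x. ennreal (norm (u x) powr ?s) \<partial>M) \<le> ennreal B" .
  have int: "integrable M (\<lambda>x. norm (u x) powr ?s)"
    using fin by (intro integrableI_bounded) (auto simp: less_top[symmetric] top_unique)
  then show "u \<in> Lp ?s \<Omega>" by (simp add: Lp_def)
  have "ennreal (pint ?s u) \<le> ennreal B"
    using fin nn_integral_eq_integral[OF int] by (simp add: pint_def)
  then have "pint ?s u \<le> B" by (simp add: B_def)
  then have "pint ?s u powr (1 / ?s) \<le> B powr (1 / ?s)"
    using n q by (intro powr_mono2) auto
  also have "B powr (1 / ?s) = (?C powr q * (2 powr q * pint q (grad u))) powr (1 / q)"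
    using n q by (simp add: B_def powr_powr)
  also have "\<dots> = 2 * ?C * pint q (grad u) powr (1 / q)"
    using n q by (simp add: powr_mult powr_powr)
  finally show "Lp_norm ?s \<Omega> u \<le> 2 * ?C * Lp_norm q \<Omega> (grad u)"
    by (simp add: Lp_norm_eq)
qed

end

section \<open>The nonlinear terms\<close>

text \<open>
  The constant \<open>C\<close> may depend on \<open>\<epsilon>\<close>: the usual conclusion of an estimate with a small parameter.
\<close>

lemma tendsto_0_if_eps_bound:
  fixes x y :: "nat \<Rightarrow> real"
  assumes le: "\<And>\<epsilon>. \<epsilon> > 0 \<Longrightarrow> \<exists>C. \<forall>k. \<bar>x k\<bar> \<le> \<epsilon> * K + C * y k"
    and y: "y \<longlonglongrightarrow> 0" and K: "0 \<le> K"
  shows "x \<longlonglongrightarrow> 0"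
proof (rule LIMSEQ_I)
  fix r :: real assume r: "0 < r"
  define \<epsilon> where "\<epsilon> = r / (2 * (K + 1))"
  have \<epsilon>: "0 < \<epsilon>" using r K by (simp add: \<epsilon>_def)
  have "\<epsilon> * K < r / 2"
    using r K by (simp add: \<epsilon>_def field_simps)
  obtain C where C: "\<And>k. \<bar>x k\<bar> \<le> \<epsilon> * K + C * y k"
    using le[OF \<epsilon>] by blast
  have "(\<lambda>k. C * y k) \<longlonglongrightarrow> 0"
    using tendsto_mult_left[OF y, of C] by simp
  then have "\<forall>\<^sub>F k in sequentially. C * y k < r / 2"
    using r by (intro order_tendstoD(2)) auto
  then obtain N where N: "\<And>k. k \<ge> N \<Longrightarrow> C * y k < r / 2"
    by (auto simp: eventually_sequentially)
  have "norm (x k - 0) < r" if "k \<ge> N" for k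
    using C[of k] N[OF that] \<open>\<epsilon> * K < r / 2\<close> by simp
  then show "\<exists>N. \<forall>k\<ge>N. norm (x k - 0) < r" by blast
qed

lemma norm_vec_sqr: "(norm (A :: real^'n^'m))\<^sup>2 = (\<Sum>i\<in>UNIV. \<Sum>j\<in>UNIV. (A $ i $ j)\<^sup>2)"
  unfolding power2_norm_eq_inner inner_vec_def by (simp add: power2_eq_square)

lemma norm_tensor: "norm (tensor a b) = norm a * norm b"
proof -
  have "(norm (tensor a b))\<^sup>2 = (\<Sum>i\<in>UNIV. (a $ i)\<^sup>2) * (\<Sum>j\<in>UNIV. (b $ j)\<^sup>2)"
    by (simp add: norm_vec_sqr tensor_def power_mult_distrib sum_product)
  also have "\<dots> = (norm a * norm b)\<^sup>2"
    unfolding power_mult_distrib power2_norm_eq_inner inner_vec_def by (simp add: power2_eq_square)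
  finally show ?thesis
    by (rule power2_eq_imp_eq) auto
qed

lemma bounded_bilinear_tensor: "bounded_bilinear (tensor :: real^'n \<Rightarrow> real^'n \<Rightarrow> real^'n^'n)"
proof
  show "\<exists>K. \<forall>a b. norm (tensor a b :: real^'n^'n) \<le> norm a * norm b * K"
    by (intro exI[of _ 1]) (simp add: norm_tensor)
qed (simp_all add: tensor_def vec_eq_iff algebra_simps)

lemma tensor_diff_diff: "tensor a a - tensor b b = tensor (a - b) a + tensor b (a - b)"
  by (simp add: tensor_def vec_eq_iff algebra_simps)

lemma norm_transpose: "norm (transpose A) = norm (A :: real^'n^'n)"
proof -
  have "(norm (transpose A))\<^sup>2 = (norm A)\<^sup>2"
    unfolding norm_vec_sqr by (simp add: transpose_def) (rule sum.swap)
  then show ?thesis by (rule power2_eq_imp_eq) auto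
qed

lemma norm_sym_part: "norm (sym_part A) \<le> norm A"
  using norm_triangle_ineq[of A "transpose A"] by (simp add: sym_part_def norm_transpose)

lemma sym_part_diff: "sym_part (A - B) = sym_part A - sym_part B"
  by (simp add: sym_part_def vec_eq_iff transpose_def algebra_simps)

lemma sym_part_scaleR: "sym_part (c *\<^sub>R A) = c *\<^sub>R sym_part A"
  by (simp add: sym_part_def vec_eq_iff transpose_def algebra_simps)

lemma bounded_linear_sym_part: "bounded_linear sym_part"
proof
  show "\<exists>K. \<forall>A. norm (sym_part A :: real^'n^'n) \<le> norm A * K"
    by (intro exI[of _ 1]) (simp add: norm_sym_part)
qed (simp_all add: sym_part_def vec_eq_iff transpose_def algebra_simps)

text \<open>
  The viscous stress tensor, without the factor \<open>\<nu>\<close>, as a function of the velocity gradient. It is 0 at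
  matrices without symmetric part, also when the exponent \<open>p - 2\<close> is negative.
\<close>

definition visc :: "real \<Rightarrow> real^'n^'n \<Rightarrow> real^'n^'n" where
  "visc p A = norm (sym_part A) powr (p - 2) *\<^sub>R sym_part A"

lemma norm_visc: "norm (visc p A) = norm (sym_part A) powr (p - 1)"
proof (cases "sym_part A = 0")
  case False
  have "norm (sym_part A) powr (p - 2) * norm (sym_part A) powr 1 = norm (sym_part A) powr (p - 2 + 1)"
    by (rule powr_add[symmetric])
  then show ?thesis using False by (simp add: visc_def)
qed (simp add: visc_def)

lemma norm_visc_le: "1 < p \<Longrightarrow> norm (visc p A) \<le> norm A powr (p - 1)"
  unfolding norm_visc by (intro powr_mono2 norm_sym_part) auto

lemma visc_scaleR: "0 < c \<Longrightarrow> visc p (c *\<^sub>R A) = c powr (p - 1) *\<^sub>R visc p A"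
  using powr_add[of c "p - 2" 1] by (simp add: visc_def sym_part_scaleR powr_mult)

lemma continuous_on_visc:
  assumes p: "1 < p"
  shows "continuous_on S (visc p :: real^'n^'n \<Rightarrow> _)"
proof -
  have "isCont (visc p) A" for A :: "real^'n^'n"
  proof (cases "sym_part A = 0")
    case False
    then show ?thesis
      unfolding visc_def isCont_def
      by (intro tendsto_scaleR tendsto_powr tendsto_norm tendsto_const
          bounded_linear.tendsto[OF bounded_linear_sym_part tendsto_ident_at]) auto
  next
    case True
    have "((\<lambda>B. norm (sym_part B)) \<longlongrightarrow> norm (sym_part A)) (at A)"
      using bounded_linear.tendsto[OF bounded_linear_sym_part tendsto_ident_at] by (rule tendsto_norm)
    then have "((\<lambda>B. norm (sym_part B) powr (p - 1)) \<longlongrightarrow> 0) (at A)"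
      using p True by (intro tendsto_zero_powrI[of _ _ _ "p - 1"]) auto
    then have "((\<lambda>B. norm (visc p B)) \<longlongrightarrow> 0) (at A)"
      by (simp add: norm_visc)
    then have "(visc p \<longlongrightarrow> 0) (at A)"
      by (rule tendsto_norm_zero_cancel)
    moreover have "visc p A = 0" using True by (simp add: visc_def)
    ultimately show ?thesis by (simp add: isCont_def)
  qed
  then show ?thesis by (auto intro: continuous_at_imp_continuous_on)
qed

text \<open>
  Uniform continuity on a ball extends to the whole space by homogeneity, as long as \<open>A - B\<close> is
  small compared to \<open>1 + norm A\<close>; otherwise the growth bound suffices.
\<close>

lemma visc_modulus:
  assumes p: "1 < p" and \<epsilon>: "0 < \<epsilon>"
  shows "\<exists>C\<ge>0. \<forall>A B :: real^'n^'n. norm (visc p A - visc p B) \<le> \<epsilon> * (1 + norm A powr p) + C * norm (A - B) powr p"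
proof -
  \<comment> \<open>The factor compensates for \<open>(1 + norm A) powr p \<le> 2 powr p * (1 + norm A powr p)\<close>.\<close>
  define \<eta> where "\<eta> = \<epsilon> / 2 powr p"
  have \<eta>: "0 < \<eta>" using \<epsilon> by (simp add: \<eta>_def)
  have "uniformly_continuous_on (cball 0 2) (visc p :: real^'n^'n \<Rightarrow> _)"
    by (intro compact_uniformly_continuous continuous_on_visc p) auto
  then obtain \<delta>' where \<delta>': "\<delta>' > 0" "\<And>A B :: real^'n^'n. A \<in> cball 0 2 \<Longrightarrow> B \<in> cball 0 2 \<Longrightarrow> dist A B < \<delta>' \<Longrightarrow>
      dist (visc p A) (visc p B) < \<eta>"
    using \<eta> unfolding uniformly_continuous_on_def by metis
  define \<delta> where "\<delta> = min \<delta>' 1"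
  have \<delta>: "0 < \<delta>" "\<delta> \<le> 1" using \<delta>' by (auto simp: \<delta>_def)
  define C where "C = 2 * (2 / \<delta>) powr p"
  have "norm (visc p A - visc p B) \<le> \<epsilon> * (1 + norm A powr p) + C * norm (A - B) powr p" for A B :: "real^'n^'n"
  proof (cases "norm (A - B) < \<delta> * (1 + norm A)")
    case True
    \<comment> \<open>Scaling by \<open>m\<close> brings \<open>A\<close> and \<open>B\<close> into the ball of radius 2.\<close>
    define m where "m = 1 + norm A"
    have m: "1 \<le> m" by (simp add: m_def)
    have nB: "norm B \<le> norm A + norm (A - B)"
      using norm_triangle_ineq4[of A "A - B"] by simp
    have "norm (A - B) \<le> m" using True \<delta> m by (auto simp: m_def intro: order_trans[OF less_imp_le mult_left_le_one_le])
    moreover have "norm A \<le> m" by (simp add: m_def)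
    ultimately have "norm A \<le> 2 * m" "norm B \<le> 2 * m"
      using nB m by linarith+
    then have in_ball: "A /\<^sub>R m \<in> cball 0 2" "B /\<^sub>R m \<in> cball 0 2"
      using m by (simp_all add: divide_inverse[symmetric] mult.commute[of "inverse m"] pos_divide_le_eq)
    have "dist (A /\<^sub>R m) (B /\<^sub>R m) = norm (A - B) / m"
      using m by (simp add: dist_norm scaleR_diff_right[symmetric] inverse_eq_divide)
    also have "\<dots> < \<delta>" using True m unfolding m_def[symmetric] by (simp add: pos_divide_less_eq)
    finally have "dist (visc p (A /\<^sub>R m)) (visc p (B /\<^sub>R m)) < \<eta>"
      using in_ball by (intro \<delta>') (auto simp: \<delta>_def)
    moreover have hom: "m powr (p - 1) *\<^sub>R visc p (X /\<^sub>R m) = visc p X" for X :: "real^'n^'n"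
      using m visc_scaleR[of m p "X /\<^sub>R m"] by simp
    have "visc p A - visc p B = m powr (p - 1) *\<^sub>R (visc p (A /\<^sub>R m) - visc p (B /\<^sub>R m))"
      unfolding scaleR_diff_right hom ..
    ultimately have le: "norm (visc p A - visc p B) \<le> m powr (p - 1) * \<eta>"
      by (simp add: dist_norm mult_left_mono)
    have "m powr (p - 1) \<le> m powr p" using m by (intro powr_mono) auto
    also have "m powr p \<le> 2 powr p * (1 powr p + norm A powr p)"
      unfolding m_def using p by (intro powr_add_le) auto
    finally have "m powr (p - 1) \<le> 2 powr p * (1 + norm A powr p)" by simp
    then have "m powr (p - 1) * \<eta> \<le> 2 powr p * (1 + norm A powr p) * \<eta>"
      using \<eta> by (intro mult_right_mono) auto
    also have "\<dots> = \<epsilon> * (1 + norm A powr p)"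
      by (simp add: \<eta>_def)
    finally have "norm (visc p A - visc p B) \<le> \<epsilon> * (1 + norm A powr p)"
      using le by linarith
    then show ?thesis by (simp add: C_def add_increasing2)
  next
    case False
    define D where "D = norm (A - B)"
    \<comment> \<open>In this case \<open>z\<close> bounds both \<open>norm A\<close> and \<open>norm B\<close>.\<close>
    define z where "z = 2 * D / \<delta>"
    have D: "\<delta> * (1 + norm A) \<le> D" using False by (simp add: D_def)
    then have DA: "1 + norm A \<le> D / \<delta>" using \<delta> by (simp add: pos_le_divide_eq mult.commute)
    have D\<delta>: "D \<le> D / \<delta>" using \<delta> by (simp add: pos_le_divide_eq D_def mult_left_le)
    have z2: "z = 2 * (D / \<delta>)" by (simp add: z_def)
    have z: "1 \<le> z" using DA norm_ge_zero[of A] unfolding z2 by linarith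
    have "norm A \<le> z" using DA D\<delta> norm_ge_zero[of "A - B"] unfolding z_def D_def[symmetric] by simp
    moreover have "norm B \<le> z"
      using norm_triangle_ineq4[of A "A - B"] DA D\<delta> by (simp add: z_def D_def)
    ultimately have "norm (visc p A) \<le> z powr (p - 1)" "norm (visc p B) \<le> z powr (p - 1)"
      using p by (auto intro!: order_trans[OF norm_visc_le] powr_mono2)
    then have "norm (visc p A - visc p B) \<le> 2 * z powr (p - 1)"
      using norm_triangle_ineq4[of "visc p A" "visc p B"] by linarith
    also have "\<dots> \<le> 2 * z powr p" using z by (intro mult_left_mono powr_mono) auto
    also have "\<dots> = C * D powr p"
      using \<delta> by (simp add: z_def C_def D_def powr_mult powr_divide)
    finally show ?thesis using \<epsilon> by (simp add: D_def add_increasing)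
  qed
  moreover have "0 \<le> C" by (simp add: C_def)
  ultimately show ?thesis by blast
qed

text \<open>
  Expand the inner product: by the Cauchy--Schwarz inequality it is at least the product of the
  differences of \<open>norm a powr (p - 1)\<close> and of \<open>norm a\<close> at the two symmetric parts, which have the same sign.
\<close>

lemma visc_monotone:
  assumes p: "1 < p"
  shows "0 \<le> (visc p A - visc p B) \<bullet> (sym_part A - sym_part B)"
proof -
  let ?a = "sym_part A" and ?b = "sym_part B"
  have e: "visc p A \<bullet> ?a = norm ?a powr (p - 1) * norm ?a" "visc p B \<bullet> ?b = norm ?b powr (p - 1) * norm ?b"
  proof -
    have "visc p X \<bullet> sym_part X = norm (sym_part X) powr (p - 1) * norm (sym_part X)" for X :: "real^'a^'a"
      using powr_add[of "norm (sym_part X)" "p - 2" 1]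
      by (cases "sym_part X = 0") (simp_all add: visc_def dot_square_norm power2_eq_square)
    then show "visc p A \<bullet> ?a = norm ?a powr (p - 1) * norm ?a" "visc p B \<bullet> ?b = norm ?b powr (p - 1) * norm ?b"
      by auto
  qed
  have c: "visc p A \<bullet> ?b \<le> norm ?a powr (p - 1) * norm ?b" "visc p B \<bullet> ?a \<le> norm ?b powr (p - 1) * norm ?a"
    using Cauchy_Schwarz_ineq2[of "visc p A" ?b] Cauchy_Schwarz_ineq2[of "visc p B" ?a] by (simp_all add: norm_visc)
  have "0 \<le> (norm ?a powr (p - 1) - norm ?b powr (p - 1)) * (norm ?a - norm ?b)"
    using p powr_mono2[of "p - 1" "norm ?a" "norm ?b"] powr_mono2[of "p - 1" "norm ?b" "norm ?a"]
    by (cases "norm ?a \<le> norm ?b") (auto intro: mult_nonpos_nonpos mult_nonneg_nonneg)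
  then show ?thesis
    using e c by (simp add: inner_diff_left inner_diff_right algebra_simps)
qed

text \<open>
  A form of Young's inequality, from the distinction whether \<open>b\<close> is smaller than \<open>\<epsilon> a\<close>.
\<close>

lemma powr_mult_eps:
  fixes a b :: real
  assumes p: "1 < p" and ab: "0 \<le> a" "0 \<le> b" and \<epsilon>: "0 < \<epsilon>"
  shows "a powr (p - 1) * b \<le> \<epsilon> * a powr p + \<epsilon> powr (1 - p) * b powr p"
proof -
  have pw: "c powr (p - 1) * c = c powr p" if "0 \<le> c" for c :: real
    using powr_mult_base[OF that, of "p - 1"] by (simp add: mult.commute)
  show ?thesis
  proof (cases "b \<le> \<epsilon> * a")
    case True
    then have "a powr (p - 1) * b \<le> a powr (p - 1) * (\<epsilon> * a)"
      by (rule mult_left_mono) simp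
    also have "\<dots> = \<epsilon> * a powr p" using pw[OF ab(1)] by (simp add: algebra_simps)
    finally show ?thesis by (simp add: add_increasing2)
  next
    case False
    then have "a \<le> b / \<epsilon>" using \<epsilon> by (simp add: pos_le_divide_eq mult.commute)
    then have "a powr (p - 1) * b \<le> (b / \<epsilon>) powr (p - 1) * b"
      using ab p by (intro mult_right_mono powr_mono2) auto
    also have "\<dots> = \<epsilon> powr (1 - p) * (b powr (p - 1) * b)"
      using ab \<epsilon> powr_minus_divide[of \<epsilon> "p - 1"] by (simp add: powr_divide)
    finally show ?thesis using pw[OF ab(2)] \<epsilon> by (simp add: add_increasing)
  qed
qed

context bounded_open
begin

lemma visc_measurable: "1 < p \<Longrightarrow> G \<in> borel_measurable M \<Longrightarrow> (\<lambda>x. visc p (G x)) \<in> borel_measurable M"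
  by (rule borel_measurable_continuous_on[OF continuous_on_visc])

lemma sym_part_measurable: "G \<in> borel_measurable M \<Longrightarrow> (\<lambda>x. sym_part (G x)) \<in> borel_measurable M"
  by (rule borel_measurable_continuous_on[OF linear_continuous_on[OF bounded_linear_sym_part]])

lemma tensor_measurable:
  "a \<in> borel_measurable M \<Longrightarrow> b \<in> borel_measurable M \<Longrightarrow> (\<lambda>x. tensor (a x) (b x)) \<in> borel_measurable M"
  by (rule borel_measurable_continuous_Pair)
     (auto intro!: bounded_bilinear.continuous_on[OF bounded_bilinear_tensor] continuous_intros)

lemma visc_integral_eps:
  assumes p: "1 < p" and G: "G \<in> Lp p \<Omega>" and H: "H \<in> Lp p \<Omega>"
  shows "integrable M (\<lambda>x. visc p (G x) \<bullet> sym_part (H x))"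
    "0 < \<epsilon> \<Longrightarrow> \<bar>\<integral>x. visc p (G x) \<bullet> sym_part (H x) \<partial>M\<bar> \<le> \<epsilon> * pint p G + \<epsilon> powr (1 - p) * pint p H"
proof -
  have m: "(\<lambda>x. visc p (G x) \<bullet> sym_part (H x)) \<in> borel_measurable M"
    by (intro borel_measurable_inner visc_measurable sym_part_measurable p LpD(1)[OF G] LpD(1)[OF H])
  have le: "\<bar>visc p (G x) \<bullet> sym_part (H x)\<bar> \<le> \<epsilon> * norm (G x) powr p + \<epsilon> powr (1 - p) * norm (H x) powr p" if "0 < \<epsilon>" for x \<epsilon>
  proof -
    have "\<bar>visc p (G x) \<bullet> sym_part (H x)\<bar> \<le> norm (visc p (G x)) * norm (sym_part (H x))"
      by (rule Cauchy_Schwarz_ineq2)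
    also have "\<dots> \<le> norm (G x) powr (p - 1) * norm (H x)"
      by (intro mult_mono norm_visc_le norm_sym_part p) auto
    also have "\<dots> \<le> \<epsilon> * norm (G x) powr p + \<epsilon> powr (1 - p) * norm (H x) powr p"
      by (intro powr_mult_eps p that) auto
    finally show ?thesis .
  qed
  have int: "integrable M (\<lambda>x. \<epsilon> * norm (G x) powr p + \<epsilon> powr (1 - p) * norm (H x) powr p)" for \<epsilon>
    using G H by (auto simp: Lp_def)
  show i: "integrable M (\<lambda>x. visc p (G x) \<bullet> sym_part (H x))"
  proof (rule Bochner_Integration.integrable_bound[OF int[of 1] m])
    show "AE x in M. norm (visc p (G x) \<bullet> sym_part (H x)) \<le> norm (1 * norm (G x) powr p + 1 powr (1 - p) * norm (H x) powr p)"
      using le[of 1] by (auto intro: order_trans[OF _ abs_ge_self])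
  qed
  assume \<epsilon>: "0 < \<epsilon>"
  have "\<bar>\<integral>x. visc p (G x) \<bullet> sym_part (H x) \<partial>M\<bar> \<le> (\<integral>x. \<bar>visc p (G x) \<bullet> sym_part (H x)\<bar> \<partial>M)"
    by (rule integral_abs_bound)
  also have "\<dots> \<le> (\<integral>x. \<epsilon> * norm (G x) powr p + \<epsilon> powr (1 - p) * norm (H x) powr p \<partial>M)"
    by (intro integral_mono integrable_abs i int le \<epsilon>)
  also have "\<dots> = \<epsilon> * pint p G + \<epsilon> powr (1 - p) * pint p H"
    using G H by (simp add: Lp_def pint_def)
  finally show "\<bar>\<integral>x. visc p (G x) \<bullet> sym_part (H x) \<partial>M\<bar> \<le> \<epsilon> * pint p G + \<epsilon> powr (1 - p) * pint p H" .
qed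

lemma visc_tendsto_test:
  assumes p: "1 < p" and G: "G \<in> Lp p \<Omega>" and H: "H \<in> Lp p \<Omega>" "\<And>k. Hs k \<in> Lp p \<Omega>"
    and lim: "(\<lambda>k. pint p (\<lambda>x. H x - Hs k x)) \<longlonglongrightarrow> 0"
  shows "(\<lambda>k. \<integral>x. visc p (G x) \<bullet> sym_part (Hs k x) \<partial>M) \<longlonglongrightarrow> (\<integral>x. visc p (G x) \<bullet> sym_part (H x) \<partial>M)"
proof -
  have d: "(\<lambda>x. H x - Hs k x) \<in> Lp p \<Omega>" for k
    using p by (intro Lp_diff H) auto
  have eq: "(\<integral>x. visc p (G x) \<bullet> sym_part (H x - Hs k x) \<partial>M) =
      (\<integral>x. visc p (G x) \<bullet> sym_part (H x) \<partial>M) - (\<integral>x. visc p (G x) \<bullet> sym_part (Hs k x) \<partial>M)" for k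
    using visc_integral_eps(1)[OF p G H(1)] visc_integral_eps(1)[OF p G H(2)]
    by (simp add: sym_part_diff inner_diff_right)
  have "(\<lambda>k. \<integral>x. visc p (G x) \<bullet> sym_part (H x - Hs k x) \<partial>M) \<longlonglongrightarrow> 0"
  proof (rule tendsto_0_if_eps_bound[OF _ lim pint_nonneg])
    fix \<epsilon> :: real assume "0 < \<epsilon>"
    then show "\<exists>C. \<forall>k. \<bar>\<integral>x. visc p (G x) \<bullet> sym_part (H x - Hs k x) \<partial>M\<bar> \<le> \<epsilon> * pint p G + C * pint p (\<lambda>x. H x - Hs k x)"
      using visc_integral_eps(2)[OF p G d] by blast
  qed
  from tendsto_diff[OF tendsto_const[of "\<integral>x. visc p (G x) \<bullet> sym_part (H x) \<partial>M"] this]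
  show ?thesis by (simp add: eq)
qed

text \<open>
  Convergence of the gradients in $L^p$ passes to the viscous term tested with a bounded function.
  Along strongly convergent simple functions of time this makes the tested viscous term measurable.
\<close>

lemma visc_tendsto:
  fixes G :: "real^'n \<Rightarrow> real^'n^'n"
  assumes p: "1 < p" and G: "G \<in> Lp p \<Omega>" "\<And>k. Gs k \<in> Lp p \<Omega>"
    and H: "H \<in> borel_measurable M" "\<And>x. norm (H x) \<le> B"
    and lim: "(\<lambda>k. pint p (\<lambda>x. G x - Gs k x)) \<longlonglongrightarrow> 0"
  shows "(\<lambda>k. \<integral>x. visc p (Gs k x) \<bullet> sym_part (H x) \<partial>M) \<longlonglongrightarrow> (\<integral>x. visc p (G x) \<bullet> sym_part (H x) \<partial>M)"
proof -
  have p0: "0 < p" using p by simp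
  have B: "0 \<le> B" using order_trans[OF norm_ge_zero H(2)] .
  have HL: "H \<in> Lp p \<Omega>" using H p0 by (rule bounded_in_Lp)
  have int: "integrable M (\<lambda>x. visc p (G x) \<bullet> sym_part (H x))" "integrable M (\<lambda>x. visc p (Gs k x) \<bullet> sym_part (H x))" for k
    using visc_integral_eps(1)[OF p _ HL] G by auto
  have d: "(\<lambda>x. G x - Gs k x) \<in> Lp p \<Omega>" for k
    by (intro Lp_diff G p0)
  have "(\<lambda>k. (\<integral>x. visc p (G x) \<bullet> sym_part (H x) \<partial>M) - (\<integral>x. visc p (Gs k x) \<bullet> sym_part (H x) \<partial>M)) \<longlonglongrightarrow> 0"
  proof (rule tendsto_0_if_eps_bound[OF _ lim])
    show "0 \<le> B * (measure M \<Omega> + pint p G)" using B by simp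
    fix \<epsilon> :: real assume "0 < \<epsilon>"
    from visc_modulus[OF p this] obtain C where C: "0 \<le> C"
      "\<And>A A' :: real^'n^'n. norm (visc p A - visc p A') \<le> \<epsilon> * (1 + norm A powr p) + C * norm (A - A') powr p"
      by blast
    have "\<bar>(\<integral>x. visc p (G x) \<bullet> sym_part (H x) \<partial>M) - (\<integral>x. visc p (Gs k x) \<bullet> sym_part (H x) \<partial>M)\<bar> \<le>
        \<epsilon> * (B * (measure M \<Omega> + pint p G)) + (B * C) * pint p (\<lambda>x. G x - Gs k x)" for k
    proof -
      let ?r = "\<lambda>x. B * (\<epsilon> * (1 + norm (G x) powr p) + C * norm (G x - Gs k x) powr p)"
      have ir: "integrable M ?r"
        using LpD(2)[OF G(1)] LpD(2)[OF d[of k]] by simp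
      have "\<bar>(\<integral>x. visc p (G x) \<bullet> sym_part (H x) \<partial>M) - (\<integral>x. visc p (Gs k x) \<bullet> sym_part (H x) \<partial>M)\<bar> =
          \<bar>\<integral>x. (visc p (G x) - visc p (Gs k x)) \<bullet> sym_part (H x) \<partial>M\<bar>"
        using int by (simp add: inner_diff_left)
      also have "\<dots> \<le> (\<integral>x. \<bar>(visc p (G x) - visc p (Gs k x)) \<bullet> sym_part (H x)\<bar> \<partial>M)"
        by (rule integral_abs_bound)
      also have "\<dots> \<le> (\<integral>x. ?r x \<partial>M)"
      proof (rule integral_mono[OF _ ir])
        show "integrable M (\<lambda>x. \<bar>(visc p (G x) - visc p (Gs k x)) \<bullet> sym_part (H x)\<bar>)"
          using int by (simp add: inner_diff_left)
        fix x
        have "\<bar>(visc p (G x) - visc p (Gs k x)) \<bullet> sym_part (H x)\<bar> \<le> norm (visc p (G x) - visc p (Gs k x)) * norm (sym_part (H x))"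
          by (rule Cauchy_Schwarz_ineq2)
        also have "\<dots> \<le> (\<epsilon> * (1 + norm (G x) powr p) + C * norm (G x - Gs k x) powr p) * B"
        proof (rule mult_mono)
          show "norm (visc p (G x) - visc p (Gs k x)) \<le> \<epsilon> * (1 + norm (G x) powr p) + C * norm (G x - Gs k x) powr p"
            by (rule C(2))
          show "norm (sym_part (H x)) \<le> B" by (rule order_trans[OF norm_sym_part H(2)])
        qed (use C(1) \<open>0 < \<epsilon>\<close> in auto)
        finally show "\<bar>(visc p (G x) - visc p (Gs k x)) \<bullet> sym_part (H x)\<bar> \<le> ?r x"
          by (simp add: mult.commute)
      qed
      also have "\<dots> = \<epsilon> * (B * (measure M \<Omega> + pint p G)) + (B * C) * pint p (\<lambda>x. G x - Gs k x)"
        using LpD(2)[OF G(1)] LpD(2)[OF d[of k]] by (simp add: pint_def algebra_simps)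
      finally show ?thesis .
    qed
    then show "\<exists>C. \<forall>k. \<bar>(\<integral>x. visc p (G x) \<bullet> sym_part (H x) \<partial>M) - (\<integral>x. visc p (Gs k x) \<bullet> sym_part (H x) \<partial>M)\<bar> \<le>
        \<epsilon> * (B * (measure M \<Omega> + pint p G)) + C * pint p (\<lambda>x. G x - Gs k x)" by blast
  qed
  from tendsto_diff[OF tendsto_const[of "\<integral>x. visc p (G x) \<bullet> sym_part (H x) \<partial>M"] this]
  show ?thesis by simp
qed

lemma conv_integrable:
  assumes a: "a \<in> Lp 2 \<Omega>" and b: "b \<in> Lp 2 \<Omega>" and H: "H \<in> borel_measurable M" "\<And>x. norm (H x) \<le> B"
  shows "integrable M (\<lambda>x. tensor (a x) (b x) \<bullet> H x)"
    "\<bar>\<integral>x. tensor (a x) (b x) \<bullet> H x \<partial>M\<bar> \<le> B * (Lp_norm 2 \<Omega> a * Lp_norm 2 \<Omega> b)"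
proof -
  have B: "0 \<le> B" using order_trans[OF norm_ge_zero H(2)] .
  have le: "\<bar>tensor (a x) (b x) \<bullet> H x\<bar> \<le> B * (norm (a x) * norm (b x))" for x
  proof -
    have "\<bar>tensor (a x) (b x) \<bullet> H x\<bar> \<le> norm (tensor (a x) (b x)) * norm (H x)"
      by (rule Cauchy_Schwarz_ineq2)
    also have "\<dots> \<le> (norm (a x) * norm (b x)) * B"
      unfolding norm_tensor using H(2) by (intro mult_left_mono) auto
    finally show ?thesis by (simp add: mult.commute)
  qed
  have int: "integrable M (\<lambda>x. B * (norm (a x) * norm (b x)))"
    using Cauchy_Schwarz_Lp(1)[OF a b] by simp
  show i: "integrable M (\<lambda>x. tensor (a x) (b x) \<bullet> H x)"
  proof (rule Bochner_Integration.integrable_bound[OF int])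
    show "(\<lambda>x. tensor (a x) (b x) \<bullet> H x) \<in> borel_measurable M"
      by (intro borel_measurable_inner tensor_measurable LpD(1)[OF a] LpD(1)[OF b] H)
    show "AE x in M. norm (tensor (a x) (b x) \<bullet> H x) \<le> norm (B * (norm (a x) * norm (b x)))"
      using le by (auto intro: order_trans[OF _ abs_ge_self])
  qed
  have "\<bar>\<integral>x. tensor (a x) (b x) \<bullet> H x \<partial>M\<bar> \<le> (\<integral>x. \<bar>tensor (a x) (b x) \<bullet> H x\<bar> \<partial>M)"
    by (rule integral_abs_bound)
  also have "\<dots> \<le> (\<integral>x. B * (norm (a x) * norm (b x)) \<partial>M)"
    by (intro integral_mono integrable_abs i int le)
  also have "\<dots> \<le> B * (Lp_norm 2 \<Omega> a * Lp_norm 2 \<Omega> b)"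
    using Cauchy_Schwarz_Lp(2)[OF a b] B by (simp add: mult_left_mono)
  finally show "\<bar>\<integral>x. tensor (a x) (b x) \<bullet> H x \<partial>M\<bar> \<le> B * (Lp_norm 2 \<Omega> a * Lp_norm 2 \<Omega> b)" .
qed

lemma conv_tendsto:
  assumes a: "a \<in> Lp 2 \<Omega>" "\<And>k. as k \<in> Lp 2 \<Omega>" and H: "H \<in> borel_measurable M" "\<And>x. norm (H x) \<le> B"
    and lim: "(\<lambda>k. Lp_norm 2 \<Omega> (\<lambda>x. a x - as k x)) \<longlonglongrightarrow> 0"
  shows "(\<lambda>k. \<integral>x. tensor (as k x) (as k x) \<bullet> H x \<partial>M) \<longlonglongrightarrow> (\<integral>x. tensor (a x) (a x) \<bullet> H x \<partial>M)"
proof -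
  let ?d = "\<lambda>k x. a x - as k x"
  have d: "?d k \<in> Lp 2 \<Omega>" for k by (intro Lp_diff a) simp
  note t = bounded_bilinear_tensor
  have eq: "tensor (as k x) (as k x) \<bullet> H x =
      tensor (a x) (a x) \<bullet> H x - tensor (?d k x) (a x) \<bullet> H x - tensor (a x) (?d k x) \<bullet> H x + tensor (?d k x) (?d k x) \<bullet> H x" for k x
    by (simp add: bounded_bilinear.diff_left[OF t] bounded_bilinear.diff_right[OF t] inner_diff_left inner_add_left)
  have int: "(\<integral>x. tensor (as k x) (as k x) \<bullet> H x \<partial>M) =
      (\<integral>x. tensor (a x) (a x) \<bullet> H x \<partial>M) - (\<integral>x. tensor (?d k x) (a x) \<bullet> H x \<partial>M)
      - (\<integral>x. tensor (a x) (?d k x) \<bullet> H x \<partial>M) + (\<integral>x. tensor (?d k x) (?d k x) \<bullet> H x \<partial>M)" for k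
    unfolding eq using conv_integrable(1)[OF a(1) a(1) H] conv_integrable(1)[OF d a(1) H]
      conv_integrable(1)[OF a(1) d H] conv_integrable(1)[OF d d H] by simp
  let ?N = "\<lambda>k. Lp_norm 2 \<Omega> (?d k)"
  have z1: "(\<lambda>k. \<integral>x. tensor (?d k x) (a x) \<bullet> H x \<partial>M) \<longlonglongrightarrow> 0"
    by (rule Lim_null_comparison[where g = "\<lambda>k. B * (?N k * Lp_norm 2 \<Omega> a)"])
       (use conv_integrable(2)[OF d a(1) H] tendsto_mult[OF tendsto_const[of B] tendsto_mult[OF lim tendsto_const]] in auto)
  have z2: "(\<lambda>k. \<integral>x. tensor (a x) (?d k x) \<bullet> H x \<partial>M) \<longlonglongrightarrow> 0"
    by (rule Lim_null_comparison[where g = "\<lambda>k. B * (Lp_norm 2 \<Omega> a * ?N k)"])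
       (use conv_integrable(2)[OF a(1) d H] tendsto_mult[OF tendsto_const[of B] tendsto_mult[OF tendsto_const lim]] in auto)
  have z3: "(\<lambda>k. \<integral>x. tensor (?d k x) (?d k x) \<bullet> H x \<partial>M) \<longlonglongrightarrow> 0"
    by (rule Lim_null_comparison[where g = "\<lambda>k. B * (?N k * ?N k)"])
       (use conv_integrable(2)[OF d d H] tendsto_mult[OF tendsto_const[of B] tendsto_mult[OF lim lim]] in auto)
  from tendsto_add[OF tendsto_diff[OF tendsto_diff[OF tendsto_const z1] z2] z3]
  show ?thesis unfolding int by simp
qed

lemma inner_tendsto:
  assumes a: "a \<in> Lp 2 \<Omega>" "\<And>k. as k \<in> Lp 2 \<Omega>" and b: "b \<in> Lp 2 \<Omega>" "\<And>k. bs k \<in> Lp 2 \<Omega>"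
    and lim: "(\<lambda>k. Lp_norm 2 \<Omega> (\<lambda>x. a x - as k x)) \<longlonglongrightarrow> 0" "(\<lambda>k. Lp_norm 2 \<Omega> (\<lambda>x. b x - bs k x)) \<longlonglongrightarrow> 0"
  shows "(\<lambda>k. \<integral>x. as k x \<bullet> bs k x \<partial>M) \<longlonglongrightarrow> (\<integral>x. a x \<bullet> b x \<partial>M)"
proof -
  let ?d = "\<lambda>k x. a x - as k x" and ?e = "\<lambda>k x. b x - bs k x"
  have d: "?d k \<in> Lp 2 \<Omega>" and e: "?e k \<in> Lp 2 \<Omega>" for k by (auto intro!: Lp_diff a b)
  have eq: "as k x \<bullet> bs k x = a x \<bullet> b x - ?d k x \<bullet> b x - a x \<bullet> ?e k x + ?d k x \<bullet> ?e k x" for k x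
    by (simp add: inner_diff_left inner_diff_right)
  have int: "(\<integral>x. as k x \<bullet> bs k x \<partial>M) = (\<integral>x. a x \<bullet> b x \<partial>M) - (\<integral>x. ?d k x \<bullet> b x \<partial>M)
      - (\<integral>x. a x \<bullet> ?e k x \<partial>M) + (\<integral>x. ?d k x \<bullet> ?e k x \<partial>M)" for k
    unfolding eq using Cauchy_Schwarz_Lp(3)[OF a(1) b(1)] Cauchy_Schwarz_Lp(3)[OF d b(1)]
      Cauchy_Schwarz_Lp(3)[OF a(1) e] Cauchy_Schwarz_Lp(3)[OF d e] by simp
  have z1: "(\<lambda>k. \<integral>x. ?d k x \<bullet> b x \<partial>M) \<longlonglongrightarrow> 0"
    by (rule Lim_null_comparison[where g = "\<lambda>k. Lp_norm 2 \<Omega> (?d k) * Lp_norm 2 \<Omega> b"])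
       (use Cauchy_Schwarz_Lp(4)[OF d b(1)] tendsto_mult[OF lim(1) tendsto_const] in auto)
  have z2: "(\<lambda>k. \<integral>x. a x \<bullet> ?e k x \<partial>M) \<longlonglongrightarrow> 0"
    by (rule Lim_null_comparison[where g = "\<lambda>k. Lp_norm 2 \<Omega> a * Lp_norm 2 \<Omega> (?e k)"])
       (use Cauchy_Schwarz_Lp(4)[OF a(1) e] tendsto_mult[OF tendsto_const lim(2)] in auto)
  have z3: "(\<lambda>k. \<integral>x. ?d k x \<bullet> ?e k x \<partial>M) \<longlonglongrightarrow> 0"
    by (rule Lim_null_comparison[where g = "\<lambda>k. Lp_norm 2 \<Omega> (?d k) * Lp_norm 2 \<Omega> (?e k)"])
       (use Cauchy_Schwarz_Lp(4)[OF d e] tendsto_mult[OF lim] in auto)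
  from tendsto_add[OF tendsto_diff[OF tendsto_diff[OF tendsto_const z1] z2] z3]
  show ?thesis unfolding int by simp
qed

section \<open>Embeddings\<close>

lemma Vp_subset_closure: "u \<in> Vp r \<Omega> \<Longrightarrow> u \<in> W1p_closure r \<Omega> (C0inf \<Omega>)"
  using solenoidal_subset unfolding Vp_def W1p_closure_def by blast

text \<open>
  The exponent \<open>q\<close> may be lowered below \<open>r\<close>, because \<open>\<Omega>\<close> is bounded. This makes the inequality available
  also when \<open>r\<close> is at least the dimension.
\<close>

lemma Vp_Sobolev:
  assumes q: "1 < q" "q < real CARD('n)" "q \<le> r"
  shows "\<exists>C\<ge>0. \<forall>u\<in>Vp r \<Omega>. u \<in> Lp (real CARD('n) * q / (real CARD('n) - q)) \<Omega> \<and>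
    Lp_norm (real CARD('n) * q / (real CARD('n) - q)) \<Omega> u \<le> C * Lp_norm r \<Omega> (grad u)"
proof -
  define K where "K = 2 * (q * (real CARD('n) - 1) / (real CARD('n) - q))"
  have K: "0 \<le> K" using q by (simp add: K_def)
  define c where "c = (1 + measure M \<Omega>) powr (1 / q - 1 / r)"
  have "u \<in> Lp (real CARD('n) * q / (real CARD('n) - q)) \<Omega> \<and>
    Lp_norm (real CARD('n) * q / (real CARD('n) - q)) \<Omega> u \<le> (K * c) * Lp_norm r \<Omega> (grad u)" if u: "u \<in> Vp r \<Omega>" for u
  proof
    note S = Sobolev_closure[OF Vp_subset_closure[OF u] q]
    show "u \<in> Lp (real CARD('n) * q / (real CARD('n) - q)) \<Omega>" by (rule S(1))
    have "Lp_norm (real CARD('n) * q / (real CARD('n) - q)) \<Omega> u \<le> K * Lp_norm q \<Omega> (grad u)"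
      using S(2) by (simp only: K_def)
    also have "\<dots> \<le> K * (c * Lp_norm r \<Omega> (grad u))"
      unfolding c_def using q by (intro mult_left_mono K Lp_embedding(2) Vp_Lp(2)[OF u]) auto
    finally show "Lp_norm (real CARD('n) * q / (real CARD('n) - q)) \<Omega> u \<le> (K * c) * Lp_norm r \<Omega> (grad u)"
      by (simp only: mult.assoc)
  qed
  moreover have "0 \<le> K * c" using K by (simp add: c_def)
  ultimately show ?thesis by blast
qed

text \<open>
  These are the exponents with which Hoelder's inequality bounds the convective term. In dimension
  \<open>n \<ge> 3\<close> they come from the embeddings of $W^{1,n/2}_0$ into $L^n$ and of $W^{1,2}_0$ into
  $L^{2n/(n-2)}$; this is where \<open>r\<close> must be at least half of the dimension. In dimension 2 both
  exponents are 4, which is obtained from $W^{1,4/3}_0$.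
\<close>

lemma convective_exponents:
  assumes d: "2 \<le> CARD('n)" and r: "2 \<le> r" "real CARD('n) \<le> 2 * r"
  shows "\<exists>a b C. 2 < a \<and> 2 < b \<and> 1 / a + 1 / b = 1 / 2 \<and> 0 \<le> C \<and>
    (\<forall>u\<in>Vp r \<Omega>. u \<in> Lp a \<Omega> \<and> Lp_norm a \<Omega> u \<le> C * Lp_norm r \<Omega> (grad u)) \<and>
    (\<forall>u\<in>Vp 2 \<Omega>. u \<in> Lp b \<Omega> \<and> Lp_norm b \<Omega> u \<le> C * Lp_norm 2 \<Omega> (grad u))"
proof -
  define n where "n = real CARD('n)"
  define q1 where "q1 = (if CARD('n) = 2 then 4 / 3 else n / 2)"
  define q2 where "q2 = (if CARD('n) = 2 then 4 / 3 else 2 :: real)"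
  define a where "a = n * q1 / (n - q1)"
  define b where "b = n * q2 / (n - q2)"
  have n: "CARD('n) = 2 \<and> n = 2 \<or> CARD('n) \<noteq> 2 \<and> 3 \<le> n" using d by (auto simp: n_def)
  then have q1: "1 < q1" "q1 < n" "q1 \<le> r" and q2: "1 < q2" "q2 < n" "q2 \<le> 2"
    using r by (auto simp: q1_def q2_def n_def)
  have ab: "2 < a" "2 < b" "1 / a + 1 / b = 1 / 2"
    using n by (auto simp: a_def b_def q1_def q2_def field_simps)
  obtain C1 where C1: "0 \<le> C1" "\<And>u. u \<in> Vp r \<Omega> \<Longrightarrow> u \<in> Lp a \<Omega>" "\<And>u. u \<in> Vp r \<Omega> \<Longrightarrow> Lp_norm a \<Omega> u \<le> C1 * Lp_norm r \<Omega> (grad u)"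
    using Vp_Sobolev[of q1 r] q1 unfolding a_def n_def by blast
  obtain C2 where C2: "0 \<le> C2" "\<And>u. u \<in> Vp 2 \<Omega> \<Longrightarrow> u \<in> Lp b \<Omega>" "\<And>u. u \<in> Vp 2 \<Omega> \<Longrightarrow> Lp_norm b \<Omega> u \<le> C2 * Lp_norm 2 \<Omega> (grad u)"
    using Vp_Sobolev[of q2 2] q2 unfolding b_def n_def by blast
  have "Lp_norm a \<Omega> u \<le> (C1 + C2) * Lp_norm r \<Omega> (grad u)" if "u \<in> Vp r \<Omega>" for u
    using C1(3)[OF that] mult_nonneg_nonneg[OF C2(1) Lp_norm_nonneg[of r "grad u"]] by (simp add: distrib_right)
  moreover have "Lp_norm b \<Omega> u \<le> (C1 + C2) * Lp_norm 2 \<Omega> (grad u)" if "u \<in> Vp 2 \<Omega>" for u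
    using C2(3)[OF that] mult_nonneg_nonneg[OF C1(1) Lp_norm_nonneg[of 2 "grad u"]] by (simp add: distrib_right)
  moreover have "0 \<le> C1 + C2" using C1 C2 by simp
  ultimately show ?thesis using ab C1(2) C2(2) by blast
qed

text \<open>
  The norm of $L^b$ with some \<open>b > 2\<close> dominates that of $L^2$ on a bounded set.
\<close>

lemma Poincare:
  assumes d: "2 \<le> CARD('n)"
  shows "\<exists>C\<ge>0. \<forall>u\<in>Vp 2 \<Omega>. Lp_norm 2 \<Omega> u \<le> C * Lp_norm 2 \<Omega> (grad u)"
proof -
  obtain b C where b: "2 < b" "0 \<le> C" "\<And>u. u \<in> Vp 2 \<Omega> \<Longrightarrow> u \<in> Lp b \<Omega>"
    "\<And>u. u \<in> Vp 2 \<Omega> \<Longrightarrow> Lp_norm b \<Omega> u \<le> C * Lp_norm 2 \<Omega> (grad u)"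
    using convective_exponents[OF d, of "real CARD('n)"] d by auto
  define c where "c = (1 + measure M \<Omega>) powr (1 / 2 - 1 / b)"
  have "Lp_norm 2 \<Omega> u \<le> (c * C) * Lp_norm 2 \<Omega> (grad u)" if u: "u \<in> Vp 2 \<Omega>" for u
  proof -
    have "Lp_norm 2 \<Omega> u \<le> c * Lp_norm b \<Omega> u"
      unfolding c_def using b by (intro Lp_embedding(2) b(3)[OF u]) auto
    also have "\<dots> \<le> c * (C * Lp_norm 2 \<Omega> (grad u))"
      by (intro mult_left_mono b(4)[OF u]) (simp add: c_def)
    finally show ?thesis by (simp only: mult.assoc)
  qed
  moreover have "0 \<le> c * C" using b by (simp add: c_def)
  ultimately show ?thesis by blast
qed

lemma Lp_prod:
  assumes v: "v \<in> Lp a \<Omega>" and u: "u \<in> Lp b \<Omega>" and ab: "2 < a" "2 < b" "1 / a + 1 / b = 1 / 2"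
  shows "(\<lambda>x. norm (v x) * norm (u x)) \<in> Lp 2 \<Omega>"
    "Lp_norm 2 \<Omega> (\<lambda>x. norm (v x) * norm (u x)) \<le> Lp_norm a \<Omega> v * Lp_norm b \<Omega> u"
proof -
  have [measurable]: "v \<in> borel_measurable M" "u \<in> borel_measurable M"
    using u v by (auto simp: Lp_def)
  have l: "0 < 2 / a" "2 / a < 1" "1 - 2 / a = 2 / b" using ab by (auto simp: field_simps)
  have eq: "(norm (v x) powr a) powr (2 / a) * (norm (u x) powr b) powr (1 - 2 / a) = norm (norm (v x) * norm (u x)) powr 2" for x
    using ab by (simp only: l(3) powr_powr) (simp add: power_mult_distrib)
  from Holder2[OF LpD(2)[OF v] LpD(2)[OF u] _ _ l(1,2)] eq
  have i: "integrable M (\<lambda>x. norm (norm (v x) * norm (u x)) powr 2)"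
    and le: "pint 2 (\<lambda>x. norm (v x) * norm (u x)) \<le> pint a v powr (2 / a) * pint b u powr (2 / b)"
    by (simp_all add: pint_def l(3) del: powr_numeral norm_mult real_norm_def)
  have "(\<lambda>x. norm (v x) * norm (u x)) \<in> borel_measurable M" by measurable
  with i show "(\<lambda>x. norm (v x) * norm (u x)) \<in> Lp 2 \<Omega>" by (simp add: Lp_def)
  have "pint 2 (\<lambda>x. norm (v x) * norm (u x)) powr (1 / 2) \<le> (pint a v powr (2 / a) * pint b u powr (2 / b)) powr (1 / 2)"
    using le by (intro powr_mono2) auto
  also have "\<dots> = Lp_norm a \<Omega> v * Lp_norm b \<Omega> u"
    by (simp add: Lp_norm_eq powr_mult powr_powr)
  finally show "Lp_norm 2 \<Omega> (\<lambda>x. norm (v x) * norm (u x)) \<le> Lp_norm a \<Omega> v * Lp_norm b \<Omega> u"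
    by (simp add: Lp_norm_eq)
qed

end

section \<open>Functions of time\<close>

lemma real_derivative_eq_frechet:
  "(\<theta> has_real_derivative D) (at t) \<Longrightarrow> frechet_derivative \<theta> (at t) = (\<lambda>h. D * h)"
  unfolding has_field_derivative_def by (rule frechet_derivative_at[symmetric])

locale time_interval =
  fixes T :: real
  assumes T_pos: "0 < T"
begin

abbreviation J where "J \<equiv> lebesgue_on {0<..<T}"

sublocale J: finite_measure J
  by (intro finite_measure_lebesgue_on) (simp add: lmeasurable_open)

lemma less_measurable [measurable]: "Measurable.pred (J \<Otimes>\<^sub>M J) (\<lambda>z. fst z < snd z)"
  "Measurable.pred J (\<lambda>s. s < t)" "Measurable.pred J (\<lambda>s. t < s)" "Measurable.pred J (\<lambda>s. t \<le> s)"
  "Measurable.pred (J \<Otimes>\<^sub>M J) (\<lambda>z. snd z < fst z)"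
  "Measurable.pred (J \<Otimes>\<^sub>M J) (\<lambda>z. fst z < t)" "Measurable.pred (J \<Otimes>\<^sub>M J) (\<lambda>z. snd z < t)"
proof -
  have id: "(\<lambda>s. s) \<in> borel_measurable J"
    using id_borel_measurable_lebesgue_on[of "{0<..<T}"] by (simp add: id_def)
  have [measurable]: "fst \<in> borel_measurable (J \<Otimes>\<^sub>M J)" "snd \<in> borel_measurable (J \<Otimes>\<^sub>M J)"
    using measurable_compose[OF measurable_fst id] measurable_compose[OF measurable_snd id] by auto
  show "Measurable.pred (J \<Otimes>\<^sub>M J) (\<lambda>z. fst z < snd z)" "Measurable.pred (J \<Otimes>\<^sub>M J) (\<lambda>z. snd z < fst z)"
    "Measurable.pred (J \<Otimes>\<^sub>M J) (\<lambda>z. fst z < t)" "Measurable.pred (J \<Otimes>\<^sub>M J) (\<lambda>z. snd z < t)"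
    by measurable
  note [measurable] = id
  show "Measurable.pred J (\<lambda>s. s < t)" "Measurable.pred J (\<lambda>s. t < s)" "Measurable.pred J (\<lambda>s. t \<le> s)"
    by measurable
qed

lemma J_AE_neq: "AE s in J. s \<noteq> t"
proof -
  have "AE s in lebesgue. s \<noteq> t"
    by (rule AE_completion[OF AE_lborel_singleton])
  then show ?thesis by (subst AE_restrict_space_iff) auto
qed

lemma absolutely_integrable_compact_J:
  fixes f :: "real \<Rightarrow> real"
  assumes "integrable J f" "compact K" "K \<subseteq> {0<..<T}"
  shows "f absolutely_integrable_on K"
proof -
  have "f absolutely_integrable_on {0<..<T}"
    using assms(1) by (simp add: integrable_restrict_space set_integrable_def)
  then show ?thesis
    by (rule set_integrable_subset) (use assms in \<open>auto intro: fmeasurableD lmeasurable_compact\<close>)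
qed

lemma fundamental_lemma_J:
  fixes f :: "real \<Rightarrow> real"
  assumes "integrable J f" "\<And>\<phi>. \<phi> \<in> C0inf {0<..<T} \<Longrightarrow> (\<integral>t. f t * \<phi> t \<partial>J) = 0"
  shows "AE t in J. f t = 0"
  by (rule fundamental_lemma) (use assms absolutely_integrable_compact_J in auto)

lemma integral_J_eq:
  fixes \<eta> :: "real \<Rightarrow> real"
  assumes c: "continuous_on UNIV \<eta>" and t: "0 \<le> t" "t \<le> T"
  shows "(\<integral>s. (if t < s then 1 else 0) * \<eta> s \<partial>J) = integral {t..T} \<eta>"
proof -
  have "(\<integral>s. (if t < s then 1 else 0) * \<eta> s \<partial>J) = (\<integral>s. indicator {0<..<T} s *\<^sub>R ((if t < s then 1 else 0) * \<eta> s) \<partial>lebesgue)"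
    by (subst integral_restrict_space) auto
  also have "\<dots> = (\<integral>s. indicator {t<..<T} s *\<^sub>R \<eta> s \<partial>lebesgue)"
    using t by (intro Bochner_Integration.integral_cong) (auto simp: indicator_def)
  also have "\<dots> = integral {t<..<T} \<eta>"
  proof -
    have "\<eta> absolutely_integrable_on {t..T}"
      using c by (intro absolutely_integrable_continuous_real) (auto intro: continuous_on_subset)
    then have "\<eta> absolutely_integrable_on {t<..<T}"
      by (rule set_integrable_subset) auto
    from set_lebesgue_integral_eq_integral(2)[OF this] show ?thesis
      by (simp add: set_lebesgue_integral_def)
  qed
  also have "\<dots> = integral {t..T} \<eta>"
    using integral_open_interval_real[of t T \<eta>] by simp
  finally show ?thesis .
qed

text \<open>A primitive that vanishes near the end of the interval, but in general not at its beginning.\<close>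

lemma backward_primitive:
  assumes \<eta>: "\<eta> \<in> C0inf {0<..<T}"
  obtains \<theta> b where "smooth \<theta>" "\<And>t. (\<theta> has_real_derivative - \<eta> t) (at t)" "b < T"
    "\<And>t. b \<le> t \<Longrightarrow> \<theta> t = 0" "\<And>t. t \<in> {0<..<T} \<Longrightarrow> \<theta> t = (\<integral>s. (if t < s then 1 else 0) * \<eta> s \<partial>J)"
proof -
  obtain K where K: "compact K" "K \<subseteq> {0<..<T}" "\<And>t. t \<notin> K \<Longrightarrow> \<eta> t = 0"
    using C0infE[OF \<eta>] by blast
  obtain a b where ab: "0 < a" "a < b" "b < T" "\<And>t. t \<le> a \<Longrightarrow> \<eta> t = 0" "\<And>t. b \<le> t \<Longrightarrow> \<eta> t = 0"
  proof (cases "K = {}")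
    case True
    show ?thesis
      by (rule that[of "T / 3" "T / 2"]) (use True K T_pos in auto)
  next
    case False
    obtain x where x: "x \<in> K" "\<And>y. y \<in> K \<Longrightarrow> x \<le> y" using compact_attains_inf[OF K(1) False] by blast
    obtain y where y: "y \<in> K" "\<And>z. z \<in> K \<Longrightarrow> z \<le> y" using compact_attains_sup[OF K(1) False] by blast
    show ?thesis
    proof (rule that[of "x / 2" "(y + T) / 2"])
      show "0 < x / 2" "x / 2 < (y + T) / 2" "(y + T) / 2 < T"
        using x(1) y(1) x(2)[OF y(1)] K(2) T_pos by auto
      show "\<eta> t = 0" if "t \<le> x / 2" for t
        using that x(1) K(2) x(2)[of t] by (intro K(3)) auto
      show "\<eta> t = 0" if "(y + T) / 2 \<le> t" for t
        using that y(1) K(2) y(2)[of t] by (intro K(3)) auto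
    qed
  qed
  have c: "continuous_on S \<eta>" for S by (rule smooth_continuous_on[OF C0inf_smooth[OF \<eta>]])
  \<comment> \<open>The primitive from 0, which is then subtracted from its final value.\<close>
  define \<Theta> where "\<Theta> = (\<lambda>t. integral {0..t} \<eta>)"
  have d\<Theta>: "(\<Theta> has_real_derivative \<eta> t) (at t)" for t
  proof (cases "t < a")
    case True
    have z: "\<Theta> s = 0" if "s < a" for s
    proof -
      have "\<Theta> s = integral {0..s} (\<lambda>x. 0)"
        unfolding \<Theta>_def using that ab(4) by (intro integral_cong) auto
      then show ?thesis by simp
    qed
    have "((\<lambda>s. 0) has_real_derivative \<eta> t) (at t)"
      using ab(4)[of t] True by simp
    then show ?thesis
      by (rule has_field_derivative_transform_within_open[where S = "{..<a}"]) (use True z in auto)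
  next
    case False
    have "(\<Theta> has_vector_derivative \<eta> t) (at t within {0..t + 1})"
      unfolding \<Theta>_def using False ab by (intro integral_has_vector_derivative c) auto
    then show ?thesis
      using False ab by (simp add: at_within_Icc_at has_real_derivative_iff_has_vector_derivative)
  qed
  define \<theta> where "\<theta> = (\<lambda>t. \<Theta> T - \<Theta> t)"
  have d\<theta>: "(\<theta> has_real_derivative - \<eta> t) (at t)" for t
    unfolding \<theta>_def using d\<Theta>[of t] by (auto intro!: derivative_eq_intros)
  have split: "\<theta> t = integral {t..T} \<eta>" if "0 \<le> t" "t \<le> T" for t
    using Henstock_Kurzweil_Integration.integral_combine[OF that integrable_continuous_interval[OF c]]
    by (simp add: \<theta>_def \<Theta>_def)
  have zero: "\<theta> t = 0" if "b \<le> t" for t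
  proof -
    have const: "\<Theta> x = \<Theta> b" if bx: "b < x" for x
    proof -
      obtain z where "b < z" "\<Theta> x - \<Theta> b = (x - b) * \<eta> z"
        using MVT2[OF bx, of \<Theta> \<eta>] d\<Theta> by blast
      then show ?thesis using ab(5)[of z] by simp
    qed
    show ?thesis
      using const[OF ab(3)] const[of t] that by (cases "t = b") (auto simp: \<theta>_def)
  qed
  have "smooth \<theta>"
  proof (rule smoothI_derivative)
    show "(\<theta> has_derivative (\<lambda>h. - \<eta> t * h)) (at t)" for t
      using d\<theta>[of t] unfolding has_field_derivative_def .
    show "smooth (\<lambda>t. - \<eta> t * h)" for h
      by (intro smooth_mult smooth_minus smooth_const C0inf_smooth[OF \<eta>])
  qed
  then show ?thesis
  proof (rule that[OF _ d\<theta> ab(3) zero])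
    show "\<theta> t = (\<integral>s. (if t < s then 1 else 0) * \<eta> s \<partial>J)" if "t \<in> {0<..<T}" for t
      using split[of t] integral_J_eq[OF c, of t] that by simp
  qed
qed

text \<open>
  Both sides integrate \<open>\<eta> s * \<beta> t\<close> over the triangle where \<open>t < s\<close>.
\<close>

lemma Fubini_triangle:
  fixes \<beta> \<eta> :: "real \<Rightarrow> real"
  assumes \<beta>: "integrable J \<beta>" and \<eta>: "\<eta> \<in> borel_measurable J" "\<And>s. \<bar>\<eta> s\<bar> \<le> B"
  shows "(\<integral>t. (\<integral>s. (if t < s then 1 else 0) * \<eta> s \<partial>J) * \<beta> t \<partial>J) =
    (\<integral>s. (\<integral>t. (if t < s then 1 else 0) * \<beta> t \<partial>J) * \<eta> s \<partial>J)"
proof -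
  interpret P: pair_sigma_finite J J ..
  have [measurable]: "\<beta> \<in> borel_measurable J" using \<beta> by auto
  note [measurable] = \<eta>(1)
  have B: "0 \<le> B" using order_trans[OF abs_ge_zero \<eta>(2)] .
  define f where "f = (\<lambda>z. (if fst z < snd z then 1 else 0) * \<eta> (snd z) * \<beta> (fst z))"
  have "integrable (J \<Otimes>\<^sub>M J) f"
  proof (rule P.Fubini_integrable)
    show m: "f \<in> borel_measurable (J \<Otimes>\<^sub>M J)" unfolding f_def by measurable
    have le: "norm (f (t, s)) \<le> B * \<bar>\<beta> t\<bar>" for t s
      using \<eta>(2)[of s] B by (auto simp: f_def abs_mult intro!: mult_right_mono)
    have m2: "(\<lambda>s. f (t, s)) \<in> borel_measurable J" if "t \<in> space J" for t
      using measurable_compose[OF measurable_Pair1'[OF that] m] by simp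
    have i2: "integrable J (\<lambda>s. f (t, s))" if "t \<in> space J" for t
      by (rule J.integrable_const_bound[of _ "B * \<bar>\<beta> t\<bar>"]) (use le m2[OF that] in auto)
    then show "AE t in J. integrable J (\<lambda>s. f (t, s))" by auto
    show "integrable J (\<lambda>t. \<integral>s. norm (f (t, s)) \<partial>J)"
    proof (rule Bochner_Integration.integrable_bound)
      show "integrable J (\<lambda>t. B * \<bar>\<beta> t\<bar> * measure J (space J))"
        using \<beta> by simp
      show "(\<lambda>t. \<integral>s. norm (f (t, s)) \<partial>J) \<in> borel_measurable J"
        using m by measurable
      show "AE t in J. norm (\<integral>s. norm (f (t, s)) \<partial>J) \<le> norm (B * \<bar>\<beta> t\<bar> * measure J (space J))"
      proof (rule AE_I2)
        fix t assume t: "t \<in> space J"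
        have "(\<integral>s. norm (f (t, s)) \<partial>J) \<le> (\<integral>s. B * \<bar>\<beta> t\<bar> \<partial>J)"
          by (intro integral_mono integrable_norm i2 t le) simp
        then show "norm (\<integral>s. norm (f (t, s)) \<partial>J) \<le> norm (B * \<bar>\<beta> t\<bar> * measure J (space J))"
          using B by (simp add: mult_ac)
      qed
    qed
  qed
  then have "integrable (J \<Otimes>\<^sub>M J) (\<lambda>(t, s). f (t, s))"
    by (simp add: case_prod_beta')
  from P.Fubini_integral[OF this]
  have "(\<integral>s. (\<integral>t. f (t, s) \<partial>J) \<partial>J) = (\<integral>t. (\<integral>s. f (t, s) \<partial>J) \<partial>J)" .
  moreover have "(\<integral>s. f (t, s) \<partial>J) = (\<integral>s. (if t < s then 1 else 0) * \<eta> s \<partial>J) * \<beta> t" for t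
    unfolding f_def fst_conv snd_conv by (rule integral_mult_left_zero)
  moreover have "(\<integral>t. f (t, s) \<partial>J) = (\<integral>t. (if t < s then 1 else 0) * \<beta> t \<partial>J) * \<eta> s" for s
  proof -
    have "f (t, s) = (if t < s then 1 else 0) * \<beta> t * \<eta> s" for t by (simp add: f_def)
    then show ?thesis by (simp only: integral_mult_left_zero)
  qed
  ultimately show ?thesis by simp
qed

lemma integrable_if:
  fixes \<beta> :: "real \<Rightarrow> real"
  assumes \<beta>: "integrable J \<beta>"
  shows "integrable J (\<lambda>s. (if s < t then 1 else 0) * \<beta> s)"
proof (rule Bochner_Integration.integrable_bound[OF \<beta>])
  have [measurable]: "\<beta> \<in> borel_measurable J" using \<beta> by auto
  show "(\<lambda>s. (if s < t then 1 else 0) * \<beta> s) \<in> borel_measurable J" by measurable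
qed auto

lemma indefinite_integral_measurable:
  fixes \<beta> :: "real \<Rightarrow> real"
  assumes [measurable]: "\<beta> \<in> borel_measurable J"
  shows "(\<lambda>s. \<integral>t. (if t < s then 1 else 0) * \<beta> t \<partial>J) \<in> borel_measurable J"
proof -
  have "(\<lambda>z. (if snd z < fst z then 1 else 0) * \<beta> (snd z)) \<in> borel_measurable (J \<Otimes>\<^sub>M J)"
    by measurable
  then have "(\<lambda>(s, t). (if t < s then 1 else 0) * \<beta> t) \<in> borel_measurable (J \<Otimes>\<^sub>M J)"
    by (simp add: case_prod_beta')
  then show ?thesis by (rule J.borel_measurable_lebesgue_integral)
qed

text \<open>
  The first hypothesis says that \<open>\<beta>\<close> is the weak derivative of \<open>b\<close>, the second one that \<open>- N\<close> is,
  and in addition that \<open>b\<close> starts from 0, since its test functions need not vanish at time 0. The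
  representation of \<open>b\<close> follows by inserting the backward primitive of an arbitrary test function into
  the second hypothesis.
\<close>

lemma du_Bois_Reymond:
  assumes b: "integrable J b" and \<beta>: "integrable J \<beta>" and N: "integrable J N"
    and H1: "\<And>\<theta> \<theta>'. \<theta> \<in> C0inf {0<..<T} \<Longrightarrow> (\<And>t. (\<theta> has_real_derivative \<theta>' t) (at t)) \<Longrightarrow>
      (\<integral>t. \<theta>' t * b t \<partial>J) = - (\<integral>t. \<theta> t * \<beta> t \<partial>J)"
    and H2: "\<And>\<theta> \<theta>' c. smooth \<theta> \<Longrightarrow> (\<And>t. (\<theta> has_real_derivative \<theta>' t) (at t)) \<Longrightarrow> c < T \<Longrightarrow>
      (\<And>t. c \<le> t \<Longrightarrow> \<theta> t = 0) \<Longrightarrow> (\<integral>t. \<theta>' t * b t \<partial>J) = (\<integral>t. \<theta> t * N t \<partial>J)"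
  shows "AE t in J. \<beta> t + N t = 0"
    and "AE t in J. b t = (\<integral>s. (if s < t then 1 else 0) * \<beta> s \<partial>J)"
proof -
  have int_mult: "integrable J (\<lambda>t. \<phi> t * f t)" if "integrable J f" "\<phi> \<in> C0inf {0<..<T}" for f \<phi> :: "real \<Rightarrow> real"
  proof -
    have "integrable J (\<lambda>t. f t * \<phi> t)"
      using that absolutely_integrable_compact_J by (intro integrable_mult_C0inf) auto
    then show ?thesis by (simp only: mult.commute)
  qed
  show eq: "AE t in J. \<beta> t + N t = 0"
  proof (rule fundamental_lemma_J)
    show "integrable J (\<lambda>t. \<beta> t + N t)" using \<beta> N by simp
    fix \<phi> :: "real \<Rightarrow> real" assume \<phi>: "\<phi> \<in> C0inf {0<..<T}"
    obtain K where K: "compact K" "K \<subseteq> {0<..<T}" "\<And>t. t \<notin> K \<Longrightarrow> \<phi> t = 0"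
      using C0infE[OF \<phi>] by blast
    obtain c where c: "c < T" "\<And>t. c \<le> t \<Longrightarrow> \<phi> t = 0"
    proof (cases "K = {}")
      case True
      then show ?thesis using K(3) T_pos by (intro that[of 0]) auto
    next
      case False
      obtain y where y: "y \<in> K" "\<And>z. z \<in> K \<Longrightarrow> z \<le> y" using compact_attains_sup[OF K(1) False] by blast
      have "\<phi> t = 0" if "(y + T) / 2 \<le> t" for t
        using that y(1) K(2) y(2)[of t] by (intro K(3)) auto
      moreover have "(y + T) / 2 < T" using y(1) K(2) by auto
      ultimately show ?thesis using that by blast
    qed
    define \<phi>' where "\<phi>' = (\<lambda>t. frechet_derivative \<phi> (at t) 1)"
    have d: "(\<phi> has_real_derivative \<phi>' t) (at t)" for t
    proof -
      note D = smooth_has_derivative[OF C0inf_smooth[OF \<phi>], of t]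
      have "frechet_derivative \<phi> (at t) = (*) (\<phi>' t)"
      proof
        fix h show "frechet_derivative \<phi> (at t) h = \<phi>' t * h"
          using linear_scale[OF has_derivative_linear[OF D], of h 1] by (simp add: \<phi>'_def mult.commute)
      qed
      with D show ?thesis by (simp add: has_field_derivative_def)
    qed
    have "(\<integral>t. \<phi> t * N t \<partial>J) = - (\<integral>t. \<phi> t * \<beta> t \<partial>J)"
      using H1[OF \<phi> d] H2[OF C0inf_smooth[OF \<phi>] d c] by simp
    moreover have "(\<integral>t. (\<beta> t + N t) * \<phi> t \<partial>J) = (\<integral>t. \<phi> t * \<beta> t + \<phi> t * N t \<partial>J)"
      by (simp add: algebra_simps)
    ultimately show "(\<integral>t. (\<beta> t + N t) * \<phi> t \<partial>J) = 0"
      using int_mult[OF \<beta> \<phi>] int_mult[OF N \<phi>] by simp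
  qed
  define B where "B = (\<lambda>s. \<integral>t. (if t < s then 1 else 0) * \<beta> t \<partial>J)"
  have \<beta>m[measurable]: "\<beta> \<in> borel_measurable J" using \<beta> by auto
  have Bm: "B \<in> borel_measurable J" unfolding B_def by (rule indefinite_integral_measurable[OF \<beta>m])
  have Ble: "\<bar>B s\<bar> \<le> (\<integral>t. \<bar>\<beta> t\<bar> \<partial>J)" for s
  proof -
    have "\<bar>B s\<bar> \<le> (\<integral>t. \<bar>(if t < s then 1 else 0) * \<beta> t\<bar> \<partial>J)"
      unfolding B_def by (rule integral_abs_bound)
    also have "\<dots> \<le> (\<integral>t. \<bar>\<beta> t\<bar> \<partial>J)"
      by (intro integral_mono integrable_abs integrable_if \<beta>) auto
    finally show ?thesis .
  qed
  have Bi: "integrable J B"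
    by (rule J.integrable_const_bound[of _ "\<integral>t. \<bar>\<beta> t\<bar> \<partial>J"]) (use Ble Bm in auto)
  have "AE t in J. b t - B t = 0"
  proof (rule fundamental_lemma_J)
    show "integrable J (\<lambda>t. b t - B t)" using b Bi by simp
    fix \<eta> :: "real \<Rightarrow> real" assume \<eta>: "\<eta> \<in> C0inf {0<..<T}"
    obtain \<theta> c where \<theta>: "smooth \<theta>" "\<And>t. (\<theta> has_real_derivative - \<eta> t) (at t)" "c < T" "\<And>t. c \<le> t \<Longrightarrow> \<theta> t = 0"
      "\<And>t. t \<in> {0<..<T} \<Longrightarrow> \<theta> t = (\<integral>s. (if t < s then 1 else 0) * \<eta> s \<partial>J)"
      using backward_primitive[OF \<eta>] by blast
    obtain C where C: "\<And>t. norm (\<eta> t) \<le> C" using C0inf_bounded[OF \<eta>] by blast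
    have \<eta>m: "\<eta> \<in> borel_measurable J"
      by (intro continuous_imp_measurable_on_sets_lebesgue smooth_continuous_on C0inf_smooth[OF \<eta>]) auto
    have "- (\<integral>t. \<eta> t * b t \<partial>J) = (\<integral>t. \<theta> t * N t \<partial>J)"
      using H2[OF \<theta>(1,2,3,4)] by simp
    also have "\<dots> = (\<integral>t. - ((\<integral>s. (if t < s then 1 else 0) * \<eta> s \<partial>J) * \<beta> t) \<partial>J)"
    proof (rule integral_cong_AE)
      have \<theta>m: "\<theta> \<in> borel_measurable J"
        by (intro continuous_imp_measurable_on_sets_lebesgue smooth_continuous_on \<theta>(1)) auto
      have "N \<in> borel_measurable J" using N by auto
      with \<theta>m show "(\<lambda>t. \<theta> t * N t) \<in> borel_measurable J" by measurable
      have "(\<lambda>t. - (\<theta> t * \<beta> t)) \<in> borel_measurable J" using \<theta>m by measurable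
      then show "(\<lambda>t. - ((\<integral>s. (if t < s then 1 else 0) * \<eta> s \<partial>J) * \<beta> t)) \<in> borel_measurable J"
        by (subst measurable_cong[where g = "\<lambda>t. - (\<theta> t * \<beta> t)"]) (use \<theta>(5) in auto)
      have sp: "AE t in J. t \<in> {0<..<T}" by (rule AE_I2) simp
      show "AE t in J. \<theta> t * N t = - ((\<integral>s. (if t < s then 1 else 0) * \<eta> s \<partial>J) * \<beta> t)"
        using eq sp
      proof eventually_elim
        case (elim t)
        then have "N t = - \<beta> t" by simp
        then show ?case using \<theta>(5)[OF elim(2)] by simp
      qed
    qed
    also have "\<dots> = - (\<integral>s. B s * \<eta> s \<partial>J)"
      using Fubini_triangle[OF \<beta> \<eta>m, of C] C by (simp add: B_def)
    finally have "(\<integral>t. \<eta> t * b t \<partial>J) = (\<integral>s. \<eta> s * B s \<partial>J)" by (simp add: mult.commute)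
    moreover have "(\<integral>t. (b t - B t) * \<eta> t \<partial>J) = (\<integral>t. \<eta> t * b t - \<eta> t * B t \<partial>J)"
      by (simp add: algebra_simps)
    ultimately show "(\<integral>t. (b t - B t) * \<eta> t \<partial>J) = 0"
      using int_mult[OF b \<eta>] int_mult[OF Bi \<eta>] by simp
  qed
  then show "AE t in J. b t = (\<integral>s. (if s < t then 1 else 0) * \<beta> s \<partial>J)"
    by eventually_elim (simp add: B_def)
qed

text \<open>
  The square with side \<open>r\<close> consists of two triangles which the reflection \<open>(s, t) \<mapsto> (t, s)\<close> exchanges,
  and the diagonal, a null set.
\<close>

lemma symmetric_square_integral:
  fixes e :: "real \<times> real \<Rightarrow> real"
  assumes e: "e \<in> borel_measurable (J \<Otimes>\<^sub>M J)" and sym: "\<And>s t. e (s, t) = e (t, s)"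
    and h: "integrable J h" and le: "AE s in J. AE t in J. \<bar>e (s, t)\<bar> \<le> h s * h t"
  shows "integrable J (\<lambda>t. \<integral>s. (if s < t then 1 else 0) * e (s, t) \<partial>J)"
    and "(\<integral>t. (if t < r then 1 else 0) * (\<integral>s. (if s < r then 1 else 0) * e (s, t) \<partial>J) \<partial>J) =
      2 * (\<integral>t. (if t < r then 1 else 0) * (\<integral>s. (if s < t then 1 else 0) * e (s, t) \<partial>J) \<partial>J)"
proof -
  interpret P: pair_sigma_finite J J ..
  have hm[measurable]: "h \<in> borel_measurable J" using h by auto
  note [measurable] = e
  have bound: "integrable (J \<Otimes>\<^sub>M J) (\<lambda>z. c z * e z)" if c[measurable]: "c \<in> borel_measurable (J \<Otimes>\<^sub>M J)" and c1: "\<And>z. \<bar>c z\<bar> \<le> 1" for c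
  proof (rule P.Fubini_integrable)
    show m: "(\<lambda>z. c z * e z) \<in> borel_measurable (J \<Otimes>\<^sub>M J)" by measurable
    have le': "AE s in J. AE t in J. norm (c (s, t) * e (s, t)) \<le> h s * h t"
      using le
    proof eventually_elim
      case (elim s)
      then show ?case
      proof eventually_elim
        case (elim t)
        have "norm (c (s, t) * e (s, t)) \<le> \<bar>e (s, t)\<bar>"
          using c1[of "(s, t)"] by (simp add: abs_mult mult_left_le_one_le)
        with elim show ?case by simp
      qed
    qed
    have sp: "AE s in J. s \<in> space J" by (rule AE_I2)
    have m2: "(\<lambda>t. c (s, t) * e (s, t)) \<in> borel_measurable J" if "s \<in> space J" for s
      using measurable_compose[OF measurable_Pair1'[OF that] m] by simp
    show i2: "AE s in J. integrable J (\<lambda>t. c (s, t) * e (s, t))"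
      using le' sp
    proof eventually_elim
      case (elim s)
      show ?case
        by (rule Bochner_Integration.integrable_bound[of J "\<lambda>t. h s * h t"])
           (use h elim m2[of s] in \<open>auto elim!: eventually_mono\<close>)
    qed
    show "integrable J (\<lambda>s. \<integral>t. norm (c (s, t) * e (s, t)) \<partial>J)"
    proof (rule Bochner_Integration.integrable_bound)
      show "integrable J (\<lambda>s. h s * (\<integral>t. h t \<partial>J))" using h by simp
      show "(\<lambda>s. \<integral>t. norm (c (s, t) * e (s, t)) \<partial>J) \<in> borel_measurable J"
        using m by measurable
      show "AE s in J. norm (\<integral>t. norm (c (s, t) * e (s, t)) \<partial>J) \<le> norm (h s * (\<integral>t. h t \<partial>J))"
        using le' i2
      proof eventually_elim
        case (elim s)
        have "(\<integral>t. norm (c (s, t) * e (s, t)) \<partial>J) \<le> (\<integral>t. h s * h t \<partial>J)"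
          by (rule integral_mono_AE[OF integrable_norm[OF elim(2)] _ elim(1)]) (use h in simp)
        moreover have "0 \<le> (\<integral>t. norm (c (s, t) * e (s, t)) \<partial>J)" by simp
        ultimately show ?case by simp
      qed
    qed
  qed
  define c0 where "c0 = (\<lambda>z::real \<times> real. (if fst z < snd z then 1 else 0) :: real)"
  \<comment> \<open>\<open>c1\<close> and \<open>c2\<close> are the indicators of the two triangles of the square with side \<open>r\<close>.\<close>
  define c1 where "c1 = (\<lambda>z::real \<times> real. (if snd z < r then 1 else 0) * (if fst z < snd z then 1 else 0) :: real)"
  define c2 where "c2 = (\<lambda>z::real \<times> real. (if fst z < r then 1 else 0) * (if snd z < fst z then 1 else 0) :: real)"
  have cm[measurable]: "c0 \<in> borel_measurable (J \<Otimes>\<^sub>M J)" "c1 \<in> borel_measurable (J \<Otimes>\<^sub>M J)" "c2 \<in> borel_measurable (J \<Otimes>\<^sub>M J)"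
    unfolding c0_def c1_def c2_def by measurable
  have i0: "integrable (J \<Otimes>\<^sub>M J) (\<lambda>(s, t). c0 (s, t) * e (s, t))"
    and i1: "integrable (J \<Otimes>\<^sub>M J) (\<lambda>(s, t). c1 (s, t) * e (s, t))"
    and i2: "integrable (J \<Otimes>\<^sub>M J) (\<lambda>(s, t). c2 (s, t) * e (s, t))"
    using bound[OF cm(1)] bound[OF cm(2)] bound[OF cm(3)]
    by (simp_all add: case_prod_beta' c0_def c1_def c2_def)
  show "integrable J (\<lambda>t. \<integral>s. (if s < t then 1 else 0) * e (s, t) \<partial>J)"
    using P.integrable_snd[OF i0] by (simp add: c0_def)
  note X1 = P.integral_snd[OF i1]
  note X2 = P.integral_snd[OF i2]
  note X3 = P.integral_fst'[OF i2]
  have "c2 (s, t) * e (s, t) = c1 (t, s) * e (t, s)" for s t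
    using sym[of s t] by (simp add: c1_def c2_def)
  with X1 X2 X3 have X: "(\<integral>t. (\<integral>s. c2 (s, t) * e (s, t) \<partial>J) \<partial>J) = (\<integral>t. (\<integral>s. c1 (s, t) * e (s, t) \<partial>J) \<partial>J)"
    by simp
  have es[measurable]: "(\<lambda>s. e (s, t)) \<in> borel_measurable J" "(\<lambda>s. c1 (s, t)) \<in> borel_measurable J"
    "(\<lambda>s. c2 (s, t)) \<in> borel_measurable J" if "t \<in> space J" for t
    using measurable_compose[OF measurable_Pair2'[OF that] e] measurable_compose[OF measurable_Pair2'[OF that] cm(2)]
      measurable_compose[OF measurable_Pair2'[OF that] cm(3)] by simp_all
  have sp: "AE t in J. t \<in> space J" by (rule AE_I2)
  have AE: "AE t in J. (if t < r then 1 else 0) * (\<integral>s. (if s < r then 1 else 0) * e (s, t) \<partial>J) =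
      (\<integral>s. c1 (s, t) * e (s, t) \<partial>J) + (\<integral>s. c2 (s, t) * e (s, t) \<partial>J)"
    using P.AE_integrable_snd[OF i1] P.AE_integrable_snd[OF i2] sp
  proof eventually_elim
    case (elim t)
    note es[OF elim(3), measurable]
    have "(if t < r then 1 else 0) * (\<integral>s. (if s < r then 1 else 0) * e (s, t) \<partial>J) =
        (\<integral>s. (if t < r then 1 else 0) * ((if s < r then 1 else 0) * e (s, t)) \<partial>J)"
      by simp
    also have "\<dots> = (\<integral>s. c1 (s, t) * e (s, t) + c2 (s, t) * e (s, t) \<partial>J)"
    proof (rule integral_cong_AE)
      show "(\<lambda>s. (if t < r then 1 else 0) * ((if s < r then 1 else 0) * e (s, t))) \<in> borel_measurable J"
        "(\<lambda>s. c1 (s, t) * e (s, t) + c2 (s, t) * e (s, t)) \<in> borel_measurable J"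
        by measurable
      show "AE s in J. (if t < r then 1 else 0) * ((if s < r then 1 else 0) * e (s, t)) =
          c1 (s, t) * e (s, t) + c2 (s, t) * e (s, t)"
        using J_AE_neq[of t] by eventually_elim (auto simp: c1_def c2_def)
    qed
    also have "\<dots> = (\<integral>s. c1 (s, t) * e (s, t) \<partial>J) + (\<integral>s. c2 (s, t) * e (s, t) \<partial>J)"
      using elim by simp
    finally show ?case .
  qed
  have "(\<integral>t. (if t < r then 1 else 0) * (\<integral>s. (if s < r then 1 else 0) * e (s, t) \<partial>J) \<partial>J) =
      (\<integral>t. (\<integral>s. c1 (s, t) * e (s, t) \<partial>J) + (\<integral>s. c2 (s, t) * e (s, t) \<partial>J) \<partial>J)"
  proof (rule integral_cong_AE[OF _ _ AE])
    have "(\<lambda>z. (if snd z < r then 1 else 0) * e z) \<in> borel_measurable (J \<Otimes>\<^sub>M J)" by measurable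
    then have "(\<lambda>(t, s). (if s < r then 1 else 0) * e (s, t)) \<in> borel_measurable (J \<Otimes>\<^sub>M J)"
      by (simp add: case_prod_beta' sym[of "snd _" "fst _"])
    then have [measurable]: "(\<lambda>t. \<integral>s. (if s < r then 1 else 0) * e (s, t) \<partial>J) \<in> borel_measurable J"
      by (rule J.borel_measurable_lebesgue_integral)
    show "(\<lambda>t. (if t < r then 1 else 0) * (\<integral>s. (if s < r then 1 else 0) * e (s, t) \<partial>J)) \<in> borel_measurable J"
      by measurable
    show "(\<lambda>t. (\<integral>s. c1 (s, t) * e (s, t) \<partial>J) + (\<integral>s. c2 (s, t) * e (s, t) \<partial>J)) \<in> borel_measurable J"
      using P.integrable_snd[OF i1] P.integrable_snd[OF i2] by (intro borel_measurable_add) auto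
  qed
  also have "\<dots> = (\<integral>t. (\<integral>s. c1 (s, t) * e (s, t) \<partial>J) \<partial>J) + (\<integral>t. (\<integral>s. c2 (s, t) * e (s, t) \<partial>J) \<partial>J)"
    by (rule Bochner_Integration.integral_add[OF P.integrable_snd[OF i1] P.integrable_snd[OF i2]])
  also have "\<dots> = 2 * (\<integral>t. (\<integral>s. c1 (s, t) * e (s, t) \<partial>J) \<partial>J)"
    unfolding X by simp
  also have "(\<lambda>t. \<integral>s. c1 (s, t) * e (s, t) \<partial>J) =
      (\<lambda>t. (if t < r then 1 else 0) * (\<integral>s. (if s < t then 1 else 0) * e (s, t) \<partial>J))"
    by (simp add: c1_def fun_eq_iff)
  finally show "(\<integral>t. (if t < r then 1 else 0) * (\<integral>s. (if s < r then 1 else 0) * e (s, t) \<partial>J) \<partial>J) =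
      2 * (\<integral>t. (if t < r then 1 else 0) * (\<integral>s. (if s < t then 1 else 0) * e (s, t) \<partial>J) \<partial>J)" .
qed

text \<open>
  Let \<open>\<tau>\<close> be the supremum of the times up to which \<open>E\<close> vanishes. If it were smaller than \<open>T\<close>, the integral
  of \<open>m\<close> over a short interval after \<open>\<tau>\<close> would be at most 1/4. Then every bound for \<open>E\<close> on this interval
  could be halved, and \<open>E\<close> would vanish beyond \<open>\<tau>\<close>.
\<close>

lemma Gronwall_AE:
  fixes m \<beta> E :: "real \<Rightarrow> real"
  assumes m: "integrable J m" "\<And>t. 0 \<le> m t" and \<beta>: "integrable J \<beta>"
    and E: "AE t in J. 0 \<le> E t" "AE t in J. E t \<le> C"
    and le: "AE t in J. \<beta> t \<le> m t * E t"
    and eq: "AE t in J. E t = 2 * (\<integral>s. (if s < t then 1 else 0) * \<beta> s \<partial>J)"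
  shows "AE t in J. E t = 0"
proof -
  define A where "A = {\<tau>. 0 \<le> \<tau> \<and> \<tau> \<le> T \<and> (AE t in J. t < \<tau> \<longrightarrow> E t = 0)}"
  have A0: "0 \<in> A"
    using T_pos by (auto simp: A_def intro!: AE_I2)
  have Abdd: "bdd_above A" by (rule bdd_aboveI[of _ T]) (simp add: A_def)
  define \<tau> where "\<tau> = Sup A"
  have \<tau>: "0 \<le> \<tau>" "\<tau> \<le> T"
  proof -
    show "0 \<le> \<tau>" unfolding \<tau>_def by (rule cSup_upper[OF A0 Abdd])
    show "\<tau> \<le> T" unfolding \<tau>_def
    proof (rule cSup_least)
      show "A \<noteq> {}" using A0 by blast
    qed (simp add: A_def)
  qed
  have \<tau>A: "AE t in J. t < \<tau> \<longrightarrow> E t = 0"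
  proof -
    have "\<forall>k. \<exists>x. x \<in> A \<and> \<tau> - 1 / real (Suc k) < x"
    proof
      fix k
      have "\<tau> - 1 / real (Suc k) < Sup A" by (simp add: \<tau>_def)
      then show "\<exists>x. x \<in> A \<and> \<tau> - 1 / real (Suc k) < x"
        using less_cSup_iff[OF _ Abdd] A0 by blast
    qed
    from choice[OF this] obtain x where x: "\<And>k. x k \<in> A" "\<And>k. \<tau> - 1 / real (Suc k) < x k" by blast
    have "AE t in J. \<forall>k. t < x k \<longrightarrow> E t = 0"
      unfolding AE_all_countable using x(1) by (auto simp: A_def)
    then show ?thesis
    proof eventually_elim
      case (elim t)
      show ?case
      proof
        assume "t < \<tau>"
        then obtain k where "1 / real (Suc k) < \<tau> - t"
          using nat_approx_posE[of "\<tau> - t"] by auto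
        then have "t < x k" using x(2)[of k] by linarith
        with elim show "E t = 0" by blast
      qed
    qed
  qed
  have "\<tau> = T"
  proof (rule ccontr)
    assume "\<tau> \<noteq> T"
    with \<tau> have \<tau>T: "\<tau> < T" by simp
    have [measurable]: "m \<in> borel_measurable J" using m by auto
    have lim: "(\<lambda>k. \<integral>s. (if s < \<tau> + 1 / real (Suc k) then 1 else 0) * ((if \<tau> \<le> s then 1 else 0) * m s) \<partial>J) \<longlonglongrightarrow> (\<integral>s. 0 \<partial>J)"
    proof (rule integral_dominated_convergence[where w = m])
      show "AE s in J. (\<lambda>k. (if s < \<tau> + 1 / real (Suc k) then 1 else 0) * ((if \<tau> \<le> s then 1 else 0) * m s)) \<longlonglongrightarrow> 0"
        using J_AE_neq[of \<tau>]
      proof eventually_elim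
        case (elim s)
        show ?case
        proof (cases "\<tau> \<le> s")
          case True
          with elim have "0 < s - \<tau>" by simp
          then obtain n where n: "1 / real (Suc n) < s - \<tau>"
            using nat_approx_posE[of "s - \<tau>"] by auto
          have "\<forall>\<^sub>F k in sequentially. (if s < \<tau> + 1 / real (Suc k) then 1 else 0) * ((if \<tau> \<le> s then 1 else 0) * m s) = 0"
            unfolding eventually_sequentially
          proof (intro exI[of _ n] allI impI)
            fix k assume "n \<le> k"
            then have "1 / real (Suc k) \<le> 1 / real (Suc n)" by (simp add: frac_le)
            with n show "(if s < \<tau> + 1 / real (Suc k) then 1 else 0) * ((if \<tau> \<le> s then 1 else 0) * m s) = 0" by auto
          qed
          then show ?thesis by (rule tendsto_eventually)
        qed simp
      qed
      show "AE s in J. norm ((if s < \<tau> + 1 / real (Suc k) then 1 else 0) * ((if \<tau> \<le> s then 1 else 0) * m s)) \<le> m s" for k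
        using m(2) by auto
      show "(\<lambda>s. (if s < \<tau> + 1 / real (Suc k) then 1 else 0) * ((if \<tau> \<le> s then 1 else 0) * m s)) \<in> borel_measurable J" for k
        by measurable
    qed (use m in auto)
    then have "\<forall>\<^sub>F k in sequentially. (\<integral>s. (if s < \<tau> + 1 / real (Suc k) then 1 else 0) * ((if \<tau> \<le> s then 1 else 0) * m s) \<partial>J) < 1 / 4"
      by (intro order_tendstoD(2)) auto
    then obtain k where k: "(\<integral>s. (if s < \<tau> + 1 / real (Suc k) then 1 else 0) * ((if \<tau> \<le> s then 1 else 0) * m s) \<partial>J) < 1 / 4"
      by (auto simp: eventually_sequentially)
    define \<tau>' where "\<tau>' = \<tau> + 1 / real (Suc k)"
    define m' where "m' = (\<lambda>s. (if s < \<tau>' then 1 else 0) * ((if \<tau> \<le> s then 1 else 0) * m s))"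
    have m'0: "0 \<le> m' s" for s using m(2) by (simp add: m'_def)
    have m'i: "integrable J m'"
    proof (rule Bochner_Integration.integrable_bound[OF m(1)])
      show "m' \<in> borel_measurable J" unfolding m'_def by measurable
    qed (use m(2) in \<open>auto simp: m'_def\<close>)
    have m'14: "(\<integral>s. m' s \<partial>J) \<le> 1 / 4" using k by (simp add: m'_def \<tau>'_def)
    have step: "AE t in J. t < \<tau>' \<longrightarrow> E t \<le> \<bar>C\<bar> * (1 / 2) ^ n" for n
    proof (induction n)
      case 0
      show ?case using E(2) by eventually_elim auto
    next
      case (Suc n)
      let ?c = "\<bar>C\<bar> * (1 / 2) ^ n"
      have \<beta>le: "AE s in J. (if s < \<tau>' then 1 else 0) * \<beta> s \<le> m' s * ?c"
        using le Suc.IH \<tau>A E(1)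
      proof eventually_elim
        case (elim s)
        show ?case
        proof (cases "s < \<tau>'")
          case True
          with elim have "E s \<le> ?c" by blast
          then have "m s * E s \<le> m s * ?c" using m(2) by (rule mult_left_mono)
          with elim True show ?thesis by (auto simp: m'_def)
        qed (use m'0[of s] in \<open>auto simp: m'_def\<close>)
      qed
      show ?case
        using eq
      proof eventually_elim
        case (elim t)
        show ?case
        proof
          assume t: "t < \<tau>'"
          have "(\<integral>s. (if s < t then 1 else 0) * \<beta> s \<partial>J) \<le> (\<integral>s. m' s * ?c \<partial>J)"
          proof (rule integral_mono_AE)
            show "integrable J (\<lambda>s. (if s < t then 1 else 0) * \<beta> s)" by (rule integrable_if[OF \<beta>])
            show "integrable J (\<lambda>s. m' s * ?c)" using m'i by simp
            show "AE s in J. (if s < t then 1 else 0) * \<beta> s \<le> m' s * ?c"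
              using \<beta>le
            proof eventually_elim
              case (elim s)
              have "0 \<le> m' s * ?c" using m'0 by simp
              with elim t show ?case by (cases "s < t") auto
            qed
          qed
          also have "\<dots> \<le> 1 / 4 * ?c"
            using mult_right_mono[OF m'14, of ?c] by simp
          finally show "E t \<le> \<bar>C\<bar> * (1 / 2) ^ Suc n" using elim by simp
        qed
      qed
    qed
    then have "AE t in J. \<forall>n. t < \<tau>' \<longrightarrow> E t \<le> \<bar>C\<bar> * (1 / 2) ^ n"
      by (subst AE_all_countable) blast
    then have zero: "AE t in J. t < \<tau>' \<longrightarrow> E t = 0"
      using E(1)
    proof eventually_elim
      case (elim t)
      show ?case
      proof
        assume "t < \<tau>'"
        then have "E t \<le> \<bar>C\<bar> * (1 / 2) ^ n" for n using elim by blast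
        moreover have "(\<lambda>n. \<bar>C\<bar> * (1 / 2) ^ n) \<longlonglongrightarrow> \<bar>C\<bar> * 0"
          by (intro tendsto_mult tendsto_const LIMSEQ_realpow_zero) auto
        ultimately have "E t \<le> 0" using LIMSEQ_le_const[of _ 0 "E t"] by auto
        with elim show "E t = 0" by simp
      qed
    qed
    have "min \<tau>' T \<in> A"
      using zero \<tau> T_pos by (auto simp: A_def \<tau>'_def elim: eventually_mono)
    then have "min \<tau>' T \<le> \<tau>" unfolding \<tau>_def by (rule cSup_upper[OF _ Abdd])
    then show False using \<tau>T by (auto simp: \<tau>'_def min_def split: if_splits)
  qed
  have sp: "AE t in J. t < T" by (rule AE_I2) simp
  show ?thesis using \<tau>A sp by eventually_elim (use \<open>\<tau> = T\<close> in auto)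
qed

end

section \<open>Strong measurability\<close>

context time_interval
begin

lemma finite_range_measurable:
  assumes fin: "finite (s ` {0<..<T})" and lev: "\<And>w. {t \<in> {0<..<T}. s t = w} \<in> sets lebesgue"
  shows "(\<lambda>t. F (s t) :: real) \<in> borel_measurable J"
    and "(\<lambda>z. G (s (fst z)) (s (snd z)) :: real) \<in> borel_measurable (J \<Otimes>\<^sub>M J)"
proof -
  let ?A = "s ` {0<..<T}"
  have s: "s \<in> J \<rightarrow>\<^sub>M count_space ?A"
  proof (subst measurable_count_space_eq2[OF fin], intro conjI ballI)
    fix a
    define A where "A = {t \<in> {0<..<T}. s t = a}"
    have "s -` {a} \<inter> space J = A" "A \<subseteq> {0<..<T}" by (auto simp: A_def)
    moreover have "A \<in> sets lebesgue" unfolding A_def by (rule lev)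
    ultimately show "s -` {a} \<inter> space J \<in> sets J"
      by (simp add: sets_restrict_space_iff)
  qed auto
  show "(\<lambda>t. F (s t)) \<in> borel_measurable J"
    by (rule measurable_compose[OF s]) simp
  have "(\<lambda>z. (s (fst z), s (snd z))) \<in> J \<Otimes>\<^sub>M J \<rightarrow>\<^sub>M count_space ?A \<Otimes>\<^sub>M count_space ?A"
    by (intro measurable_Pair measurable_compose[OF measurable_fst s] measurable_compose[OF measurable_snd s])
  then have "(\<lambda>z. (s (fst z), s (snd z))) \<in> J \<Otimes>\<^sub>M J \<rightarrow>\<^sub>M count_space (?A \<times> ?A)"
    by (simp only: pair_measure_count_space[OF fin fin])
  from measurable_compose[OF this, of "\<lambda>y. G (fst y) (snd y)" borel]
  show "(\<lambda>z. G (s (fst z)) (s (snd z))) \<in> borel_measurable (J \<Otimes>\<^sub>M J)" by simp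
qed

text \<open>
  Strongly measurable functions take values in a seminormed space without a measurable structure of
  its own, hence measurability is transported from the simple functions through the limit.
\<close>

lemma strongly_measurable_comp:
  assumes sm: "strongly_measurable T X N u" and X: "AE t in J. u t \<in> X"
    and cont: "\<And>a as. a \<in> X \<Longrightarrow> (\<And>k. as k \<in> X) \<Longrightarrow> (\<lambda>k. N (as k - a)) \<longlonglongrightarrow> 0 \<Longrightarrow> (\<lambda>k. F (as k)) \<longlonglongrightarrow> F a"
  shows "(\<lambda>t. F (u t) :: real) \<in> borel_measurable J"
proof -
  obtain s where s: "\<And>k. finite (s k ` {0<..<T})" "\<And>k. s k ` {0<..<T} \<subseteq> X"
    "\<And>k w. {t \<in> {0<..<T}. s k t = w} \<in> sets lebesgue"
    "AE t in J. (\<lambda>k. N (s k t - u t)) \<longlonglongrightarrow> 0"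
    using sm unfolding strongly_measurable_def by blast
  have m: "(\<lambda>t. lim (\<lambda>k. F (s k t))) \<in> borel_measurable J"
    by (intro borel_measurable_lim_metric finite_range_measurable s)
  have sp: "AE t in J. t \<in> {0<..<T}" by (rule AE_I2) simp
  have eq: "AE t in J. F (u t) = lim (\<lambda>k. F (s k t))"
    using s(4) X sp
  proof eventually_elim
    case (elim t)
    have "s k t \<in> X" for k using s(2) elim(3) by blast
    with elim have "(\<lambda>k. F (s k t)) \<longlonglongrightarrow> F (u t)"
      by (intro cont) auto
    then show ?case by (simp add: limI)
  qed
  show ?thesis
    by (rule borel_measurable_lebesgue_on_AE[OF _ m eq]) simp
qed

text \<open>
  The function \<open>F (u s) (u t)\<close> need not be jointly measurable, because \<open>u\<close> is arbitrary on a null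
  set and the product of complete measures is in general not complete. The limit of the simple functions
  is a jointly measurable version of it, which inherits the symmetry.
\<close>

lemma strongly_measurable_comp2:
  assumes sm: "strongly_measurable T X N u" and X: "AE t in J. u t \<in> X"
    and cont: "\<And>a b as bs. a \<in> X \<Longrightarrow> b \<in> X \<Longrightarrow> (\<And>k. as k \<in> X) \<Longrightarrow> (\<And>k. bs k \<in> X) \<Longrightarrow>
      (\<lambda>k. N (as k - a)) \<longlonglongrightarrow> 0 \<Longrightarrow> (\<lambda>k. N (bs k - b)) \<longlonglongrightarrow> 0 \<Longrightarrow> (\<lambda>k. F (as k) (bs k)) \<longlonglongrightarrow> F a b"
    and sym: "\<And>a b. F a b = F b a"
  shows "\<exists>e. e \<in> borel_measurable (J \<Otimes>\<^sub>M J) \<and> (\<forall>s t. e (s, t) = e (t, s)) \<and>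
    (AE s in J. AE t in J. e (s, t) = (F (u s) (u t) :: real))"
proof -
  obtain s where s: "\<And>k. finite (s k ` {0<..<T})" "\<And>k. s k ` {0<..<T} \<subseteq> X"
    "\<And>k w. {t \<in> {0<..<T}. s k t = w} \<in> sets lebesgue"
    "AE t in J. (\<lambda>k. N (s k t - u t)) \<longlonglongrightarrow> 0"
    using sm unfolding strongly_measurable_def by blast
  define e where "e = (\<lambda>z. lim (\<lambda>k. F (s k (fst z)) (s k (snd z))))"
  have "e \<in> borel_measurable (J \<Otimes>\<^sub>M J)"
    unfolding e_def by (intro borel_measurable_lim_metric finite_range_measurable s)
  moreover have "e (x, y) = e (y, x)" for x y
    unfolding e_def by (subst sym) simp
  moreover have good: "AE t in J. (\<lambda>k. N (s k t - u t)) \<longlonglongrightarrow> 0 \<and> u t \<in> X \<and> t \<in> {0<..<T}"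
    using s(4) X by (auto intro: AE_I2)
  have "AE x in J. AE y in J. e (x, y) = F (u x) (u y)"
    using good
  proof eventually_elim
    case x: (elim x)
    show ?case
      using good
    proof eventually_elim
      case y: (elim y)
      have "s k x \<in> X" "s k y \<in> X" for k using s(2) x y by blast+
      with x y have "(\<lambda>k. F (s k x) (s k y)) \<longlonglongrightarrow> F (u x) (u y)"
        by (intro cont) auto
      then show ?case by (simp add: limI e_def)
    qed
  qed
  ultimately show ?thesis by blast
qed

lemma strongly_measurable_diff:
  assumes u: "strongly_measurable T X N u" "AE t in J. u t \<in> X"
    and w: "strongly_measurable T X N w" "AE t in J. w t \<in> X"
    and X: "\<And>a b. a \<in> X \<Longrightarrow> b \<in> X \<Longrightarrow> a - b \<in> X"
    and cont: "\<And>a b as bs. a \<in> X \<Longrightarrow> b \<in> X \<Longrightarrow> (\<And>k. as k \<in> X) \<Longrightarrow> (\<And>k. bs k \<in> X) \<Longrightarrow>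
      (\<lambda>k. N (as k - a)) \<longlonglongrightarrow> 0 \<Longrightarrow> (\<lambda>k. N (bs k - b)) \<longlonglongrightarrow> 0 \<Longrightarrow> (\<lambda>k. N ((as k - bs k) - (a - b))) \<longlonglongrightarrow> 0"
  shows "strongly_measurable T X N (\<lambda>t. u t - w t)"
proof -
  obtain s where s: "\<And>k. finite (s k ` {0<..<T})" "\<And>k. s k ` {0<..<T} \<subseteq> X"
    "\<And>k w. {t \<in> {0<..<T}. s k t = w} \<in> sets lebesgue" "AE t in J. (\<lambda>k. N (s k t - u t)) \<longlonglongrightarrow> 0"
    using u(1) unfolding strongly_measurable_def by blast
  obtain r where r: "\<And>k. finite (r k ` {0<..<T})" "\<And>k. r k ` {0<..<T} \<subseteq> X"
    "\<And>k w. {t \<in> {0<..<T}. r k t = w} \<in> sets lebesgue" "AE t in J. (\<lambda>k. N (r k t - w t)) \<longlonglongrightarrow> 0"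
    using w(1) unfolding strongly_measurable_def by blast
  show ?thesis
    unfolding strongly_measurable_def
  proof (intro exI[of _ "\<lambda>k t. s k t - r k t"] conjI allI)
    fix k
    let ?S = "s k ` {0<..<T}" and ?R = "r k ` {0<..<T}"
    have sub: "(\<lambda>t. s k t - r k t) ` {0<..<T} \<subseteq> (\<lambda>(a, b). a - b) ` (?S \<times> ?R)" by force
    show "finite ((\<lambda>t. s k t - r k t) ` {0<..<T})"
      by (rule finite_subset[OF sub]) (intro finite_imageI finite_cartesian_product s r)
    show "(\<lambda>t. s k t - r k t) ` {0<..<T} \<subseteq> X"
      using s(2) r(2) X by blast
    fix c
    have "{t \<in> {0<..<T}. s k t - r k t = c} =
        (\<Union>a\<in>?S. \<Union>b\<in>?R. if a - b = c then {t \<in> {0<..<T}. s k t = a} \<inter> {t \<in> {0<..<T}. r k t = b} else {})"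
      by (auto split: if_splits)
    also have "\<dots> \<in> sets lebesgue"
    proof (intro sets.finite_UN s(1) r(1))
      fix a b
      show "(if a - b = c then {t \<in> {0<..<T}. s k t = a} \<inter> {t \<in> {0<..<T}. r k t = b} else {}) \<in> sets lebesgue"
        using sets.Int[OF s(3)[of k a] r(3)[of k b]] by (cases "a - b = c") (simp_all only: simp_thms if_True if_False sets.empty_sets)
    qed
    finally show "{t \<in> {0<..<T}. s k t - r k t = c} \<in> sets lebesgue" .
  next
    have sp: "AE t in J. t \<in> {0<..<T}" by (rule AE_I2) simp
    show "AE t in J. (\<lambda>k. N (s k t - r k t - (u t - w t))) \<longlonglongrightarrow> 0"
      using s(4) r(4) u(2) w(2) sp
    proof eventually_elim
      case (elim t)
      have "s k t \<in> X" "r k t \<in> X" for k using s(2) r(2) elim by blast+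
      with elim show ?case by (intro cont) auto
    qed
  qed
qed

end

section \<open>Energy form and countable families of test functions\<close>

text \<open>
  The assumption \<open>critical\<close> is the common consequence of the two sets of hypotheses on \<open>p\<close> and the
  dimension that the estimate of the convective term needs.
\<close>

locale nsv = bounded_open \<Omega> + time_interval T for \<Omega> :: "(real^'n) set" and T :: real +
  fixes p \<nu> \<kappa> :: real
  assumes dim: "2 \<le> CARD('n)" and \<nu>_pos: "0 < \<nu>" and \<kappa>_pos: "0 < \<kappa>" and p_gt_1: "1 < p"
    and critical: "CARD('n) \<le> 4 \<or> real CARD('n) \<le> 2 * p"
begin

lemma p_pos: "0 < p" using p_gt_1 by simp

text \<open>
  The family \<open>P\<close> approximates \<open>a\<close> with respect to the gradients in $L^q$. It
  is used for countable families, which take the place of the test functions.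
\<close>

definition near :: "real \<Rightarrow> (real^'n \<Rightarrow> real^'n) set \<Rightarrow> (real^'n \<Rightarrow> real^'n) \<Rightarrow> bool" where
  "near q P a \<longleftrightarrow> (\<exists>\<psi>. (\<forall>k::nat. \<psi> k \<in> P) \<and>
    (\<lambda>k. pint q (\<lambda>x. grad a x - jacobian (\<psi> k) (at x))) \<longlonglongrightarrow> 0)"

lemma grad_jac_diff_Lp:
  "a \<in> Vp q \<Omega> \<Longrightarrow> \<psi> \<in> C0inf \<Omega> \<Longrightarrow> 0 < q \<Longrightarrow> (\<lambda>x. grad a x - jacobian \<psi> (at x)) \<in> Lp q \<Omega>"
  by (intro Lp_diff Vp_Lp(2) jacobian_C0inf(3))

lemma near_lower_exponent:
  assumes a: "a \<in> Vp r \<Omega>" and P: "P \<subseteq> C0inf \<Omega>" and near: "near r P a" and q: "0 < q" "q \<le> r"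
  shows "near q P a"
proof -
  obtain \<psi> where \<psi>: "\<And>k. \<psi> k \<in> P" "(\<lambda>k. pint r (\<lambda>x. grad a x - jacobian (\<psi> k) (at x))) \<longlonglongrightarrow> 0"
    using near unfolding near_def by blast
  have "(\<lambda>k. pint q (\<lambda>x. grad a x - jacobian (\<psi> k) (at x))) \<longlonglongrightarrow> 0"
    using \<psi>(1) P q by (intro pint_tendsto_embedding[OF _ \<psi>(2) q] grad_jac_diff_Lp a) auto
  with \<psi>(1) show ?thesis unfolding near_def by blast
qed

lemma near_diff:
  assumes a: "a \<in> Vp q \<Omega>" and b: "b \<in> Vp q \<Omega>" and P: "P \<subseteq> C0inf \<Omega>" "Q \<subseteq> C0inf \<Omega>"
    and near: "near q P a" "near q Q b" and q: "0 < q"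
  shows "near q ((\<lambda>(\<phi>, \<psi>) x. \<phi> x - \<psi> x) ` (P \<times> Q)) (\<lambda>x. a x - b x)"
proof -
  obtain \<phi> where \<phi>: "\<And>k. \<phi> k \<in> P" "(\<lambda>k. pint q (\<lambda>x. grad a x - jacobian (\<phi> k) (at x))) \<longlonglongrightarrow> 0"
    using near(1) unfolding near_def by blast
  obtain \<psi> where \<psi>: "\<And>k. \<psi> k \<in> Q" "(\<lambda>k. pint q (\<lambda>x. grad b x - jacobian (\<psi> k) (at x))) \<longlonglongrightarrow> 0"
    using near(2) unfolding near_def by blast
  have C: "\<phi> k \<in> C0inf \<Omega>" "\<psi> k \<in> C0inf \<Omega>" for k using \<phi>(1) \<psi>(1) P by auto
  let ?d = "\<lambda>k x. (grad a x - jacobian (\<phi> k) (at x)) - (grad b x - jacobian (\<psi> k) (at x))"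
  have le: "pint q (?d k) \<le> 2 powr q * (pint q (\<lambda>x. grad a x - jacobian (\<phi> k) (at x)) + pint q (\<lambda>x. grad b x - jacobian (\<psi> k) (at x)))" for k
    by (intro Lp_diff(2) grad_jac_diff_Lp a b C q)
  have eq: "pint q (\<lambda>x. grad (\<lambda>x. a x - b x) x - jacobian (\<lambda>x. \<phi> k x - \<psi> k x) (at x)) = pint q (?d k)" for k
  proof (rule pint_cong_AE)
    note W = Vp_W1p[OF a] Vp_W1p[OF b]
    show "AE x in M. grad (\<lambda>x. a x - b x) x - jacobian (\<lambda>x. \<phi> k x - \<psi> k x) (at x) = ?d k x"
      using grad_diff[OF grad_in_Lp(2)[OF W(1)] grad_in_Lp(2)[OF W(2)]]
      by eventually_elim (simp add: jacobian_diff C0inf_smooth[OF C(1)] C0inf_smooth[OF C(2)])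
    show "(\<lambda>x. grad (\<lambda>x. a x - b x) x - jacobian (\<lambda>x. \<phi> k x - \<psi> k x) (at x)) \<in> borel_measurable M"
      by (rule LpD(1)[OF grad_jac_diff_Lp[OF Vp_diff[OF a b q] C0inf_diff[OF C] q]])
    show "?d k \<in> borel_measurable M"
      by (rule LpD(1)[OF Lp_diff(1)[OF grad_jac_diff_Lp[OF a C(1) q] grad_jac_diff_Lp[OF b C(2) q] q]])
  qed
  have "(\<lambda>k. 2 powr q * (pint q (\<lambda>x. grad a x - jacobian (\<phi> k) (at x)) + pint q (\<lambda>x. grad b x - jacobian (\<psi> k) (at x)))) \<longlonglongrightarrow> 2 powr q * (0 + 0)"
    by (intro tendsto_mult tendsto_const tendsto_add \<phi> \<psi>)
  then have y: "(\<lambda>k. 2 powr q * (pint q (\<lambda>x. grad a x - jacobian (\<phi> k) (at x)) + pint q (\<lambda>x. grad b x - jacobian (\<psi> k) (at x)))) \<longlonglongrightarrow> 0"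
    by simp
  have "(\<lambda>k. pint q (?d k)) \<longlonglongrightarrow> 0"
  proof (rule tendsto_sandwich[OF _ _ tendsto_const y])
    show "\<forall>\<^sub>F k in sequentially. 0 \<le> pint q (?d k)" by simp
    show "\<forall>\<^sub>F k in sequentially. pint q (?d k) \<le> 2 powr q * (pint q (\<lambda>x. grad a x - jacobian (\<phi> k) (at x)) + pint q (\<lambda>x. grad b x - jacobian (\<psi> k) (at x)))"
      by (intro always_eventually allI le)
  qed
  then have lim: "(\<lambda>k. pint q (\<lambda>x. grad (\<lambda>x. a x - b x) x - jacobian (\<lambda>x. \<phi> k x - \<psi> k x) (at x))) \<longlonglongrightarrow> 0"
    unfolding eq .
  show ?thesis
    unfolding near_def
  proof (intro exI[of _ "\<lambda>k x. \<phi> k x - \<psi> k x"] conjI allI lim)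
    fix k show "(\<lambda>x. \<phi> k x - \<psi> k x) \<in> (\<lambda>(\<phi>, \<psi>) x. \<phi> x - \<psi> x) ` (P \<times> Q)"
      using \<phi>(1)[of k] \<psi>(1)[of k] by (intro image_eqI[of _ _ "(\<phi> k, \<psi> k)"]) auto
  qed
qed

text \<open>
  The simple functions of a strongly measurable function have countably many values altogether,
  and each of them is a limit of a sequence of test functions.
\<close>

lemma countable_tests:
  assumes sm: "strongly_measurable T (Vp q \<Omega>) N u" and X: "AE t in J. u t \<in> Vp q \<Omega>" and q: "0 < q"
    and N: "\<And>a. 0 \<le> N a" "\<And>a b. a \<in> Vp q \<Omega> \<Longrightarrow> b \<in> Vp q \<Omega> \<Longrightarrow> pint q (\<lambda>x. grad a x - grad b x) \<le> N (a - b) powr q"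
  shows "\<exists>P. countable P \<and> P \<subseteq> solenoidal_C0inf \<Omega> \<and> (AE t in J. near q P (u t))"
proof -
  obtain s where s: "\<And>k. finite (s k ` {0<..<T})" "\<And>k. s k ` {0<..<T} \<subseteq> Vp q \<Omega>"
    "AE t in J. (\<lambda>k. N (s k t - u t)) \<longlonglongrightarrow> 0"
    using sm unfolding strongly_measurable_def by blast
  define Q where "Q = (\<lambda>c \<psi>. fst c \<in> Vp q \<Omega> \<longrightarrow> \<psi> \<in> solenoidal_C0inf \<Omega> \<and>
      pint q (\<lambda>x. grad (fst c) x - jacobian \<psi> (at x)) < 1 / real (Suc (snd c)))"
  have "\<forall>c :: (real^'n \<Rightarrow> real^'n) \<times> nat. \<exists>\<psi>. Q c \<psi>"
  proof
    fix c :: "(real^'n \<Rightarrow> real^'n) \<times> nat"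
    have "0 < 1 / real (Suc (snd c))" by simp
    then show "\<exists>\<psi>. Q c \<psi>"
      unfolding Q_def Vp_def W1p_closure_iff[OF solenoidal_subset q] by blast
  qed
  from choice[OF this] obtain \<psi> where Q: "\<And>c. Q c (\<psi> c)" by blast
  define C where "C = (\<Union>k. s k ` {0<..<T})"
  have C: "countable C" "C \<subseteq> Vp q \<Omega>"
    unfolding C_def using s(1,2) by (auto intro: countable_finite)
  define P where "P = \<psi> ` (C \<times> UNIV)"
  have "countable P" unfolding P_def using C(1) by (intro countable_image countable_SIGMA) auto
  moreover have "P \<subseteq> solenoidal_C0inf \<Omega>"
    using Q C(2) unfolding P_def Q_def by force
  moreover have sp: "AE t in J. t \<in> {0<..<T}" by (rule AE_I2) simp
  have "AE t in J. near q P (u t)"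
    using s(3) X sp
  proof eventually_elim
    case (elim t)
    let ?\<psi> = "\<lambda>k. \<psi> (s k t, k)"
    have st: "s k t \<in> Vp q \<Omega>" "s k t \<in> C" for k using s(2) elim(3) unfolding C_def by blast+
    have \<psi>: "?\<psi> k \<in> solenoidal_C0inf \<Omega>" "pint q (\<lambda>x. grad (s k t) x - jacobian (?\<psi> k) (at x)) < 1 / real (Suc k)" for k
      using Q[of "(s k t, k)"] st by (simp_all add: Q_def)
    have \<psi>C: "?\<psi> k \<in> C0inf \<Omega>" for k using \<psi>(1) solenoidal_subset by blast
    let ?y = "\<lambda>k. 2 powr q * (N (s k t - u t) powr q + 1 / real (Suc k))"
    have le: "pint q (\<lambda>x. grad (u t) x - jacobian (?\<psi> k) (at x)) \<le> ?y k" for k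
    proof -
      have L: "(\<lambda>x. grad (s k t) x - grad (u t) x) \<in> Lp q \<Omega>"
        by (intro Lp_diff(1) Vp_Lp(2) st elim q)
      have "pint q (\<lambda>x. grad (u t) x - jacobian (?\<psi> k) (at x)) =
          pint q (\<lambda>x. (grad (s k t) x - jacobian (?\<psi> k) (at x)) - (grad (s k t) x - grad (u t) x))"
        by simp
      also have "\<dots> \<le> 2 powr q * (pint q (\<lambda>x. grad (s k t) x - jacobian (?\<psi> k) (at x)) + pint q (\<lambda>x. grad (s k t) x - grad (u t) x))"
        by (intro Lp_diff(2) L grad_jac_diff_Lp st \<psi>C q)
      also have "\<dots> \<le> ?y k"
        using \<psi>(2)[of k] N(2)[OF st(1)[of k] elim(2)] by (intro mult_left_mono) auto
      finally show ?thesis .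
    qed
    have "?y \<longlonglongrightarrow> 2 powr q * (0 powr q + 0)"
      using LIMSEQ_Suc[OF lim_1_over_n]
      by (intro tendsto_mult tendsto_const tendsto_add tendsto_powr' elim(1)) (use q N(1) in auto)
    then have y: "?y \<longlonglongrightarrow> 0" by simp
    have "(\<lambda>k. pint q (\<lambda>x. grad (u t) x - jacobian (?\<psi> k) (at x))) \<longlonglongrightarrow> 0"
    proof (rule tendsto_sandwich[OF _ _ tendsto_const y])
      show "\<forall>\<^sub>F k in sequentially. 0 \<le> pint q (\<lambda>x. grad (u t) x - jacobian (?\<psi> k) (at x))" by simp
      show "\<forall>\<^sub>F k in sequentially. pint q (\<lambda>x. grad (u t) x - jacobian (?\<psi> k) (at x)) \<le> ?y k"
        by (intro always_eventually allI le)
    qed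
    moreover have "?\<psi> k \<in> P" for k using st(2) by (auto simp: P_def)
    ultimately show ?case unfolding near_def by (intro exI[of _ ?\<psi>]) auto
  qed
  ultimately show ?thesis by blast
qed

lemma near_mono: "near q P a \<Longrightarrow> P \<subseteq> Q \<Longrightarrow> near q Q a"
  unfolding near_def by blast

lemma solenoidal_in_Vp: "\<psi> \<in> solenoidal_C0inf \<Omega> \<Longrightarrow> 0 < q \<Longrightarrow> \<psi> \<in> Vp q \<Omega>"
proof -
  assume \<psi>: "\<psi> \<in> solenoidal_C0inf \<Omega>" and q: "0 < q"
  then have C: "\<psi> \<in> C0inf \<Omega>" using solenoidal_subset by auto
  have z: "pint q (\<lambda>x. \<psi> x - \<psi> x) = 0"
    using q by (simp add: pint_def)
  have "pint q (\<lambda>x. grad \<psi> x - jacobian \<psi> (at x)) = pint q (\<lambda>x. 0 :: real^'n^'n)"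
    using LpD(1)[OF grad_in_Lp(1)[OF C0inf_in_W1p[OF C q]]] jacobian_C0inf(1)[OF C] grad_test[OF C]
    by (intro pint_cong_AE borel_measurable_diff) (auto elim: eventually_mono)
  also have "\<dots> = 0" using q by (simp add: pint_def)
  finally show "\<psi> \<in> Vp q \<Omega>"
    unfolding Vp_def W1p_closure_iff[OF solenoidal_subset q]
    by (intro conjI allI impI C0inf_in_W1p[OF C q] bexI[OF _ \<psi>]) (simp_all only: z)
qed

abbreviation n2 :: "(real^'n \<Rightarrow> real^'n) \<Rightarrow> real" where
  "n2 a \<equiv> Lp_norm 2 \<Omega> (grad a)"

text \<open>
  The energy form of the problem. In \<open>Bt\<close> the second argument is a test function with its classical
  gradient, as in the weak formulation.
\<close>

definition B :: "(real^'n \<Rightarrow> real^'n) \<Rightarrow> (real^'n \<Rightarrow> real^'n) \<Rightarrow> real" where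
  "B a c = (\<integral>x. a x \<bullet> c x \<partial>M) + \<kappa> * (\<integral>x. grad a x \<bullet> grad c x \<partial>M)"

definition Bt :: "(real^'n \<Rightarrow> real^'n) \<Rightarrow> (real^'n \<Rightarrow> real^'n) \<Rightarrow> real" where
  "Bt a \<psi> = (\<integral>x. a x \<bullet> \<psi> x \<partial>M) + \<kappa> * (\<integral>x. grad a x \<bullet> jacobian \<psi> (at x) \<partial>M)"

lemma B_sym: "B a c = B c a"
  by (simp add: B_def inner_commute)

text \<open>
  A constant in the Poincare inequality on \<open>V\<close>.
\<close>

definition CP :: real where
  "CP = (SOME C. 0 \<le> C \<and> (\<forall>u\<in>Vp 2 \<Omega>. Lp_norm 2 \<Omega> u \<le> C * n2 u))"

lemma CP: "0 \<le> CP" "u \<in> Vp 2 \<Omega> \<Longrightarrow> Lp_norm 2 \<Omega> u \<le> CP * n2 u"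
proof -
  have "\<exists>C. 0 \<le> C \<and> (\<forall>u\<in>Vp 2 \<Omega>. Lp_norm 2 \<Omega> u \<le> C * n2 u)"
    using Poincare[OF dim] by blast
  from someI_ex[OF this]
  show "0 \<le> CP" "u \<in> Vp 2 \<Omega> \<Longrightarrow> Lp_norm 2 \<Omega> u \<le> CP * n2 u" by (auto simp: CP_def)
qed

lemma n2_diff:
  assumes "a \<in> Vp 2 \<Omega>" "b \<in> Vp 2 \<Omega>"
  shows "n2 (\<lambda>x. a x - b x) = Lp_norm 2 \<Omega> (\<lambda>x. grad a x - grad b x)"
  unfolding Lp_norm_eq pint_grad_diff[OF Vp_W1p[OF assms(1)] Vp_W1p[OF assms(2)] zero_less_numeral] ..

lemma n2_diff_test:
  assumes a: "a \<in> Vp 2 \<Omega>" and \<psi>: "\<psi> \<in> solenoidal_C0inf \<Omega>"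
  shows "n2 (\<lambda>x. a x - \<psi> x) = Lp_norm 2 \<Omega> (\<lambda>x. grad a x - jacobian \<psi> (at x))"
  using n2_diff[OF a solenoidal_in_Vp[OF \<psi>]] pint_grad_diff_test[OF Vp_W1p[OF a], of \<psi> 2] \<psi> solenoidal_subset
  by (auto simp: Lp_norm_eq)

definition CB :: real where "CB = CP * CP + \<kappa>"

lemma CB_nonneg: "0 \<le> CB"
  using CP(1) \<kappa>_pos by (simp add: CB_def)

lemma bilinear_bound:
  fixes G H :: "real^'n \<Rightarrow> real^'n^'n" and a c :: "real^'n \<Rightarrow> real^'n"
  assumes "a \<in> Lp 2 \<Omega>" "c \<in> Lp 2 \<Omega>" "G \<in> Lp 2 \<Omega>" "H \<in> Lp 2 \<Omega>"
    "Lp_norm 2 \<Omega> a \<le> CP * Lp_norm 2 \<Omega> G" "Lp_norm 2 \<Omega> c \<le> CP * Lp_norm 2 \<Omega> H"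
  shows "\<bar>(\<integral>x. a x \<bullet> c x \<partial>M) + \<kappa> * (\<integral>x. G x \<bullet> H x \<partial>M)\<bar> \<le> CB * Lp_norm 2 \<Omega> G * Lp_norm 2 \<Omega> H"
proof -
  have "\<bar>\<integral>x. a x \<bullet> c x \<partial>M\<bar> \<le> Lp_norm 2 \<Omega> a * Lp_norm 2 \<Omega> c"
    by (rule Cauchy_Schwarz_Lp(4)[OF assms(1,2)])
  also have "\<dots> \<le> (CP * Lp_norm 2 \<Omega> G) * (CP * Lp_norm 2 \<Omega> H)"
    using CP(1) by (intro mult_mono assms Lp_norm_nonneg mult_nonneg_nonneg)
  finally have 1: "\<bar>\<integral>x. a x \<bullet> c x \<partial>M\<bar> \<le> (CP * CP) * (Lp_norm 2 \<Omega> G * Lp_norm 2 \<Omega> H)" by (simp add: mult_ac)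
  have "\<bar>\<kappa> * (\<integral>x. G x \<bullet> H x \<partial>M)\<bar> \<le> \<kappa> * (Lp_norm 2 \<Omega> G * Lp_norm 2 \<Omega> H)"
    using Cauchy_Schwarz_Lp(4)[OF assms(3,4)] \<kappa>_pos by (simp add: abs_mult)
  with 1 show ?thesis by (simp add: CB_def algebra_simps)
qed

lemma B_bound:
  assumes "a \<in> Vp 2 \<Omega>" "c \<in> Vp 2 \<Omega>"
  shows "\<bar>B a c\<bar> \<le> CB * n2 a * n2 c"
  unfolding B_def by (intro bilinear_bound Vp_Lp CP assms)

lemma Bt_eq_B:
  assumes a: "a \<in> Vp 2 \<Omega>" and \<psi>: "\<psi> \<in> solenoidal_C0inf \<Omega>"
  shows "Bt a \<psi> = B a \<psi>"
proof -
  have C: "\<psi> \<in> C0inf \<Omega>" using \<psi> solenoidal_subset by auto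
  have "(\<integral>x. grad a x \<bullet> grad \<psi> x \<partial>M) = (\<integral>x. grad a x \<bullet> jacobian \<psi> (at x) \<partial>M)"
    using grad_test[OF C]
    by (intro integral_cong_AE borel_measurable_inner jacobian_C0inf(1)[OF C] LpD(1)[OF Vp_Lp(2)[OF a]]
        LpD(1)[OF Vp_Lp(2)[OF solenoidal_in_Vp[OF \<psi> zero_less_numeral]]]) (auto elim: eventually_mono)
  then show ?thesis by (simp add: B_def Bt_def)
qed

lemma B_diff_right:
  assumes a: "a \<in> Vp 2 \<Omega>" and b: "b \<in> Vp 2 \<Omega>" and c: "c \<in> Vp 2 \<Omega>"
  shows "B a (\<lambda>x. b x - c x) = B a b - B a c"
proof -
  have "(\<integral>x. grad a x \<bullet> grad (\<lambda>x. b x - c x) x \<partial>M) = (\<integral>x. grad a x \<bullet> grad b x - grad a x \<bullet> grad c x \<partial>M)"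
  proof (rule integral_cong_AE)
    show "AE x in M. grad a x \<bullet> grad (\<lambda>x. b x - c x) x = grad a x \<bullet> grad b x - grad a x \<bullet> grad c x"
      using grad_diff[OF grad_in_Lp(2)[OF Vp_W1p[OF b]] grad_in_Lp(2)[OF Vp_W1p[OF c]]]
      by eventually_elim (simp add: inner_diff_right)
    show "(\<lambda>x. grad a x \<bullet> grad (\<lambda>x. b x - c x) x) \<in> borel_measurable M"
      by (intro borel_measurable_inner LpD(1)[OF Vp_Lp(2)[OF a]] LpD(1)[OF Vp_Lp(2)[OF Vp_diff[OF b c zero_less_numeral]]])
    show "(\<lambda>x. grad a x \<bullet> grad b x - grad a x \<bullet> grad c x) \<in> borel_measurable M"
      by (intro borel_measurable_diff borel_measurable_inner LpD(1)[OF Vp_Lp(2)[OF a]]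
          LpD(1)[OF Vp_Lp(2)[OF b]] LpD(1)[OF Vp_Lp(2)[OF c]])
  qed
  also have "\<dots> = (\<integral>x. grad a x \<bullet> grad b x \<partial>M) - (\<integral>x. grad a x \<bullet> grad c x \<partial>M)"
    using Cauchy_Schwarz_Lp(3)[OF Vp_Lp(2)[OF a] Vp_Lp(2)[OF b]] Cauchy_Schwarz_Lp(3)[OF Vp_Lp(2)[OF a] Vp_Lp(2)[OF c]]
    by simp
  finally have eq: "(\<integral>x. grad a x \<bullet> grad (\<lambda>x. b x - c x) x \<partial>M) = (\<integral>x. grad a x \<bullet> grad b x \<partial>M) - (\<integral>x. grad a x \<bullet> grad c x \<partial>M)" .
  have "(\<integral>x. a x \<bullet> (b x - c x) \<partial>M) = (\<integral>x. a x \<bullet> b x \<partial>M) - (\<integral>x. a x \<bullet> c x \<partial>M)"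
    using Cauchy_Schwarz_Lp(3)[OF Vp_Lp(1)[OF a] Vp_Lp(1)[OF b]] Cauchy_Schwarz_Lp(3)[OF Vp_Lp(1)[OF a] Vp_Lp(1)[OF c]]
    by (simp add: inner_diff_right)
  then show ?thesis by (simp add: B_def eq right_diff_distrib)
qed

lemma B_diff_left:
  assumes "a \<in> Vp 2 \<Omega>" "b \<in> Vp 2 \<Omega>" "c \<in> Vp 2 \<Omega>"
  shows "B (\<lambda>x. b x - c x) a = B b a - B c a"
  using B_diff_right[OF assms] by (simp add: B_sym)

lemma B_self: "B a a = pint 2 a + \<kappa> * pint 2 (grad a)"
  by (simp add: B_def pint_def dot_square_norm)

text \<open>
  By the Poincare inequality the norm of \<open>V\<close>, which sees only the gradients, controls the functions.
\<close>

lemma V_norm_tendsto: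
  assumes a: "a \<in> Vp 2 \<Omega>" and as: "\<And>k. as k \<in> Vp 2 \<Omega>" and lim: "(\<lambda>k. V_norm \<Omega> (as k - a)) \<longlonglongrightarrow> 0"
  shows "(\<lambda>k. Lp_norm 2 \<Omega> (\<lambda>x. grad a x - grad (as k) x)) \<longlonglongrightarrow> 0"
    "(\<lambda>k. Lp_norm 2 \<Omega> (\<lambda>x. a x - as k x)) \<longlonglongrightarrow> 0"
proof -
  have "V_norm \<Omega> (as k - a) = Lp_norm 2 \<Omega> (\<lambda>x. grad a x - grad (as k) x)" for k
    using n2_diff[OF as a] by (simp add: V_norm_def fun_diff_def Lp_norm_eq pint_def norm_minus_commute)
  with lim show 1: "(\<lambda>k. Lp_norm 2 \<Omega> (\<lambda>x. grad a x - grad (as k) x)) \<longlonglongrightarrow> 0" by simp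
  show "(\<lambda>k. Lp_norm 2 \<Omega> (\<lambda>x. a x - as k x)) \<longlonglongrightarrow> 0"
  proof (rule tendsto_sandwich[OF _ _ tendsto_const])
    show "(\<lambda>k. CP * Lp_norm 2 \<Omega> (\<lambda>x. grad a x - grad (as k) x)) \<longlonglongrightarrow> 0"
      using tendsto_mult[OF tendsto_const[of CP] 1] by simp
    show "\<forall>\<^sub>F k in sequentially. 0 \<le> Lp_norm 2 \<Omega> (\<lambda>x. a x - as k x)"
      by (simp add: Lp_norm_nonneg)
    have "Lp_norm 2 \<Omega> (\<lambda>x. a x - as k x) \<le> CP * Lp_norm 2 \<Omega> (\<lambda>x. grad a x - grad (as k) x)" for k
      using CP(2)[OF Vp_diff[OF a as zero_less_numeral]] by (simp only: n2_diff[OF a as])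
    then show "\<forall>\<^sub>F k in sequentially. Lp_norm 2 \<Omega> (\<lambda>x. a x - as k x) \<le> CP * Lp_norm 2 \<Omega> (\<lambda>x. grad a x - grad (as k) x)"
      by simp
  qed
qed

lemma B_tendsto:
  assumes a: "a \<in> Vp 2 \<Omega>" and b: "b \<in> Vp 2 \<Omega>" and as: "\<And>k. as k \<in> Vp 2 \<Omega>" and bs: "\<And>k. bs k \<in> Vp 2 \<Omega>"
    and lim: "(\<lambda>k. V_norm \<Omega> (as k - a)) \<longlonglongrightarrow> 0" "(\<lambda>k. V_norm \<Omega> (bs k - b)) \<longlonglongrightarrow> 0"
  shows "(\<lambda>k. B (as k) (bs k)) \<longlonglongrightarrow> B a b"
  unfolding B_def
  by (intro tendsto_add tendsto_mult tendsto_const inner_tendsto Vp_Lp a b as bs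
      V_norm_tendsto[OF a as lim(1)] V_norm_tendsto[OF b bs lim(2)])

lemma V_norm_diff_tendsto:
  assumes a: "a \<in> Vp 2 \<Omega>" and b: "b \<in> Vp 2 \<Omega>" and as: "\<And>k. as k \<in> Vp 2 \<Omega>" and bs: "\<And>k. bs k \<in> Vp 2 \<Omega>"
    and lim: "(\<lambda>k. V_norm \<Omega> (as k - a)) \<longlonglongrightarrow> 0" "(\<lambda>k. V_norm \<Omega> (bs k - b)) \<longlonglongrightarrow> 0"
  shows "(\<lambda>k. V_norm \<Omega> ((as k - bs k) - (a - b))) \<longlonglongrightarrow> 0"
proof -
  have sq: "V_norm \<Omega> u powr 2 = pint 2 (grad u)" for u
    by (simp only: V_norm_def Lp_norm_powr[OF zero_less_numeral])
  have le: "pint 2 (grad ((as k - bs k) - (a - b))) \<le> 2 powr 2 * (V_norm \<Omega> (as k - a) powr 2 + V_norm \<Omega> (bs k - b) powr 2)" for k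
  proof -
    have d: "as k - a \<in> Vp 2 \<Omega>" "bs k - b \<in> Vp 2 \<Omega>"
      using Vp_diff[OF as a zero_less_numeral] Vp_diff[OF bs b zero_less_numeral] by (simp_all add: fun_diff_def)
    have "(as k - bs k) - (a - b) = (\<lambda>x. (as k - a) x - (bs k - b) x)"
      by (auto simp: fun_eq_iff)
    then have "pint 2 (grad ((as k - bs k) - (a - b))) = pint 2 (\<lambda>x. grad (as k - a) x - grad (bs k - b) x)"
      using pint_grad_diff[OF Vp_W1p[OF d(1)] Vp_W1p[OF d(2)] zero_less_numeral, of 2] by simp
    also have "\<dots> \<le> 2 powr 2 * (pint 2 (grad (as k - a)) + pint 2 (grad (bs k - b)))"
      by (intro Lp_diff Vp_Lp d) simp
    finally show ?thesis by (simp only: sq)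
  qed
  have "(\<lambda>k. 2 powr 2 * (V_norm \<Omega> (as k - a) powr 2 + V_norm \<Omega> (bs k - b) powr 2)) \<longlonglongrightarrow> 2 powr 2 * (0 powr 2 + 0 powr 2)"
    by (intro tendsto_mult tendsto_const tendsto_add tendsto_powr' lim) (auto simp: V_norm_def Lp_norm_nonneg)
  then have y: "(\<lambda>k. 2 powr 2 * (V_norm \<Omega> (as k - a) powr 2 + V_norm \<Omega> (bs k - b) powr 2)) \<longlonglongrightarrow> 0" by simp
  have "(\<lambda>k. pint 2 (grad ((as k - bs k) - (a - b)))) \<longlonglongrightarrow> 0"
  proof (rule tendsto_sandwich[OF _ _ tendsto_const y])
    show "\<forall>\<^sub>F k in sequentially. 0 \<le> pint 2 (grad ((as k - bs k) - (a - b)))" by simp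
    show "\<forall>\<^sub>F k in sequentially. pint 2 (grad ((as k - bs k) - (a - b))) \<le> 2 powr 2 * (V_norm \<Omega> (as k - a) powr 2 + V_norm \<Omega> (bs k - b) powr 2)"
      by (intro always_eventually allI le)
  qed
  then have "(\<lambda>k. pint 2 (grad ((as k - bs k) - (a - b))) powr (1 / 2)) \<longlonglongrightarrow> 0 powr (1 / 2)"
    by (intro tendsto_powr' tendsto_const) auto
  then show ?thesis by (simp add: V_norm_def Lp_norm_eq)
qed

lemma Bt_approximates_B:
  assumes y: "y \<in> Vp 2 \<Omega>" and \<psi>: "\<And>k. \<psi> k \<in> solenoidal_C0inf \<Omega>" and a: "a \<in> Vp 2 \<Omega>"
  shows "\<bar>Bt a (\<psi> k) - B a y\<bar> \<le> CB * n2 a * Lp_norm 2 \<Omega> (\<lambda>x. grad y x - jacobian (\<psi> k) (at x))"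
proof -
  have v: "\<psi> k \<in> Vp 2 \<Omega>" by (rule solenoidal_in_Vp[OF \<psi>]) simp
  have "\<bar>Bt a (\<psi> k) - B a y\<bar> = \<bar>B a (\<lambda>x. y x - \<psi> k x)\<bar>"
    unfolding Bt_eq_B[OF a \<psi>] B_diff_right[OF a y v] by (rule abs_minus_commute)
  also have "\<dots> \<le> CB * n2 a * n2 (\<lambda>x. y x - \<psi> k x)"
    by (intro B_bound a Vp_diff y v) simp
  finally show ?thesis unfolding n2_diff_test[OF y \<psi>] .
qed

text \<open>
  Since the test functions are smooth, \<open>\<psi> - \<kappa> \<Delta> \<psi>\<close> is again a test function, which represents the
  energy form: this transfers the distributional time derivative to the energy form.
\<close>

lemma energy_representative:
  assumes \<psi>: "\<psi> \<in> C0inf \<Omega>"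
  shows "\<exists>L\<in>C0inf \<Omega>. \<forall>a\<in>W1p 2 \<Omega>. (\<integral>x. a x \<bullet> L x \<partial>M) = Bt a \<psi>"
proof -
  define D where "D = (\<lambda>j x. frechet_derivative \<psi> (at x) (axis j 1))"
  have D: "D j \<in> C0inf \<Omega>" for j
    unfolding D_def by (rule C0inf_frechet_derivative[OF \<psi>])
  define DD where "DD = (\<lambda>j x. frechet_derivative (D j) (at x) (axis j 1))"
  have DD: "DD j \<in> C0inf \<Omega>" for j
    unfolding DD_def by (rule C0inf_frechet_derivative[OF D])
  \<comment> \<open>This is \<open>\<psi> - \<kappa> \<Delta> \<psi>\<close>.\<close>
  define L where "L = (\<lambda>x. \<psi> x - \<kappa> *\<^sub>R (\<Sum>j\<in>UNIV. DD j x))"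
  have L: "L \<in> C0inf \<Omega>"
    unfolding L_def by (intro C0inf_diff \<psi> C0inf_linear_comp[OF bounded_linear_scaleR_right] C0inf_sum DD) simp
  have "(\<integral>x. a x \<bullet> L x \<partial>M) = Bt a \<psi>" if a: "a \<in> W1p 2 \<Omega>" for a
  proof -
    have aL: "a \<in> Lp 2 \<Omega>" using a by (simp add: W1p_def)
    note G = grad_in_Lp(2)[OF a]
    have Dij: "(\<lambda>x. D j x $ i) \<in> C0inf \<Omega>" for i j
      by (rule C0inf_linear_comp[OF bounded_linear_vec_nth D])
    have fd: "frechet_derivative (\<lambda>x. D j x $ i) (at x) h = frechet_derivative (D j) (at x) h $ i" for i j x h
    proof -
      have "((\<lambda>x. D j x $ i) has_derivative (\<lambda>h. frechet_derivative (D j) (at x) h $ i)) (at x)"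
        by (intro bounded_linear.has_derivative[OF bounded_linear_vec_nth] smooth_has_derivative C0inf_smooth[OF D])
      from frechet_derivative_at[OF this, symmetric] show ?thesis by simp
    qed
    have part: "(\<integral>x. a x $ i * DD j x $ i \<partial>M) = - (\<integral>x. grad a x $ i $ j * D j x $ i \<partial>M)" for i j
      using has_weak_gradientD[OF G Dij[of j i], of i j] by (simp add: fd DD_def)
    have DDi: "(\<lambda>x. DD j x $ i) \<in> C0inf \<Omega>" for i j
      by (rule C0inf_linear_comp[OF bounded_linear_vec_nth DD])
    have i1: "integrable M (\<lambda>x. a x $ i * DD j x $ i)" for i j
      by (intro integrable_mult_C0inf[OF _ DDi open_\<Omega>] has_weak_gradient_entry_integrable[OF G])
    have i2: "integrable M (\<lambda>x. grad a x $ i $ j * D j x $ i)" for i j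
      by (intro integrable_mult_C0inf[OF _ Dij open_\<Omega>] has_weak_gradient_entry_integrable[OF G])
    have e1: "a x \<bullet> (\<Sum>j\<in>UNIV. DD j x) = (\<Sum>j\<in>UNIV. \<Sum>i\<in>UNIV. a x $ i * DD j x $ i)" for x
      unfolding inner_sum_right by (simp add: inner_vec_def)
    have e2: "grad a x \<bullet> jacobian \<psi> (at x) = (\<Sum>j\<in>UNIV. \<Sum>i\<in>UNIV. grad a x $ i $ j * D j x $ i)" for x
      unfolding inner_vec_def by (subst sum.swap) (simp add: jacobian_entry D_def)
    have lap: "(\<integral>x. a x \<bullet> (\<Sum>j\<in>UNIV. DD j x) \<partial>M) = - (\<integral>x. grad a x \<bullet> jacobian \<psi> (at x) \<partial>M)"
      unfolding e1 e2 using i1 i2 by (simp add: Bochner_Integration.integral_sum part sum_negf)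
    have "integrable M (\<lambda>x. a x \<bullet> \<psi> x)" "integrable M (\<lambda>x. a x \<bullet> (\<Sum>j\<in>UNIV. DD j x))"
      by (intro Cauchy_Schwarz_Lp(3) aL C0inf_in_Lp[OF \<psi>] C0inf_in_Lp[OF C0inf_sum[OF _ DD]]; simp)+
    then have "(\<integral>x. a x \<bullet> L x \<partial>M) = (\<integral>x. a x \<bullet> \<psi> x \<partial>M) - \<kappa> * (\<integral>x. a x \<bullet> (\<Sum>j\<in>UNIV. DD j x) \<partial>M)"
      by (simp add: L_def inner_diff_right)
    then show ?thesis by (simp add: lap Bt_def)
  qed
  with L show ?thesis by blast
qed

end

section \<open>Testing with products of functions of time and of space\<close>

lemma product_test_C0inf:
  fixes \<theta> :: "real \<Rightarrow> real" and \<psi> :: "real^'n \<Rightarrow> real^'n"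
  assumes \<theta>: "\<theta> \<in> C0inf S" and \<psi>: "\<psi> \<in> C0inf \<Omega>"
  shows "(\<lambda>z. \<theta> (fst z) *\<^sub>R \<psi> (snd z)) \<in> C0inf (S \<times> \<Omega>)"
proof -
  obtain K where K: "compact K" "K \<subseteq> S" "\<And>t. t \<notin> K \<Longrightarrow> \<theta> t = 0"
    using C0infE[OF \<theta>] by blast
  obtain L where L: "compact L" "L \<subseteq> \<Omega>" "\<And>x. x \<notin> L \<Longrightarrow> \<psi> x = 0"
    using C0infE[OF \<psi>] by blast
  show ?thesis
  proof (rule C0infI[of _ "K \<times> L"])
    show "smooth (\<lambda>z. \<theta> (fst z) *\<^sub>R \<psi> (snd z))"
      by (intro smooth_scaleR smooth_comp_linear[OF bounded_linear_fst] smooth_comp_linear[OF bounded_linear_snd]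
          C0inf_smooth[OF \<theta>] C0inf_smooth[OF \<psi>])
    show "compact (K \<times> L)" by (intro compact_Times K L)
    show "K \<times> L \<subseteq> S \<times> \<Omega>" using K L by auto
    show "\<theta> (fst z) *\<^sub>R \<psi> (snd z) = 0" if "z \<notin> K \<times> L" for z
      using that K(3)[of "fst z"] L(3)[of "snd z"] by (cases z) auto
  qed
qed

lemma dt_product:
  assumes "\<And>t. (\<theta> has_real_derivative \<theta>' t) (at t)"
  shows "dt (\<lambda>z. \<theta> (fst z) *\<^sub>R \<psi> (snd z)) t x = \<theta>' t *\<^sub>R \<psi> x"
proof -
  have "((\<lambda>s. \<theta> s *\<^sub>R \<psi> x) has_vector_derivative \<theta>' t *\<^sub>R \<psi> x) (at t)"
    using has_vector_derivative_scaleR[OF assms[of t] has_vector_derivative_const[of "\<psi> x"]] by simp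
  then show ?thesis by (simp add: dt_def vector_derivative_at)
qed

lemma jacobian_scaleR:
  fixes \<psi> :: "real^'n \<Rightarrow> real^'n"
  assumes "smooth \<psi>"
  shows "jacobian (\<lambda>y. c *\<^sub>R \<psi> y) (at x) = c *\<^sub>R jacobian \<psi> (at x)"
proof -
  have "((\<lambda>y. c *\<^sub>R \<psi> y) has_derivative (\<lambda>h. c *\<^sub>R frechet_derivative \<psi> (at x) h)) (at x)"
    by (intro has_derivative_scaleR_right smooth_has_derivative assms)
  from frechet_derivative_at[OF this, symmetric] show ?thesis
    by (simp add: vec_eq_iff jacobian_entry)
qed

context nsv
begin

lemma product_test_NSV:
  assumes \<theta>: "smooth \<theta>" "c < T" "\<And>t. c \<le> t \<Longrightarrow> \<theta> t = 0" and \<psi>: "\<psi> \<in> solenoidal_C0inf \<Omega>"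
  shows "(\<lambda>z. \<theta> (fst z) *\<^sub>R \<psi> (snd z)) \<in> NSV_test T \<Omega>"
proof -
  have C: "\<psi> \<in> C0inf \<Omega>" using \<psi> solenoidal_subset by auto
  obtain L where L: "compact L" "L \<subseteq> \<Omega>" "\<And>x. x \<notin> L \<Longrightarrow> \<psi> x = 0"
    using C0infE[OF C] by blast
  define S where "S = closure {(t, x). 0 \<le> t \<and> \<theta> (fst (t, x)) *\<^sub>R \<psi> (snd (t, x)) \<noteq> 0}"
  have sub: "S \<subseteq> {0..c} \<times> L"
    unfolding S_def
  proof (rule closure_minimal)
    show "{(t, x). 0 \<le> t \<and> \<theta> (fst (t, x)) *\<^sub>R \<psi> (snd (t, x)) \<noteq> 0} \<subseteq> {0..c} \<times> L"
    proof clarify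
      fix t x assume t: "0 \<le> t" and nz: "\<theta> (fst (t, x)) *\<^sub>R \<psi> (snd (t, x)) \<noteq> 0"
      then have "t \<le> c" "x \<in> L" using \<theta>(3)[of t] L(3)[of x] by (force, force)
      with t show "t \<in> {0..c} \<and> x \<in> L" by simp
    qed
    show "closed ({0..c} \<times> L)" by (intro closed_Times closed_atLeastAtMost compact_imp_closed[OF L(1)])
  qed
  have "compact ({0..c} \<times> L)" by (intro compact_Times compact_Icc L)
  then have "compact S"
    using sub compact_Int_closed[of "{0..c} \<times> L" S] by (simp add: S_def inf.absorb2)
  moreover have "{0..c} \<times> L \<subseteq> {0..<T} \<times> \<Omega>" using \<theta>(2) L(2) by auto
  then have "S \<subseteq> {0..<T} \<times> \<Omega>" using sub by blast
  moreover have "smooth (\<lambda>z. \<theta> (fst z) *\<^sub>R \<psi> (snd z))"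
    by (intro smooth_scaleR smooth_comp_linear[OF bounded_linear_fst] smooth_comp_linear[OF bounded_linear_snd]
        \<theta>(1) C0inf_smooth[OF C])
  moreover have "trace (jacobian (\<lambda>y. \<theta> t *\<^sub>R \<psi> y) (at x)) = 0" for t x
  proof -
    have "trace (jacobian \<psi> (at x)) = 0" using \<psi> by (simp add: solenoidal_C0inf_def)
    then show ?thesis
      by (simp add: jacobian_scaleR[OF C0inf_smooth[OF C]] trace_def flip: sum_distrib_left)
  qed
  ultimately show ?thesis by (simp add: NSV_test_def S_def Let_def)
qed

section \<open>Integrability in time\<close>

lemma V_norm_powr2: "V_norm \<Omega> a powr 2 = pint 2 (grad a)"
  unfolding V_norm_def by (rule Lp_norm_powr) simp

lemma V_norm_bound: "a \<in> Vp 2 \<Omega> \<Longrightarrow> b \<in> Vp 2 \<Omega> \<Longrightarrow> pint 2 (\<lambda>x. grad a x - grad b x) \<le> V_norm \<Omega> (a - b) powr 2"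
  unfolding V_norm_powr2 fun_diff_def
  by (subst pint_grad_diff[OF Vp_W1p Vp_W1p]) auto

lemma W1p_norm_bound: "a \<in> Vp p \<Omega> \<Longrightarrow> b \<in> Vp p \<Omega> \<Longrightarrow> pint p (\<lambda>x. grad a x - grad b x) \<le> W1p_norm p \<Omega> (a - b) powr p"
  unfolding W1p_norm_powr[OF p_pos] fun_diff_def
  by (subst pint_grad_diff[OF Vp_W1p Vp_W1p, symmetric]) (use p_pos in auto)

lemma W1p_norm_nonneg: "0 \<le> W1p_norm p \<Omega> a"
  by (simp add: W1p_norm_def)

lemma V_norm_nonneg: "0 \<le> V_norm \<Omega> a"
  by (simp add: V_norm_def Lp_norm_nonneg)

lemma integrable_mult_continuous:
  fixes f \<theta> :: "real \<Rightarrow> real"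
  assumes f: "integrable J f" and \<theta>: "continuous_on UNIV \<theta>"
  shows "integrable J (\<lambda>t. \<theta> t * f t)"
proof -
  have "compact (\<theta> ` {0..T})"
    by (intro compact_continuous_image continuous_on_subset[OF \<theta>]) auto
  then have "bounded (\<theta> ` {0..T})" by (rule compact_imp_bounded)
  then obtain C where "\<forall>x\<in>\<theta> ` {0..T}. norm x \<le> C"
    unfolding bounded_iff by (elim exE)
  then have C: "\<bar>\<theta> t\<bar> \<le> C" if "t \<in> {0..T}" for t
    using that by auto
  have C0: "0 \<le> C" using C[of 0] T_pos by (auto intro: order_trans[OF abs_ge_zero])
  have [measurable]: "\<theta> \<in> borel_measurable J" "f \<in> borel_measurable J"
    using f by (auto intro!: continuous_imp_measurable_on_sets_lebesgue continuous_on_subset[OF \<theta>])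
  show ?thesis
  proof (rule Bochner_Integration.integrable_bound[of J "\<lambda>t. C * f t"])
    show "integrable J (\<lambda>t. C * f t)" using f by simp
    show "(\<lambda>t. \<theta> t * f t) \<in> borel_measurable J" by measurable
    show "AE t in J. norm (\<theta> t * f t) \<le> norm (C * f t)"
      using C C0 by (intro AE_I2) (auto simp: abs_mult intro!: mult_right_mono)
  qed
qed

lemma Lp_norm_zero_diff: "(\<lambda>k::nat. Lp_norm 2 \<Omega> (\<lambda>x. f x - f x)) \<longlonglongrightarrow> 0"
  by (simp add: Lp_norm_eq pint_def)

lemma value_slice_measurable:
  assumes v: "strongly_measurable T (Vp 2 \<Omega>) (V_norm \<Omega>) v" "AE t in J. v t \<in> Vp 2 \<Omega>" and \<psi>: "\<psi> \<in> C0inf \<Omega>"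
  shows "(\<lambda>t. \<integral>x. v t x \<bullet> \<psi> x \<partial>M) \<in> borel_measurable J"
    "(\<lambda>t. \<integral>x. grad (v t) x \<bullet> jacobian \<psi> (at x) \<partial>M) \<in> borel_measurable J"
    "(\<lambda>t. \<integral>x. tensor (v t x) (v t x) \<bullet> jacobian \<psi> (at x) \<partial>M) \<in> borel_measurable J"
proof -
  have j2: "(\<lambda>x. jacobian \<psi> (at x)) \<in> Lp 2 \<Omega>" by (rule jacobian_C0inf(3)[OF \<psi>]) simp
  have p2: "\<psi> \<in> Lp 2 \<Omega>" by (rule C0inf_in_Lp[OF \<psi>]) simp
  obtain C where C: "\<And>x. norm (jacobian \<psi> (at x)) \<le> C" using jacobian_C0inf(2)[OF \<psi>] by blast
  show "(\<lambda>t. \<integral>x. v t x \<bullet> \<psi> x \<partial>M) \<in> borel_measurable J"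
  proof (rule strongly_measurable_comp[OF v, where F = "\<lambda>a. \<integral>x. a x \<bullet> \<psi> x \<partial>M"])
    fix a as assume a: "a \<in> Vp 2 \<Omega>" "\<And>k. as k \<in> Vp 2 \<Omega>" "(\<lambda>k. V_norm \<Omega> (as k - a)) \<longlonglongrightarrow> 0"
    show "(\<lambda>k. \<integral>x. as k x \<bullet> \<psi> x \<partial>M) \<longlonglongrightarrow> (\<integral>x. a x \<bullet> \<psi> x \<partial>M)"
      by (intro inner_tendsto Vp_Lp(1) a p2 V_norm_tendsto(2)[OF a] Lp_norm_zero_diff)
  qed
  show "(\<lambda>t. \<integral>x. grad (v t) x \<bullet> jacobian \<psi> (at x) \<partial>M) \<in> borel_measurable J"
  proof (rule strongly_measurable_comp[OF v, where F = "\<lambda>a. \<integral>x. grad a x \<bullet> jacobian \<psi> (at x) \<partial>M"])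
    fix a as assume a: "a \<in> Vp 2 \<Omega>" "\<And>k. as k \<in> Vp 2 \<Omega>" "(\<lambda>k. V_norm \<Omega> (as k - a)) \<longlonglongrightarrow> 0"
    show "(\<lambda>k. \<integral>x. grad (as k) x \<bullet> jacobian \<psi> (at x) \<partial>M) \<longlonglongrightarrow> (\<integral>x. grad a x \<bullet> jacobian \<psi> (at x) \<partial>M)"
      by (intro inner_tendsto Vp_Lp(2) a j2 V_norm_tendsto(1)[OF a] Lp_norm_zero_diff)
  qed
  show "(\<lambda>t. \<integral>x. tensor (v t x) (v t x) \<bullet> jacobian \<psi> (at x) \<partial>M) \<in> borel_measurable J"
  proof (rule strongly_measurable_comp[OF v, where F = "\<lambda>a. \<integral>x. tensor (a x) (a x) \<bullet> jacobian \<psi> (at x) \<partial>M"])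
    fix a as assume a: "a \<in> Vp 2 \<Omega>" "\<And>k. as k \<in> Vp 2 \<Omega>" "(\<lambda>k. V_norm \<Omega> (as k - a)) \<longlonglongrightarrow> 0"
    show "(\<lambda>k. \<integral>x. tensor (as k x) (as k x) \<bullet> jacobian \<psi> (at x) \<partial>M) \<longlonglongrightarrow> (\<integral>x. tensor (a x) (a x) \<bullet> jacobian \<psi> (at x) \<partial>M)"
      by (rule conv_tendsto[OF Vp_Lp(1)[OF a(1)] Vp_Lp(1)[OF a(2)] jacobian_C0inf(1)[OF \<psi>] C V_norm_tendsto(2)[OF a]])
  qed
qed

lemma visc_slice_measurable:
  assumes v: "strongly_measurable T (Vp p \<Omega>) (W1p_norm p \<Omega>) v" "AE t in J. v t \<in> Vp p \<Omega>" and \<psi>: "\<psi> \<in> C0inf \<Omega>"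
  shows "(\<lambda>t. \<integral>x. visc p (grad (v t) x) \<bullet> sym_part (jacobian \<psi> (at x)) \<partial>M) \<in> borel_measurable J"
proof (rule strongly_measurable_comp[OF v, where F = "\<lambda>a. \<integral>x. visc p (grad a x) \<bullet> sym_part (jacobian \<psi> (at x)) \<partial>M"])
  fix a as assume a: "a \<in> Vp p \<Omega>" "\<And>k. as k \<in> Vp p \<Omega>" "(\<lambda>k. W1p_norm p \<Omega> (as k - a)) \<longlonglongrightarrow> 0"
  obtain C where C: "\<And>x. norm (jacobian \<psi> (at x)) \<le> C" using jacobian_C0inf(2)[OF \<psi>] by blast
  have "(\<lambda>k. W1p_norm p \<Omega> (as k - a) powr p) \<longlonglongrightarrow> 0 powr p"
    by (intro tendsto_powr' a tendsto_const) (use p_pos W1p_norm_nonneg in auto)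
  then have y: "(\<lambda>k. W1p_norm p \<Omega> (as k - a) powr p) \<longlonglongrightarrow> 0" by simp
  have le: "pint p (\<lambda>x. grad a x - grad (as k) x) \<le> W1p_norm p \<Omega> (as k - a) powr p" for k
    using W1p_norm_bound[OF a(2,1), of k] by (simp add: pint_def norm_minus_commute)
  have lim: "(\<lambda>k. pint p (\<lambda>x. grad a x - grad (as k) x)) \<longlonglongrightarrow> 0"
  proof (rule tendsto_sandwich[OF _ _ tendsto_const y])
    show "\<forall>\<^sub>F k in sequentially. 0 \<le> pint p (\<lambda>x. grad a x - grad (as k) x)" by simp
    show "\<forall>\<^sub>F k in sequentially. pint p (\<lambda>x. grad a x - grad (as k) x) \<le> W1p_norm p \<Omega> (as k - a) powr p"
      by (intro always_eventually allI le)
  qed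
  show "(\<lambda>k. \<integral>x. visc p (grad (as k) x) \<bullet> sym_part (jacobian \<psi> (at x)) \<partial>M) \<longlonglongrightarrow>
      (\<integral>x. visc p (grad a x) \<bullet> sym_part (jacobian \<psi> (at x)) \<partial>M)"
    by (rule visc_tendsto[OF p_gt_1 Vp_Lp(2)[OF a(1)] Vp_Lp(2)[OF a(2)] jacobian_C0inf(1)[OF \<psi>] C lim])
qed

text \<open>
  The stationary part of the equation: viscous minus convective term, tested with \<open>\<psi>\<close>.
\<close>

definition Nt :: "(real^'n \<Rightarrow> real^'n) \<Rightarrow> (real^'n \<Rightarrow> real^'n) \<Rightarrow> real" where
  "Nt a \<psi> = \<nu> * (\<integral>x. visc p (grad a x) \<bullet> sym_part (jacobian \<psi> (at x)) \<partial>M)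
     - (\<integral>x. tensor (a x) (a x) \<bullet> jacobian \<psi> (at x) \<partial>M)"

lemma velocity_slices_integrable:
  assumes v2: "v \<in> Bochner_Linf T (Vp 2 \<Omega>) (V_norm \<Omega>)" and \<psi>: "\<psi> \<in> C0inf \<Omega>"
  shows "integrable J (\<lambda>t. \<integral>x. v t x \<bullet> \<psi> x \<partial>M)"
    "integrable J (\<lambda>t. \<integral>x. grad (v t) x \<bullet> jacobian \<psi> (at x) \<partial>M)"
    "integrable J (\<lambda>t. \<integral>x. tensor (v t x) (v t x) \<bullet> jacobian \<psi> (at x) \<partial>M)"
proof -
  have v: "strongly_measurable T (Vp 2 \<Omega>) (V_norm \<Omega>) v" "AE t in J. v t \<in> Vp 2 \<Omega>"
    using v2 by (auto simp: Bochner_Linf_def)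
  obtain C where C: "AE t in J. n2 (v t) \<le> C"
    using v2 by (auto simp: Bochner_Linf_def V_norm_def)
  have j2: "(\<lambda>x. jacobian \<psi> (at x)) \<in> Lp 2 \<Omega>" by (rule jacobian_C0inf(3)[OF \<psi>]) simp
  have p2: "\<psi> \<in> Lp 2 \<Omega>" by (rule C0inf_in_Lp[OF \<psi>]) simp
  obtain D where D: "0 \<le> D" "\<And>x. norm (jacobian \<psi> (at x)) \<le> D" using jacobian_C0inf(2)[OF \<psi>] by blast
  show "integrable J (\<lambda>t. \<integral>x. v t x \<bullet> \<psi> x \<partial>M)"
  proof (rule J.integrable_const_bound[OF _ value_slice_measurable(1)[OF v \<psi>]])
    show "AE t in J. norm (\<integral>x. v t x \<bullet> \<psi> x \<partial>M) \<le> (CP * C) * Lp_norm 2 \<Omega> \<psi>"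
      using v(2) C
    proof eventually_elim
      case (elim t)
      have "norm (\<integral>x. v t x \<bullet> \<psi> x \<partial>M) \<le> Lp_norm 2 \<Omega> (v t) * Lp_norm 2 \<Omega> \<psi>"
        using Cauchy_Schwarz_Lp(4)[OF Vp_Lp(1)[OF elim(1)] p2] by simp
      also have "\<dots> \<le> (CP * C) * Lp_norm 2 \<Omega> \<psi>"
        using CP(2)[OF elim(1)] mult_left_mono[OF elim(2) CP(1)]
        by (intro mult_right_mono Lp_norm_nonneg) linarith
      finally show ?case .
    qed
  qed
  show "integrable J (\<lambda>t. \<integral>x. grad (v t) x \<bullet> jacobian \<psi> (at x) \<partial>M)"
  proof (rule J.integrable_const_bound[OF _ value_slice_measurable(2)[OF v \<psi>]])
    show "AE t in J. norm (\<integral>x. grad (v t) x \<bullet> jacobian \<psi> (at x) \<partial>M) \<le> C * Lp_norm 2 \<Omega> (\<lambda>x. jacobian \<psi> (at x))"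
      using v(2) C
    proof eventually_elim
      case (elim t)
      have "norm (\<integral>x. grad (v t) x \<bullet> jacobian \<psi> (at x) \<partial>M) \<le> n2 (v t) * Lp_norm 2 \<Omega> (\<lambda>x. jacobian \<psi> (at x))"
        using Cauchy_Schwarz_Lp(4)[OF Vp_Lp(2)[OF elim(1)] j2] by simp
      also have "\<dots> \<le> C * Lp_norm 2 \<Omega> (\<lambda>x. jacobian \<psi> (at x))"
        by (intro mult_right_mono Lp_norm_nonneg elim)
      finally show ?case .
    qed
  qed
  show "integrable J (\<lambda>t. \<integral>x. tensor (v t x) (v t x) \<bullet> jacobian \<psi> (at x) \<partial>M)"
  proof (rule J.integrable_const_bound[OF _ value_slice_measurable(3)[OF v \<psi>]])
    show "AE t in J. norm (\<integral>x. tensor (v t x) (v t x) \<bullet> jacobian \<psi> (at x) \<partial>M) \<le> D * ((CP * C) * (CP * C))"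
      using v(2) C
    proof eventually_elim
      case (elim t)
      have le: "Lp_norm 2 \<Omega> (v t) \<le> CP * C"
        using CP(2)[OF elim(1)] mult_left_mono[OF elim(2) CP(1)] by linarith
      have "norm (\<integral>x. tensor (v t x) (v t x) \<bullet> jacobian \<psi> (at x) \<partial>M) \<le> D * (Lp_norm 2 \<Omega> (v t) * Lp_norm 2 \<Omega> (v t))"
        using conv_integrable(2)[OF Vp_Lp(1)[OF elim(1)] Vp_Lp(1)[OF elim(1)] jacobian_C0inf(1)[OF \<psi>] D(2)] by simp
      also have "\<dots> \<le> D * ((CP * C) * (CP * C))"
        using D(1) le order_trans[OF Lp_norm_nonneg le] by (intro mult_left_mono mult_mono Lp_norm_nonneg)
      finally show ?case .
    qed
  qed
qed

lemma visc_slice_integrable: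
  assumes vp: "v \<in> Bochner_Lp p T (Vp p \<Omega>) (W1p_norm p \<Omega>)" and \<psi>: "\<psi> \<in> C0inf \<Omega>"
  shows "integrable J (\<lambda>t. \<integral>x. visc p (grad (v t) x) \<bullet> sym_part (jacobian \<psi> (at x)) \<partial>M)"
proof -
  have v: "strongly_measurable T (Vp p \<Omega>) (W1p_norm p \<Omega>) v" "AE t in J. v t \<in> Vp p \<Omega>"
    and int: "integrable J (\<lambda>t. W1p_norm p \<Omega> (v t) powr p)"
    using vp by (auto simp: Bochner_Lp_def)
  have jp: "(\<lambda>x. jacobian \<psi> (at x)) \<in> Lp p \<Omega>" by (rule jacobian_C0inf(3)[OF \<psi> p_pos])
  let ?c = "pint p (\<lambda>x. jacobian \<psi> (at x))"
  have i: "integrable J (\<lambda>t. W1p_norm p \<Omega> (v t) powr p + ?c)"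
    using int by simp
  show ?thesis
  proof (rule Bochner_Integration.integrable_bound[OF i visc_slice_measurable[OF v \<psi>]])
    show "AE t in J. norm (\<integral>x. visc p (grad (v t) x) \<bullet> sym_part (jacobian \<psi> (at x)) \<partial>M) \<le> norm (W1p_norm p \<Omega> (v t) powr p + ?c)"
      using v(2)
    proof eventually_elim
      case (elim t)
      have "\<bar>\<integral>x. visc p (grad (v t) x) \<bullet> sym_part (jacobian \<psi> (at x)) \<partial>M\<bar> \<le> pint p (grad (v t)) + ?c"
        using visc_integral_eps(2)[OF p_gt_1 Vp_Lp(2)[OF elim] jp, of 1] by simp
      moreover have "pint p (grad (v t)) \<le> W1p_norm p \<Omega> (v t) powr p"
        by (simp add: W1p_norm_powr[OF p_pos])
      ultimately show ?case by simp
    qed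
  qed
qed

section \<open>The equation for fixed test functions in space\<close>

text \<open>
  The weak formulation for a product of \<open>\<theta>\<close> and \<open>\<psi>\<close>. The function \<open>\<theta>\<close> vanishes before time \<open>T\<close>, but need
  not vanish at time 0, which brings in the initial value.
\<close>

lemma weak_identity:
  assumes ws: "weak_solution_NSV T \<Omega> p \<nu> \<kappa> v\<^sub>0 f v" and \<psi>: "\<psi> \<in> solenoidal_C0inf \<Omega>"
    and \<theta>: "smooth \<theta>" "\<And>t. (\<theta> has_real_derivative \<theta>' t) (at t)" "c < T" "\<And>t. c \<le> t \<Longrightarrow> \<theta> t = 0"
  shows "- (\<integral>t. \<theta>' t * Bt (v t) \<psi> \<partial>J) + (\<integral>t. \<theta> t * Nt (v t) \<psi> \<partial>J) =
    \<theta> 0 * Bt v\<^sub>0 \<psi> + (\<integral>t. \<theta> t * (\<integral>x. f t x \<bullet> \<psi> x \<partial>M) \<partial>J)"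
proof -
  have C: "\<psi> \<in> C0inf \<Omega>" using \<psi> solenoidal_subset by auto
  note sm = C0inf_smooth[OF C]
  have v2: "v \<in> Bochner_Linf T (Vp 2 \<Omega>) (V_norm \<Omega>)" and vp: "v \<in> Bochner_Lp p T (Vp p \<Omega>) (W1p_norm p \<Omega>)"
    using ws by (auto simp: weak_solution_NSV_def)
  define \<phi> where "\<phi> = (\<lambda>z. \<theta> (fst z) *\<^sub>R \<psi> (snd z))"
  have "\<phi> \<in> NSV_test T \<Omega>"
    unfolding \<phi>_def by (rule product_test_NSV[OF \<theta>(1,3,4) \<psi>])
  then have eq: "- (\<integral>t. (\<integral>x. v t x \<bullet> dt \<phi> t x \<partial>M) \<partial>J)
        - \<kappa> * (\<integral>t. (\<integral>x. grad (v t) x \<bullet> jacobian (dt \<phi> t) (at x) \<partial>M) \<partial>J)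
        + \<nu> * (\<integral>t. (\<integral>x. visc p (grad (v t) x) \<bullet> sym_part (jacobian (\<lambda>y. \<phi> (t, y)) (at x)) \<partial>M) \<partial>J)
        = (\<integral>x. v\<^sub>0 x \<bullet> \<phi> (0, x) \<partial>M)
        + \<kappa> * (\<integral>x. grad v\<^sub>0 x \<bullet> jacobian (\<lambda>y. \<phi> (0, y)) (at x) \<partial>M)
        + (\<integral>t. (\<integral>x. f t x \<bullet> \<phi> (t, x) \<partial>M) \<partial>J)
        + (\<integral>t. (\<integral>x. tensor (v t x) (v t x) \<bullet> jacobian (\<lambda>y. \<phi> (t, y)) (at x) \<partial>M) \<partial>J)"
    using ws unfolding weak_solution_NSV_def visc_def by blast
  have dt: "dt \<phi> t = (\<lambda>x. \<theta>' t *\<^sub>R \<psi> x)" for t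
    unfolding \<phi>_def by (rule ext, rule dt_product[OF \<theta>(2)])
  have \<phi>t: "\<phi> (t, x) = \<theta> t *\<^sub>R \<psi> x" for t x by (simp add: \<phi>_def)
  have c\<theta>: "continuous_on UNIV \<theta>" by (rule smooth_continuous_on[OF \<theta>(1)])
  have "smooth (\<lambda>t. frechet_derivative \<theta> (at t) 1)" by (rule smooth_frechet_derivative[OF \<theta>(1)])
  then have c\<theta>': "continuous_on UNIV \<theta>'"
    using smooth_continuous_on[of \<theta>'] by (simp add: real_derivative_eq_frechet[OF \<theta>(2)])
  let ?a = "\<lambda>t. \<integral>x. v t x \<bullet> \<psi> x \<partial>M" and ?b = "\<lambda>t. \<integral>x. grad (v t) x \<bullet> jacobian \<psi> (at x) \<partial>M"
    and ?c = "\<lambda>t. \<integral>x. visc p (grad (v t) x) \<bullet> sym_part (jacobian \<psi> (at x)) \<partial>M"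
    and ?d = "\<lambda>t. \<integral>x. tensor (v t x) (v t x) \<bullet> jacobian \<psi> (at x) \<partial>M"
  note I = velocity_slices_integrable[OF v2 C] visc_slice_integrable[OF vp C]
  have e1: "(\<integral>t. \<theta>' t * Bt (v t) \<psi> \<partial>J) = (\<integral>t. \<theta>' t * ?a t \<partial>J) + \<kappa> * (\<integral>t. \<theta>' t * ?b t \<partial>J)"
  proof -
    have "\<theta>' t * Bt (v t) \<psi> = \<theta>' t * ?a t + \<kappa> * (\<theta>' t * ?b t)" for t
      by (simp only: Bt_def distrib_left mult.left_commute[of "\<theta>' t" \<kappa>])
    then have "(\<integral>t. \<theta>' t * Bt (v t) \<psi> \<partial>J) = (\<integral>t. \<theta>' t * ?a t + \<kappa> * (\<theta>' t * ?b t) \<partial>J)"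
      by (simp only:)
    also have "\<dots> = (\<integral>t. \<theta>' t * ?a t \<partial>J) + (\<integral>t. \<kappa> * (\<theta>' t * ?b t) \<partial>J)"
      by (intro Bochner_Integration.integral_add integrable_mult_right integrable_mult_continuous[OF _ c\<theta>'] I)
    finally show ?thesis by simp
  qed
  have e2: "(\<integral>t. \<theta> t * Nt (v t) \<psi> \<partial>J) = \<nu> * (\<integral>t. \<theta> t * ?c t \<partial>J) - (\<integral>t. \<theta> t * ?d t \<partial>J)"
  proof -
    have "\<theta> t * Nt (v t) \<psi> = \<nu> * (\<theta> t * ?c t) - \<theta> t * ?d t" for t
      by (simp only: Nt_def right_diff_distrib mult.left_commute[of "\<theta> t" \<nu>])
    then have "(\<integral>t. \<theta> t * Nt (v t) \<psi> \<partial>J) = (\<integral>t. \<nu> * (\<theta> t * ?c t) - \<theta> t * ?d t \<partial>J)"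
      by (simp only:)
    also have "\<dots> = (\<integral>t. \<nu> * (\<theta> t * ?c t) \<partial>J) - (\<integral>t. \<theta> t * ?d t \<partial>J)"
      by (intro Bochner_Integration.integral_diff integrable_mult_right integrable_mult_continuous[OF _ c\<theta>] I)
    finally show ?thesis by simp
  qed
  have "- (\<integral>t. \<theta>' t * ?a t \<partial>J) - \<kappa> * (\<integral>t. \<theta>' t * ?b t \<partial>J) + \<nu> * (\<integral>t. \<theta> t * ?c t \<partial>J) =
      \<theta> 0 * (\<integral>x. v\<^sub>0 x \<bullet> \<psi> x \<partial>M) + \<kappa> * (\<theta> 0 * (\<integral>x. grad v\<^sub>0 x \<bullet> jacobian \<psi> (at x) \<partial>M)) +
      (\<integral>t. \<theta> t * (\<integral>x. f t x \<bullet> \<psi> x \<partial>M) \<partial>J) + (\<integral>t. \<theta> t * ?d t \<partial>J)"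
    using eq by (simp only: dt \<phi>t jacobian_scaleR[OF sm] sym_part_scaleR inner_scaleR_right integral_mult_right_zero)
  moreover have "\<theta> 0 * Bt v\<^sub>0 \<psi> = \<theta> 0 * (\<integral>x. v\<^sub>0 x \<bullet> \<psi> x \<partial>M) + \<kappa> * (\<theta> 0 * (\<integral>x. grad v\<^sub>0 x \<bullet> jacobian \<psi> (at x) \<partial>M))"
    by (simp add: Bt_def distrib_left mult.left_commute)
  ultimately show ?thesis
    using e1 e2 by linarith
qed

lemma derivative_slice_integrable:
  assumes g: "g \<in> Bochner_Lp 2 T (Vp 2 \<Omega>) (V_norm \<Omega>)" and \<psi>: "\<psi> \<in> solenoidal_C0inf \<Omega>"
  shows "integrable J (\<lambda>t. Bt (g t) \<psi>)"
proof -
  have C: "\<psi> \<in> C0inf \<Omega>" using \<psi> solenoidal_subset by auto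
  have v: "strongly_measurable T (Vp 2 \<Omega>) (V_norm \<Omega>) g" "AE t in J. g t \<in> Vp 2 \<Omega>"
    and int: "integrable J (\<lambda>t. V_norm \<Omega> (g t) powr 2)"
    using g by (auto simp: Bochner_Lp_def)
  have m: "(\<lambda>t. Bt (g t) \<psi>) \<in> borel_measurable J"
    unfolding Bt_def by (intro borel_measurable_add borel_measurable_times borel_measurable_const value_slice_measurable[OF v C])
  have i: "integrable J (\<lambda>t. CB * (1 + V_norm \<Omega> (g t) powr 2) * n2 \<psi>)"
    using int by simp
  have le: "AE t in J. norm (Bt (g t) \<psi>) \<le> norm (CB * (1 + V_norm \<Omega> (g t) powr 2) * n2 \<psi>)"
    using v(2)
  proof eventually_elim
    case (elim t)
    have x: "x \<le> 1 + x powr 2" if "0 \<le> x" for x :: real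
      using that zero_le_power2[of "x - 1"] by (simp add: power2_diff)
    have "\<bar>Bt (g t) \<psi>\<bar> \<le> CB * n2 (g t) * n2 \<psi>"
      unfolding Bt_eq_B[OF elim \<psi>] by (intro B_bound elim solenoidal_in_Vp[OF \<psi>]) simp
    also have "\<dots> \<le> CB * (1 + V_norm \<Omega> (g t) powr 2) * n2 \<psi>"
      unfolding V_norm_def by (intro mult_right_mono mult_left_mono x Lp_norm_nonneg CB_nonneg)
    finally show ?case by simp
  qed
  show ?thesis by (rule Bochner_Integration.integrable_bound[OF i m le])
qed

text \<open>
  The distributional derivative pairs functions in $L^2$ only. Applied to the test function that
  represents the energy form it yields the derivative of \<open>Bt (v t) \<psi>\<close>.
\<close>

lemma weak_derivative_identity:
  assumes v2: "v \<in> Bochner_Linf T (Vp 2 \<Omega>) (V_norm \<Omega>)" and g: "g \<in> Bochner_Lp 2 T (Vp 2 \<Omega>) (V_norm \<Omega>)"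
    and dt: "has_weak_dt T \<Omega> v g" and \<psi>: "\<psi> \<in> solenoidal_C0inf \<Omega>"
    and \<theta>: "\<theta> \<in> C0inf {0<..<T}" "\<And>t. (\<theta> has_real_derivative \<theta>' t) (at t)"
  shows "(\<integral>t. \<theta>' t * Bt (v t) \<psi> \<partial>J) = - (\<integral>t. \<theta> t * Bt (g t) \<psi> \<partial>J)"
proof -
  have C: "\<psi> \<in> C0inf \<Omega>" using \<psi> solenoidal_subset by auto
  obtain L where L: "L \<in> C0inf \<Omega>" "\<And>a. a \<in> W1p 2 \<Omega> \<Longrightarrow> (\<integral>x. a x \<bullet> L x \<partial>M) = Bt a \<psi>"
    using energy_representative[OF C] by blast
  have v: "strongly_measurable T (Vp 2 \<Omega>) (V_norm \<Omega>) v" "AE t in J. v t \<in> Vp 2 \<Omega>"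
    and g': "strongly_measurable T (Vp 2 \<Omega>) (V_norm \<Omega>) g" "AE t in J. g t \<in> Vp 2 \<Omega>"
    using v2 g by (auto simp: Bochner_Linf_def Bochner_Lp_def)
  have sm: "smooth \<theta>" by (rule C0inf_smooth[OF \<theta>(1)])
  have "smooth (\<lambda>t. frechet_derivative \<theta> (at t) 1)" by (rule smooth_frechet_derivative[OF sm])
  then have c\<theta>': "continuous_on UNIV \<theta>'"
    using smooth_continuous_on[of \<theta>'] by (simp add: real_derivative_eq_frechet[OF \<theta>(2)])
  have [measurable]: "\<theta> \<in> borel_measurable J" "\<theta>' \<in> borel_measurable J"
    by (auto intro!: continuous_imp_measurable_on_sets_lebesgue smooth_continuous_on[OF sm] continuous_on_subset[OF c\<theta>'])
  have slice: "(\<integral>t. \<eta> t * (\<integral>x. a t x \<bullet> L x \<partial>M) \<partial>J) = (\<integral>t. \<eta> t * Bt (a t) \<psi> \<partial>J)"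
    if a: "strongly_measurable T (Vp 2 \<Omega>) (V_norm \<Omega>) a" "AE t in J. a t \<in> Vp 2 \<Omega>" and [measurable]: "\<eta> \<in> borel_measurable J" for a \<eta>
  proof (rule integral_cong_AE)
    note [measurable] = value_slice_measurable(1)[OF a L(1)] value_slice_measurable(1,2)[OF a C]
    show "(\<lambda>t. \<eta> t * (\<integral>x. a t x \<bullet> L x \<partial>M)) \<in> borel_measurable J" by measurable
    show "(\<lambda>t. \<eta> t * Bt (a t) \<psi>) \<in> borel_measurable J" unfolding Bt_def by measurable
    show "AE t in J. \<eta> t * (\<integral>x. a t x \<bullet> L x \<partial>M) = \<eta> t * Bt (a t) \<psi>"
      using a(2) by eventually_elim (simp add: L(2) Vp_W1p)
  qed
  define \<phi> where "\<phi> = (\<lambda>z. \<theta> (fst z) *\<^sub>R L (snd z))"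
  have "\<phi> \<in> C0inf ({0<..<T} \<times> \<Omega>)"
    unfolding \<phi>_def by (rule product_test_C0inf[OF \<theta>(1) L(1)])
  then have "(\<integral>t. (\<integral>x. v t x \<bullet> dt \<phi> t x \<partial>M) \<partial>J) = - (\<integral>t. (\<integral>x. g t x \<bullet> \<phi> (t, x) \<partial>M) \<partial>J)"
    using dt unfolding has_weak_dt_def by blast
  moreover have "dt \<phi> t x = \<theta>' t *\<^sub>R L x" for t x
    unfolding \<phi>_def by (rule dt_product[OF \<theta>(2)])
  moreover have "\<phi> (t, x) = \<theta> t *\<^sub>R L x" for t x by (simp add: \<phi>_def)
  ultimately have "(\<integral>t. \<theta>' t * (\<integral>x. v t x \<bullet> L x \<partial>M) \<partial>J) = - (\<integral>t. \<theta> t * (\<integral>x. g t x \<bullet> L x \<partial>M) \<partial>J)"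
    by simp
  then show ?thesis by (simp add: slice[OF v] slice[OF g'])
qed

text \<open>
  Subtracting the equations of two solutions removes the force and the initial velocity. The
  exceptional null sets of times depend on the test function.
\<close>

lemma difference_equation:
  assumes v: "weak_solution_NSV T \<Omega> p \<nu> \<kappa> v\<^sub>0 f v" and w: "weak_solution_NSV T \<Omega> p \<nu> \<kappa> v\<^sub>0 f w"
    and gv: "gv \<in> Bochner_Lp 2 T (Vp 2 \<Omega>) (V_norm \<Omega>)" "has_weak_dt T \<Omega> v gv"
    and gw: "gw \<in> Bochner_Lp 2 T (Vp 2 \<Omega>) (V_norm \<Omega>)" "has_weak_dt T \<Omega> w gw"
    and \<psi>: "\<psi> \<in> solenoidal_C0inf \<Omega>"
  shows "AE t in J. Bt (gv t) \<psi> - Bt (gw t) \<psi> + (Nt (v t) \<psi> - Nt (w t) \<psi>) = 0"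
    and "AE t in J. Bt (v t) \<psi> - Bt (w t) \<psi> = (\<integral>s. (if s < t then 1 else 0) * (Bt (gv s) \<psi> - Bt (gw s) \<psi>) \<partial>J)"
proof -
  have C: "\<psi> \<in> C0inf \<Omega>" using \<psi> solenoidal_subset by auto
  have v2: "v \<in> Bochner_Linf T (Vp 2 \<Omega>) (V_norm \<Omega>)" and vp: "v \<in> Bochner_Lp p T (Vp p \<Omega>) (W1p_norm p \<Omega>)"
    using v by (auto simp: weak_solution_NSV_def)
  have w2: "w \<in> Bochner_Linf T (Vp 2 \<Omega>) (V_norm \<Omega>)" and wp: "w \<in> Bochner_Lp p T (Vp p \<Omega>) (W1p_norm p \<Omega>)"
    using w by (auto simp: weak_solution_NSV_def)
  have iB: "integrable J (\<lambda>t. Bt (v t) \<psi>)" "integrable J (\<lambda>t. Bt (w t) \<psi>)"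
    unfolding Bt_def by (intro Bochner_Integration.integrable_add integrable_mult_right
        velocity_slices_integrable[OF v2 C] velocity_slices_integrable[OF w2 C])+
  have iN: "integrable J (\<lambda>t. Nt (v t) \<psi>)" "integrable J (\<lambda>t. Nt (w t) \<psi>)"
    unfolding Nt_def by (intro Bochner_Integration.integrable_diff integrable_mult_right visc_slice_integrable[OF vp C]
        visc_slice_integrable[OF wp C] velocity_slices_integrable[OF v2 C] velocity_slices_integrable[OF w2 C])+
  have ig: "integrable J (\<lambda>t. Bt (gv t) \<psi>)" "integrable J (\<lambda>t. Bt (gw t) \<psi>)"
    by (intro derivative_slice_integrable[OF gv(1) \<psi>] derivative_slice_integrable[OF gw(1) \<psi>])+
  have split: "(\<integral>t. \<eta> t * (x t - y t) \<partial>J) = (\<integral>t. \<eta> t * x t \<partial>J) - (\<integral>t. \<eta> t * y t \<partial>J)"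
    if "integrable J x" "integrable J y" "continuous_on UNIV \<eta>" for \<eta> x y :: "real \<Rightarrow> real"
    unfolding right_diff_distrib
    by (intro Bochner_Integration.integral_diff integrable_mult_continuous that)
  have cd: "continuous_on UNIV \<theta>'" if "smooth \<theta>" "\<And>t. (\<theta> has_real_derivative \<theta>' t) (at t)" for \<theta> \<theta>' :: "real \<Rightarrow> real"
    using smooth_continuous_on[OF smooth_frechet_derivative[OF that(1)], of UNIV 1]
    by (simp add: real_derivative_eq_frechet[OF that(2)])
  have H1: "(\<integral>t. \<theta>' t * (Bt (v t) \<psi> - Bt (w t) \<psi>) \<partial>J) = - (\<integral>t. \<theta> t * (Bt (gv t) \<psi> - Bt (gw t) \<psi>) \<partial>J)"
    if "\<theta> \<in> C0inf {0<..<T}" "\<And>t. (\<theta> has_real_derivative \<theta>' t) (at t)" for \<theta> \<theta>'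
    using weak_derivative_identity[OF v2 gv \<psi> that] weak_derivative_identity[OF w2 gw \<psi> that]
      split[OF iB cd[OF C0inf_smooth[OF that(1)] that(2)]] split[OF ig smooth_continuous_on[OF C0inf_smooth[OF that(1)]]]
    by simp
  have H2: "(\<integral>t. \<theta>' t * (Bt (v t) \<psi> - Bt (w t) \<psi>) \<partial>J) = (\<integral>t. \<theta> t * (Nt (v t) \<psi> - Nt (w t) \<psi>) \<partial>J)"
    if "smooth \<theta>" "\<And>t. (\<theta> has_real_derivative \<theta>' t) (at t)" "c < T" "\<And>t. c \<le> t \<Longrightarrow> \<theta> t = 0" for \<theta> \<theta>' c
    using weak_identity[OF v \<psi> that] weak_identity[OF w \<psi> that]
      split[OF iB cd[OF that(1,2)]] split[OF iN smooth_continuous_on[OF that(1)]]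
    by simp
  define b where "b = (\<lambda>t. Bt (v t) \<psi> - Bt (w t) \<psi>)"
  define \<beta> where "\<beta> = (\<lambda>t. Bt (gv t) \<psi> - Bt (gw t) \<psi>)"
  define N where "N = (\<lambda>t. Nt (v t) \<psi> - Nt (w t) \<psi>)"
  have I: "integrable J b" "integrable J \<beta>" "integrable J N"
    unfolding b_def \<beta>_def N_def by (intro Bochner_Integration.integrable_diff iB ig iN)+
  have K1: "(\<integral>t. \<theta>' t * b t \<partial>J) = - (\<integral>t. \<theta> t * \<beta> t \<partial>J)"
    if "\<theta> \<in> C0inf {0<..<T}" "\<And>t. (\<theta> has_real_derivative \<theta>' t) (at t)" for \<theta> \<theta>'
    unfolding b_def \<beta>_def by (rule H1[OF that])
  have K2: "(\<integral>t. \<theta>' t * b t \<partial>J) = (\<integral>t. \<theta> t * N t \<partial>J)"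
    if "smooth \<theta>" "\<And>t. (\<theta> has_real_derivative \<theta>' t) (at t)" "c < T" "\<And>t. c \<le> t \<Longrightarrow> \<theta> t = 0" for \<theta> \<theta>' c
    unfolding b_def N_def by (rule H2[OF that])
  have "AE t in J. \<beta> t + N t = 0"
    by (rule du_Bois_Reymond(1)[OF I]) (fact K1, fact K2)
  then show "AE t in J. Bt (gv t) \<psi> - Bt (gw t) \<psi> + (Nt (v t) \<psi> - Nt (w t) \<psi>) = 0"
    by (simp add: \<beta>_def N_def)
  have "AE t in J. b t = (\<integral>s. (if s < t then 1 else 0) * \<beta> s \<partial>J)"
    by (rule du_Bois_Reymond(2)[OF I]) (fact K1, fact K2)
  then show "AE t in J. Bt (v t) \<psi> - Bt (w t) \<psi> = (\<integral>s. (if s < t then 1 else 0) * (Bt (gv s) \<psi> - Bt (gw s) \<psi>) \<partial>J)"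
    by (simp add: \<beta>_def b_def)
qed

end

section \<open>Uniqueness\<close>

context nsv
begin

lemma n2_sqr: "n2 a * n2 a = pint 2 (grad a)"
proof -
  have "n2 a * n2 a = n2 a powr 2"
    using Lp_norm_nonneg[of 2 "grad a"] by (simp add: power2_eq_square)
  also have "\<dots> = pint 2 (grad a)" by (rule Lp_norm_powr) simp
  finally show ?thesis .
qed

text \<open>
  The difference of two solutions lies in both \<open>Vp 2 \<Omega>\<close> and \<open>Vp p \<Omega>\<close>, and one sequence of test
  functions must approximate it in both spaces; the larger exponent achieves this.
\<close>

definition r_test :: real where "r_test = max 2 p"

text \<open>
  In at most four dimensions the bound in \<open>V\<close> suffices for the convective term. Above, the
  integrability of the gradient to the power \<open>p\<close> is needed.
\<close>

definition r_conv :: real where "r_conv = (if CARD('n) \<le> 4 then 2 else p)"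

lemma r_test: "2 \<le> r_test" "p \<le> r_test" "r_test = 2 \<or> r_test = p"
  by (auto simp: r_test_def max_def)

lemma r_conv: "2 \<le> r_conv" "real CARD('n) \<le> 2 * r_conv" "r_conv = 2 \<or> r_conv = p"
  using critical by (auto simp: r_conv_def)

lemma difference_tests:
  assumes v: "v \<in> Bochner_Linf T (Vp 2 \<Omega>) (V_norm \<Omega>)" "v \<in> Bochner_Lp p T (Vp p \<Omega>) (W1p_norm p \<Omega>)"
    and w: "w \<in> Bochner_Linf T (Vp 2 \<Omega>) (V_norm \<Omega>)" "w \<in> Bochner_Lp p T (Vp p \<Omega>) (W1p_norm p \<Omega>)"
  shows "\<exists>P. countable P \<and> P \<subseteq> solenoidal_C0inf \<Omega> \<and>
    (AE t in J. (\<lambda>x. v t x - w t x) \<in> Vp r_test \<Omega> \<and> near r_test P (\<lambda>x. v t x - w t x))"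
proof -
  have r0: "0 < r_test" using r_test(1) by simp
  have tests: "\<exists>P. countable P \<and> P \<subseteq> solenoidal_C0inf \<Omega> \<and> (AE t in J. a t \<in> Vp r_test \<Omega> \<and> near r_test P (a t))"
    if a: "a \<in> Bochner_Linf T (Vp 2 \<Omega>) (V_norm \<Omega>)" "a \<in> Bochner_Lp p T (Vp p \<Omega>) (W1p_norm p \<Omega>)" for a
  proof (cases "r_test = 2")
    case True
    have *: "strongly_measurable T (Vp 2 \<Omega>) (V_norm \<Omega>) a" "AE t in J. a t \<in> Vp 2 \<Omega>"
      using a by (auto simp: Bochner_Linf_def)
    obtain P where "countable P" "P \<subseteq> solenoidal_C0inf \<Omega>" "AE t in J. near 2 P (a t)"
      using countable_tests[OF * zero_less_numeral V_norm_nonneg V_norm_bound] by blast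
    then show ?thesis using *(2) unfolding True by (intro exI[of _ P]) auto
  next
    case False
    then have p: "r_test = p" using r_test(3) by simp
    have *: "strongly_measurable T (Vp p \<Omega>) (W1p_norm p \<Omega>) a" "AE t in J. a t \<in> Vp p \<Omega>"
      using a by (auto simp: Bochner_Lp_def)
    obtain P where "countable P" "P \<subseteq> solenoidal_C0inf \<Omega>" "AE t in J. near p P (a t)"
      using countable_tests[OF * p_pos W1p_norm_nonneg W1p_norm_bound] by blast
    then show ?thesis using *(2) unfolding p by (intro exI[of _ P]) auto
  qed
  obtain P where P: "countable P" "P \<subseteq> solenoidal_C0inf \<Omega>" "AE t in J. v t \<in> Vp r_test \<Omega> \<and> near r_test P (v t)"
    using tests[OF v] by blast
  obtain Q where Q: "countable Q" "Q \<subseteq> solenoidal_C0inf \<Omega>" "AE t in J. w t \<in> Vp r_test \<Omega> \<and> near r_test Q (w t)"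
    using tests[OF w] by blast
  let ?D = "(\<lambda>(\<phi>, \<psi>) x. \<phi> x - \<psi> x) ` (P \<times> Q)"
  have "countable ?D" using P(1) Q(1) by (intro countable_image countable_SIGMA) auto
  moreover have "?D \<subseteq> solenoidal_C0inf \<Omega>"
    using P(2) Q(2) by (auto intro: solenoidal_diff)
  moreover have PC: "P \<subseteq> C0inf \<Omega>" "Q \<subseteq> C0inf \<Omega>"
    using P(2) Q(2) solenoidal_subset by auto
  have "AE t in J. (\<lambda>x. v t x - w t x) \<in> Vp r_test \<Omega> \<and> near r_test ?D (\<lambda>x. v t x - w t x)"
    using P(3) Q(3)
  proof eventually_elim
    case (elim t)
    then show ?case using near_diff[of "v t" r_test "w t" P Q] Vp_diff[of "v t" r_test "w t"] PC r0 by blast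
  qed
  ultimately show ?thesis by blast
qed

text \<open>
  When \<open>r_conv\<close> is 2, the norm of the gradient is bounded in time; when it is \<open>p\<close>, the power \<open>p\<close> of
  the norm is integrable in time.
\<close>

lemma convective_weight:
  assumes v: "v \<in> Bochner_Linf T (Vp 2 \<Omega>) (V_norm \<Omega>)" "v \<in> Bochner_Lp p T (Vp p \<Omega>) (W1p_norm p \<Omega>)"
  shows "\<exists>m. integrable J m \<and> (\<forall>t. 0 \<le> m t) \<and> (AE t in J. v t \<in> Vp r_conv \<Omega> \<and> Lp_norm r_conv \<Omega> (grad (v t)) \<le> m t)"
proof (cases "r_conv = 2")
  case True
  obtain C where "AE t in J. v t \<in> Vp 2 \<Omega>" "AE t in J. V_norm \<Omega> (v t) \<le> C"
    using v(1) by (auto simp: Bochner_Linf_def)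
  then have "AE t in J. v t \<in> Vp r_conv \<Omega> \<and> Lp_norm r_conv \<Omega> (grad (v t)) \<le> max 0 C"
    by eventually_elim (simp add: True V_norm_def)
  then show ?thesis
    by (intro exI[of _ "\<lambda>t. max 0 C"]) auto
next
  case False
  then have p: "r_conv = p" using r_conv(3) by simp
  have 1: "AE t in J. v t \<in> Vp p \<Omega>" and 2: "integrable J (\<lambda>t. W1p_norm p \<Omega> (v t) powr p)"
    using v(2) by (auto simp: Bochner_Lp_def)
  have "AE t in J. v t \<in> Vp r_conv \<Omega> \<and> Lp_norm r_conv \<Omega> (grad (v t)) \<le> 1 + W1p_norm p \<Omega> (v t) powr p"
    using 1
  proof eventually_elim
    case (elim t)
    have x: "x powr (1 / p) \<le> 1 + x" if "0 \<le> x" for x :: real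
    proof (cases "x \<le> 1")
      case True
      then have "x powr (1 / p) \<le> 1 powr (1 / p)" using that p_pos by (intro powr_mono2) auto
      then show ?thesis using that by simp
    next
      case False
      then have "x powr (1 / p) \<le> x powr 1" using p_gt_1 by (intro powr_mono) auto
      then show ?thesis using False by simp
    qed
    have "Lp_norm p \<Omega> (grad (v t)) \<le> 1 + pint p (grad (v t))"
      unfolding Lp_norm_eq by (rule x) simp
    also have "\<dots> \<le> 1 + W1p_norm p \<Omega> (v t) powr p"
      by (simp add: W1p_norm_powr[OF p_pos])
    finally show ?case using elim by (simp add: p)
  qed
  then show ?thesis
    using 2 by (intro exI[of _ "\<lambda>t. 1 + W1p_norm p \<Omega> (v t) powr p"]) auto
qed

text \<open>
  Split \<open>v \<otimes> v - w \<otimes> w = u \<otimes> v + w \<otimes> u\<close> with \<open>u = v - w\<close>, and apply Hoelder's inequality with exponents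
  \<open>a\<close> for \<open>v\<close> and \<open>w\<close>, \<open>b\<close> for \<open>u\<close>, and 2 for the gradient of \<open>u\<close>.
\<close>

lemma convective_estimate:
  "\<exists>C\<ge>0. \<forall>v w. v \<in> Vp 2 \<Omega> \<longrightarrow> v \<in> Vp r_conv \<Omega> \<longrightarrow> w \<in> Vp 2 \<Omega> \<longrightarrow> w \<in> Vp r_conv \<Omega> \<longrightarrow>
    (\<lambda>x. tensor (v x) (v x)) \<in> Lp 2 \<Omega> \<and>
    (\<integral>x. (tensor (v x) (v x) - tensor (w x) (w x)) \<bullet> grad (\<lambda>x. v x - w x) x \<partial>M) \<le>
      C * (Lp_norm r_conv \<Omega> (grad v) + Lp_norm r_conv \<Omega> (grad w)) * pint 2 (grad (\<lambda>x. v x - w x))"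
proof -
  obtain a b C where ab: "2 < a" "2 < b" "1 / a + 1 / b = 1 / 2" and C: "0 \<le> C"
    and La: "\<And>u. u \<in> Vp r_conv \<Omega> \<Longrightarrow> u \<in> Lp a \<Omega>" "\<And>u. u \<in> Vp r_conv \<Omega> \<Longrightarrow> Lp_norm a \<Omega> u \<le> C * Lp_norm r_conv \<Omega> (grad u)"
    and Lb: "\<And>u. u \<in> Vp 2 \<Omega> \<Longrightarrow> u \<in> Lp b \<Omega>" "\<And>u. u \<in> Vp 2 \<Omega> \<Longrightarrow> Lp_norm b \<Omega> u \<le> C * n2 u"
    using convective_exponents[OF dim r_conv(1,2)] by blast
  have tens: "(\<lambda>x. tensor (v x) (v x)) \<in> Lp 2 \<Omega>" if v: "v \<in> Vp 2 \<Omega>" "v \<in> Vp r_conv \<Omega>" for v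
  proof (rule Lp_bound(1)[OF Lp_prod(1)[OF La(1)[OF v(2)] Lb(1)[OF v(1)] ab], where C = 1])
    show "(\<lambda>x. tensor (v x) (v x)) \<in> borel_measurable M"
      by (intro tensor_measurable LpD(1)[OF Vp_Lp(1)[OF v(1)]])
  qed (auto simp: norm_tensor)
  have est: "(\<integral>x. (tensor (v x) (v x) - tensor (w x) (w x)) \<bullet> grad (\<lambda>x. v x - w x) x \<partial>M) \<le>
      (C * C) * (Lp_norm r_conv \<Omega> (grad v) + Lp_norm r_conv \<Omega> (grad w)) * pint 2 (grad (\<lambda>x. v x - w x))"
    if v: "v \<in> Vp 2 \<Omega>" "v \<in> Vp r_conv \<Omega>" and w: "w \<in> Vp 2 \<Omega>" "w \<in> Vp r_conv \<Omega>" for v w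
  proof -
    let ?u = "\<lambda>x. v x - w x"
    have u: "?u \<in> Vp 2 \<Omega>" by (rule Vp_diff[OF v(1) w(1)]) simp
    note Gu = Vp_Lp(2)[OF u]
    have nG: "(\<lambda>x. norm (grad ?u x)) \<in> Lp 2 \<Omega>"
      by (rule Lp_bound(1)[OF Gu, where C = 1]) (use LpD(1)[OF Gu] in auto)
    have nG2: "Lp_norm 2 \<Omega> (\<lambda>x. norm (grad ?u x)) = n2 ?u"
      unfolding Lp_norm_def by simp
    let ?f = "\<lambda>z x. norm (z x) * norm (?u x)"
    have f: "?f z \<in> Lp 2 \<Omega>" "Lp_norm 2 \<Omega> (?f z) \<le> (C * Lp_norm r_conv \<Omega> (grad z)) * (C * n2 ?u)"
      if z: "z \<in> Vp r_conv \<Omega>" for z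
    proof -
      show "?f z \<in> Lp 2 \<Omega>" by (rule Lp_prod(1)[OF La(1)[OF z] Lb(1)[OF u] ab])
      have "Lp_norm 2 \<Omega> (?f z) \<le> Lp_norm a \<Omega> z * Lp_norm b \<Omega> ?u"
        by (rule Lp_prod(2)[OF La(1)[OF z] Lb(1)[OF u] ab])
      also have "\<dots> \<le> (C * Lp_norm r_conv \<Omega> (grad z)) * (C * n2 ?u)"
        by (intro mult_mono La(2)[OF z] Lb(2)[OF u] Lp_norm_nonneg mult_nonneg_nonneg C)
      finally show "Lp_norm 2 \<Omega> (?f z) \<le> (C * Lp_norm r_conv \<Omega> (grad z)) * (C * n2 ?u)" .
    qed
    have F: "integrable M (\<lambda>x. norm (?f z x) * norm (grad ?u x))"
      "(\<integral>x. norm (?f z x) * norm (grad ?u x) \<partial>M) \<le> (C * C) * Lp_norm r_conv \<Omega> (grad z) * pint 2 (grad ?u)"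
      if z: "z \<in> Vp r_conv \<Omega>" for z
    proof -
      show "integrable M (\<lambda>x. norm (?f z x) * norm (grad ?u x))"
        using Cauchy_Schwarz_Lp(1)[OF f(1)[OF z] nG] unfolding real_norm_def abs_norm_cancel .
      have "(\<integral>x. norm (?f z x) * norm (grad ?u x) \<partial>M) \<le> Lp_norm 2 \<Omega> (?f z) * n2 ?u"
        using Cauchy_Schwarz_Lp(2)[OF f(1)[OF z] nG] unfolding real_norm_def abs_norm_cancel nG2 .
      also have "\<dots> \<le> ((C * Lp_norm r_conv \<Omega> (grad z)) * (C * n2 ?u)) * n2 ?u"
        by (intro mult_right_mono f(2)[OF z] Lp_norm_nonneg)
      also have "\<dots> = (C * C) * Lp_norm r_conv \<Omega> (grad z) * (n2 ?u * n2 ?u)"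
        by (simp only: mult_ac)
      finally show "(\<integral>x. norm (?f z x) * norm (grad ?u x) \<partial>M) \<le> (C * C) * Lp_norm r_conv \<Omega> (grad z) * pint 2 (grad ?u)"
        unfolding n2_sqr .
    qed
    have le: "(tensor (v x) (v x) - tensor (w x) (w x)) \<bullet> grad ?u x \<le>
        norm (?f v x) * norm (grad ?u x) + norm (?f w x) * norm (grad ?u x)" for x
    proof -
      have "(tensor (v x) (v x) - tensor (w x) (w x)) \<bullet> grad ?u x \<le>
          norm (tensor (v x) (v x) - tensor (w x) (w x)) * norm (grad ?u x)"
        by (rule norm_cauchy_schwarz)
      also have "norm (tensor (v x) (v x) - tensor (w x) (w x)) \<le> norm (?f v x) + norm (?f w x)"
        unfolding tensor_diff_diff
        using norm_triangle_ineq[of "tensor (?u x) (v x)" "tensor (w x) (?u x)"] by (simp add: norm_tensor mult.commute)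
      finally show ?thesis by (simp add: distrib_right mult_right_mono)
    qed
    have i: "integrable M (\<lambda>x. (tensor (v x) (v x) - tensor (w x) (w x)) \<bullet> grad ?u x)"
      by (intro Cauchy_Schwarz_Lp(3) Lp_diff(1) tens v w Gu) simp
    have "(\<integral>x. (tensor (v x) (v x) - tensor (w x) (w x)) \<bullet> grad ?u x \<partial>M) \<le>
        (\<integral>x. norm (?f v x) * norm (grad ?u x) + norm (?f w x) * norm (grad ?u x) \<partial>M)"
      by (intro integral_mono i Bochner_Integration.integrable_add F(1) v w le)
    also have "\<dots> = (\<integral>x. norm (?f v x) * norm (grad ?u x) \<partial>M) + (\<integral>x. norm (?f w x) * norm (grad ?u x) \<partial>M)"
      by (intro Bochner_Integration.integral_add F(1) v w)
    also have "\<dots> \<le> (C * C) * Lp_norm r_conv \<Omega> (grad v) * pint 2 (grad ?u) + (C * C) * Lp_norm r_conv \<Omega> (grad w) * pint 2 (grad ?u)"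
      by (intro add_mono F(2) v w)
    finally show ?thesis by (simp only: distrib_left distrib_right mult.assoc)
  qed
  have "0 \<le> C * C" by simp
  with tens est show ?thesis by (intro exI[of _ "C * C"]) simp
qed

text \<open>
  At a fixed time, the equation extends by density from the test functions in \<open>P\<close> to the difference
  of the two solutions. For this test function monotonicity gives the viscous term a sign, and it
  can be dropped.
\<close>

lemma tested_with_difference:
  assumes v: "v \<in> Vp 2 \<Omega>" "v \<in> Vp p \<Omega>" "v \<in> Vp r_conv \<Omega>" and w: "w \<in> Vp 2 \<Omega>" "w \<in> Vp p \<Omega>" "w \<in> Vp r_conv \<Omega>"
    and g: "g \<in> Vp 2 \<Omega>" and P: "P \<subseteq> solenoidal_C0inf \<Omega>"
    and u: "(\<lambda>x. v x - w x) \<in> Vp r_test \<Omega>" "near r_test P (\<lambda>x. v x - w x)"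
    and eq: "\<And>\<psi>. \<psi> \<in> P \<Longrightarrow> Bt g \<psi> + (Nt v \<psi> - Nt w \<psi>) = 0"
    and tens: "(\<lambda>x. tensor (v x) (v x)) \<in> Lp 2 \<Omega>" "(\<lambda>x. tensor (w x) (w x)) \<in> Lp 2 \<Omega>"
  shows "B g (\<lambda>x. v x - w x) \<le>
    (\<integral>x. (tensor (v x) (v x) - tensor (w x) (w x)) \<bullet> grad (\<lambda>x. v x - w x) x \<partial>M)"
proof -
  let ?u = "\<lambda>x. v x - w x"
  have u2: "?u \<in> Vp 2 \<Omega>" by (rule Vp_diff[OF v(1) w(1)]) simp
  have up: "?u \<in> Vp p \<Omega>" by (rule Vp_diff[OF v(2) w(2) p_pos])
  obtain \<psi> where \<psi>: "\<And>k. \<psi> k \<in> P" "(\<lambda>k. pint r_test (\<lambda>x. grad ?u x - jacobian (\<psi> k) (at x))) \<longlonglongrightarrow> 0"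
    using u(2) unfolding near_def by blast
  have sol: "\<psi> k \<in> solenoidal_C0inf \<Omega>" for k using \<psi>(1) P by blast
  have C: "\<psi> k \<in> C0inf \<Omega>" for k using sol solenoidal_subset by blast
  have r0: "0 < r_test" using r_test(1) by simp
  have L: "(\<lambda>x. grad ?u x - jacobian (\<psi> k) (at x)) \<in> Lp r_test \<Omega>" for k
    by (rule grad_jac_diff_Lp[OF u(1) C r0])
  have lim2: "(\<lambda>k. pint 2 (\<lambda>x. grad ?u x - jacobian (\<psi> k) (at x))) \<longlonglongrightarrow> 0"
    by (rule pint_tendsto_embedding[OF L \<psi>(2)]) (use r_test in auto)
  have limp: "(\<lambda>k. pint p (\<lambda>x. grad ?u x - jacobian (\<psi> k) (at x))) \<longlonglongrightarrow> 0"
    by (rule pint_tendsto_embedding[OF L \<psi>(2) p_pos r_test(2)])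
  have limn: "(\<lambda>k. Lp_norm 2 \<Omega> (\<lambda>x. grad ?u x - jacobian (\<psi> k) (at x))) \<longlonglongrightarrow> 0"
  proof -
    have "(\<lambda>k. pint 2 (\<lambda>x. grad ?u x - jacobian (\<psi> k) (at x)) powr (1 / 2)) \<longlonglongrightarrow> 0 powr (1 / 2)"
      by (intro tendsto_powr' tendsto_const lim2) auto
    then show ?thesis by (simp add: Lp_norm_eq)
  qed
  have B: "(\<lambda>k. Bt g (\<psi> k)) \<longlonglongrightarrow> B g ?u"
  proof -
    have y: "(\<lambda>k. CB * n2 g * Lp_norm 2 \<Omega> (\<lambda>x. grad ?u x - jacobian (\<psi> k) (at x))) \<longlonglongrightarrow> 0"
      using tendsto_mult[OF tendsto_const[of "CB * n2 g"] limn] by simp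
    have "(\<lambda>k. Bt g (\<psi> k) - B g ?u) \<longlonglongrightarrow> 0"
      by (rule Lim_null_comparison[OF always_eventually y]) (intro allI, simp only: real_norm_def, rule Bt_approximates_B[OF u2 sol g])
    then show ?thesis by (rule LIM_zero_cancel)
  qed
  have jp: "(\<lambda>x. jacobian (\<psi> k) (at x)) \<in> Lp p \<Omega>" and j2: "(\<lambda>x. jacobian (\<psi> k) (at x)) \<in> Lp 2 \<Omega>" for k
    by (rule jacobian_C0inf(3)[OF C p_pos], rule jacobian_C0inf(3)[OF C]) simp
  have N: "(\<lambda>k. Nt z (\<psi> k)) \<longlonglongrightarrow> \<nu> * (\<integral>x. visc p (grad z x) \<bullet> sym_part (grad ?u x) \<partial>M) - (\<integral>x. tensor (z x) (z x) \<bullet> grad ?u x \<partial>M)"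
    if z: "z \<in> Vp p \<Omega>" "(\<lambda>x. tensor (z x) (z x)) \<in> Lp 2 \<Omega>" for z
    unfolding Nt_def
    by (intro tendsto_diff tendsto_mult tendsto_const visc_tendsto_test[OF p_gt_1 Vp_Lp(2)[OF z(1)] Vp_Lp(2)[OF up] jp limp]
        inner_tendsto[OF z(2) z(2) Vp_Lp(2)[OF u2] j2 Lp_norm_zero_diff limn])
  have lim: "(\<lambda>k. Bt g (\<psi> k) + (Nt v (\<psi> k) - Nt w (\<psi> k))) \<longlonglongrightarrow> B g ?u +
     ((\<nu> * (\<integral>x. visc p (grad v x) \<bullet> sym_part (grad ?u x) \<partial>M) - (\<integral>x. tensor (v x) (v x) \<bullet> grad ?u x \<partial>M)) -
      (\<nu> * (\<integral>x. visc p (grad w x) \<bullet> sym_part (grad ?u x) \<partial>M) - (\<integral>x. tensor (w x) (w x) \<bullet> grad ?u x \<partial>M)))"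
    by (intro tendsto_add tendsto_diff B N v w tens)
  have "(\<lambda>k. Bt g (\<psi> k) + (Nt v (\<psi> k) - Nt w (\<psi> k))) = (\<lambda>k. 0)"
    using eq[OF \<psi>(1)] by simp
  from lim[unfolded this] have zero: "B g ?u +
     ((\<nu> * (\<integral>x. visc p (grad v x) \<bullet> sym_part (grad ?u x) \<partial>M) - (\<integral>x. tensor (v x) (v x) \<bullet> grad ?u x \<partial>M)) -
      (\<nu> * (\<integral>x. visc p (grad w x) \<bullet> sym_part (grad ?u x) \<partial>M) - (\<integral>x. tensor (w x) (w x) \<bullet> grad ?u x \<partial>M))) = 0"
    unfolding LIMSEQ_const_iff by (rule sym)
  have vi: "integrable M (\<lambda>x. visc p (grad z x) \<bullet> sym_part (grad ?u x))" if "z \<in> Vp p \<Omega>" for z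
    by (rule visc_integral_eps(1)[OF p_gt_1 Vp_Lp(2)[OF that] Vp_Lp(2)[OF up]])
  have "0 \<le> (\<integral>x. (visc p (grad v x) - visc p (grad w x)) \<bullet> sym_part (grad ?u x) \<partial>M)"
  proof (rule integral_nonneg_AE)
    show "AE x in M. 0 \<le> (visc p (grad v x) - visc p (grad w x)) \<bullet> sym_part (grad ?u x)"
      using grad_diff[OF grad_in_Lp(2)[OF Vp_W1p[OF v(2)]] grad_in_Lp(2)[OF Vp_W1p[OF w(2)]]]
      by eventually_elim (simp add: sym_part_diff visc_monotone[OF p_gt_1])
  qed
  also have "\<dots> = (\<integral>x. visc p (grad v x) \<bullet> sym_part (grad ?u x) \<partial>M) - (\<integral>x. visc p (grad w x) \<bullet> sym_part (grad ?u x) \<partial>M)"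
    unfolding inner_diff_left by (rule Bochner_Integration.integral_diff[OF vi[OF v(2)] vi[OF w(2)]])
  finally have mono: "0 \<le> \<nu> * ((\<integral>x. visc p (grad v x) \<bullet> sym_part (grad ?u x) \<partial>M) - (\<integral>x. visc p (grad w x) \<bullet> sym_part (grad ?u x) \<partial>M))"
    using \<nu>_pos by simp
  have "(\<integral>x. (tensor (v x) (v x) - tensor (w x) (w x)) \<bullet> grad ?u x \<partial>M) =
      (\<integral>x. tensor (v x) (v x) \<bullet> grad ?u x \<partial>M) - (\<integral>x. tensor (w x) (w x) \<bullet> grad ?u x \<partial>M)"
    unfolding inner_diff_left
    by (intro Bochner_Integration.integral_diff Cauchy_Schwarz_Lp(3) tens Vp_Lp(2)[OF u2])
  with zero mono show ?thesis by (simp add: right_diff_distrib)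
qed

lemma B_slice_measurable:
  assumes g: "strongly_measurable T (Vp 2 \<Omega>) (V_norm \<Omega>) g" "AE t in J. g t \<in> Vp 2 \<Omega>" and y: "y \<in> Vp 2 \<Omega>"
  shows "(\<lambda>s. B (g s) y) \<in> borel_measurable J"
proof (rule strongly_measurable_comp[OF g, where F = "\<lambda>a. B a y"])
  fix a as assume a: "a \<in> Vp 2 \<Omega>" "\<And>k. as k \<in> Vp 2 \<Omega>" "(\<lambda>k. V_norm \<Omega> (as k - a)) \<longlonglongrightarrow> 0"
  have "V_norm \<Omega> (y - y) = 0"
    using n2_diff[OF y y] by (simp add: V_norm_def fun_diff_def Lp_norm_eq pint_def)
  then show "(\<lambda>k. B (as k) y) \<longlonglongrightarrow> B a y"
    by (intro B_tendsto a y) simp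
qed

lemma B_slice_integrable:
  assumes g: "strongly_measurable T (Vp 2 \<Omega>) (V_norm \<Omega>) g" "AE t in J. g t \<in> Vp 2 \<Omega>" and y: "y \<in> Vp 2 \<Omega>"
    and H: "integrable J H" "AE t in J. n2 (g t) \<le> H t"
  shows "integrable J (\<lambda>s. B (g s) y)"
proof (rule Bochner_Integration.integrable_bound[OF _ B_slice_measurable[OF g y]])
  show "integrable J (\<lambda>s. CB * H s * n2 y)" using H(1) by simp
  show "AE s in J. norm (B (g s) y) \<le> norm (CB * H s * n2 y)"
    using g(2) H(2)
  proof eventually_elim
    case (elim s)
    have "\<bar>B (g s) y\<bar> \<le> CB * n2 (g s) * n2 y" by (rule B_bound[OF elim(1) y])
    also have "\<dots> \<le> CB * H s * n2 y"
      by (intro mult_right_mono mult_left_mono elim Lp_norm_nonneg CB_nonneg)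
    finally show ?case by simp
  qed
qed

text \<open>
  The formula for the test functions in \<open>P\<close> passes to the limit in the test function at a fixed time
  \<open>t\<close>, under the integral because \<open>H\<close> dominates.
\<close>

lemma indefinite_integral_extension:
  assumes g: "strongly_measurable T (Vp 2 \<Omega>) (V_norm \<Omega>) g" "AE t in J. g t \<in> Vp 2 \<Omega>"
    and H: "integrable J H" "AE t in J. n2 (g t) \<le> H t"
    and a: "a \<in> Vp 2 \<Omega>" and P: "P \<subseteq> solenoidal_C0inf \<Omega>"
    and eq: "\<And>\<psi>. \<psi> \<in> P \<Longrightarrow> Bt a \<psi> = (\<integral>s. (if s < t then 1 else 0) * Bt (g s) \<psi> \<partial>J)"
    and y: "y \<in> Vp 2 \<Omega>" "near 2 P y"
  shows "B a y = (\<integral>s. (if s < t then 1 else 0) * B (g s) y \<partial>J)"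
proof -
  obtain \<psi> where \<psi>: "\<And>k. \<psi> k \<in> P" "(\<lambda>k. pint 2 (\<lambda>x. grad y x - jacobian (\<psi> k) (at x))) \<longlonglongrightarrow> 0"
    using y(2) unfolding near_def by blast
  have sol: "\<psi> k \<in> solenoidal_C0inf \<Omega>" for k using \<psi>(1) P by blast
  define d where "d = (\<lambda>k. Lp_norm 2 \<Omega> (\<lambda>x. grad y x - jacobian (\<psi> k) (at x)))"
  have d: "d \<longlonglongrightarrow> 0"
  proof -
    have "(\<lambda>k. pint 2 (\<lambda>x. grad y x - jacobian (\<psi> k) (at x)) powr (1 / 2)) \<longlonglongrightarrow> 0 powr (1 / 2)"
      by (intro tendsto_powr' tendsto_const \<psi>(2)) auto
    then show ?thesis by (simp add: d_def Lp_norm_eq)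
  qed
  have d0: "0 \<le> d k" for k by (simp add: d_def Lp_norm_nonneg)
  have le: "\<bar>Bt c (\<psi> k) - B c y\<bar> \<le> CB * n2 c * d k" if "c \<in> Vp 2 \<Omega>" for c k
    unfolding d_def by (rule Bt_approximates_B[OF y(1) sol that])
  have L1: "(\<lambda>k. Bt a (\<psi> k)) \<longlonglongrightarrow> B a y"
  proof -
    have z: "(\<lambda>k. CB * n2 a * d k) \<longlonglongrightarrow> 0"
      using tendsto_mult[OF tendsto_const[of "CB * n2 a"] d] by simp
    have "(\<lambda>k. Bt a (\<psi> k) - B a y) \<longlonglongrightarrow> 0"
      by (rule Lim_null_comparison[OF always_eventually z]) (simp add: le[OF a])
    then show ?thesis by (rule LIM_zero_cancel)
  qed
  have iy: "integrable J (\<lambda>s. (if s < t then 1 else 0) * B (g s) y)"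
    by (intro integrable_if B_slice_integrable[OF g y(1) H])
  have gt: "integrable J (\<lambda>s. Bt (g s) (\<psi> k))" for k
  proof -
    have v: "\<psi> k \<in> Vp 2 \<Omega>" by (rule solenoidal_in_Vp[OF sol]) simp
    have C: "\<psi> k \<in> C0inf \<Omega>" using sol solenoidal_subset by blast
    have "(\<lambda>s. Bt (g s) (\<psi> k)) \<in> borel_measurable J"
      unfolding Bt_def by (intro borel_measurable_add borel_measurable_times borel_measurable_const value_slice_measurable[OF g C])
    then show ?thesis
      by (subst integrable_cong_AE[OF _ B_slice_measurable[OF g v]])
         (use g(2) in \<open>auto elim!: eventually_mono simp: Bt_eq_B[OF _ sol] intro: B_slice_integrable[OF g v H]\<close>)
  qed
  have ik: "integrable J (\<lambda>s. (if s < t then 1 else 0) * Bt (g s) (\<psi> k))" for k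
    by (intro integrable_if gt)
  have L2: "(\<lambda>k. \<integral>s. (if s < t then 1 else 0) * Bt (g s) (\<psi> k) \<partial>J) \<longlonglongrightarrow> (\<integral>s. (if s < t then 1 else 0) * B (g s) y \<partial>J)"
  proof -
    have bound: "\<bar>(\<integral>s. (if s < t then 1 else 0) * Bt (g s) (\<psi> k) \<partial>J) - (\<integral>s. (if s < t then 1 else 0) * B (g s) y \<partial>J)\<bar>
        \<le> CB * d k * (\<integral>s. H s \<partial>J)" for k
    proof -
      let ?f = "\<lambda>s. (if s < t then 1 else 0) * Bt (g s) (\<psi> k) - (if s < t then 1 else 0) * B (g s) y"
      have if': "integrable J ?f" by (rule Bochner_Integration.integrable_diff[OF ik iy])
      have "\<bar>(\<integral>s. (if s < t then 1 else 0) * Bt (g s) (\<psi> k) \<partial>J) - (\<integral>s. (if s < t then 1 else 0) * B (g s) y \<partial>J)\<bar> = \<bar>\<integral>s. ?f s \<partial>J\<bar>"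
        by (simp only: Bochner_Integration.integral_diff[OF ik iy])
      also have "\<dots> \<le> (\<integral>s. \<bar>?f s\<bar> \<partial>J)" by (rule integral_abs_bound)
      also have "\<dots> \<le> (\<integral>s. CB * d k * H s \<partial>J)"
      proof (rule integral_mono_AE)
        show "integrable J (\<lambda>s. \<bar>?f s\<bar>)" by (rule integrable_abs[OF if'])
        show "integrable J (\<lambda>s. CB * d k * H s)" using H(1) by simp
        show "AE s in J. \<bar>?f s\<bar> \<le> CB * d k * H s"
          using g(2) H(2)
        proof eventually_elim
          case (elim s)
          have "\<bar>?f s\<bar> \<le> \<bar>Bt (g s) (\<psi> k) - B (g s) y\<bar>" by simp
          also have "\<dots> \<le> CB * n2 (g s) * d k" by (rule le[OF elim(1)])
          also have "\<dots> \<le> CB * H s * d k"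
            by (intro mult_right_mono mult_left_mono elim d0 CB_nonneg)
          finally show ?case by (simp only: mult_ac)
        qed
      qed
      finally show ?thesis by simp
    qed
    have z: "(\<lambda>k. CB * d k * (\<integral>s. H s \<partial>J)) \<longlonglongrightarrow> 0"
      using tendsto_mult[OF tendsto_mult[OF tendsto_const[of CB] d] tendsto_const[of "\<integral>s. H s \<partial>J"]] by simp
    have "(\<lambda>k. (\<integral>s. (if s < t then 1 else 0) * Bt (g s) (\<psi> k) \<partial>J) - (\<integral>s. (if s < t then 1 else 0) * B (g s) y \<partial>J)) \<longlonglongrightarrow> 0"
      by (rule Lim_null_comparison[OF always_eventually z]) (simp only: real_norm_def bound, simp)
    then show ?thesis by (rule LIM_zero_cancel)
  qed
  have "(\<lambda>k. Bt a (\<psi> k)) = (\<lambda>k. \<integral>s. (if s < t then 1 else 0) * Bt (g s) (\<psi> k) \<partial>J)"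
    using eq[OF \<psi>(1)] by (rule ext)
  with L1 have "(\<lambda>k. \<integral>s. (if s < t then 1 else 0) * Bt (g s) (\<psi> k) \<partial>J) \<longlonglongrightarrow> B a y" by simp
  then show ?thesis using L2 by (rule LIMSEQ_unique)
qed

text \<open>
  The norms of \<open>g t\<close> have an integrable majorant, since their squares are integrable and
  \<open>x \<le> 1 + x * x\<close>.
\<close>

lemma derivative_difference:
  assumes gv: "gv \<in> Bochner_Lp 2 T (Vp 2 \<Omega>) (V_norm \<Omega>)" and gw: "gw \<in> Bochner_Lp 2 T (Vp 2 \<Omega>) (V_norm \<Omega>)"
  defines "g \<equiv> \<lambda>t x. gv t x - gw t x"
  shows "strongly_measurable T (Vp 2 \<Omega>) (V_norm \<Omega>) g" "AE t in J. g t \<in> Vp 2 \<Omega>"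
    "\<exists>H. integrable J H \<and> (\<forall>t. 0 \<le> H t) \<and> (AE t in J. n2 (g t) \<le> H t)"
proof -
  have v: "strongly_measurable T (Vp 2 \<Omega>) (V_norm \<Omega>) gv" "AE t in J. gv t \<in> Vp 2 \<Omega>" "integrable J (\<lambda>t. V_norm \<Omega> (gv t) powr 2)"
    using gv by (auto simp: Bochner_Lp_def)
  have w: "strongly_measurable T (Vp 2 \<Omega>) (V_norm \<Omega>) gw" "AE t in J. gw t \<in> Vp 2 \<Omega>" "integrable J (\<lambda>t. V_norm \<Omega> (gw t) powr 2)"
    using gw by (auto simp: Bochner_Lp_def)
  have geq: "(\<lambda>t. gv t - gw t) = g" by (simp add: g_def fun_eq_iff)
  have Vd: "a - b \<in> Vp 2 \<Omega>" if "a \<in> Vp 2 \<Omega>" "b \<in> Vp 2 \<Omega>" for a b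
    using Vp_diff[OF that zero_less_numeral] by (simp add: fun_diff_def)
  show "strongly_measurable T (Vp 2 \<Omega>) (V_norm \<Omega>) g"
    unfolding geq[symmetric]
  proof (rule strongly_measurable_diff[OF v(1,2) w(1,2)])
    fix a b assume ab: "a \<in> Vp 2 \<Omega>" "b \<in> Vp 2 \<Omega>"
    show "a - b \<in> Vp 2 \<Omega>" by (rule Vd[OF ab])
    fix as bs assume "\<And>k. as k \<in> Vp 2 \<Omega>" "\<And>k. bs k \<in> Vp 2 \<Omega>"
      "(\<lambda>k. V_norm \<Omega> (as k - a)) \<longlonglongrightarrow> 0" "(\<lambda>k. V_norm \<Omega> (bs k - b)) \<longlonglongrightarrow> 0"
    then show "(\<lambda>k. V_norm \<Omega> ((as k - bs k) - (a - b))) \<longlonglongrightarrow> 0"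
      by (rule V_norm_diff_tendsto[OF ab])
  qed
  show "AE t in J. g t \<in> Vp 2 \<Omega>"
    using v(2) w(2) by eventually_elim (simp add: g_def Vp_diff)
  let ?H = "\<lambda>t. 1 + 4 * (V_norm \<Omega> (gv t) powr 2 + V_norm \<Omega> (gw t) powr 2)"
  have "AE t in J. n2 (g t) \<le> ?H t"
    using v(2) w(2)
  proof eventually_elim
    case (elim t)
    have "n2 (g t) \<le> 1 + n2 (g t) * n2 (g t)"
      using zero_le_power2[of "n2 (g t) - 1"] Lp_norm_nonneg[of 2 "grad (g t)"] by (simp add: power2_eq_square algebra_simps)
    also have "n2 (g t) * n2 (g t) = pint 2 (\<lambda>x. grad (gv t) x - grad (gw t) x)"
      unfolding n2_sqr g_def using pint_grad_diff[OF Vp_W1p[OF elim(1)] Vp_W1p[OF elim(2)] zero_less_numeral, of 2] .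
    also have "\<dots> \<le> 2 powr 2 * (pint 2 (grad (gv t)) + pint 2 (grad (gw t)))"
      by (intro Lp_diff Vp_Lp elim) simp
    finally show ?case by (simp add: V_norm_powr2)
  qed
  moreover have "integrable J ?H" using v(3) w(3) by simp
  moreover have "0 \<le> ?H t" for t by (simp add: V_norm_powr2)
  ultimately show "\<exists>H. integrable J H \<and> (\<forall>t. 0 \<le> H t) \<and> (AE t in J. n2 (g t) \<le> H t)" by blast
qed

lemma Bt_diff:
  assumes a: "a \<in> Vp 2 \<Omega>" and b: "b \<in> Vp 2 \<Omega>" and \<psi>: "\<psi> \<in> solenoidal_C0inf \<Omega>"
  shows "Bt (\<lambda>x. a x - b x) \<psi> = Bt a \<psi> - Bt b \<psi>"
proof -
  have d: "(\<lambda>x. a x - b x) \<in> Vp 2 \<Omega>" by (rule Vp_diff[OF a b]) simp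
  have p: "\<psi> \<in> Vp 2 \<Omega>" by (rule solenoidal_in_Vp[OF \<psi>]) simp
  show ?thesis
    unfolding Bt_eq_B[OF d \<psi>] Bt_eq_B[OF a \<psi>] Bt_eq_B[OF b \<psi>] by (rule B_diff_left[OF p a b])
qed

text \<open>
  This is the chain rule for the energy, in integrated form. Inserting the representation of \<open>u\<close> by
  the integral of its derivative \<open>g\<close> into the energy twice gives the integral of the symmetric kernel
  \<open>B (g s) (g t)\<close> over a square, hence twice its integral over a triangle, whose inner integral is
  \<open>B (g t) (u t)\<close>.
\<close>

lemma energy_identity:
  assumes g: "strongly_measurable T (Vp 2 \<Omega>) (V_norm \<Omega>) g" "AE t in J. g t \<in> Vp 2 \<Omega>"
    and H: "integrable J H" "\<And>t. 0 \<le> H t" "AE t in J. n2 (g t) \<le> H t"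
    and P: "P \<subseteq> solenoidal_C0inf \<Omega>" and ng: "AE t in J. near 2 P (g t)"
    and u: "AE t in J. u t \<in> Vp 2 \<Omega> \<and> near 2 P (u t)"
    and eq: "AE t in J. \<forall>\<psi>\<in>P. Bt (u t) \<psi> = (\<integral>s. (if s < t then 1 else 0) * Bt (g s) \<psi> \<partial>J)"
  shows "\<exists>\<beta>. integrable J \<beta> \<and> (AE t in J. B (g t) (u t) = \<beta> t) \<and>
    (AE t in J. B (u t) (u t) = 2 * (\<integral>s. (if s < t then 1 else 0) * \<beta> s \<partial>J))"
proof -
  obtain e where em: "e \<in> borel_measurable (J \<Otimes>\<^sub>M J)" and sym: "\<And>s t. e (s, t) = e (t, s)"
    and eB: "AE s in J. AE t in J. e (s, t) = B (g s) (g t)"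
  proof -
    have "\<exists>e. e \<in> borel_measurable (J \<Otimes>\<^sub>M J) \<and> (\<forall>s t. e (s, t) = e (t, s)) \<and>
        (AE s in J. AE t in J. e (s, t) = B (g s) (g t))"
    proof (rule strongly_measurable_comp2[OF g])
      fix a b as bs assume "a \<in> Vp 2 \<Omega>" "b \<in> Vp 2 \<Omega>" "\<And>k. as k \<in> Vp 2 \<Omega>" "\<And>k. bs k \<in> Vp 2 \<Omega>"
        "(\<lambda>k. V_norm \<Omega> (as k - a)) \<longlonglongrightarrow> 0" "(\<lambda>k. V_norm \<Omega> (bs k - b)) \<longlonglongrightarrow> 0"
      then show "(\<lambda>k. B (as k) (bs k)) \<longlonglongrightarrow> B a b" by (rule B_tendsto)
    qed (rule B_sym)
    then show ?thesis using that by (elim exE conjE) blast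
  qed
  define \<beta> where "\<beta> = (\<lambda>t. \<integral>s. (if s < t then 1 else 0) * e (s, t) \<partial>J)"
  \<comment> \<open>The factor is chosen such that its square is at least \<open>CB\<close>.\<close>
  define h where "h = (\<lambda>t. (1 + CB) * H t)"
  have h: "integrable J h" unfolding h_def using H(1) by simp
  have le: "AE s in J. AE t in J. \<bar>e (s, t)\<bar> \<le> h s * h t"
    using eB g(2) H(3)
  proof eventually_elim
    case (elim s)
    note s = elim
    show ?case
      using s(1) g(2) H(3)
    proof eventually_elim
      case (elim t)
      have "\<bar>B (g s) (g t)\<bar> \<le> CB * n2 (g s) * n2 (g t)" by (rule B_bound[OF s(2) elim(2)])
      also have "\<dots> \<le> CB * H s * H t"
        by (intro mult_mono s elim Lp_norm_nonneg CB_nonneg mult_nonneg_nonneg H order_refl)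
      also have "\<dots> = CB * (H s * H t)" by (simp only: mult.assoc)
      also have "\<dots> \<le> ((1 + CB) * (1 + CB)) * (H s * H t)"
        using CB_nonneg by (intro mult_right_mono mult_nonneg_nonneg H) (simp add: algebra_simps)
      also have "\<dots> = h s * h t" by (simp only: h_def mult_ac)
      finally show ?case unfolding elim(1) .
    qed
  qed
  note square = symmetric_square_integral[OF em sym h le]
  have rep: "AE t in J. \<forall>y. y \<in> Vp 2 \<Omega> \<longrightarrow> near 2 P y \<longrightarrow> B (u t) y = (\<integral>s. (if s < t then 1 else 0) * B (g s) y \<partial>J)"
    using u eq
  proof eventually_elim
    case (elim t)
    show ?case
    proof (intro allI impI)
      fix y assume y: "y \<in> Vp 2 \<Omega>" "near 2 P y"
      show "B (u t) y = (\<integral>s. (if s < t then 1 else 0) * B (g s) y \<partial>J)"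
        by (rule indefinite_integral_extension[OF g H(1,3) conjunct1[OF elim(1)] P _ y]) (rule bspec[OF elim(2)])
    qed
  qed
  define Good where "Good = (\<lambda>s. s \<in> space J \<and> g s \<in> Vp 2 \<Omega> \<and> near 2 P (g s) \<and> (AE t in J. e (s, t) = B (g s) (g t)))"
  have Good: "AE s in J. Good s"
    using AE_space g(2) ng eB by eventually_elim (simp add: Good_def)
  have kernel: "B (g s) (u t) = (\<integral>\<sigma>. (if \<sigma> < t then 1 else 0) * e (\<sigma>, s) \<partial>J)"
    if t: "\<forall>y. y \<in> Vp 2 \<Omega> \<longrightarrow> near 2 P y \<longrightarrow> B (u t) y = (\<integral>s. (if s < t then 1 else 0) * B (g s) y \<partial>J)"
      and s: "Good s" for s t
  proof -
    have gs: "s \<in> space J" "g s \<in> Vp 2 \<Omega>" "near 2 P (g s)" "AE \<sigma> in J. e (s, \<sigma>) = B (g s) (g \<sigma>)"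
      using s by (auto simp: Good_def)
    have "B (g s) (u t) = B (u t) (g s)" by (rule B_sym)
    also have "\<dots> = (\<integral>\<sigma>. (if \<sigma> < t then 1 else 0) * B (g \<sigma>) (g s) \<partial>J)"
      using t gs(2,3) by blast
    also have "\<dots> = (\<integral>\<sigma>. (if \<sigma> < t then 1 else 0) * e (\<sigma>, s) \<partial>J)"
    proof (rule integral_cong_AE)
      note [measurable] = B_slice_measurable[OF g gs(2)]
      show "(\<lambda>\<sigma>. (if \<sigma> < t then 1 else 0) * B (g \<sigma>) (g s)) \<in> borel_measurable J" by measurable
      have [measurable]: "(\<lambda>\<sigma>. e (\<sigma>, s)) \<in> borel_measurable J"
        by (rule measurable_compose[OF measurable_Pair2'[OF gs(1)] em])
      show "(\<lambda>\<sigma>. (if \<sigma> < t then 1 else 0) * e (\<sigma>, s)) \<in> borel_measurable J" by measurable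
      show "AE \<sigma> in J. (if \<sigma> < t then 1 else 0) * B (g \<sigma>) (g s) = (if \<sigma> < t then 1 else 0) * e (\<sigma>, s)"
        using gs(4)
      proof eventually_elim
        case (elim \<sigma>)
        have "e (\<sigma>, s) = B (g \<sigma>) (g s)"
          unfolding sym[of \<sigma> s] B_sym[of "g \<sigma>" "g s"] by (rule elim)
        then show ?case by simp
      qed
    qed
    finally show ?thesis .
  qed
  have "AE t in J. B (g t) (u t) = \<beta> t"
    using rep Good
  proof eventually_elim
    case (elim t)
    then show ?case unfolding \<beta>_def by (rule kernel)
  qed
  moreover have "AE t in J. B (u t) (u t) = 2 * (\<integral>s. (if s < t then 1 else 0) * \<beta> s \<partial>J)"
    using rep u
  proof eventually_elim
    case (elim t)
    have ut: "u t \<in> Vp 2 \<Omega>" "near 2 P (u t)" using elim(2) by auto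
    let ?k = "\<lambda>s. (if s < t then 1 else 0) * (\<integral>\<sigma>. (if \<sigma> < t then 1 else 0) * e (\<sigma>, s) \<partial>J)"
    have k: "AE s in J. ?k s = (if s < t then 1 else 0) * B (g s) (u t)"
      using Good
    proof eventually_elim
      case (elim s)
      show ?case unfolding kernel[OF \<open>\<forall>y. y \<in> Vp 2 \<Omega> \<longrightarrow> near 2 P y \<longrightarrow> B (u t) y = (\<integral>s. (if s < t then 1 else 0) * B (g s) y \<partial>J)\<close> elim] ..
    qed
    note [measurable] = B_slice_measurable[OF g ut(1)]
    have m: "(\<lambda>s. (if s < t then 1 else 0) * B (g s) (u t)) \<in> borel_measurable J" by measurable
    have "B (u t) (u t) = (\<integral>s. (if s < t then 1 else 0) * B (g s) (u t) \<partial>J)"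
      using elim(1) ut by blast
    also have "\<dots> = (\<integral>s. ?k s \<partial>J)"
      by (rule integral_cong_AE[OF m borel_measurable_lebesgue_on_AE[OF _ m k]])
         (use k in \<open>auto elim: eventually_mono\<close>)
    also have "\<dots> = 2 * (\<integral>s. (if s < t then 1 else 0) * \<beta> s \<partial>J)"
      unfolding \<beta>_def by (rule square(2))
    finally show ?case .
  qed
  ultimately show ?thesis
    using square(1) by (intro exI[of _ \<beta>] conjI) (simp_all only: \<beta>_def)
qed

lemma energy_bounded:
  assumes v: "v \<in> Bochner_Linf T (Vp 2 \<Omega>) (V_norm \<Omega>)" and w: "w \<in> Bochner_Linf T (Vp 2 \<Omega>) (V_norm \<Omega>)"
  shows "\<exists>C. AE t in J. B (\<lambda>x. v t x - w t x) (\<lambda>x. v t x - w t x) \<le> C"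
proof -
  have sqr: "\<exists>C. AE t in J. pint 2 (grad (a t)) \<le> C" if "a \<in> Bochner_Linf T (Vp 2 \<Omega>) (V_norm \<Omega>)" for a
  proof -
    have "\<exists>C. AE t in J. V_norm \<Omega> (a t) \<le> C" using that by (auto simp: Bochner_Linf_def)
    then obtain C where "AE t in J. V_norm \<Omega> (a t) \<le> C" by (rule exE)
    then have "AE t in J. pint 2 (grad (a t)) \<le> C * C"
    proof eventually_elim
      case (elim t)
      have "V_norm \<Omega> (a t) * V_norm \<Omega> (a t) \<le> C * C"
        using elim V_norm_nonneg[of "a t"] by (intro mult_mono) auto
      then show ?case unfolding V_norm_def n2_sqr .
    qed
    then show ?thesis by (rule exI)
  qed
  obtain C where C: "AE t in J. pint 2 (grad (v t)) \<le> C" using sqr[OF v] by blast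
  obtain D where D: "AE t in J. pint 2 (grad (w t)) \<le> D" using sqr[OF w] by blast
  have V: "AE t in J. v t \<in> Vp 2 \<Omega>" "AE t in J. w t \<in> Vp 2 \<Omega>"
    using v w by (auto simp: Bochner_Linf_def)
  have "AE t in J. B (\<lambda>x. v t x - w t x) (\<lambda>x. v t x - w t x) \<le> CB * (2 powr 2 * (C + D))"
    using V C D
  proof eventually_elim
    case (elim t)
    let ?u = "\<lambda>x. v t x - w t x"
    have u: "?u \<in> Vp 2 \<Omega>" by (rule Vp_diff[OF elim(1,2)]) simp
    have "B ?u ?u \<le> CB * n2 ?u * n2 ?u" using B_bound[OF u u] by (rule abs_le_D1)
    also have "\<dots> = CB * pint 2 (grad ?u)" by (simp only: mult.assoc n2_sqr)
    also have "pint 2 (grad ?u) = pint 2 (\<lambda>x. grad (v t) x - grad (w t) x)"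
      by (rule pint_grad_diff[OF Vp_W1p[OF elim(1)] Vp_W1p[OF elim(2)]]) simp
    also have "CB * \<dots> \<le> CB * (2 powr 2 * (pint 2 (grad (v t)) + pint 2 (grad (w t))))"
      by (intro mult_left_mono Lp_diff(2) Vp_Lp elim CB_nonneg) simp
    also have "\<dots> \<le> CB * (2 powr 2 * (C + D))"
      by (intro mult_left_mono add_mono elim CB_nonneg) simp
    finally show ?case .
  qed
  then show ?thesis by (rule exI)
qed

lemma difference_system:
  assumes v: "weak_solution_NSV T \<Omega> p \<nu> \<kappa> v\<^sub>0 f v" and w: "weak_solution_NSV T \<Omega> p \<nu> \<kappa> v\<^sub>0 f w"
    and gv: "gv \<in> Bochner_Lp 2 T (Vp 2 \<Omega>) (V_norm \<Omega>)" "has_weak_dt T \<Omega> v gv"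
    and gw: "gw \<in> Bochner_Lp 2 T (Vp 2 \<Omega>) (V_norm \<Omega>)" "has_weak_dt T \<Omega> w gw"
    and \<psi>: "\<psi> \<in> solenoidal_C0inf \<Omega>"
  shows "AE t in J. Bt (\<lambda>x. gv t x - gw t x) \<psi> + (Nt (v t) \<psi> - Nt (w t) \<psi>) = 0"
    and "AE t in J. Bt (\<lambda>x. v t x - w t x) \<psi> = (\<integral>s. (if s < t then 1 else 0) * Bt (\<lambda>x. gv s x - gw s x) \<psi> \<partial>J)"
proof -
  have g: "AE t in J. gv t \<in> Vp 2 \<Omega>" "AE t in J. gw t \<in> Vp 2 \<Omega>"
    using gv(1) gw(1) by (auto simp: Bochner_Lp_def)
  have V: "AE t in J. v t \<in> Vp 2 \<Omega>" "AE t in J. w t \<in> Vp 2 \<Omega>"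
    using v w by (auto simp: weak_solution_NSV_def Bochner_Linf_def)
  note D = difference_equation[OF v w gv gw \<psi>]
  have split: "AE t in J. Bt (\<lambda>x. gv t x - gw t x) \<psi> = Bt (gv t) \<psi> - Bt (gw t) \<psi>"
    using g by eventually_elim (rule Bt_diff[OF _ _ \<psi>])
  show "AE t in J. Bt (\<lambda>x. gv t x - gw t x) \<psi> + (Nt (v t) \<psi> - Nt (w t) \<psi>) = 0"
    using D(1) split by eventually_elim simp
  have [measurable]: "(\<lambda>t. Bt (gv t) \<psi>) \<in> borel_measurable J" "(\<lambda>t. Bt (gw t) \<psi>) \<in> borel_measurable J"
    using derivative_slice_integrable[OF gv(1) \<psi>] derivative_slice_integrable[OF gw(1) \<psi>] by auto
  have m: "(\<lambda>t. Bt (gv t) \<psi> - Bt (gw t) \<psi>) \<in> borel_measurable J" by measurable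
  have [measurable]: "(\<lambda>t. Bt (\<lambda>x. gv t x - gw t x) \<psi>) \<in> borel_measurable J"
    by (rule borel_measurable_lebesgue_on_AE[OF _ m split]) simp
  have int: "(\<integral>s. (if s < t then 1 else 0) * Bt (\<lambda>x. gv s x - gw s x) \<psi> \<partial>J) =
      (\<integral>s. (if s < t then 1 else 0) * (Bt (gv s) \<psi> - Bt (gw s) \<psi>) \<partial>J)" for t
  proof (rule integral_cong_AE)
    show "(\<lambda>s. (if s < t then 1 else 0) * Bt (\<lambda>x. gv s x - gw s x) \<psi>) \<in> borel_measurable J" by measurable
    show "(\<lambda>s. (if s < t then 1 else 0) * (Bt (gv s) \<psi> - Bt (gw s) \<psi>)) \<in> borel_measurable J" by measurable
    show "AE s in J. (if s < t then 1 else 0) * Bt (\<lambda>x. gv s x - gw s x) \<psi> = (if s < t then 1 else 0) * (Bt (gv s) \<psi> - Bt (gw s) \<psi>)"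
      using split by eventually_elim simp
  qed
  show "AE t in J. Bt (\<lambda>x. v t x - w t x) \<psi> = (\<integral>s. (if s < t then 1 else 0) * Bt (\<lambda>x. gv s x - gw s x) \<psi> \<partial>J)"
    using D(2) V
  proof eventually_elim
    case (elim t)
    then show ?case unfolding int Bt_diff[OF elim(2,3) \<psi>] by (simp only:)
  qed
qed

lemma zero_energy:
  assumes u: "u \<in> Vp 2 \<Omega>" and zero: "B u u = 0"
  shows "AE x in M. u x = 0"
proof -
  have "pint 2 u = 0"
    using zero \<kappa>_pos pint_nonneg[of 2 u] mult_nonneg_nonneg[OF less_imp_le[OF \<kappa>_pos] pint_nonneg[of 2 "grad u"]]
    unfolding B_self by linarith
  then have "AE x in M. norm (u x) powr 2 = 0"
    unfolding pint_def using LpD(2)[OF Vp_Lp(1)[OF u]]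
    by (subst (asm) integral_nonneg_eq_0_iff_AE) auto
  then show ?thesis by eventually_elim simp
qed

text \<open>
  The energy \<open>E t = B (u t) (u t)\<close> of the difference satisfies the hypotheses of Gronwall's lemma with
  \<open>\<beta> t = B (g t) (u t)\<close>, half of its derivative, and a multiple of the convective weights, in which
  the factor \<open>1 / \<kappa>\<close> comes from bounding the squared norm of the gradient by the energy.
\<close>

lemma nsv_unique:
  assumes v: "weak_solution_NSV T \<Omega> p \<nu> \<kappa> v\<^sub>0 f v" and w: "weak_solution_NSV T \<Omega> p \<nu> \<kappa> v\<^sub>0 f w"
  shows "AE t in J. AE x in M. v t x = w t x"
proof -
  have v2: "v \<in> Bochner_Linf T (Vp 2 \<Omega>) (V_norm \<Omega>)" and vp: "v \<in> Bochner_Lp p T (Vp p \<Omega>) (W1p_norm p \<Omega>)"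
    using v by (auto simp: weak_solution_NSV_def)
  have w2: "w \<in> Bochner_Linf T (Vp 2 \<Omega>) (V_norm \<Omega>)" and wp: "w \<in> Bochner_Lp p T (Vp p \<Omega>) (W1p_norm p \<Omega>)"
    using w by (auto simp: weak_solution_NSV_def)
  obtain gv where gv: "gv \<in> Bochner_Lp 2 T (Vp 2 \<Omega>) (V_norm \<Omega>)" "has_weak_dt T \<Omega> v gv"
    using v unfolding weak_solution_NSV_def by blast
  obtain gw where gw: "gw \<in> Bochner_Lp 2 T (Vp 2 \<Omega>) (V_norm \<Omega>)" "has_weak_dt T \<Omega> w gw"
    using w unfolding weak_solution_NSV_def by blast
  define u where "u = (\<lambda>t x. v t x - w t x)"
  define g where "g = (\<lambda>t x. gv t x - gw t x)"
  have V: "AE t in J. v t \<in> Vp 2 \<Omega> \<and> w t \<in> Vp 2 \<Omega> \<and> v t \<in> Vp p \<Omega> \<and> w t \<in> Vp p \<Omega>"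
    using v2 w2 vp wp by (auto simp: Bochner_Linf_def Bochner_Lp_def)
  have g: "strongly_measurable T (Vp 2 \<Omega>) (V_norm \<Omega>) g" "AE t in J. g t \<in> Vp 2 \<Omega>"
    "\<exists>H. integrable J H \<and> (\<forall>t. 0 \<le> H t) \<and> (AE t in J. n2 (g t) \<le> H t)"
    unfolding g_def by (rule derivative_difference[OF gv(1) gw(1)])+
  obtain H where H: "integrable J H" "\<And>t. 0 \<le> H t" "AE t in J. n2 (g t) \<le> H t"
    using g(3) by blast
  obtain P1 where P1: "countable P1" "P1 \<subseteq> solenoidal_C0inf \<Omega>"
    "AE t in J. u t \<in> Vp r_test \<Omega> \<and> near r_test P1 (u t)"
    using difference_tests[OF v2 vp w2 wp] unfolding u_def by blast
  obtain P2 where P2: "countable P2" "P2 \<subseteq> solenoidal_C0inf \<Omega>" "AE t in J. near 2 P2 (g t)"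
    using countable_tests[OF g(1,2) zero_less_numeral V_norm_nonneg V_norm_bound] by blast
  \<comment> \<open>\<open>P1\<close> approximates \<open>u\<close> and \<open>P2\<close> approximates \<open>g\<close>; the exceptional null sets of both are united.\<close>
  define P where "P = P1 \<union> P2"
  have P: "countable P" "P \<subseteq> solenoidal_C0inf \<Omega>" using P1 P2 by (auto simp: P_def)
  have PC: "P \<subseteq> C0inf \<Omega>" using P(2) solenoidal_subset by blast
  have ng: "AE t in J. near 2 P (g t)"
    using P2(3) by eventually_elim (rule near_mono, auto simp: P_def)
  have nu: "AE t in J. u t \<in> Vp r_test \<Omega> \<and> near r_test P (u t)"
    using P1(3)
  proof eventually_elim
    case (elim t)
    then show ?case using near_mono[of r_test P1 "u t" P] by (auto simp: P_def)
  qed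
  have nu2: "AE t in J. u t \<in> Vp 2 \<Omega> \<and> near 2 P (u t)"
    using nu V
  proof eventually_elim
    case (elim t)
    have "near 2 P (u t)"
      by (rule near_lower_exponent[OF conjunct1[OF elim(1)] PC conjunct2[OF elim(1)] zero_less_numeral r_test(1)])
    moreover have "u t \<in> Vp 2 \<Omega>"
      unfolding u_def using elim(2) by (intro Vp_diff) auto
    ultimately show ?case by simp
  qed
  have sys: "AE t in J. Bt (g t) \<psi> + (Nt (v t) \<psi> - Nt (w t) \<psi>) = 0"
    "AE t in J. Bt (u t) \<psi> = (\<integral>s. (if s < t then 1 else 0) * Bt (g s) \<psi> \<partial>J)" if "\<psi> \<in> P" for \<psi>
    unfolding u_def g_def using that P(2) by (intro difference_system[OF v w gv gw]; blast)+
  have eq1: "AE t in J. \<forall>\<psi>\<in>P. Bt (g t) \<psi> + (Nt (v t) \<psi> - Nt (w t) \<psi>) = 0"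
    unfolding AE_ball_countable[OF P(1)] by (rule ballI) (rule sys(1))
  have eq2: "AE t in J. \<forall>\<psi>\<in>P. Bt (u t) \<psi> = (\<integral>s. (if s < t then 1 else 0) * Bt (g s) \<psi> \<partial>J)"
    unfolding AE_ball_countable[OF P(1)] by (rule ballI) (rule sys(2))
  obtain \<beta> where \<beta>: "integrable J \<beta>" "AE t in J. B (g t) (u t) = \<beta> t"
    "AE t in J. B (u t) (u t) = 2 * (\<integral>s. (if s < t then 1 else 0) * \<beta> s \<partial>J)"
    using energy_identity[OF g(1,2) H P(2) ng nu2 eq2] by (elim exE conjE) (rule that)
  obtain mv where mv: "integrable J mv" "\<And>t. 0 \<le> mv t"
    "AE t in J. v t \<in> Vp r_conv \<Omega> \<and> Lp_norm r_conv \<Omega> (grad (v t)) \<le> mv t"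
    using convective_weight[OF v2 vp] by blast
  obtain mw where mw: "integrable J mw" "\<And>t. 0 \<le> mw t"
    "AE t in J. w t \<in> Vp r_conv \<Omega> \<and> Lp_norm r_conv \<Omega> (grad (w t)) \<le> mw t"
    using convective_weight[OF w2 wp] by blast
  obtain C where C: "0 \<le> C" and conv: "\<And>a b. a \<in> Vp 2 \<Omega> \<Longrightarrow> a \<in> Vp r_conv \<Omega> \<Longrightarrow> b \<in> Vp 2 \<Omega> \<Longrightarrow> b \<in> Vp r_conv \<Omega> \<Longrightarrow>
    (\<lambda>x. tensor (a x) (a x)) \<in> Lp 2 \<Omega> \<and>
    (\<integral>x. (tensor (a x) (a x) - tensor (b x) (b x)) \<bullet> grad (\<lambda>x. a x - b x) x \<partial>M) \<le>
      C * (Lp_norm r_conv \<Omega> (grad a) + Lp_norm r_conv \<Omega> (grad b)) * pint 2 (grad (\<lambda>x. a x - b x))"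
    using convective_estimate by blast
  define m where "m = (\<lambda>t. C / \<kappa> * (mv t + mw t))"
  have m: "integrable J m" "\<And>t. 0 \<le> m t"
    unfolding m_def using mv mw C \<kappa>_pos by auto
  have energy_nonneg: "0 \<le> B a a" "\<kappa> * pint 2 (grad a) \<le> B a a" for a
    unfolding B_self using \<kappa>_pos by auto
  have le: "AE t in J. \<beta> t \<le> m t * B (u t) (u t)"
    using \<beta>(2) V g(2) nu eq1 mv(3) mw(3)
  proof eventually_elim
    case (elim t)
    have a: "v t \<in> Vp 2 \<Omega>" "v t \<in> Vp p \<Omega>" "v t \<in> Vp r_conv \<Omega>" "w t \<in> Vp 2 \<Omega>" "w t \<in> Vp p \<Omega>" "w t \<in> Vp r_conv \<Omega>"
      using elim(2,6,7) by auto
    have nr: "(\<lambda>x. v t x - w t x) \<in> Vp r_test \<Omega>" "near r_test P (\<lambda>x. v t x - w t x)"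
      using elim(4) by (simp_all add: u_def)
    have "\<beta> t = B (g t) (\<lambda>x. v t x - w t x)"
      using elim(1) by (simp add: u_def)
    also have "\<dots> \<le> (\<integral>x. (tensor (v t x) (v t x) - tensor (w t x) (w t x)) \<bullet> grad (\<lambda>x. v t x - w t x) x \<partial>M)"
      by (rule tested_with_difference[OF a elim(3) P(2) nr bspec[OF elim(5)]
            conjunct1[OF conv[OF a(1,3) a(4,6)]] conjunct1[OF conv[OF a(4,6) a(1,3)]]])
    also have "\<dots> \<le> C * (Lp_norm r_conv \<Omega> (grad (v t)) + Lp_norm r_conv \<Omega> (grad (w t))) * pint 2 (grad (\<lambda>x. v t x - w t x))"
      by (rule conjunct2[OF conv[OF a(1,3) a(4,6)]])
    also have "\<dots> \<le> C * (mv t + mw t) * pint 2 (grad (\<lambda>x. v t x - w t x))"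
      using elim(6,7) by (intro mult_right_mono mult_left_mono add_mono C) auto
    also have "\<dots> = m t * (\<kappa> * pint 2 (grad (u t)))"
      using \<kappa>_pos by (simp add: m_def u_def)
    also have "\<dots> \<le> m t * B (u t) (u t)"
      by (intro mult_left_mono energy_nonneg m)
    finally show ?case .
  qed
  obtain D where D: "AE t in J. B (u t) (u t) \<le> D"
    using energy_bounded[OF v2 w2] unfolding u_def by blast
  have "AE t in J. B (u t) (u t) = 0"
    by (rule Gronwall_AE[OF m \<beta>(1) _ D le \<beta>(3)]) (simp add: energy_nonneg)
  then show ?thesis
    using nu2
  proof eventually_elim
    case (elim t)
    have "AE x in M. u t x = 0" by (rule zero_energy) (use elim in auto)
    then show ?case by eventually_elim (simp add: u_def)
  qed
qed

end

theorem theorem3p4: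
  fixes \<Omega> :: "(real^'n) set" and d :: nat
    and T \<nu> \<kappa> p p' :: real
    and v\<^sub>0 :: "real^'n \<Rightarrow> real^'n"
    and f v w :: "real \<Rightarrow> real^'n \<Rightarrow> real^'n"
  assumes "d = CARD('n)" and "d \<ge> 2"
    and "0 < T" and "\<nu> > 0" and "\<kappa> > 0"
    and "bounded_domain \<Omega>"
    and "1 < p" and "p' = p / (p - 1)"
    and "v\<^sub>0 \<in> Vp 2 \<Omega> \<inter> Vp p \<Omega>"
    and "(Lipschitz_boundary \<Omega> \<and>
          f \<in> Linf_Wm12 T \<Omega> \<inter> Bochner_Lp p' T (Lp p' \<Omega>) (Lp_norm p' \<Omega>) \<and>
          (p > 1 \<and> 2 \<le> d \<and> d \<le> 3 \<or> p \<ge> real d / 2 \<and> d > 3))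
       \<or> (C2_boundary \<Omega> \<and>
          f \<in> Bochner_Lp p' T (Lp p' \<Omega>) (Lp_norm p' \<Omega>) \<and>
          d = 4 \<and> 2 * real d / (real d + 2) < p \<and> p < real d / 2)"
    and "weak_solution_NSV T \<Omega> p \<nu> \<kappa> v\<^sub>0 f v"
    and "weak_solution_NSV T \<Omega> p \<nu> \<kappa> v\<^sub>0 f w"
  shows "AE t in lebesgue_on {0<..<T}. AE x in lebesgue_on \<Omega>. v t x = w t x"
proof -
  have d: "d \<le> 4 \<or> real d \<le> 2 * p"
    using assms(10) by (elim disjE conjE) linarith+
  interpret nsv \<Omega> T p \<nu> \<kappa>
  proof
    show "open \<Omega>" "bounded \<Omega>" using assms(6) by (simp_all add: bounded_domain_def)
    show "CARD('n) \<le> 4 \<or> real CARD('n) \<le> 2 * p" "2 \<le> CARD('n)" using d assms(1,2) by simp_all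
  qed (fact assms)+
  show ?thesis by (rule nsv_unique[OF assms(11,12)])
qed

end
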